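(* Let $(\rho_0,\vec v_0)=(\rho_0(r,z),r\omega_0(r)\mathbf e_\theta)$ be an axi-symmetric rotating star with support $\Omega$ and support radius $R_0$ (see context). Assume $\omega_0\in C^1[0,R_0]$, $\rho_0(r,z)\approx\mathrm{dist}((r,z),\partial\Omega)^{\frac1{\gamma_0-1}}$ for $(r,z)\in\Omega$ near $\partial\Omega$, and $\inf_{r\in[0,R_0]}\Upsilon(r)<0$, where $\Upsilon(r)=\frac{\partial_r(\omega_0^2r^4)}{r^3}$. Write $\mathrm{range}(\Upsilon)=[-a,b]$ with $a>0$, $b\ge0$, and let $\eta_0\le-a$ be the minimum of $\lambda\in\sigma(\tilde{\mathbb L})$. Then: (i) The equation $\partial_{tt}u_2=-\tilde{\mathbb L}u_2$ defines a $C^0$ group $T(t)$, $t\in\mathbb R$, on $Z\times Y$ (acting on $(u_2,u_{2t})$). There exists $C>0$ such that for any $(u_2(0),u_{2t}(0))\in Z\times Y$, $$\|u_2(t)\|_Z+\|u_{2t}(t)\|_Y\le Ce^{\sqrt{-\eta_0}\,t}\big(\|u_2(0)\|_Z+\|u_{2t}(0)\|_Y\big),\quad\forall t>0.$$ The flow $T(t)$ conserves the total energy $E(u_2,u_{2t})=\|u_{2t}\|_Y^2+[\tilde{\mathbb L}u_2,u_2]$. (ii) For any $\varepsilon\in(0,-\eta_0)$ there exists initial data $u_2^\varepsilon(0)\in Z$, $u_2^\varepsilon(0)\ne0$, $u_{2t}^\varepsilon(0)=0$, and a constant $c>0$ such that the solution satisfies $$\|u_2^\varepsilon(t)\|_Y\ge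 c\,e^{\sqrt{-\eta_0-\varepsilon}\,t}\,\|u_2^\varepsilon(0)\|_Z,\quad\forall t>0.$$
   Context: Pressure and enthalpy: $P\in C^1(0,\infty)$, $P'>0$, and there is $\gamma_0\in(\frac65,2)$ with $\lim_{s\to0+}s^{1-\gamma_0}P'(s)=K>0$. The enthalpy $\Phi$ satisfies $\Phi(0)=\Phi'(0)=0$, $\Phi'(\rho)=\int_0^\rho\frac{P'(s)}{s}ds$. Euler-Poisson system on $\mathbb R^3$: $\rho_t+\nabla\cdot(\rho v)=0$, $\rho(v_t+v\cdot\nabla v)+\nabla P(\rho)=-\rho\nabla V$, $\Delta V=4\pi\rho$, $V\to0$ as $|x|\to\infty$. Cylindrical coordinates are $(r,\theta,z)$; axi-symmetric means independent of $\theta$. Rotating star: a steady solution $(\rho_0(r,z),r\omega_0(r)\mathbf e_\theta)$ where $\rho_0\ge0$, the support of $\rho_0$ is (the closure of) an axi-symmetric bounded domain $\Omega$ on which $\rho_0>0$, and $\Phi'(\rho_0)-|x|^{-1}*\rho_0-\int_0^r\omega_0^2(s)s\,ds+c_0=0$ in $\Omega$ for a constant $c_0>0$. $R_0$ is the maximum of $r$ for $(r,z)$ in the support, with $(R_0,0)\in\partial\Omega$. Standing assumption: $\partial\Omega$ is $C^2$ with positive curvature near $(R_0,0)$. The notation $a\approx b$ means $C_1a\le b\le C_2a$ for some constants $C_1,C_2>0$. Spaces: for a weight $w>0$ on $\Omega$, $L^2_w$ is the Hilbert space of axi-symmetric functions on $\Omega$ with $\int_\Omega wf^2dx<\infty$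 (extended by zero outside $\Omega$). $Y=(L^2_{\rho_0})^2$, with inner product $[u,v]=\int\rho_0u\cdot v\,dx$; elements are $u_2=(v_r,v_z)$ and $\nabla\cdot(\rho_0u_2)=\frac1r\partial_r(r\rho_0v_r)+\partial_z(\rho_0v_z)$. $Z=\{u_2\in Y:\nabla\cdot(\rho_0u_2)\in L^2_{\Phi''(\rho_0)}\}$ with norm $\|u_2\|_Z=\|u_2\|_Y+\|\nabla\cdot(\rho_0u_2)\|_{L^2_{\Phi''(\rho_0)}}$. Operator: $\tilde{\mathbb L}=\mathbb L_1+\mathbb L_2$ is the self-adjoint operator on $(Y,[\cdot,\cdot])$ with $$\mathbb L_1u_2=-\nabla\big[\Phi''(\rho_0)\nabla\cdot(\rho_0u_2)-4\pi(-\Delta)^{-1}(\nabla\cdot(\rho_0u_2))\big],\qquad \mathbb L_2u_2=\begin{pmatrix}\Upsilon(r)v_r\\0\end{pmatrix},$$ where $\nabla=(\partial_r,\partial_z)$ and $4\pi(-\Delta)^{-1}f=|x|^{-1}*f$. Its quadratic form, defined on $Z$, is $$[\tilde{\mathbb L}u_2,u_2]=\int\Phi''(\rho_0)|\nabla\cdot(\rho_0u_2)|^2dx-4\pi\int\big((-\Delta)^{-1}\nabla\cdot(\rho_0u_2)\big)\nabla\cdot(\rho_0u_2)\,dx+\int\rho_0\Upsilon v_r^2dx.$$ The equation $\partial_{tt}u_2=-\tilde{\mathbb L}u_2$ is the second order form of the axi-symmetric linearized Euler-Poisson system at the rotating star. *)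

theory Defs
  imports "HOL-Analysis.Analysis"
begin

section \<open>Cylindrical coordinates\<close>

text \<open>Axi-symmetric functions on \<open>\<real>\<^sup>3\<close> are represented by functions of \<open>(r, z)\<close>;
  their values at \<open>r < 0\<close> are irrelevant.  All integrals are taken over subsets of \<open>\<real>\<^sup>3\<close>.\<close>

type_synonym rz = "real \<times> real"

definition cyl :: "real ^ 3 \<Rightarrow> rz" where
  "cyl x = (sqrt ((x $ 1)\<^sup>2 + (x $ 2)\<^sup>2), x $ 3)"

definition merid :: "rz \<Rightarrow> real ^ 3" where
  "merid p = vector [fst p, 0, snd p]"

definition axisymmetric_set :: "(real ^ 3) set \<Rightarrow> bool" where
  "axisymmetric_set S \<longleftrightarrow> (\<forall>x y. x \<in> S \<and> cyl x = cyl y \<longrightarrow> y \<in> S)"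

text \<open>The vector field \<open>v\<^sub>r e\<^sub>r + v\<^sub>z e\<^sub>z\<close>; its value on the axis, a null set, plays no role.\<close>

definition field3 :: "(rz \<Rightarrow> rz) \<Rightarrow> real ^ 3 \<Rightarrow> real ^ 3" where
  "field3 u x = vector [fst (u (cyl x)) * (x $ 1 / fst (cyl x)),
                        fst (u (cyl x)) * (x $ 2 / fst (cyl x)),
                        snd (u (cyl x))]"

text \<open>The velocity field \<open>r \<omega>(r) e\<^sub>\<theta>\<close>.\<close>

definition rotation_field :: "(real \<Rightarrow> real) \<Rightarrow> real ^ 3 \<Rightarrow> real ^ 3" where
  "rotation_field \<omega> x = \<omega> (fst (cyl x)) *\<^sub>R vector [- x $ 2, x $ 1, 0]"

text \<open>\<open>|x|\<^sup>-\<^sup>1 * f = 4\<pi> (-\<Delta>)\<^sup>-\<^sup>1 f\<close>, where \<open>f\<close> is extended by zero outside \<open>\<Omega>\<close>.\<close>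

definition newton :: "(real ^ 3) set \<Rightarrow> (rz \<Rightarrow> real) \<Rightarrow> real ^ 3 \<Rightarrow> real" where
  "newton \<Omega> f x = (LINT y|lebesgue_on \<Omega>. f (cyl y) / norm (x - y))"


section \<open>Pressure and enthalpy\<close>

definition pressure_law :: "(real \<Rightarrow> real) \<Rightarrow> real \<Rightarrow> real \<Rightarrow> bool" where
  "pressure_law P \<gamma>\<^sub>0 K \<longleftrightarrow>
     (\<forall>s>0. P differentiable (at s)) \<and> continuous_on {0<..} (deriv P) \<and>
     (\<forall>s>0. deriv P s > 0) \<and> 6/5 < \<gamma>\<^sub>0 \<and> \<gamma>\<^sub>0 < 2 \<and> K > 0 \<and>
     ((\<lambda>s. s powr (1 - \<gamma>\<^sub>0) * deriv P s) \<longlongrightarrow> K) (at_right 0)"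

definition enthalpy1 :: "(real \<Rightarrow> real) \<Rightarrow> real \<Rightarrow> real" where \<comment> \<open>\<open>\<Phi>'\<close>\<close>
  "enthalpy1 P \<rho> = integral {0..\<rho>} (\<lambda>s. deriv P s / s)"

definition enthalpy2 :: "(real \<Rightarrow> real) \<Rightarrow> real \<Rightarrow> real" where \<comment> \<open>\<open>\<Phi>''\<close>\<close>
  "enthalpy2 P = deriv (enthalpy1 P)"


section \<open>Rotating stars\<close>

text \<open>Time-independent solutions of the Euler--Poisson system: the Poisson equation holds on
  \<open>\<real>\<^sup>3\<close>, the fluid equations hold in the region \<open>\<Omega>\<close> occupied by the fluid.  Here \<open>DW x\<close> is the
  Hessian of the potential \<open>V\<close>, and the divergence of a field is the trace of its derivative.\<close>

definition steady_euler_poisson ::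
  "(real \<Rightarrow> real) \<Rightarrow> (real ^ 3) set \<Rightarrow> (real ^ 3 \<Rightarrow> real) \<Rightarrow> (real ^ 3 \<Rightarrow> real ^ 3) \<Rightarrow> bool" where
  "steady_euler_poisson P \<Omega> \<rho> v \<longleftrightarrow>
     (\<exists>V W DW.
        (\<forall>x. GDERIV V x :> W x) \<and>
        (\<forall>x. (W has_derivative DW x) (at x)) \<and>
        (\<forall>x. (\<Sum>i\<in>Basis. DW x i \<bullet> i) = 4 * pi * \<rho> x) \<and>
        (V \<longlongrightarrow> 0) at_infinity \<and>
        (\<forall>x\<in>\<Omega>. \<exists>M. ((\<lambda>y. \<rho> y *\<^sub>R v y) has_derivative M) (at x) \<and> (\<Sum>i\<in>Basis. M i \<bullet> i) = 0) \<and>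
        (\<forall>x\<in>\<Omega>. \<exists>Dv G. (v has_derivative Dv) (at x) \<and> GDERIV (\<lambda>y. P (\<rho> y)) x :> G \<and>
            \<rho> x *\<^sub>R Dv (v x) + G = - (\<rho> x *\<^sub>R W x)))"

definition rotating_star ::
  "(real \<Rightarrow> real) \<Rightarrow> (rz \<Rightarrow> real) \<Rightarrow> (real ^ 3) set \<Rightarrow> (real \<Rightarrow> real) \<Rightarrow> real \<Rightarrow> bool" where
  "rotating_star P \<rho>\<^sub>0 \<Omega> \<omega>\<^sub>0 R\<^sub>0 \<longleftrightarrow>
     open \<Omega> \<and> connected \<Omega> \<and> bounded \<Omega> \<and> \<Omega> \<noteq> {} \<and> axisymmetric_set \<Omega> \<and>
     continuous_on UNIV (\<lambda>x. \<rho>\<^sub>0 (cyl x)) \<and> (\<forall>x. \<rho>\<^sub>0 (cyl x) \<ge> 0) \<and>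
     (\<forall>x\<in>\<Omega>. \<rho>\<^sub>0 (cyl x) > 0) \<and> closure {x. \<rho>\<^sub>0 (cyl x) \<noteq> 0} = closure \<Omega> \<and>
     (\<forall>x\<in>closure \<Omega>. fst (cyl x) \<le> R\<^sub>0) \<and> merid (R\<^sub>0, 0) \<in> frontier \<Omega> \<and>
     steady_euler_poisson P \<Omega> (\<lambda>x. \<rho>\<^sub>0 (cyl x)) (rotation_field \<omega>\<^sub>0) \<and>
     (\<exists>c\<^sub>0>0. \<forall>x\<in>\<Omega>. enthalpy1 P (\<rho>\<^sub>0 (cyl x)) - newton UNIV \<rho>\<^sub>0 x
                 - integral {0..fst (cyl x)} (\<lambda>s. (\<omega>\<^sub>0 s)\<^sup>2 * s) + c\<^sub>0 = 0)"

text \<open>Near \<open>p\<^sub>0\<close> the meridional section of \<open>\<Omega>\<close> is \<open>{F < 0}\<close> for a \<open>C\<^sup>2\<close> function \<open>F\<close> with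
  gradient \<open>G \<noteq> 0\<close> and Hessian \<open>H\<close>.  The curvature of the level curve \<open>F = 0\<close> with respect to the
  inner normal is \<open>(H \<tau> \<bullet> \<tau>) / |G|\<close> with the unit tangent \<open>\<tau> = (-G\<^sub>z, G\<^sub>r) / |G|\<close>; it is positive for
  a disc.\<close>

definition C2_pos_curvature_near :: "(real ^ 3) set \<Rightarrow> rz \<Rightarrow> bool" where
  "C2_pos_curvature_near \<Omega> p\<^sub>0 \<longleftrightarrow>
     (\<exists>U (F :: rz \<Rightarrow> real) (G :: rz \<Rightarrow> rz) (H :: rz \<Rightarrow> rz \<Rightarrow>\<^sub>L rz).
        open U \<and> p\<^sub>0 \<in> U \<and>
        (\<forall>p\<in>U. GDERIV F p :> G p) \<and>
        (\<forall>p\<in>U. (G has_derivative blinfun_apply (H p)) (at p)) \<and> continuous_on U H \<and>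
        (\<forall>p\<in>U. G p \<noteq> 0) \<and>
        (\<forall>p\<in>U. merid p \<in> \<Omega> \<longleftrightarrow> F p < 0) \<and>
        (\<forall>p\<in>U. F p = 0 \<longrightarrow>
           (let \<tau> = (1 / norm (G p)) *\<^sub>R (- snd (G p), fst (G p))
            in (blinfun_apply (H p) \<tau> \<bullet> \<tau>) / norm (G p) > 0)))"

definition comparable_to_dist_power :: "(real ^ 3) set \<Rightarrow> (rz \<Rightarrow> real) \<Rightarrow> real \<Rightarrow> bool" where
  "comparable_to_dist_power \<Omega> \<rho>\<^sub>0 \<alpha> \<longleftrightarrow>
     (\<exists>C\<^sub>1>0. \<exists>C\<^sub>2>0. \<exists>\<delta>>0. \<forall>x\<in>\<Omega>. infdist x (frontier \<Omega>) < \<delta> \<longrightarrow>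
        C\<^sub>1 * infdist x (frontier \<Omega>) powr \<alpha> \<le> \<rho>\<^sub>0 (cyl x) \<and>
        \<rho>\<^sub>0 (cyl x) \<le> C\<^sub>2 * infdist x (frontier \<Omega>) powr \<alpha>)"

definition C1_on_interval :: "(real \<Rightarrow> real) \<Rightarrow> real \<Rightarrow> real \<Rightarrow> bool" where
  "C1_on_interval f a b \<longleftrightarrow>
     (\<exists>f'. continuous_on {a..b} f' \<and>
           (\<forall>r\<in>{a..b}. (f has_real_derivative f' r) (at r within {a..b})))"

text \<open>\<open>\<Upsilon>(r) = \<partial>\<^sub>r(\<omega>\<^sub>0\<^sup>2 r\<^sup>4) / r\<^sup>3\<close> on \<open>[0, R\<^sub>0]\<close>, one-sided derivative at \<open>R\<^sub>0\<close>.  For \<open>r > 0\<close> this is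
  \<open>4 \<omega>\<^sub>0\<^sup>2 + 2 r \<omega>\<^sub>0 \<omega>\<^sub>0'\<close>, hence the value \<open>4 \<omega>\<^sub>0(0)\<^sup>2\<close> of its continuous extension at \<open>r = 0\<close>.\<close>

definition Upsilon :: "(real \<Rightarrow> real) \<Rightarrow> real \<Rightarrow> real \<Rightarrow> real" where
  "Upsilon \<omega>\<^sub>0 R\<^sub>0 r =
     (if r = 0 then 4 * (\<omega>\<^sub>0 0)\<^sup>2
      else vector_derivative (\<lambda>s. (\<omega>\<^sub>0 s)\<^sup>2 * s ^ 4) (at r within {0..R\<^sub>0}) / r ^ 3)"


section \<open>The spaces\<close>

text \<open>Elements are representatives: two functions are the same element of a space iff the norm of
  their difference is zero, i.e. (the weights being positive on \<open>\<Omega>\<close>) iff they agree almost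
  everywhere on \<open>\<Omega>\<close>.\<close>

definition L2w :: "(real ^ 3) set \<Rightarrow> (rz \<Rightarrow> real) \<Rightarrow> (rz \<Rightarrow> real) set" where
  "L2w \<Omega> w = {f. (\<lambda>x. f (cyl x)) \<in> borel_measurable (lebesgue_on \<Omega>) \<and>
                  integrable (lebesgue_on \<Omega>) (\<lambda>x. w (cyl x) * (f (cyl x))\<^sup>2)}"

definition norm_L2w :: "(real ^ 3) set \<Rightarrow> (rz \<Rightarrow> real) \<Rightarrow> (rz \<Rightarrow> real) \<Rightarrow> real" where
  "norm_L2w \<Omega> w f = sqrt (LINT x|lebesgue_on \<Omega>. w (cyl x) * (f (cyl x))\<^sup>2)"

definition Ysp :: "(real ^ 3) set \<Rightarrow> (rz \<Rightarrow> real) \<Rightarrow> (rz \<Rightarrow> rz) set" where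
  "Ysp \<Omega> \<rho>\<^sub>0 = {u. (\<lambda>p. fst (u p)) \<in> L2w \<Omega> \<rho>\<^sub>0 \<and> (\<lambda>p. snd (u p)) \<in> L2w \<Omega> \<rho>\<^sub>0}"

definition innerY :: "(real ^ 3) set \<Rightarrow> (rz \<Rightarrow> real) \<Rightarrow> (rz \<Rightarrow> rz) \<Rightarrow> (rz \<Rightarrow> rz) \<Rightarrow> real" where
  "innerY \<Omega> \<rho>\<^sub>0 u v = (LINT x|lebesgue_on \<Omega>. \<rho>\<^sub>0 (cyl x) * (u (cyl x) \<bullet> v (cyl x)))"

definition normY :: "(real ^ 3) set \<Rightarrow> (rz \<Rightarrow> real) \<Rightarrow> (rz \<Rightarrow> rz) \<Rightarrow> real" where
  "normY \<Omega> \<rho>\<^sub>0 u = sqrt (innerY \<Omega> \<rho>\<^sub>0 u u)"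

text \<open>\<open>f = \<nabla>\<cdot>(\<rho>\<^sub>0 u)\<close> in the sense of distributions on \<open>\<Omega>\<close>.  As both sides are locally integrable,
  testing with \<open>C\<^sup>1\<close> functions of compact support is the same as testing with \<open>C\<^sup>\<infinity>\<close> ones.  The
  three-dimensional divergence of \<open>\<rho>\<^sub>0 (v\<^sub>r e\<^sub>r + v\<^sub>z e\<^sub>z)\<close> is
  \<open>\<partial>\<^sub>r(r \<rho>\<^sub>0 v\<^sub>r) / r + \<partial>\<^sub>z(\<rho>\<^sub>0 v\<^sub>z)\<close>.\<close>

definition is_div :: "(real ^ 3) set \<Rightarrow> (rz \<Rightarrow> real) \<Rightarrow> (rz \<Rightarrow> rz) \<Rightarrow> (rz \<Rightarrow> real) \<Rightarrow> bool" where
  "is_div \<Omega> \<rho>\<^sub>0 u f \<longleftrightarrow>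
     (\<forall>\<phi> g. (\<forall>x. GDERIV \<phi> x :> g x) \<and> continuous_on UNIV g \<and>
            (\<exists>S. compact S \<and> S \<subseteq> \<Omega> \<and> (\<forall>x. x \<notin> S \<longrightarrow> \<phi> x = 0)) \<longrightarrow>
        (LINT x|lebesgue_on \<Omega>. f (cyl x) * \<phi> x) =
        - (LINT x|lebesgue_on \<Omega>. \<rho>\<^sub>0 (cyl x) * (field3 u x \<bullet> g x)))"

definition Xsp :: "(real \<Rightarrow> real) \<Rightarrow> (real ^ 3) set \<Rightarrow> (rz \<Rightarrow> real) \<Rightarrow> (rz \<Rightarrow> real) set" where
  "Xsp P \<Omega> \<rho>\<^sub>0 = L2w \<Omega> (\<lambda>p. enthalpy2 P (\<rho>\<^sub>0 p))"

definition Zsp :: "(real \<Rightarrow> real) \<Rightarrow> (real ^ 3) set \<Rightarrow> (rz \<Rightarrow> real) \<Rightarrow> (rz \<Rightarrow> rz) set" where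
  "Zsp P \<Omega> \<rho>\<^sub>0 = {u \<in> Ysp \<Omega> \<rho>\<^sub>0. \<exists>f\<in>Xsp P \<Omega> \<rho>\<^sub>0. is_div \<Omega> \<rho>\<^sub>0 u f}"

definition wdiv :: "(real \<Rightarrow> real) \<Rightarrow> (real ^ 3) set \<Rightarrow> (rz \<Rightarrow> real) \<Rightarrow> (rz \<Rightarrow> rz) \<Rightarrow> rz \<Rightarrow> real" where
  "wdiv P \<Omega> \<rho>\<^sub>0 u = (SOME f. f \<in> Xsp P \<Omega> \<rho>\<^sub>0 \<and> is_div \<Omega> \<rho>\<^sub>0 u f)"

definition normZ :: "(real \<Rightarrow> real) \<Rightarrow> (real ^ 3) set \<Rightarrow> (rz \<Rightarrow> real) \<Rightarrow> (rz \<Rightarrow> rz) \<Rightarrow> real" where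
  "normZ P \<Omega> \<rho>\<^sub>0 u =
     normY \<Omega> \<rho>\<^sub>0 u + norm_L2w \<Omega> (\<lambda>p. enthalpy2 P (\<rho>\<^sub>0 p)) (wdiv P \<Omega> \<rho>\<^sub>0 u)"


section \<open>The operator\<close>

text \<open>\<open>h = \<nabla>g\<close> in \<open>Y\<close>, where \<open>\<nabla>\<close> is minus the adjoint of the densely defined closed operator
  \<open>u \<mapsto> \<nabla>\<cdot>(\<rho>\<^sub>0 u)\<close> with domain \<open>Z\<close>.  Since \<open>\<phi>/\<rho>\<^sub>0 \<in> Z\<close> for every axi-symmetric \<open>C\<^sup>1\<close> field \<open>\<phi>\<close> with
  compact support in \<open>\<Omega>\<close>, \<open>h\<close> is in particular the distributional gradient of \<open>g\<close> on \<open>\<Omega>\<close>.  Testing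
  with all of \<open>Z\<close> fixes the domain for which the operator is self-adjoint with form domain \<open>Z\<close>.\<close>

definition is_grad ::
  "(real \<Rightarrow> real) \<Rightarrow> (real ^ 3) set \<Rightarrow> (rz \<Rightarrow> real) \<Rightarrow> (real ^ 3 \<Rightarrow> real) \<Rightarrow> (rz \<Rightarrow> rz) \<Rightarrow> bool" where
  "is_grad P \<Omega> \<rho>\<^sub>0 g h \<longleftrightarrow>
     h \<in> Ysp \<Omega> \<rho>\<^sub>0 \<and>
     (\<forall>v\<in>Zsp P \<Omega> \<rho>\<^sub>0.
        innerY \<Omega> \<rho>\<^sub>0 h v = - (LINT x|lebesgue_on \<Omega>. g x * wdiv P \<Omega> \<rho>\<^sub>0 v (cyl x)))"

text \<open>The graph of the (unbounded) operator \<open>L\<^sub>1 + L\<^sub>2\<close> on \<open>Y\<close>: \<open>Lop \<dots> u w\<close> means that \<open>u\<close> is in the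
  domain and is mapped to \<open>w\<close>.\<close>

definition Lop ::
  "(real \<Rightarrow> real) \<Rightarrow> (real ^ 3) set \<Rightarrow> (rz \<Rightarrow> real) \<Rightarrow> (real \<Rightarrow> real) \<Rightarrow> real \<Rightarrow>
   (rz \<Rightarrow> rz) \<Rightarrow> (rz \<Rightarrow> rz) \<Rightarrow> bool" where
  "Lop P \<Omega> \<rho>\<^sub>0 \<omega>\<^sub>0 R\<^sub>0 u w \<longleftrightarrow>
     u \<in> Zsp P \<Omega> \<rho>\<^sub>0 \<and> w \<in> Ysp \<Omega> \<rho>\<^sub>0 \<and>
     (\<exists>h. is_grad P \<Omega> \<rho>\<^sub>0
            (\<lambda>x. enthalpy2 P (\<rho>\<^sub>0 (cyl x)) * wdiv P \<Omega> \<rho>\<^sub>0 u (cyl x)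
                 - newton \<Omega> (wdiv P \<Omega> \<rho>\<^sub>0 u) x) h \<and>
          (AE x in lebesgue_on \<Omega>.
             w (cyl x) = - h (cyl x) + (Upsilon \<omega>\<^sub>0 R\<^sub>0 (fst (cyl x)) * fst (u (cyl x)), 0)))"

definition Lform ::
  "(real \<Rightarrow> real) \<Rightarrow> (real ^ 3) set \<Rightarrow> (rz \<Rightarrow> real) \<Rightarrow> (real \<Rightarrow> real) \<Rightarrow> real \<Rightarrow> (rz \<Rightarrow> rz) \<Rightarrow> real" where
  "Lform P \<Omega> \<rho>\<^sub>0 \<omega>\<^sub>0 R\<^sub>0 u =
     (LINT x|lebesgue_on \<Omega>. enthalpy2 P (\<rho>\<^sub>0 (cyl x)) * (wdiv P \<Omega> \<rho>\<^sub>0 u (cyl x))\<^sup>2)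
     - (LINT x|lebesgue_on \<Omega>. newton \<Omega> (wdiv P \<Omega> \<rho>\<^sub>0 u) x * wdiv P \<Omega> \<rho>\<^sub>0 u (cyl x))
     + (LINT x|lebesgue_on \<Omega>. \<rho>\<^sub>0 (cyl x) * Upsilon \<omega>\<^sub>0 R\<^sub>0 (fst (cyl x)) * (fst (u (cyl x)))\<^sup>2)"

definition energy ::
  "(real \<Rightarrow> real) \<Rightarrow> (real ^ 3) set \<Rightarrow> (rz \<Rightarrow> real) \<Rightarrow> (real \<Rightarrow> real) \<Rightarrow> real \<Rightarrow>
   (rz \<Rightarrow> rz) \<Rightarrow> (rz \<Rightarrow> rz) \<Rightarrow> real" where
  "energy P \<Omega> \<rho>\<^sub>0 \<omega>\<^sub>0 R\<^sub>0 u v = (normY \<Omega> \<rho>\<^sub>0 v)\<^sup>2 + Lform P \<Omega> \<rho>\<^sub>0 \<omega>\<^sub>0 R\<^sub>0 u"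


section \<open>Spectrum and groups\<close>

text \<open>In what follows \<open>H\<close> is a space of functions, \<open>N\<close> its (semi)norm; identities between elements
  are understood modulo \<open>N\<close>-null functions.  \<open>A u w\<close> is the graph of an operator.\<close>

definition resolvent_set ::
  "('a \<Rightarrow> 'b::real_vector) set \<Rightarrow> (('a \<Rightarrow> 'b) \<Rightarrow> real) \<Rightarrow> (('a \<Rightarrow> 'b) \<Rightarrow> ('a \<Rightarrow> 'b) \<Rightarrow> bool) \<Rightarrow> real set"
where
  "resolvent_set H N A =
     {\<mu>. \<exists>C. \<forall>w\<in>H. \<exists>u\<in>H. A u (\<lambda>p. \<mu> *\<^sub>R u p + w p) \<and> N u \<le> C * N w \<and>
            (\<forall>u'\<in>H. A u' (\<lambda>p. \<mu> *\<^sub>R u' p + w p) \<longrightarrow> N (\<lambda>p. u' p - u p) = 0)}"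

text \<open>Only real spectral values occur, since the spectrum of a self-adjoint operator is real.\<close>

definition spectrum ::
  "('a \<Rightarrow> 'b::real_vector) set \<Rightarrow> (('a \<Rightarrow> 'b) \<Rightarrow> real) \<Rightarrow> (('a \<Rightarrow> 'b) \<Rightarrow> ('a \<Rightarrow> 'b) \<Rightarrow> bool) \<Rightarrow> real set"
where
  "spectrum H N A = - resolvent_set H N A"

definition C0_group ::
  "('a \<Rightarrow> 'b::real_vector) set \<Rightarrow> (('a \<Rightarrow> 'b) \<Rightarrow> real) \<Rightarrow> (real \<Rightarrow> ('a \<Rightarrow> 'b) \<Rightarrow> ('a \<Rightarrow> 'b)) \<Rightarrow> bool" where
  "C0_group H N T \<longleftrightarrow>
     (\<forall>t. \<forall>U\<in>H. T t U \<in> H) \<and>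
     (\<forall>t. \<forall>U\<in>H. \<forall>V\<in>H. \<forall>a b.
        N (\<lambda>p. T t (\<lambda>q. a *\<^sub>R U q + b *\<^sub>R V q) p - (a *\<^sub>R T t U p + b *\<^sub>R T t V p)) = 0) \<and>
     (\<forall>t. \<exists>C. \<forall>U\<in>H. N (T t U) \<le> C * N U) \<and>
     (\<forall>U\<in>H. N (\<lambda>p. T 0 U p - U p) = 0) \<and>
     (\<forall>s t. \<forall>U\<in>H. N (\<lambda>p. T (s + t) U p - T s (T t U) p) = 0) \<and>
     (\<forall>U\<in>H. ((\<lambda>t. N (\<lambda>p. T t U p - U p)) \<longlongrightarrow> 0) (at 0))"

definition generator ::
  "('a \<Rightarrow> 'b::real_vector) set \<Rightarrow> (('a \<Rightarrow> 'b) \<Rightarrow> real) \<Rightarrow> (real \<Rightarrow> ('a \<Rightarrow> 'b) \<Rightarrow> ('a \<Rightarrow> 'b)) \<Rightarrow>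
   ('a \<Rightarrow> 'b) \<Rightarrow> ('a \<Rightarrow> 'b) \<Rightarrow> bool" where
  "generator H N T U W \<longleftrightarrow>
     U \<in> H \<and> W \<in> H \<and> ((\<lambda>t. N (\<lambda>p. (1 / t) *\<^sub>R (T t U p - U p) - W p)) \<longlongrightarrow> 0) (at 0)"

text \<open>A state \<open>(u\<^sub>2, u\<^sub>2\<^sub>t)\<close> in \<open>Z \<times> Y\<close> is represented by the function \<open>p \<mapsto> (u\<^sub>2 p, u\<^sub>2\<^sub>t p)\<close>.\<close>

definition ZYsp :: "(real \<Rightarrow> real) \<Rightarrow> (real ^ 3) set \<Rightarrow> (rz \<Rightarrow> real) \<Rightarrow> (rz \<Rightarrow> rz \<times> rz) set" where
  "ZYsp P \<Omega> \<rho>\<^sub>0 = {U. fst \<circ> U \<in> Zsp P \<Omega> \<rho>\<^sub>0 \<and> snd \<circ> U \<in> Ysp \<Omega> \<rho>\<^sub>0}"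

definition normZY :: "(real \<Rightarrow> real) \<Rightarrow> (real ^ 3) set \<Rightarrow> (rz \<Rightarrow> real) \<Rightarrow> (rz \<Rightarrow> rz \<times> rz) \<Rightarrow> real" where
  "normZY P \<Omega> \<rho>\<^sub>0 U = normZ P \<Omega> \<rho>\<^sub>0 (fst \<circ> U) + normY \<Omega> \<rho>\<^sub>0 (snd \<circ> U)"

text \<open>\<open>u\<^sub>t\<^sub>t = - L u\<close> as the first order system \<open>(u, v)\<^sub>t = (v, - L u)\<close>: the operator with domain
  \<open>D(L) \<times> Z\<close> mapping \<open>U = (u, v)\<close> to \<open>W = (v, - L u)\<close>.\<close>

definition second_order_op ::
  "(real \<Rightarrow> real) \<Rightarrow> (real ^ 3) set \<Rightarrow> (rz \<Rightarrow> real) \<Rightarrow> (real \<Rightarrow> real) \<Rightarrow> real \<Rightarrow>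
   (rz \<Rightarrow> rz \<times> rz) \<Rightarrow> (rz \<Rightarrow> rz \<times> rz) \<Rightarrow> bool" where
  "second_order_op P \<Omega> \<rho>\<^sub>0 \<omega>\<^sub>0 R\<^sub>0 U W \<longleftrightarrow>
     W \<in> ZYsp P \<Omega> \<rho>\<^sub>0 \<and> snd \<circ> U \<in> Zsp P \<Omega> \<rho>\<^sub>0 \<and>
     normZ P \<Omega> \<rho>\<^sub>0 (\<lambda>p. fst (W p) - snd (U p)) = 0 \<and>
     Lop P \<Omega> \<rho>\<^sub>0 \<omega>\<^sub>0 R\<^sub>0 (fst \<circ> U) (\<lambda>p. - snd (W p))"

end

theory Submission
  imports Defs
begin

text \<open>
  Let \<open>\<Gamma>\<close> be the graph of \<open>u \<mapsto> \<nabla>\<cdot>(\<rho>\<^sub>0 u)\<close>, a closed subspace of \<open>L\<^sup>2 \<times> L\<^sup>2\<close>, and \<open>a\<close> the quadratic form of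
  \<open>L\<close> on it.  The Newtonian term is a compact perturbation, so \<open>a\<close> is coercive up to a multiple of \<open>|u|\<^sup>2\<close>.

  No spectral theorem is needed.  If \<open>m\<close>, the infimum of \<open>a(u,u) / |u|\<^sup>2\<close>, were in the resolvent set, so that
  \<open>z = (L - m) q\<close> with \<open>|q| \<le> B |z|\<close> for every \<open>z\<close>, then \<open>0 \<le> (a - m)(z - q/B, z - q/B)\<close> would give
  \<open>(a - m)(z,z) \<ge> |z|\<^sup>2 / B\<close>; hence \<open>a \<ge> \<eta>\<^sub>0 |u|\<^sup>2\<close>, and \<open>\<eta>\<^sub>0\<close> is the infimum.

  The group is the strong limit of the exponentials of commuting bounded operators built from the resolvents
  of \<open>L\<close>.  With \<open>s\<^sup>2 = - \<eta>\<^sub>0\<close> and the conserved energy \<open>E\<close>, the function \<open>P = s\<^sup>2 |u|\<^sup>2 + |E|\<close> satisfies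
  \<open>|P'| \<le> 2 s P\<close>, which is the sharp growth rate.  For the instability start from \<open>(u\<^sub>0, 0)\<close> with
  \<open>a(u\<^sub>0,u\<^sub>0) = - s\<^sup>2 |u\<^sub>0|\<^sup>2\<close> for some \<open>s\<^sup>2 \<ge> - \<eta>\<^sub>0 - \<epsilon>\<close>: then \<open>f = |u|\<^sup>2\<close> satisfies
  \<open>f f'' \<ge> f'\<^sup>2 + 2 s\<^sup>2 f(0) f\<close>, hence \<open>f \<ge> f(0) exp (2 s t) / 4\<close>.
\<close>

section \<open>Symmetric coercive forms\<close>

text \<open>Multiplication by the square root of the weight carries every weighted space
  isometrically into one \<open>l2\<close> space over R^3. There \<open>Y\<close> and the space of
  divergences become closed subspaces, an element of \<open>Z\<close> becomes a point of
  \<open>\<Gamma>\<close> with the graph norm, and the phase space is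
  \<open>\<Gamma> \<times> Y\<close>. Representatives are chosen only at the very end. The sharp
  exponent dictates the regularisation. With \<open>F = (1 + k (L + M))^-1\<close> the bounded
  system is \<open>u' = F v\<close>, \<open>v' = - L F u\<close>. The same symmetric contraction
  stands in both entries, so the original energy is an exact invariant of every approximate flow,
  and the growth bound holds with the same constants for all \<open>k\<close>. The limit of such
  flows has a generator that extends the second order operator; that it is not larger is shown with
  an injective bounded operator which commutes with the flow and maps into the domain. Compactness
  of the Newtonian term enters by contradiction: if \<open>u\<close> tends to 0 in \<open>Y\<close>
  along a sequence of graph norm 1, the divergences tend weakly to 0, because the inner product with
  densely many graph points sees only \<open>u\<close>.\<close>

lemma lax_milgram_symmetric:
  fixes B :: "'a::{real_inner,banach} \<Rightarrow> 'a \<Rightarrow> real"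
  assumes B: "bounded_bilinear B" and sym: "\<And>x y. B x y = B y x"
    and S: "subspace S" "closed S"
    and pos: "\<delta> > 0" and coer: "\<And>x. x \<in> S \<Longrightarrow> \<delta> * (norm x)\<^sup>2 \<le> B x x"
    and l: "bounded_linear l"
  obtains x where "x \<in> S" "\<And>y. y \<in> S \<Longrightarrow> B x y = l y"
proof -
  interpret B: bounded_bilinear B by (rule B)
  interpret l: bounded_linear l by (rule l)
  define J where "J x = B x x - 2 * l x" for x
  obtain C where C: "C > 0" "\<And>x. \<bar>l x\<bar> \<le> norm x * C"
    using l.pos_bounded by auto
  have below: "J x \<ge> - C\<^sup>2 / \<delta>" if "x \<in> S" for x
  proof -
    have "0 \<le> (\<delta> * norm x - C)\<^sup>2 / \<delta>" using pos by simp
    also have "\<dots> = \<delta> * (norm x)\<^sup>2 - 2 * (norm x * C) + C\<^sup>2 / \<delta>"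
      using pos by (simp add: power2_diff field_simps power2_eq_square)
    finally show ?thesis using coer[OF that] C(2)[of x] by (simp add: J_def)
  qed
  define m where "m = Inf (J ` S)"
  have ne: "J ` S \<noteq> {}" using subspace_0[OF S(1)] by auto
  have bdd: "bdd_below (J ` S)" using below by (intro bdd_belowI2) 
  have m_le: "m \<le> J x" if "x \<in> S" for x
    unfolding m_def using bdd that by (simp add: cInf_lower)
  have "\<exists>x\<in>S. J x < m + 1 / Suc n" for n
    using cInf_lessD[OF ne, of "m + 1 / Suc n"] by (auto simp: m_def)
  then obtain x where x: "\<And>n. x n \<in> S" "\<And>n. J (x n) < m + 1 / Suc n" by metis
  \<comment> \<open>Parallelogram law for \<open>B\<close>; the linear terms cancel. As
    \<open>J\<close> is at least \<open>m\<close> at the midpoint, two almost minimal points must be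
    close to each other.\<close>
  have par: "B (u - v) (u - v) = 2 * J u + 2 * J v - 4 * J ((1/2) *\<^sub>R (u + v))" for u v
    by (simp add: J_def B.add_left B.add_right B.diff_left B.diff_right B.scaleR_left B.scaleR_right
        l.add l.scaleR sym[of v u] algebra_simps)
  have cauchy_est: "\<delta> * (norm (x i - x j))\<^sup>2 \<le> 2 / Suc i + 2 / Suc j" for i j
  proof -
    have "(1/2) *\<^sub>R (x i + x j) \<in> S" "x i - x j \<in> S"
      using x(1) S(1) by (auto intro!: subspace_scale subspace_add subspace_diff)
    then have "\<delta> * (norm (x i - x j))\<^sup>2 \<le> B (x i - x j) (x i - x j)" "m \<le> J ((1/2) *\<^sub>R (x i + x j))"
      using coer m_le by auto
    then show ?thesis using x(2)[of i] x(2)[of j] par[of "x i" "x j"] by simp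
  qed
  have "Cauchy x"
  proof (rule CauchyI)
    fix e :: real assume e: "e > 0"
    obtain N where N: "4 / (\<delta> * e\<^sup>2) < of_nat N" using reals_Archimedean2 by blast
    have "norm (x i - x j) < e" if "i \<ge> N" "j \<ge> N" for i j
    proof -
      have "4 / (\<delta> * e\<^sup>2) < Suc N" using N by simp
      then have N': "4 / Suc N < \<delta> * e\<^sup>2" using e pos by (simp add: field_simps)
      have "2 / real (Suc i) \<le> 2 / Suc N" "2 / real (Suc j) \<le> 2 / Suc N"
        using that by (auto intro!: divide_left_mono)
      then have "\<delta> * (norm (x i - x j))\<^sup>2 < \<delta> * e\<^sup>2" using cauchy_est[of i j] N' by simp
      then have "(norm (x i - x j))\<^sup>2 < e\<^sup>2" using pos by simp
      then show ?thesis using e by (meson less_imp_le power2_less_imp_less)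
    qed
    then show "\<exists>N. \<forall>i\<ge>N. \<forall>j\<ge>N. norm (x i - x j) < e" by blast
  qed
  then obtain z where z: "x \<longlonglongrightarrow> z" using Cauchy_convergent_iff convergent_def by blast
  have zS: "z \<in> S" using S(2) x(1) z closed_sequentially by blast
  have Jz: "J z \<le> m"
  proof (rule LIMSEQ_le)
    show "(\<lambda>n. J (x n)) \<longlonglongrightarrow> J z" unfolding J_def by (intro tendsto_intros B.tendsto l.tendsto z)
    show "(\<lambda>n. m + 1 / real (Suc n)) \<longlonglongrightarrow> m"
      using tendsto_add[OF tendsto_const LIMSEQ_inverse_real_of_nat, of m] by (simp add: inverse_eq_divide)
    show "\<exists>N. \<forall>n\<ge>N. J (x n) \<le> m + 1 / real (Suc n)" using x(2) less_imp_le by blast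
  qed
  have "B z y = l y" if y: "y \<in> S" for y
  proof (rule ccontr)
    assume ne: "B z y \<noteq> l y"
    define d where "d = B z y - l y"
    \<comment> \<open>The summand 1 excludes a zero denominator. The step \<open>t = - d / k\<close>
      then lowers \<open>J\<close> by at least \<open>d\<^sup>2 / k\<close>, against the minimality
      of \<open>z\<close>.\<close>
    define k where "k = B y y + 1"
    have "0 \<le> \<delta> * (norm y)\<^sup>2" using pos by simp
    then have k: "k > 0" using coer[OF y] unfolding k_def by linarith
    define t where "t = - d / k"
    have "z + t *\<^sub>R y \<in> S" using y zS S(1) by (auto intro!: subspace_scale subspace_add)
    then have "J z \<le> J (z + t *\<^sub>R y)" using m_le Jz by force
    also have "\<dots> = J z + 2 * t * d + t\<^sup>2 * B y y"
      by (simp add: J_def d_def B.add_left B.add_right B.scaleR_left B.scaleR_right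
        l.add l.scaleR sym[of y z] algebra_simps power2_eq_square)
    also have "\<dots> \<le> J z + 2 * t * d + t\<^sup>2 * k" by (simp add: k_def algebra_simps)
    also have "\<dots> = J z - d\<^sup>2 / k" using k by (simp add: t_def field_simps power2_eq_square)
    finally show False using ne k by (simp add: d_def divide_le_0_iff)
  qed
  then show ?thesis using zS that by blast
qed

lemma subspace_closure:
  fixes D :: "'a::real_normed_vector set"
  assumes "subspace D" shows "subspace (closure D)"
  unfolding subspace_def
proof (intro conjI ballI allI)
  show "0 \<in> closure D" using subspace_0[OF assms] closure_subset by blast
next
  fix x y assume "x \<in> closure D" "y \<in> closure D"
  then obtain f g where "\<And>n. f n \<in> D" "f \<longlonglongrightarrow> x" "\<And>n. g n \<in> D" "g \<longlonglongrightarrow> y"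
    unfolding closure_sequential by blast
  then have "\<And>n. f n + g n \<in> D" "(\<lambda>n. f n + g n) \<longlonglongrightarrow> x + y"
    by (auto intro: subspace_add[OF assms] tendsto_add)
  then show "x + y \<in> closure D" unfolding closure_sequential by (intro exI[of _ "\<lambda>n. f n + g n"]) auto
next
  fix c :: real and x assume "x \<in> closure D"
  then obtain f where "\<And>n. f n \<in> D" "f \<longlonglongrightarrow> x" unfolding closure_sequential by blast
  then have "\<And>n. c *\<^sub>R f n \<in> D" "(\<lambda>n. c *\<^sub>R f n) \<longlonglongrightarrow> c *\<^sub>R x"
    by (auto intro: subspace_scale[OF assms] tendsto_intros)
  then show "c *\<^sub>R x \<in> closure D" unfolding closure_sequential by (intro exI[of _ "\<lambda>n. c *\<^sub>R f n"]) auto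
qed

text \<open>Representing \<open>B x\<close> on \<open>closure D\<close> yields the projection of
  \<open>x\<close> that is orthogonal with respect to \<open>B\<close>; the remainder is orthogonal
  to \<open>D\<close>, hence zero. The density of operator domains is obtained from this
  test.\<close>

lemma subset_closure_if_orthogonal_zero:
  fixes B :: "'a::{real_inner,banach} \<Rightarrow> 'a \<Rightarrow> real"
  assumes B: "bounded_bilinear B" and sym: "\<And>x y. B x y = B y x"
    and S: "subspace S" "closed S"
    and pos: "\<delta> > 0" and coer: "\<And>x. x \<in> S \<Longrightarrow> \<delta> * (norm x)\<^sup>2 \<le> B x x"
    and D: "subspace D" "D \<subseteq> S"
    and orth: "\<And>x. x \<in> S \<Longrightarrow> (\<And>d. d \<in> D \<Longrightarrow> B x d = 0) \<Longrightarrow> x = 0"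
  shows "S \<subseteq> closure D"
proof
  fix x assume x: "x \<in> S"
  interpret B: bounded_bilinear B by (rule B)
  have sub: "closure D \<subseteq> S" using D(2) S(2) by (simp add: closure_minimal)
  have cl: "subspace (closure D)" by (rule subspace_closure[OF D(1)]) 
  obtain d where d: "d \<in> closure D" "\<And>y. y \<in> closure D \<Longrightarrow> B d y = B x y"
    using lax_milgram_symmetric[OF B sym cl closed_closure pos _ B.bounded_linear_right[of x]] coer sub
    by blast
  have "x - d = 0"
  proof (rule orth)
    show "x - d \<in> S" using x d(1) sub S(1) by (auto intro: subspace_diff)
    show "B (x - d) e = 0" if "e \<in> D" for e
      using d(2)[of e] that closure_subset[of D] by (auto simp: B.diff_left)
  qed
  then show "x \<in> closure D" using d(1) by simp
qed

section \<open>The exponential of a bounded operator\<close>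

text \<open>A copy of the bounded operators in which multiplication is composition, so that
  \<open>exp\<close> and its calculus apply. \<open>perfect_space\<close> excludes the zero space,
  where the identity would have norm 0 and not 1.\<close>

typedef (overloaded) 'a endo = "UNIV :: ('a::{banach,perfect_space} \<Rightarrow>\<^sub>L 'a) set"
  morphisms endo_blinfun Endo ..

setup_lifting type_definition_endo

instantiation endo :: ("{banach,perfect_space}") real_normed_algebra_1
begin

lift_definition zero_endo :: "'a endo" is 0 .
lift_definition one_endo :: "'a endo" is id_blinfun .
lift_definition plus_endo :: "'a endo \<Rightarrow> 'a endo \<Rightarrow> 'a endo" is "(+)" .
lift_definition minus_endo :: "'a endo \<Rightarrow> 'a endo \<Rightarrow> 'a endo" is "(-)" .
lift_definition uminus_endo :: "'a endo \<Rightarrow> 'a endo" is uminus .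
lift_definition times_endo :: "'a endo \<Rightarrow> 'a endo \<Rightarrow> 'a endo" is "(o\<^sub>L)" .
lift_definition scaleR_endo :: "real \<Rightarrow> 'a endo \<Rightarrow> 'a endo" is "(*\<^sub>R)" .
lift_definition norm_endo :: "'a endo \<Rightarrow> real" is norm .
lift_definition dist_endo :: "'a endo \<Rightarrow> 'a endo \<Rightarrow> real" is dist .
definition sgn_endo :: "'a endo \<Rightarrow> 'a endo" where "sgn_endo x = scaleR (inverse (norm x)) x"
definition uniformity_endo :: "('a endo \<times> 'a endo) filter" where
  "uniformity_endo = (INF e\<in>{0<..}. principal {(x, y). dist x y < e})"
definition open_endo :: "'a endo set \<Rightarrow> bool" where
  "open_endo U = (\<forall>x\<in>U. eventually (\<lambda>(x', y). x' = x \<longrightarrow> y \<in> U) uniformity)"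

instance
proof
  fix x y z :: "'a endo" and a b :: real
  show "dist x y = norm (x - y)" by transfer (rule dist_norm)
  show "sgn x = scaleR (inverse (norm x)) x" by (rule sgn_endo_def)
  show "x + y + z = x + (y + z)" "x + y = y + x" "0 + x = x" "- x + x = 0" "x - y = x + - y"
    by (transfer; simp)+
  show "a *\<^sub>R (x + y) = a *\<^sub>R x + a *\<^sub>R y" "(a + b) *\<^sub>R x = a *\<^sub>R x + b *\<^sub>R x"
    "a *\<^sub>R b *\<^sub>R x = (a * b) *\<^sub>R x" "1 *\<^sub>R x = x"
    by (transfer; simp add: scaleR_right_distrib scaleR_left_distrib)+
  show "uniformity = (INF e\<in>{0<..}. principal {(x::'a endo, y). dist x y < e})"
    by (rule uniformity_endo_def)
  show "open U = (\<forall>x\<in>U. eventually (\<lambda>(x', y). x' = x \<longrightarrow> y \<in> U) uniformity)" for U :: "'a endo set"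
    by (rule open_endo_def)
  show "(norm x = 0) = (x = 0)" "norm (x + y) \<le> norm x + norm y" "norm (a *\<^sub>R x) = \<bar>a\<bar> * norm x"
    by (transfer; simp add: norm_triangle_ineq)+
  show "x * y * z = x * (y * z)" by (transfer; auto intro!: blinfun_eqI)
  show "1 * x = x" "x * 1 = x" by (transfer; auto intro!: blinfun_eqI)+
  show "(x + y) * z = x * z + y * z" "x * (y + z) = x * y + x * z"
    "a *\<^sub>R x * y = a *\<^sub>R (x * y)" "x * a *\<^sub>R y = a *\<^sub>R (x * y)"
    by (transfer; auto intro!: blinfun_eqI simp: blinfun.bilinear_simps)+
  show "norm (1::'a endo) = 1" by transfer (rule norm_blinfun_id)
  show "norm (x * y) \<le> norm x * norm y" by transfer (rule norm_blinfun_compose)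
  show "(0::'a endo) \<noteq> 1"
  proof transfer
    show "(0::'a \<Rightarrow>\<^sub>L 'a) \<noteq> id_blinfun"
      using norm_blinfun_id[where 'a='a] norm_zero[where 'a="'a \<Rightarrow>\<^sub>L 'a"] by (metis zero_neq_one)
  qed
qed

end

instance endo :: ("{banach,perfect_space}") banach
proof
  fix X :: "nat \<Rightarrow> 'a endo" assume "Cauchy X"
  then have "Cauchy (\<lambda>n. endo_blinfun (X n))" by (simp add: Cauchy_def dist_endo.rep_eq)
  then obtain L where "(\<lambda>n. endo_blinfun (X n)) \<longlonglongrightarrow> L" using Cauchy_convergent_iff convergent_def by blast
  then have "X \<longlonglongrightarrow> Endo L" by (simp add: lim_sequentially dist_endo.rep_eq Endo_inverse)
  then show "convergent X" by (rule convergentI)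
qed

text \<open>States of the first order system live in \<open>('a \<times> 'b) \<times> 'a\<close>,
  and \<open>endo\<close> is formed over this product.\<close>

instance prod :: (perfect_space, topological_space) perfect_space
proof
  fix x :: "'a \<times> 'b"
  show "\<not> open {x}" using open_image_fst[of "{x}"] not_open_singleton[of "fst x"] by auto
qed

definition apply_endo :: "'a::{banach,perfect_space} endo \<Rightarrow> 'a \<Rightarrow> 'a" (infixr "\<cdot>" 75) where
  "A \<cdot> x = blinfun_apply (endo_blinfun A) x"

definition endo_of :: "('a::{banach,perfect_space} \<Rightarrow> 'a) \<Rightarrow> 'a endo" where
  "endo_of f = Endo (Blinfun f)"

lemma endo_of_apply: "bounded_linear f \<Longrightarrow> endo_of f \<cdot> x = f x"
  by (simp add: endo_of_def apply_endo_def Endo_inverse bounded_linear_Blinfun_apply)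

lemma endo_eqI: "(\<And>x. A \<cdot> x = B \<cdot> x) \<Longrightarrow> A = B"
  unfolding apply_endo_def by (metis blinfun_eqI endo_blinfun_inject)

lemma bounded_bilinear_apply_endo: "bounded_bilinear (\<cdot>)"
proof -
  have 1: "bounded_linear (endo_blinfun :: 'a endo \<Rightarrow> _)"
    by (rule bounded_linear_intro[where K=1])
      (simp_all add: plus_endo.rep_eq scaleR_endo.rep_eq norm_endo.rep_eq)
  show ?thesis
    unfolding apply_endo_def
    by (rule bounded_bilinear.comp1[OF bounded_bilinear_blinfun_apply 1])
qed

interpretation apply_endo: bounded_bilinear "(\<cdot>)" by (rule bounded_bilinear_apply_endo)

lemma mult_apply_endo: "(A * B) \<cdot> x = A \<cdot> B \<cdot> x"
  by (simp add: apply_endo_def times_endo.rep_eq)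

lemma one_apply_endo: "1 \<cdot> x = x"
  by (simp add: apply_endo_def one_endo.rep_eq)

definition flow :: "'a::{banach,perfect_space} endo \<Rightarrow> real \<Rightarrow> 'a \<Rightarrow> 'a" where
  "flow A t x = exp (t *\<^sub>R A) \<cdot> x"

lemma flow_0: "flow A 0 x = x"
  by (simp add: flow_def one_apply_endo)

lemma flow_add: "flow A (s + t) x = flow A s (flow A t x)"
  by (simp add: flow_def mult_apply_endo[symmetric] scaleR_add_left exp_add_commuting)

lemma bounded_linear_flow: "bounded_linear (flow A t)"
  unfolding flow_def[abs_def] by (rule apply_endo.bounded_linear_right)

lemma flow_has_vector_derivative:
  "((\<lambda>t. flow A t x) has_vector_derivative A \<cdot> flow A t x) (at t within S)"
proof -
  have "((\<lambda>t. exp (t *\<^sub>R A)) has_vector_derivative A * exp (t *\<^sub>R A)) (at t within S)"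
    using exp_scaleR_has_vector_derivative_left has_vector_derivative_at_within by blast
  from bounded_linear.has_vector_derivative[OF apply_endo.bounded_linear_left[of x] this]
  show ?thesis by (simp add: flow_def mult_apply_endo)
qed

lemma exp_commute:
  fixes A B :: "'a::{real_normed_algebra_1,banach}"
  assumes "A * B = B * A" shows "exp A * B = B * exp A"
proof -
  have pow: "A ^ n * B = B * A ^ n" for n
  proof (induction n)
    case (Suc n)
    have "A ^ Suc n * B = A * (A ^ n * B)" by (simp only: power_Suc mult.assoc)
    also have "\<dots> = (A * B) * A ^ n" by (simp only: Suc mult.assoc)
    finally show ?case by (simp only: assms mult.assoc power_Suc)
  qed simp
  have "exp A * B = (\<Sum>n. (A ^ n /\<^sub>R fact n) * B)"
    unfolding exp_def by (rule suminf_mult2[OF summable_exp_generic])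
  also have "(\<lambda>n. (A ^ n /\<^sub>R fact n) * B) = (\<lambda>n. B * (A ^ n /\<^sub>R fact n))"
    by (rule ext) (simp only: mult_scaleR_left mult_scaleR_right pow)
  also have "(\<Sum>n. B * (A ^ n /\<^sub>R fact n)) = B * exp A"
    unfolding exp_def by (rule suminf_mult[OF summable_exp_generic])
  finally show ?thesis .
qed

lemma flow_commute:
  assumes "A * B = B * A" shows "B \<cdot> flow A t x = flow A t (B \<cdot> x)"
proof -
  have "exp (t *\<^sub>R A) * B = B * exp (t *\<^sub>R A)"
    by (rule exp_commute) (simp only: mult_scaleR_left mult_scaleR_right assms)
  then show ?thesis unfolding flow_def by (simp only: mult_apply_endo[symmetric])
qed

text \<open>The phase space is a closed subspace and not a type of its own, so its invariance has to
  be shown: the partial sums of the exponential series lie in \<open>E\<close>.\<close>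

lemma flow_invariant:
  assumes E: "subspace E" "closed E" and A: "\<And>x. x \<in> E \<Longrightarrow> A \<cdot> x \<in> E" and x: "x \<in> E"
  shows "flow A t x \<in> E"
proof -
  have pow: "A ^ n \<cdot> x \<in> E" for n
    by (induction n) (auto simp: one_apply_endo mult_apply_endo x intro: A)
  have "(\<lambda>n. ((t *\<^sub>R A) ^ n /\<^sub>R fact n) \<cdot> x) sums (exp (t *\<^sub>R A) \<cdot> x)"
    by (intro bounded_linear.sums[OF apply_endo.bounded_linear_left] exp_converges)
  then have "(\<lambda>n. \<Sum>k<n. ((t *\<^sub>R A) ^ k /\<^sub>R fact k) \<cdot> x) \<longlonglongrightarrow> flow A t x"
    by (simp add: sums_def flow_def)
  moreover have "(\<Sum>k<n. ((t *\<^sub>R A) ^ k /\<^sub>R fact k) \<cdot> x) \<in> E" for n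
  proof (intro subspace_sum[OF E(1)])
    fix k
    have "((t *\<^sub>R A) ^ k /\<^sub>R fact k) \<cdot> x = (inverse (fact k) * t ^ k) *\<^sub>R (A ^ k \<cdot> x)"
      by (simp only: scaleR_power apply_endo.scaleR_left scaleR_scaleR)
    then show "((t *\<^sub>R A) ^ k /\<^sub>R fact k) \<cdot> x \<in> E"
      by (simp only: subspace_scale[OF E(1) pow])
  qed
  ultimately show ?thesis by (rule closed_sequentially[OF E(2), rotated])
qed

lemma norm_diff_le_if_vector_derivative_le:
  fixes f :: "real \<Rightarrow> 'a::real_normed_vector"
  assumes "\<And>r. r \<in> {0..1} \<Longrightarrow> (f has_vector_derivative f' r) (at r within {0..1})"
    and "\<And>r. r \<in> {0..1} \<Longrightarrow> norm (f' r) \<le> B"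
  shows "norm (f 1 - f 0) \<le> B"
proof -
  have "norm (f 1 - f 0) \<le> B * norm (1 - 0 :: real)"
  proof (rule differentiable_bound[of "{0..1}" f "\<lambda>r h. h *\<^sub>R f' r" B 1 0])
    show "(f has_derivative (\<lambda>h. h *\<^sub>R f' r)) (at r within {0..1})" if "r \<in> {0..1}" for r
      using assms(1)[OF that] by (simp add: has_vector_derivative_def)
    show "onorm (\<lambda>h. h *\<^sub>R f' r) \<le> B" if "r \<in> {0..1}" for r
      using assms(2)[OF that] by (intro onorm_le) (simp add: mult.commute[of B] mult_left_mono)
  qed auto
  then show ?thesis by simp
qed

section \<open>Groups as limits of flows of commuting bounded operators\<close>

text \<open>A Trotter-Kato setting. The bound \<open>flow_le\<close> is uniform in \<open>n\<close>
  and two-sided in time, the generators converge on the dense set \<open>D\<close>, and commutation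
  makes the difference of two flows explicit. \<open>G\<close> is the limit on \<open>D\<close>, not
  yet known to be the whole generator.\<close>

locale approx_group =
  fixes E :: "'e::{banach,perfect_space} set" and A :: "nat \<Rightarrow> 'e endo"
    and D :: "'e set" and G :: "'e \<Rightarrow> 'e" and C s :: real
  assumes subspace_E: "subspace E" and closed_E: "closed E"
    and A_E: "\<And>n x. x \<in> E \<Longrightarrow> A n \<cdot> x \<in> E"
    and A_commute: "\<And>m n. A m * A n = A n * A m"
    and flow_le: "\<And>n t x. x \<in> E \<Longrightarrow> norm (flow (A n) t x) \<le> C * exp (s * \<bar>t\<bar>) * norm x"
    and C_pos: "C > 0" and s_nonneg: "s \<ge> 0"
    and D_E: "D \<subseteq> E" and dense: "E \<subseteq> closure D"
    and A_tendsto: "\<And>x. x \<in> D \<Longrightarrow> (\<lambda>n. A n \<cdot> x) \<longlonglongrightarrow> G x"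
begin

definition T :: "real \<Rightarrow> 'e \<Rightarrow> 'e" where "T t x = lim (\<lambda>n. flow (A n) t x)"

lemma flow_E: "x \<in> E \<Longrightarrow> flow (A n) t x \<in> E"
  by (rule flow_invariant[OF subspace_E closed_E A_E])

lemma flow_le_mono:
  assumes "x \<in> E" "\<bar>t\<bar> \<le> \<tau>" shows "norm (flow (A n) t x) \<le> C * exp (s * \<tau>) * norm x"
proof -
  have "C * exp (s * \<bar>t\<bar>) * norm x \<le> C * exp (s * \<tau>) * norm x"
    using assms(2) C_pos s_nonneg by (intro mult_right_mono mult_left_mono) (auto intro: mult_left_mono)
  then show ?thesis using flow_le[OF assms(1), of n t] by linarith
qed

lemma flow_scale: "flow B (r * t) x = flow (t *\<^sub>R B) r x"
  by (simp add: flow_def)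

text \<open>Interpolate between the two flows by running \<open>A n\<close> for time
  \<open>r * t\<close> and \<open>A m\<close> for the remaining time. By commutation the derivative
  in \<open>r\<close> has \<open>A n - A m\<close> acting directly on \<open>x\<close>, which is
  small for \<open>x\<close> in \<open>D\<close>.\<close>

lemma flow_diff_le:
  assumes x: "x \<in> E"
  shows "norm (flow (A n) t x - flow (A m) t x)
    \<le> \<bar>t\<bar> * (C * exp (s * \<bar>t\<bar>) * (C * exp (s * \<bar>t\<bar>))) * norm (A n \<cdot> x - A m \<cdot> x)"
proof -
  define B where "B = A n - A m"
  \<comment> \<open>The left side is convenient to differentiate in \<open>r\<close>, the right side
    to estimate: the flow of \<open>A n - A m\<close> alone has no uniform bound.\<close>
  have split: "flow (A m) t (flow B (r * t) y) = flow (A m) ((1 - r) * t) (flow (A n) (r * t) y)" for r y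
  proof -
    have c: "A m * A n = A n * A m" by (rule A_commute)
    have "exp (t *\<^sub>R A m) * exp ((r * t) *\<^sub>R B) = exp (t *\<^sub>R A m + (r * t) *\<^sub>R B)"
      by (rule exp_add_commuting[symmetric]) (simp add: B_def algebra_simps c)
    also have "t *\<^sub>R A m + (r * t) *\<^sub>R B = ((1 - r) * t) *\<^sub>R A m + (r * t) *\<^sub>R A n"
      by (simp add: B_def algebra_simps)
    also have "exp \<dots> = exp (((1 - r) * t) *\<^sub>R A m) * exp ((r * t) *\<^sub>R A n)"
      by (rule exp_add_commuting) (simp add: c)
    finally show ?thesis by (simp add: flow_def mult_apply_endo[symmetric])
  qed
  define f where "f r = flow (A m) t (flow B (r * t) x)" for r
  have "norm (f 1 - f 0) \<le> \<bar>t\<bar> * (C * exp (s * \<bar>t\<bar>) * (C * exp (s * \<bar>t\<bar>))) * norm (B \<cdot> x)"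
  proof (rule norm_diff_le_if_vector_derivative_le)
    fix r :: real assume r: "r \<in> {0..1}"
    let ?d = "flow (A m) t ((t *\<^sub>R B) \<cdot> flow (t *\<^sub>R B) r x)"
    show "(f has_vector_derivative ?d) (at r within {0..1})"
      unfolding f_def flow_scale
      by (rule bounded_linear.has_vector_derivative[OF bounded_linear_flow flow_has_vector_derivative])
    have "?d = t *\<^sub>R flow (A m) t (flow B (r * t) (B \<cdot> x))"
      by (simp add: flow_scale[symmetric] apply_endo.scaleR_left flow_commute
          linear_cmul[OF bounded_linear.linear[OF bounded_linear_flow]])
    also have "\<dots> = t *\<^sub>R flow (A m) ((1 - r) * t) (flow (A n) (r * t) (B \<cdot> x))" by (simp add: split)
    finally have d: "?d = \<dots>" .
    have le: "\<bar>(1 - r) * t\<bar> \<le> \<bar>t\<bar>" "\<bar>r * t\<bar> \<le> \<bar>t\<bar>"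
      using r by (auto simp: abs_mult intro: mult_left_le_one_le)
    have Bx: "B \<cdot> x \<in> E" using A_E[OF x] subspace_E
      by (simp add: B_def apply_endo.diff_left subspace_diff)
    have "norm (flow (A m) ((1 - r) * t) (flow (A n) (r * t) (B \<cdot> x)))
      \<le> C * exp (s * \<bar>t\<bar>) * norm (flow (A n) (r * t) (B \<cdot> x))"
      by (rule flow_le_mono[OF flow_E[OF Bx] le(1)])
    also have "\<dots> \<le> C * exp (s * \<bar>t\<bar>) * (C * exp (s * \<bar>t\<bar>) * norm (B \<cdot> x))"
      using flow_le_mono[OF Bx le(2)] C_pos by (intro mult_left_mono) auto
    finally show "norm ?d \<le> \<bar>t\<bar> * (C * exp (s * \<bar>t\<bar>) * (C * exp (s * \<bar>t\<bar>))) * norm (B \<cdot> x)"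
      unfolding d by (simp add: mult.assoc mult_left_mono)
  qed
  moreover have "f 1 = flow (A n) t x" "f 0 = flow (A m) t x"
    using split[of 1 x] by (simp_all add: f_def flow_0)
  ultimately show ?thesis by (simp add: B_def apply_endo.diff_left)
qed

lemma flow_tendsto_T:
  assumes x: "x \<in> E" shows "(\<lambda>n. flow (A n) t x) \<longlonglongrightarrow> T t x"
proof -
  let ?K = "C * exp (s * \<bar>t\<bar>)"
  have K: "?K > 0" using C_pos by simp
  have "Cauchy (\<lambda>n. flow (A n) t x)"
  proof (rule CauchyI)
    fix e :: real assume e: "e > 0"
    have "x \<in> closure D" using x dense by blast
    then obtain y where y: "y \<in> D" "dist y x < e / (4 * ?K)"
      using e K unfolding closure_approachable by (metis divide_pos_pos mult_pos_pos zero_less_numeral)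
    have yE: "y \<in> E" "x - y \<in> E" using y(1) x D_E subspace_E by (auto intro: subspace_diff)
    \<comment> \<open>The summand 1 keeps \<open>K2\<close> positive at
      \<open>t = 0\<close>.\<close>
    define K2 where "K2 = \<bar>t\<bar> * (?K * ?K) + 1"
    have K2: "K2 > 0" unfolding K2_def using K by (intro add_nonneg_pos) auto
    have "Cauchy (\<lambda>n. A n \<cdot> y)" using A_tendsto[OF y(1)] LIMSEQ_imp_Cauchy by blast
    then obtain N where N: "\<And>i j. i \<ge> N \<Longrightarrow> j \<ge> N \<Longrightarrow> norm (A i \<cdot> y - A j \<cdot> y) < e / (2 * K2)"
      using e K2 by (metis CauchyD divide_pos_pos mult_pos_pos zero_less_numeral)
    have "norm (flow (A i) t x - flow (A j) t x) < e" if ij: "i \<ge> N" "j \<ge> N" for i j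
    proof -
      have lin: "flow (A k) t x = flow (A k) t y + flow (A k) t (x - y)" for k
        by (simp add: linear_diff[OF bounded_linear.linear[OF bounded_linear_flow]])
      have small: "norm (flow (A k) t (x - y)) \<le> e / 4" for k
      proof -
        have "norm (flow (A k) t (x - y)) \<le> ?K * norm (x - y)" using flow_le[OF yE(2)] by simp
        also have "\<dots> \<le> ?K * (e / (4 * ?K))"
          using y(2) K by (intro mult_left_mono) (auto simp: dist_norm norm_minus_commute)
        also have "\<dots> = e / 4" using C_pos by (simp add: field_simps)
        finally show ?thesis .
      qed
      have "norm (flow (A i) t y - flow (A j) t y) \<le> \<bar>t\<bar> * (?K * ?K) * norm (A i \<cdot> y - A j \<cdot> y)"
        by (rule flow_diff_le[OF yE(1)])
      also have "\<dots> \<le> K2 * norm (A i \<cdot> y - A j \<cdot> y)"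
        by (intro mult_right_mono) (auto simp: K2_def)
      also have "\<dots> < K2 * (e / (2 * K2))" using N[OF ij] K2 by (intro mult_strict_left_mono)
      also have "\<dots> = e / 2" using K2 by simp
      finally have 1: "norm (flow (A i) t y - flow (A j) t y) < e / 2" .
      have eq: "flow (A i) t x - flow (A j) t x
          = (flow (A i) t y - flow (A j) t y) + flow (A i) t (x - y) - flow (A j) t (x - y)"
        unfolding lin[of i] lin[of j] by (simp add: algebra_simps)
      show ?thesis
        unfolding eq using 1 small[of i] small[of j]
          norm_triangle_ineq4[of "(flow (A i) t y - flow (A j) t y) + flow (A i) t (x - y)" "flow (A j) t (x - y)"]
          norm_triangle_ineq[of "flow (A i) t y - flow (A j) t y" "flow (A i) t (x - y)"]
        by linarith
    qed
    then show "\<exists>N. \<forall>i\<ge>N. \<forall>j\<ge>N. norm (flow (A i) t x - flow (A j) t x) < e" by blast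
  qed
  then show ?thesis unfolding T_def using Cauchy_convergent_iff convergent_LIMSEQ_iff by blast
qed

lemma T_eqI: "x \<in> E \<Longrightarrow> (\<lambda>n. flow (A n) t x) \<longlonglongrightarrow> y \<Longrightarrow> T t x = y"
  using LIMSEQ_unique flow_tendsto_T by blast

lemma T_E: "x \<in> E \<Longrightarrow> T t x \<in> E"
  by (rule closed_sequentially[OF closed_E flow_E flow_tendsto_T])

lemma T_le: "x \<in> E \<Longrightarrow> norm (T t x) \<le> C * exp (s * \<bar>t\<bar>) * norm x"
  by (rule LIMSEQ_le_const2[OF tendsto_norm[OF flow_tendsto_T]]) (auto intro: flow_le)

lemma T_linear:
  assumes "x \<in> E" "y \<in> E"
  shows "T t (a *\<^sub>R x + b *\<^sub>R y) = a *\<^sub>R T t x + b *\<^sub>R T t y"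
proof (rule T_eqI)
  show "a *\<^sub>R x + b *\<^sub>R y \<in> E" using assms subspace_E by (auto intro: subspace_add subspace_scale)
  have "flow (A n) t (a *\<^sub>R x + b *\<^sub>R y) = a *\<^sub>R flow (A n) t x + b *\<^sub>R flow (A n) t y" for n
    by (simp add: linear_add[OF bounded_linear.linear[OF bounded_linear_flow]]
        linear_cmul[OF bounded_linear.linear[OF bounded_linear_flow]])
  then show "(\<lambda>n. flow (A n) t (a *\<^sub>R x + b *\<^sub>R y)) \<longlonglongrightarrow> a *\<^sub>R T t x + b *\<^sub>R T t y"
    by (simp add: tendsto_add tendsto_scaleR flow_tendsto_T assms)
qed

lemma T_0: "x \<in> E \<Longrightarrow> T 0 x = x"
  by (rule T_eqI) (simp_all add: flow_0)

lemma T_add: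
  assumes x: "x \<in> E" shows "T (r + t) x = T r (T t x)"
proof (rule T_eqI[OF x])
  let ?z = "T t x"
  have z: "?z \<in> E" by (rule T_E[OF x])
  have "(\<lambda>n. flow (A n) r (flow (A n) t x - ?z)) \<longlonglongrightarrow> 0"
  proof (rule Lim_null_comparison)
    show "\<forall>\<^sub>F n in sequentially. norm (flow (A n) r (flow (A n) t x - ?z))
        \<le> C * exp (s * \<bar>r\<bar>) * norm (flow (A n) t x - ?z)"
      using flow_E[OF x] z subspace_E by (intro always_eventually allI flow_le) (auto intro: subspace_diff)
    show "(\<lambda>n. C * exp (s * \<bar>r\<bar>) * norm (flow (A n) t x - ?z)) \<longlonglongrightarrow> 0"
      using flow_tendsto_T[OF x, of t]
      by (intro tendsto_mult_right_zero tendsto_norm_zero) (simp add: LIM_zero)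
  qed
  from tendsto_add[OF this flow_tendsto_T[OF z, of r]]
  show "(\<lambda>n. flow (A n) (r + t) x) \<longlonglongrightarrow> T r ?z"
    by (simp add: flow_add linear_diff[OF bounded_linear.linear[OF bounded_linear_flow]])
qed

lemma T_commute:
  assumes J: "\<And>n. A n * J = J * A n" and JE: "\<And>x. x \<in> E \<Longrightarrow> J \<cdot> x \<in> E" and x: "x \<in> E"
  shows "T t (J \<cdot> x) = J \<cdot> T t x"
proof (rule T_eqI[OF JE[OF x]])
  have "(\<lambda>n. J \<cdot> flow (A n) t x) \<longlonglongrightarrow> J \<cdot> T t x"
    by (intro apply_endo.tendsto tendsto_const flow_tendsto_T[OF x])
  then show "(\<lambda>n. flow (A n) t (J \<cdot> x)) \<longlonglongrightarrow> J \<cdot> T t x" by (simp add: flow_commute[OF J])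
qed

lemma flow_diff_id_le:
  assumes x: "x \<in> E"
  shows "norm (flow (A n) t x - x) \<le> \<bar>t\<bar> * (C * exp (s * \<bar>t\<bar>) * norm (A n \<cdot> x))"
proof -
  have "norm (flow (A n) (1 * t) x - flow (A n) (0 * t) x) \<le> \<bar>t\<bar> * (C * exp (s * \<bar>t\<bar>) * norm (A n \<cdot> x))"
  proof (rule norm_diff_le_if_vector_derivative_le)
    fix r :: real assume r: "r \<in> {0..1}"
    show "((\<lambda>r. flow (A n) (r * t) x) has_vector_derivative (t *\<^sub>R A n) \<cdot> flow (t *\<^sub>R A n) r x) (at r within {0..1})"
      unfolding flow_scale by (rule flow_has_vector_derivative)
    have "(t *\<^sub>R A n) \<cdot> flow (t *\<^sub>R A n) r x = t *\<^sub>R flow (A n) (r * t) (A n \<cdot> x)"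
      by (simp add: flow_scale[symmetric] apply_endo.scaleR_left flow_commute)
    moreover have "\<bar>r * t\<bar> \<le> \<bar>t\<bar>" using r by (auto simp: abs_mult intro: mult_left_le_one_le)
    ultimately show "norm ((t *\<^sub>R A n) \<cdot> flow (t *\<^sub>R A n) r x) \<le> \<bar>t\<bar> * (C * exp (s * \<bar>t\<bar>) * norm (A n \<cdot> x))"
      using flow_le_mono[OF A_E[OF x]] by (simp add: mult_left_mono)
  qed
  then show ?thesis by (simp add: flow_0)
qed

text \<open>\<open>\<tau>\<close> must not depend on \<open>n\<close>, so that the estimate survives
  the limit. On a nearby \<open>y\<close> in \<open>D\<close> the convergent sequence
  \<open>A n \<cdot> y\<close> is bounded by one \<open>M\<close>, and the error
  \<open>x - y\<close> is absorbed by the uniform growth bound.\<close>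

lemma flow_near_id:
  assumes x: "x \<in> E" and e: "e > 0"
  obtains \<tau> where "0 < \<tau>" "\<tau> \<le> 1" "\<And>n t. \<bar>t\<bar> \<le> \<tau> \<Longrightarrow> norm (flow (A n) t x - x) \<le> e"
proof -
  let ?K = "C * exp s"
  have K: "?K > 0" using C_pos by simp
  have "x \<in> closure D" using x dense by blast
  moreover have "0 < e / (2 * (?K + 1))" using e K by simp
  ultimately obtain y where y: "y \<in> D" "dist y x < e / (2 * (?K + 1))"
    unfolding closure_approachable by blast
  have yE: "y \<in> E" "x - y \<in> E" using y(1) x D_E subspace_E by (auto intro: subspace_diff)
  obtain M where M: "M > 0" "\<And>n. norm (A n \<cdot> y) \<le> M"
    using A_tendsto[OF y(1)] convergent_imp_Bseq BseqE unfolding convergent_def by metis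
  define \<tau> where "\<tau> = min 1 (e / (2 * (?K * M)))"
  have "0 < \<tau>" "\<tau> \<le> 1" using e K M by (auto simp: \<tau>_def)
  moreover have "norm (flow (A n) t x - x) \<le> e" if t: "\<bar>t\<bar> \<le> \<tau>" for n t
  proof -
    have t1: "\<bar>t\<bar> \<le> 1" "\<bar>t\<bar> \<le> e / (2 * (?K * M))" using t by (auto simp: \<tau>_def)
    have "norm (flow (A n) t y - y) \<le> \<bar>t\<bar> * (C * exp (s * \<bar>t\<bar>) * norm (A n \<cdot> y))"
      by (rule flow_diff_id_le[OF yE(1)])
    also have "\<dots> \<le> (e / (2 * (?K * M))) * (?K * M)"
      using t1 C_pos s_nonneg M K e by (intro mult_mono) (auto intro: mult_left_le)
    also have "\<dots> = e / 2" using C_pos M(1) by simp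
    finally have 1: "norm (flow (A n) t y - y) \<le> e / 2" .
    have "norm (flow (A n) t (x - y)) + norm (x - y) \<le> ?K * norm (x - y) + norm (x - y)"
      using flow_le_mono[OF yE(2) t1(1), of n] by simp
    also have "\<dots> = (?K + 1) * norm (x - y)" by (simp add: algebra_simps)
    also have "\<dots> \<le> (?K + 1) * (e / (2 * (?K + 1)))"
      using y(2) K by (intro mult_left_mono) (auto simp: dist_norm norm_minus_commute)
    also have "\<dots> = e / 2" using K by (simp add: field_simps)
    finally have 2: "norm (flow (A n) t (x - y)) + norm (x - y) \<le> e / 2" .
    have eq: "flow (A n) t x - x = (flow (A n) t y - y) + (flow (A n) t (x - y) - (x - y))"
      by (simp add: linear_diff[OF bounded_linear.linear[OF bounded_linear_flow]])
    show ?thesis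
      unfolding eq using 1 2 norm_triangle_ineq[of "flow (A n) t y - y" "flow (A n) t (x - y) - (x - y)"]
        norm_triangle_ineq4[of "flow (A n) t (x - y)" "x - y"] by linarith
  qed
  ultimately show ?thesis using that by blast
qed

lemma T_continuous_0:
  assumes x: "x \<in> E" shows "((\<lambda>t. T t x) \<longlongrightarrow> x) (at 0)"
proof (rule LIM_I)
  fix e :: real assume e: "e > 0"
  then obtain \<tau> where \<tau>: "0 < \<tau>" "\<tau> \<le> 1" "\<And>n t. \<bar>t\<bar> \<le> \<tau> \<Longrightarrow> norm (flow (A n) t x - x) \<le> e / 2"
    using flow_near_id[OF x, of "e / 2"] by auto
  have "norm (T t x - x) < e" if "\<bar>t\<bar> \<le> \<tau>" for t
  proof -
    have "norm (T t x - x) \<le> e / 2"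
      by (rule LIMSEQ_le_const2[OF tendsto_norm[OF tendsto_diff[OF flow_tendsto_T[OF x] tendsto_const]]])
        (use \<tau>(3)[OF that] in auto)
    then show ?thesis using e by simp
  qed
  then show "\<exists>r>0. \<forall>t. t \<noteq> 0 \<and> norm (t - 0) < r \<longrightarrow> norm (T t x - x) < e"
    using \<tau>(1) by (intro exI[of _ \<tau>]) auto
qed

lemma G_E:
  assumes "x \<in> D" shows "G x \<in> E"
proof (rule closed_sequentially[OF closed_E _ A_tendsto[OF assms]])
  show "A n \<cdot> x \<in> E" for n using assms D_E by (intro A_E) blast
qed

lemma T_derivative_0:
  assumes x: "x \<in> D" shows "((\<lambda>t. (1 / t) *\<^sub>R (T t x - x)) \<longlongrightarrow> G x) (at 0)"
proof (rule LIM_I)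
  fix e :: real assume e: "e > 0"
  have xE: "x \<in> E" using x D_E by blast
  obtain \<tau> where \<tau>: "0 < \<tau>" "\<tau> \<le> 1" "\<And>n t. \<bar>t\<bar> \<le> \<tau> \<Longrightarrow> norm (flow (A n) t (G x) - G x) \<le> e / 2"
    using flow_near_id[OF G_E[OF x], of "e / 2"] e by auto
  \<comment> \<open>First order Taylor remainder. In the derivative with respect to \<open>r\<close>
    the vector \<open>A n \<cdot> x\<close> is replaced by \<open>G x\<close>, on which the flow is
    close to the identity uniformly in \<open>n\<close>. The price is a multiple of
    \<open>norm (A n \<cdot> x - G x)\<close>, which vanishes in the limit.\<close>
  have est: "norm (T t x - x - t *\<^sub>R G x) \<le> \<bar>t\<bar> * (e / 2)" if t: "\<bar>t\<bar> \<le> \<tau>" for t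
  proof (rule LIMSEQ_le)
    let ?K = "C * exp s"
    show "(\<lambda>n. norm (flow (A n) t x - x - t *\<^sub>R (A n \<cdot> x))) \<longlonglongrightarrow> norm (T t x - x - t *\<^sub>R G x)"
      by (intro tendsto_intros flow_tendsto_T[OF xE] A_tendsto[OF x])
    have "(\<lambda>n. norm (A n \<cdot> x - G x)) \<longlonglongrightarrow> 0"
      using A_tendsto[OF x] by (simp add: LIM_zero tendsto_norm_zero)
    then have "(\<lambda>n. \<bar>t\<bar> * ((?K + 1) * norm (A n \<cdot> x - G x) + e / 2)) \<longlonglongrightarrow> \<bar>t\<bar> * ((?K + 1) * 0 + e / 2)"
      by (intro tendsto_intros)
    then show "(\<lambda>n. \<bar>t\<bar> * ((?K + 1) * norm (A n \<cdot> x - G x) + e / 2)) \<longlonglongrightarrow> \<bar>t\<bar> * (e / 2)" by simp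
    have "norm (flow (A n) t x - x - t *\<^sub>R (A n \<cdot> x)) \<le> \<bar>t\<bar> * ((?K + 1) * norm (A n \<cdot> x - G x) + e / 2)" for n
    proof -
      let ?f = "\<lambda>r. flow (A n) (r * t) x - r *\<^sub>R (t *\<^sub>R (A n \<cdot> x))"
      have "norm (?f 1 - ?f 0) \<le> \<bar>t\<bar> * ((?K + 1) * norm (A n \<cdot> x - G x) + e / 2)"
      proof (rule norm_diff_le_if_vector_derivative_le)
        fix r :: real assume r: "r \<in> {0..1}"
        let ?d = "(t *\<^sub>R A n) \<cdot> flow (t *\<^sub>R A n) r x - t *\<^sub>R (A n \<cdot> x)"
        show "(?f has_vector_derivative ?d) (at r within {0..1})"
          unfolding flow_scale
          by (auto intro!: derivative_eq_intros flow_has_vector_derivative)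
        have rt: "\<bar>r * t\<bar> \<le> \<bar>t\<bar>" using r by (auto simp: abs_mult intro: mult_left_le_one_le)
        then have rt1: "\<bar>r * t\<bar> \<le> 1" "\<bar>r * t\<bar> \<le> \<tau>" using t \<tau> by auto
        have z: "A n \<cdot> x - G x \<in> E" using A_E[OF xE] G_E[OF x] subspace_E by (simp add: subspace_diff)
        have "?d = t *\<^sub>R (flow (A n) (r * t) (A n \<cdot> x) - A n \<cdot> x)"
          by (simp add: flow_scale[symmetric] apply_endo.scaleR_left flow_commute scaleR_diff_right)
        also have "flow (A n) (r * t) (A n \<cdot> x) - A n \<cdot> x = flow (A n) (r * t) (A n \<cdot> x - G x)
            - (A n \<cdot> x - G x) + (flow (A n) (r * t) (G x) - G x)"
          by (simp add: linear_diff[OF bounded_linear.linear[OF bounded_linear_flow]])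
        finally have d: "norm ?d = \<bar>t\<bar> * norm (flow (A n) (r * t) (A n \<cdot> x - G x)
            - (A n \<cdot> x - G x) + (flow (A n) (r * t) (G x) - G x))" by simp
        have "norm (flow (A n) (r * t) (A n \<cdot> x - G x)
            - (A n \<cdot> x - G x) + (flow (A n) (r * t) (G x) - G x))
          \<le> (norm (flow (A n) (r * t) (A n \<cdot> x - G x)) + norm (A n \<cdot> x - G x)) + norm (flow (A n) (r * t) (G x) - G x)"
          by (rule order_trans[OF norm_triangle_ineq add_right_mono[OF norm_triangle_ineq4]])
        also have "\<dots> \<le> (?K * norm (A n \<cdot> x - G x) + norm (A n \<cdot> x - G x)) + e / 2"
          using flow_le_mono[OF z rt1(1), of n] \<tau>(3)[OF rt1(2)] by (intro add_mono) auto
        finally show "norm ?d \<le> \<bar>t\<bar> * ((?K + 1) * norm (A n \<cdot> x - G x) + e / 2)"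
          unfolding d by (intro mult_left_mono) (auto simp: algebra_simps)
      qed
      then show ?thesis by (simp add: flow_0 algebra_simps)
    qed
    then show "\<exists>N. \<forall>n\<ge>N. norm (flow (A n) t x - x - t *\<^sub>R (A n \<cdot> x)) \<le> \<bar>t\<bar> * ((?K + 1) * norm (A n \<cdot> x - G x) + e / 2)"
      by blast
  qed
  have "norm ((1 / t) *\<^sub>R (T t x - x) - G x) < e" if t: "t \<noteq> 0" "\<bar>t\<bar> \<le> \<tau>" for t
  proof -
    have "(1 / t) *\<^sub>R (T t x - x) - G x = (1 / t) *\<^sub>R (T t x - x - t *\<^sub>R G x)"
      using t by (simp add: algebra_simps)
    then have "norm ((1 / t) *\<^sub>R (T t x - x) - G x) = norm (T t x - x - t *\<^sub>R G x) / \<bar>t\<bar>" by simp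
    also have "\<dots> \<le> e / 2" using est[OF t(2)] t(1) by (simp add: field_simps)
    finally show ?thesis using e by simp
  qed
  then show "\<exists>r>0. \<forall>t. t \<noteq> 0 \<and> norm (t - 0) < r \<longrightarrow> norm ((1 / t) *\<^sub>R (T t x - x) - G x) < e"
    using \<tau>(1) by (intro exI[of _ \<tau>]) auto
qed

end

section \<open>The operator of a closed form on a graph\<close>

lemma strong_convergence_dense:
  fixes S :: "nat \<Rightarrow> 'a::real_normed_vector \<Rightarrow> 'a"
  assumes D: "E \<subseteq> closure D" "D \<subseteq> E"
    and L: "\<And>n x y. x \<in> E \<Longrightarrow> y \<in> E \<Longrightarrow> norm (S n x - S n y) \<le> L * norm (x - y)"
    and conv: "\<And>x. x \<in> D \<Longrightarrow> (\<lambda>n. S n x) \<longlonglongrightarrow> x"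
    and x: "x \<in> E"
  shows "(\<lambda>n. S n x) \<longlonglongrightarrow> x"
proof (rule LIMSEQ_I)
  fix e :: real assume e: "e > 0"
  define K where "K = \<bar>L\<bar> + 1"
  have K: "K > 0" by (simp add: K_def)
  have "x \<in> closure D" "0 < e / (2 * K)" using x D e K by auto
  then obtain y where y: "y \<in> D" "dist y x < e / (2 * K)"
    unfolding closure_approachable by blast
  have yE: "y \<in> E" using y D by auto
  obtain N where N: "\<And>n. n \<ge> N \<Longrightarrow> norm (S n y - y) < e / 2"
    using LIMSEQ_D[OF conv[OF y(1)], of "e / 2"] e by auto
  have "norm (S n x - x) < e" if n: "n \<ge> N" for n
  proof -
    have "norm (S n x - S n y) + norm (x - y) \<le> L * norm (x - y) + norm (x - y)"
      using L[OF x yE] by simp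
    also have "\<dots> \<le> K * norm (x - y)" by (simp add: K_def distrib_right mult_right_mono)
    also have "\<dots> < K * (e / (2 * K))"
      using y(2) K by (intro mult_strict_left_mono) (auto simp: dist_norm norm_minus_commute)
    also have "\<dots> = e / 2" using K by simp
    finally have 1: "norm (S n x - S n y) + norm (x - y) < e / 2" .
    have eq: "S n x - x = (S n x - S n y) + (S n y - y) - (x - y)" by simp
    show ?thesis unfolding eq
      using 1 N[OF n] norm_triangle_ineq4[of "(S n x - S n y) + (S n y - y)" "x - y"]
        norm_triangle_ineq[of "S n x - S n y" "S n y - y"] by linarith
  qed
  then show "\<exists>N. \<forall>n\<ge>N. norm (S n x - x) < e" by blast
qed

lemma norm_fst_le': "norm (fst p) \<le> norm p"
  using norm_fst_le[of "fst p" "snd p"] by simp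

lemma norm_snd_le': "norm (snd p) \<le> norm p"
  using norm_snd_le[of "snd p" "fst p"] by simp

lemma bounded_bilinear_plus:
  assumes "bounded_bilinear f" "bounded_bilinear g"
  shows "bounded_bilinear (\<lambda>x y. f x y + g x y)"
proof -
  interpret f: bounded_bilinear f by fact
  interpret g: bounded_bilinear g by fact
  obtain K L where K: "\<And>x y. norm (f x y) \<le> norm x * norm y * K" and L: "\<And>x y. norm (g x y) \<le> norm x * norm y * L"
    using f.bounded g.bounded by blast
  show ?thesis
  proof
    show "\<exists>K. \<forall>x y. norm (f x y + g x y) \<le> norm x * norm y * K"
    proof (intro exI allI)
      show "norm (f x y + g x y) \<le> norm x * norm y * (K + L)" for x y
        using norm_triangle_ineq[of "f x y" "g x y"] K[of x y] L[of x y] by (simp add: distrib_left)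
    qed
  qed (simp_all add: f.add_left f.add_right g.add_left g.add_right f.scaleR_left f.scaleR_right
      g.scaleR_left g.scaleR_right scaleR_add_right)
qed

lemma bounded_bilinear_cmult:
  fixes f :: "'a::real_normed_vector \<Rightarrow> 'b::real_normed_vector \<Rightarrow> real"
  assumes "bounded_bilinear f"
  shows "bounded_bilinear (\<lambda>x y. c * f x y)"
proof -
  interpret f: bounded_bilinear f by fact
  obtain K where K: "\<And>x y. norm (f x y) \<le> norm x * norm y * K" using f.bounded by blast
  show ?thesis
  proof
    show "\<exists>K. \<forall>x y. norm (c * f x y) \<le> norm x * norm y * K"
    proof (intro exI allI)
      show "norm (c * f x y) \<le> norm x * norm y * (K * \<bar>c\<bar>)" for x y
        using mult_right_mono[OF K[of x y], of "\<bar>c\<bar>"] by (simp add: abs_mult mult.commute mult.left_commute)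
    qed
  qed (simp_all add: f.add_left f.add_right f.scaleR_left f.scaleR_right distrib_left)
qed

text \<open>\<open>\<Gamma>\<close> is the graph of a closed, densely defined operator on
  \<open>Y\<close> and carries the graph norm of the product; \<open>graph\<close> makes the second
  component a function of the first. \<open>coercive\<close> is a Garding inequality, so
  \<open>a\<close> determines a self-adjoint operator \<open>L\<close> bounded below, which appears
  here only through the weak equation \<open>dom_op\<close>.\<close>

locale energy_form =
  fixes \<Gamma> :: "('y::{real_inner,banach,perfect_space} \<times> 'x::{real_inner,banach,perfect_space}) set"
    and Y :: "'y set" and a :: "'y \<times> 'x \<Rightarrow> 'y \<times> 'x \<Rightarrow> real" and M \<delta> :: real
  assumes \<Gamma>: "subspace \<Gamma>" "closed \<Gamma>" and graph: "\<And>f. (0, f) \<in> \<Gamma> \<Longrightarrow> f = 0"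
    and Y: "subspace Y" "closed Y" and fst_Y: "\<And>p. p \<in> \<Gamma> \<Longrightarrow> fst p \<in> Y"
    and dense_Y: "\<And>w. w \<in> Y \<Longrightarrow> (\<And>p. p \<in> \<Gamma> \<Longrightarrow> w \<bullet> fst p = 0) \<Longrightarrow> w = 0"
    and bilinear_a: "bounded_bilinear a" and sym_a: "\<And>p q. a p q = a q p"
    and \<delta>: "\<delta> > 0" and coercive: "\<And>p. p \<in> \<Gamma> \<Longrightarrow> \<delta> * (norm p)\<^sup>2 \<le> a p p + M * (norm (fst p))\<^sup>2"
begin

sublocale a: bounded_bilinear a by (rule bilinear_a)

definition b :: "'y \<times> 'x \<Rightarrow> 'y \<times> 'x \<Rightarrow> real" where
  "b p q = a p q + M * (fst p \<bullet> fst q)"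

lemma bilinear_fst: "bounded_bilinear (\<lambda>(p::'y \<times> 'x) (q::'y \<times> 'x). fst p \<bullet> fst q)"
  using bounded_bilinear.comp[OF bounded_bilinear_inner bounded_linear_fst bounded_linear_fst] .

lemma bilinear_b: "bounded_bilinear b"
  unfolding b_def[abs_def]
  by (intro bounded_bilinear_plus bounded_bilinear_cmult bilinear_a bilinear_fst)

sublocale b: bounded_bilinear b by (rule bilinear_b)

lemma sym_b: "b p q = b q p"
  by (simp add: b_def sym_a[of p q] inner_commute[of "fst p"])

lemma b_ge: "p \<in> \<Gamma> \<Longrightarrow> \<delta> * (norm p)\<^sup>2 \<le> b p p"
  using coercive by (simp add: b_def power2_norm_eq_inner)

lemma b_nonneg: "p \<in> \<Gamma> \<Longrightarrow> 0 \<le> b p p"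
  using b_ge[of p] \<delta> by (meson less_imp_le mult_nonneg_nonneg order_trans zero_le_power2)

text \<open>The form of \<open>1 + k (L + M)\<close>. The shift by \<open>M\<close> makes
  \<open>b\<close> positive, hence the problem is solvable for every \<open>k > 0\<close>.\<close>

definition shifted :: "real \<Rightarrow> 'y \<times> 'x \<Rightarrow> 'y \<times> 'x \<Rightarrow> real" where
  "shifted k p q = fst p \<bullet> fst q + k * b p q"

lemma bilinear_shifted: "bounded_bilinear (shifted k)"
  unfolding shifted_def[abs_def]
  by (intro bounded_bilinear_plus bounded_bilinear_cmult bilinear_b bilinear_fst)

lemma sym_shifted: "shifted k p q = shifted k q p"
  by (simp add: shifted_def sym_b[of p q] inner_commute[of "fst p"])

lemma shifted_ge:
  assumes "p \<in> \<Gamma>" "k > 0" shows "k * \<delta> * (norm p)\<^sup>2 \<le> shifted k p p"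
proof -
  have "k * (\<delta> * (norm p)\<^sup>2) \<le> k * b p p" using b_ge[OF assms(1)] assms(2) by (intro mult_left_mono) auto
  then show ?thesis by (simp add: shifted_def mult.assoc add_increasing)
qed

lemma \<Gamma>_eqI:
  assumes "p \<in> \<Gamma>" "q \<in> \<Gamma>" "fst p = fst q" shows "p = q"
proof -
  have "p - q = (0, snd (p - q))" using assms(3) by (simp add: prod_eq_iff)
  then have "(0, snd (p - q)) \<in> \<Gamma>" using subspace_diff[OF \<Gamma>(1) assms(1,2)] by simp
  then have "snd (p - q) = 0" by (rule graph)
  then show ?thesis using assms(3) by (simp add: prod_eq_iff)
qed

text \<open>The resolvent \<open>(1 + k (L + M))^-1\<close>, with values in the graph and not only
  in \<open>Y\<close>, because bounds and convergence are needed in the graph norm.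
  \<open>F k\<close> is the same operator seen in \<open>Y\<close>.\<close>

definition R :: "real \<Rightarrow> 'y \<Rightarrow> 'y \<times> 'x" where
  "R k w = (THE p. p \<in> \<Gamma> \<and> (\<forall>q\<in>\<Gamma>. shifted k p q = w \<bullet> fst q))"

definition F :: "real \<Rightarrow> 'y \<Rightarrow> 'y" where "F k w = fst (R k w)"

lemma shifted_unique:
  assumes k: "k > 0" and p: "p \<in> \<Gamma>" "\<And>q. q \<in> \<Gamma> \<Longrightarrow> shifted k p q = w \<bullet> fst q"
    and p': "p' \<in> \<Gamma>" "\<And>q. q \<in> \<Gamma> \<Longrightarrow> shifted k p' q = w \<bullet> fst q"
  shows "p = p'"
proof -
  interpret s: bounded_bilinear "shifted k" by (rule bilinear_shifted)
  have d: "p - p' \<in> \<Gamma>" using p p' \<Gamma> by (simp add: subspace_diff)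
  have "shifted k (p - p') (p - p') = 0" by (simp add: s.diff_left p(2)[OF d] p'(2)[OF d])
  then have "k * \<delta> * (norm (p - p'))\<^sup>2 \<le> 0" using shifted_ge[OF d k] by simp
  then show ?thesis using k \<delta> by (simp add: mult_le_0_iff)
qed

lemma ex_R:
  assumes k: "k > 0"
  shows "\<exists>p. p \<in> \<Gamma> \<and> (\<forall>q\<in>\<Gamma>. shifted k p q = w \<bullet> fst q)"
  using lax_milgram_symmetric[OF bilinear_shifted sym_shifted \<Gamma>, of "k * \<delta>" k "\<lambda>q. w \<bullet> fst q"] k \<delta> shifted_ge
    bounded_linear_compose[OF bounded_linear_inner_right[of w] bounded_linear_fst]
  by (metis mult_pos_pos)

lemma
  assumes k: "k > 0"
  shows R_\<Gamma>: "R k w \<in> \<Gamma>" and shifted_R: "q \<in> \<Gamma> \<Longrightarrow> shifted k (R k w) q = w \<bullet> fst q"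
proof -
  have "\<exists>!p. p \<in> \<Gamma> \<and> (\<forall>q\<in>\<Gamma>. shifted k p q = w \<bullet> fst q)"
    using ex_R[OF k, of w] shifted_unique[OF k] by (intro ex_ex1I) blast+
  from theI'[OF this] show "R k w \<in> \<Gamma>" "q \<in> \<Gamma> \<Longrightarrow> shifted k (R k w) q = w \<bullet> fst q"
    unfolding R_def by blast+
qed

lemma R_eqI: "k > 0 \<Longrightarrow> p \<in> \<Gamma> \<Longrightarrow> (\<And>q. q \<in> \<Gamma> \<Longrightarrow> shifted k p q = w \<bullet> fst q) \<Longrightarrow> R k w = p"
  using shifted_unique[of k "R k w" w p] R_\<Gamma> shifted_R by blast

text \<open>Weak form of \<open>k (L + M) (F k w) = w - F k w\<close>. It expresses the unbounded
  operator after the resolvent by bounded operators.\<close>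

lemma b_R: "k > 0 \<Longrightarrow> q \<in> \<Gamma> \<Longrightarrow> k * b (R k w) q = (w - F k w) \<bullet> fst q"
  using shifted_R[of k q w] by (simp add: shifted_def F_def inner_diff_left)

lemma F_Y: "k > 0 \<Longrightarrow> F k w \<in> Y"
  by (simp add: F_def fst_Y R_\<Gamma>)

lemma bounded_linear_R:
  assumes k: "k > 0" shows "bounded_linear (R k)"
proof (rule bounded_linear_intro)
  interpret s: bounded_bilinear "shifted k" by (rule bilinear_shifted)
  show "R k (x + y) = R k x + R k y" for x y
    by (rule R_eqI[OF k]) (auto simp: s.add_left shifted_R[OF k] inner_add_left intro: subspace_add[OF \<Gamma>(1)] R_\<Gamma>[OF k])
  show "R k (c *\<^sub>R x) = c *\<^sub>R R k x" for c x
    by (rule R_eqI[OF k]) (auto simp: s.scaleR_left shifted_R[OF k] intro: subspace_scale[OF \<Gamma>(1)] R_\<Gamma>[OF k])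
  show "norm (R k x) \<le> norm x * (1 / (k * \<delta>))" for x
  proof -
    have "k * \<delta> * (norm (R k x))\<^sup>2 \<le> x \<bullet> fst (R k x)"
      using shifted_ge[OF R_\<Gamma>[OF k] k] shifted_R[OF k R_\<Gamma>[OF k]] by metis
    also have "\<dots> \<le> norm x * norm (fst (R k x))" by (rule norm_cauchy_schwarz)
    also have "\<dots> \<le> norm x * norm (R k x)" by (intro mult_left_mono norm_fst_le') auto
    finally have "(k * \<delta> * norm (R k x)) * norm (R k x) \<le> norm x * norm (R k x)"
      by (simp add: power2_eq_square mult.assoc)
    then have "k * \<delta> * norm (R k x) \<le> norm x"
      by (cases "norm (R k x) = 0") (auto simp: mult_le_cancel_right)
    then show ?thesis using k \<delta> by (simp add: field_simps)
  qed
qed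

lemma bounded_linear_F: "k > 0 \<Longrightarrow> bounded_linear (F k)"
  unfolding F_def[abs_def] by (rule bounded_linear_fst_comp[OF bounded_linear_R, unfolded o_def]) 

lemma F_diff: "k > 0 \<Longrightarrow> F k (x - y) = F k x - F k y"
  and F_add: "k > 0 \<Longrightarrow> F k (x + y) = F k x + F k y"
  and F_scaleR: "k > 0 \<Longrightarrow> F k (c *\<^sub>R x) = c *\<^sub>R F k x"
  and R_diff: "k > 0 \<Longrightarrow> R k (x - y) = R k x - R k y"
  and R_add: "k > 0 \<Longrightarrow> R k (x + y) = R k x + R k y"
  and R_scaleR: "k > 0 \<Longrightarrow> R k (c *\<^sub>R x) = c *\<^sub>R R k x"
  using bounded_linear_F[of k, THEN bounded_linear.linear] bounded_linear_R[of k, THEN bounded_linear.linear]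
  by (auto simp: linear_diff linear_add linear_cmul)

lemma F_sym: "k > 0 \<Longrightarrow> F k x \<bullet> y = x \<bullet> F k y"
  using shifted_R[of k "R k y" x] shifted_R[of k "R k x" y] R_\<Gamma>[of k] sym_shifted[of k "R k x" "R k y"]
  by (simp add: F_def inner_commute)

lemma norm_F_le:
  assumes k: "k > 0" shows "norm (F k w) \<le> norm w"
proof -
  have "F k w \<bullet> F k w + k * b (R k w) (R k w) = w \<bullet> F k w"
    using shifted_R[OF k R_\<Gamma>[OF k], of w w] by (simp add: shifted_def F_def)
  moreover have "0 \<le> k * b (R k w) (R k w)" using k b_nonneg[OF R_\<Gamma>[OF k]] by simp
  ultimately have "(norm (F k w))\<^sup>2 \<le> w \<bullet> F k w" by (simp add: power2_norm_eq_inner)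
  also have "\<dots> \<le> norm w * norm (F k w)" by (rule norm_cauchy_schwarz)
  finally show ?thesis by (cases "norm (F k w) = 0") (auto simp: power2_eq_square mult_le_cancel_right)
qed

lemma b_R_le:
  assumes k: "k > 0" shows "k * b (R k w) (R k w) \<le> (norm w)\<^sup>2"
proof -
  have "k * b (R k w) (R k w) = w \<bullet> F k w - F k w \<bullet> F k w"
    using b_R[OF k R_\<Gamma>[OF k], of w w] by (simp add: F_def inner_diff_left)
  also have "\<dots> \<le> norm w * norm (F k w)" using norm_cauchy_schwarz[of w "F k w"] by (simp add: add_increasing2 diff_le_eq)
  also have "\<dots> \<le> (norm w)\<^sup>2" using norm_F_le[OF k, of w] by (simp add: power2_eq_square mult_left_mono)
  finally show ?thesis .
qed

text \<open>The resolvent contracts the energy norm as well. With \<open>r = R k (fst p)\<close>,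
  testing with \<open>p - r\<close> shows that \<open>k * b r (p - r)\<close> is the squared norm of
  \<open>fst (p - r)\<close>, so \<open>b r r \<le> b r p\<close>; positivity of
  \<open>b (p - r) (p - r)\<close> does the rest.\<close>

lemma b_R_fst_le:
  assumes k: "k > 0" and p: "p \<in> \<Gamma>" shows "b (R k (fst p)) (R k (fst p)) \<le> b p p"
proof -
  define r where "r = R k (fst p)"
  have r: "r \<in> \<Gamma>" by (simp add: r_def R_\<Gamma>[OF k])
  have d: "p - r \<in> \<Gamma>" using p r \<Gamma> by (simp add: subspace_diff)
  have "k * b r (p - r) = (fst p - fst r) \<bullet> fst (p - r)"
    using b_R[OF k d, of "fst p"] by (simp add: r_def F_def)
  then have "0 \<le> k * b r (p - r)" by simp
  then have "b r r \<le> b r p" using k by (simp add: zero_le_mult_iff b.diff_right)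
  moreover have "0 \<le> b (p - r) (p - r)" by (rule b_nonneg[OF d])
  ultimately show ?thesis
    unfolding r_def[symmetric] by (simp add: b.diff_left b.diff_right sym_b[of p r])
qed

lemma R_inj:
  assumes k: "k > 0" and w: "w \<in> Y" "R k w = 0" shows "w = 0"
proof (rule dense_Y[OF w(1)])
  interpret s: bounded_bilinear "shifted k" by (rule bilinear_shifted)
  show "w \<bullet> fst p = 0" if "p \<in> \<Gamma>" for p
    using shifted_R[OF k that, of w] by (simp add: w(2) s.zero_left)
qed

text \<open>The argument on the left is \<open>(L + M) (F m w)\<close>, and on the operator domain
  the resolvent composed with \<open>L + M\<close> is \<open>(1 - F k) / k\<close>.\<close>

lemma resolvent_identity:
  assumes k: "k > 0" and m: "m > 0"
  shows "R k ((1 / m) *\<^sub>R (w - F m w)) = (1 / k) *\<^sub>R (R m w - R k (F m w))"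
proof (rule R_eqI[OF k])
  show "(1 / k) *\<^sub>R (R m w - R k (F m w)) \<in> \<Gamma>"
    by (intro subspace_scale subspace_diff \<Gamma> R_\<Gamma> k m)
  fix q assume q: "q \<in> \<Gamma>"
  have "shifted k ((1 / k) *\<^sub>R (R m w - R k (F m w))) q
    = (1 / k) * ((F m w - F k (F m w)) \<bullet> fst q) + b (R m w) q - b (R k (F m w)) q"
    using k by (simp add: shifted_def b.scaleR_left b.diff_left F_def algebra_simps)
  also have "b (R k (F m w)) q = (1 / k) * ((F m w - F k (F m w)) \<bullet> fst q)"
    using b_R[OF k q, of "F m w"] k by (simp add: field_simps)
  also have "b (R m w) q = (1 / m) * ((w - F m w) \<bullet> fst q)"
    using b_R[OF m q, of w] m by (simp add: field_simps)
  finally show "shifted k ((1 / k) *\<^sub>R (R m w - R k (F m w))) q = (1 / m) *\<^sub>R (w - F m w) \<bullet> fst q"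
    by simp
qed

text \<open>Adding the resolvent identity for \<open>(k, m)\<close> and for \<open>(m, k)\<close>
  leaves both products with the factor \<open>1 / m - 1 / k\<close>; this is why
  \<open>k = m\<close> is separated.\<close>

lemma F_commute:
  assumes k: "k > 0" and m: "m > 0" shows "F k (F m w) = F m (F k w)"
proof (cases "k = m")
  case False
  have 1: "(1 / m) *\<^sub>R (F k w - F k (F m w)) = (1 / k) *\<^sub>R (F m w - F k (F m w))"
    using arg_cong[OF resolvent_identity[OF k m, of w], of fst]
    by (simp add: F_def[symmetric] F_scaleR[OF k] F_diff[OF k])
  have 2: "(1 / k) *\<^sub>R (F m w - F m (F k w)) = (1 / m) *\<^sub>R (F k w - F m (F k w))"
    using arg_cong[OF resolvent_identity[OF m k, of w], of fst]
    by (simp add: F_def[symmetric] F_scaleR[OF m] F_diff[OF m])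
  have "(1 / m - 1 / k) *\<^sub>R F k (F m w) = (1 / m - 1 / k) *\<^sub>R F m (F k w)"
    using arg_cong2[OF 1 2, of "(+)"] by (simp add: algebra_simps)
  moreover have "1 / m - 1 / k \<noteq> 0" using False k m by (simp add: field_simps)
  ultimately show ?thesis by simp
qed simp

text \<open>\<open>w = L (fst p)\<close> in the sense of the representation theorem for forms: the
  functional \<open>a p\<close> is represented by an element of \<open>Y\<close>.\<close>

definition dom_op :: "'y \<times> 'x \<Rightarrow> 'y \<Rightarrow> bool" where
  "dom_op p w \<longleftrightarrow> p \<in> \<Gamma> \<and> w \<in> Y \<and> (\<forall>q\<in>\<Gamma>. a p q = w \<bullet> fst q)"

lemma dom_op_R:
  assumes "k > 0" "w \<in> Y" shows "dom_op (R k w) ((1 / k) *\<^sub>R (w - F k w) - M *\<^sub>R F k w)"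
  unfolding dom_op_def
proof (intro conjI ballI)
  show "R k w \<in> \<Gamma>" by (rule R_\<Gamma>[OF assms(1)])
  show "(1 / k) *\<^sub>R (w - F k w) - M *\<^sub>R F k w \<in> Y"
    by (intro subspace_diff subspace_scale Y F_Y assms)
  show "a (R k w) q = ((1 / k) *\<^sub>R (w - F k w) - M *\<^sub>R F k w) \<bullet> fst q" if "q \<in> \<Gamma>" for q
    using b_R[OF assms(1) that, of w] assms(1)
    by (simp add: b_def F_def inner_diff_left inner_add_left field_simps)
qed

lemma R_dom_op:
  assumes k: "k > 0" and p: "dom_op p w" shows "R k (fst p + k *\<^sub>R (w + M *\<^sub>R fst p)) = p"
  using p by (intro R_eqI[OF k]) (auto simp: dom_op_def shifted_def b_def inner_add_left algebra_simps)

lemma subspace_dom_op: "subspace {p. \<exists>w. dom_op p w}"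
proof -
  have 0: "dom_op 0 0"
    by (simp add: dom_op_def subspace_0[OF Y(1)] a.zero_left subspace_0[OF \<Gamma>(1)])
  have "dom_op (p + q) (w + z)" if "dom_op p w" "dom_op q z" for p q w z
    using that by (simp add: dom_op_def subspace_add[OF Y(1)] subspace_add[OF \<Gamma>(1)] a.add_left inner_add_left)
  moreover have "dom_op (c *\<^sub>R p) (c *\<^sub>R w)" if "dom_op p w" for c p w
    using that by (simp add: dom_op_def subspace_scale[OF Y(1)] subspace_scale[OF \<Gamma>(1)] a.scaleR_left)
  ultimately show ?thesis using 0 unfolding subspace_def by blast
qed

text \<open>Density in the graph norm. A \<open>p\<close> orthogonal to the domain for
  \<open>shifted 1\<close> is orthogonal to \<open>R 1 (fst p)\<close>, and this pairing equals
  \<open>fst p \<bullet> fst p\<close>.\<close>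

lemma dom_op_dense: "\<Gamma> \<subseteq> closure {p. \<exists>w. dom_op p w}"
proof (rule subset_closure_if_orthogonal_zero[OF bilinear_shifted[of 1] sym_shifted \<Gamma> _ _ subspace_dom_op])
  show "1 * \<delta> > 0" using \<delta> by simp
  show "1 * \<delta> * (norm p)\<^sup>2 \<le> shifted 1 p p" if "p \<in> \<Gamma>" for p using shifted_ge[OF that, of 1] by simp
  show "{p. \<exists>w. dom_op p w} \<subseteq> \<Gamma>" by (auto simp: dom_op_def)
  fix p assume p: "p \<in> \<Gamma>" and orth: "\<And>d. d \<in> {p. \<exists>w. dom_op p w} \<Longrightarrow> shifted 1 p d = 0"
  have "shifted 1 p (R 1 (fst p)) = 0" using dom_op_R[of 1 "fst p"] fst_Y[OF p] by (intro orth) auto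
  then have "fst p \<bullet> fst p = 0" using shifted_R[of 1 p "fst p"] p sym_shifted[of 1 p] by simp
  then show "p = 0" using graph[of "snd p"] p by (metis inner_eq_zero_iff prod.collapse zero_prod_def)
qed

lemma Y_dense: "Y \<subseteq> closure (fst ` \<Gamma>)"
proof (rule subset_closure_if_orthogonal_zero[OF bounded_bilinear_inner inner_commute Y])
  show "(0::real) < 1" by simp
  show "1 * (norm x)\<^sup>2 \<le> x \<bullet> x" for x :: 'y by (simp add: power2_norm_eq_inner)
  show "subspace (fst ` \<Gamma>)" by (intro linear_subspace_image \<Gamma> bounded_linear.linear bounded_linear_fst)
  show "fst ` \<Gamma> \<subseteq> Y" using fst_Y by auto
  show "x = 0" if "x \<in> Y" "\<And>d. d \<in> fst ` \<Gamma> \<Longrightarrow> x \<bullet> d = 0" for x using that by (intro dense_Y) auto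
qed

definition \<kappa> :: "nat \<Rightarrow> real" where "\<kappa> n = 1 / Suc n"

lemma \<kappa>_pos: "\<kappa> n > 0" by (simp add: \<kappa>_def)

lemma \<kappa>_tendsto: "\<kappa> \<longlonglongrightarrow> 0"
  unfolding \<kappa>_def[abs_def] by (rule LIMSEQ_Suc[OF lim_1_over_n])

text \<open>Convergence in the graph norm. The energy contraction \<open>b_R_fst_le\<close> gives a
  Lipschitz constant independent of \<open>n\<close>; on the operator domain there is even the rate
  \<open>sqrt (\<kappa> n)\<close>.\<close>

lemma R_tendsto:
  assumes p: "p \<in> \<Gamma>" shows "(\<lambda>n. R (\<kappa> n) (fst p)) \<longlonglongrightarrow> p"
proof -
  obtain K where K: "K > 0" "\<And>x y. norm (b x y) \<le> norm x * norm y * K" using b.pos_bounded by blast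
  define L where "L = sqrt (K / \<delta>)"
  show ?thesis
  proof (rule strong_convergence_dense[OF dom_op_dense _ _ _ p])
    show "{p. \<exists>w. dom_op p w} \<subseteq> \<Gamma>" by (auto simp: dom_op_def)
    fix n x y assume xy: "x \<in> \<Gamma>" "y \<in> \<Gamma>"
    then have d: "x - y \<in> \<Gamma>" using \<Gamma> by (simp add: subspace_diff)
    have "\<delta> * (norm (R (\<kappa> n) (fst (x - y))))\<^sup>2 \<le> b (R (\<kappa> n) (fst (x - y))) (R (\<kappa> n) (fst (x - y)))"
      by (rule b_ge[OF R_\<Gamma>[OF \<kappa>_pos]])
    also have "\<dots> \<le> b (x - y) (x - y)" by (rule b_R_fst_le[OF \<kappa>_pos d])
    also have "\<dots> \<le> K * (norm (x - y))\<^sup>2" using K(2)[of "x - y" "x - y"] by (simp add: power2_eq_square mult.commute)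
    finally have "(norm (R (\<kappa> n) (fst (x - y))))\<^sup>2 \<le> (K / \<delta>) * (norm (x - y))\<^sup>2"
      using \<delta> by (simp add: field_simps)
    also have "\<dots> = (L * norm (x - y))\<^sup>2" using K(1) \<delta> by (simp add: L_def power_mult_distrib)
    finally have sq: "(norm (R (\<kappa> n) (fst (x - y))))\<^sup>2 \<le> (L * norm (x - y))\<^sup>2" .
    have "0 \<le> L * norm (x - y)" using K(1) \<delta> by (simp add: L_def)
    then have "norm (R (\<kappa> n) (fst (x - y))) \<le> L * norm (x - y)" by (rule power2_le_imp_le[OF sq])
    then show "norm (R (\<kappa> n) (fst x) - R (\<kappa> n) (fst y)) \<le> L * norm (x - y)"
      by (simp add: R_diff[OF \<kappa>_pos])
  next
    fix x assume "x \<in> {p. \<exists>w. dom_op p w}"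
    then obtain w where x: "dom_op x w" by blast
    define z where "z = w + M *\<^sub>R fst x"
    \<comment> \<open>With \<open>z = (L + M) (fst x)\<close> the difference is
      \<open>- k R k z\<close> for \<open>k = \<kappa> n\<close>, and \<open>b_R_le\<close> bounds
      the energy of \<open>R k z\<close> by \<open>norm z ^ 2 / k\<close>; in the square of the
      difference one factor \<open>k\<close> survives.\<close>
    have est: "norm (R (\<kappa> n) (fst x) - x) \<le> sqrt (\<kappa> n) * (norm z / sqrt \<delta>)" for n
    proof -
      let ?r = "R (\<kappa> n) z"
      have r: "?r \<in> \<Gamma>" by (rule R_\<Gamma>[OF \<kappa>_pos])
      have "R (\<kappa> n) (fst x + \<kappa> n *\<^sub>R z) = x" unfolding z_def by (rule R_dom_op[OF \<kappa>_pos x])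
      then have "R (\<kappa> n) (fst x) + \<kappa> n *\<^sub>R ?r = x"
        by (simp only: R_add[OF \<kappa>_pos] R_scaleR[OF \<kappa>_pos])
      moreover have "u - y = - v" if "u + v = y" for u v y :: "'y \<times> 'x"
        unfolding that[symmetric] by simp
      ultimately have eq: "R (\<kappa> n) (fst x) - x = - (\<kappa> n *\<^sub>R ?r)" by blast
      have "\<delta> * (norm (\<kappa> n *\<^sub>R ?r))\<^sup>2 \<le> (\<kappa> n)\<^sup>2 * b ?r ?r"
        using mult_left_mono[OF b_ge[OF r], of "(\<kappa> n)\<^sup>2"] by (simp add: power_mult_distrib mult.left_commute)
      also have "\<dots> \<le> \<kappa> n * (norm z)\<^sup>2"
        using mult_left_mono[OF b_R_le[OF \<kappa>_pos[of n], of z], of "\<kappa> n"] \<kappa>_pos[of n]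
        by (simp add: power2_eq_square mult.assoc)
      finally have "(norm (R (\<kappa> n) (fst x) - x))\<^sup>2 \<le> \<kappa> n * (norm z)\<^sup>2 / \<delta>"
        using \<delta> by (simp add: eq field_simps)
      also have "\<dots> = (sqrt (\<kappa> n) * (norm z / sqrt \<delta>))\<^sup>2"
        using \<delta> \<kappa>_pos[of n] by (simp add: power_mult_distrib power_divide)
      finally have sq: "(norm (R (\<kappa> n) (fst x) - x))\<^sup>2 \<le> (sqrt (\<kappa> n) * (norm z / sqrt \<delta>))\<^sup>2" .
      have "0 \<le> sqrt (\<kappa> n) * (norm z / sqrt \<delta>)" using \<delta> \<kappa>_pos[of n] by simp
      then show ?thesis by (rule power2_le_imp_le[OF sq])
    qed
    have "(\<lambda>n. sqrt (\<kappa> n) * (norm z / sqrt \<delta>)) \<longlonglongrightarrow> sqrt 0 * (norm z / sqrt \<delta>)"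
      by (intro tendsto_intros \<kappa>_tendsto)
    then have "(\<lambda>n. R (\<kappa> n) (fst x) - x) \<longlonglongrightarrow> 0"
      by (intro Lim_null_comparison[OF always_eventually[OF allI[OF est]]]) simp
    then show "(\<lambda>n. R (\<kappa> n) (fst x)) \<longlonglongrightarrow> x" by (rule LIM_zero_cancel)
  qed
qed

lemma F_tendsto:
  assumes w: "w \<in> Y" shows "(\<lambda>n. F (\<kappa> n) w) \<longlonglongrightarrow> w"
proof (rule strong_convergence_dense[OF Y_dense _ _ _ w])
  show "fst ` \<Gamma> \<subseteq> Y" using fst_Y by auto
  show "norm (F (\<kappa> n) x - F (\<kappa> n) y) \<le> 1 * norm (x - y)" for n x y
    using norm_F_le[OF \<kappa>_pos, of n "x - y"] by (simp add: F_diff[OF \<kappa>_pos])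
  show "(\<lambda>n. F (\<kappa> n) x) \<longlonglongrightarrow> x" if x: "x \<in> fst ` \<Gamma>" for x
  proof -
    obtain p where p: "p \<in> \<Gamma>" "x = fst p" using x by blast
    show ?thesis unfolding F_def p(2) by (rule tendsto_fst[OF R_tendsto[OF p(1)]])
  qed
qed

end

section \<open>Differential inequalities for growth bounds from above and below\<close>

lemma exp_growth_if_derivative_le:
  fixes f :: "real \<Rightarrow> real"
  assumes f: "\<And>t. (f has_real_derivative f' t) (at t)" and le: "\<And>t. \<bar>f' t\<bar> \<le> c * f t"
  shows "f t \<le> exp (c * \<bar>t\<bar>) * f 0"
proof (cases "t \<ge> 0")
  case True
  have "exp (- c * t) * f t \<le> exp (- c * 0) * f 0"
  proof (rule DERIV_nonpos_imp_nonincreasing[OF True])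
    fix r
    have "((\<lambda>r. exp (- c * r) * f r) has_real_derivative exp (- c * r) * (f' r - c * f r)) (at r)"
      by (auto intro!: derivative_eq_intros f simp: algebra_simps)
    moreover have "exp (- c * r) * (f' r - c * f r) \<le> 0" using le[of r] by (simp add: mult_le_0_iff)
    ultimately show "\<exists>y. ((\<lambda>r. exp (- c * r) * f r) has_real_derivative y) (at r) \<and> y \<le> 0" by blast
  qed
  then show ?thesis using True by (simp add: exp_minus field_simps)
next
  case False
  have "exp (c * t) * f t \<le> exp (c * 0) * f 0"
  proof (rule DERIV_nonneg_imp_nondecreasing[where a = t and b = 0 and f = "\<lambda>r. exp (c * r) * f r"])
    show "t \<le> 0" using False by simp
    fix r
    have "((\<lambda>r. exp (c * r) * f r) has_real_derivative exp (c * r) * (f' r + c * f r)) (at r)"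
      by (auto intro!: derivative_eq_intros f simp: algebra_simps)
    moreover have "exp (c * r) * (f' r + c * f r) \<ge> 0" using le[of r] by (simp add: zero_le_mult_iff)
    ultimately show "\<exists>y. ((\<lambda>r. exp (c * r) * f r) has_real_derivative y) (at r) \<and> 0 \<le> y" by blast
  qed
  then show ?thesis using False by (simp add: exp_minus field_simps)
qed

text \<open>Equality in \<open>le\<close> holds for the model \<open>f 0 * cosh (s * t) ^ 2\<close>,
  which has the stated rate. The first integral \<open>g\<close> of the model is nondecreasing in
  general; it bounds the square of \<open>f'\<close> from below, and \<open>le\<close> turns this
  into a linear inequality for \<open>f''\<close>.\<close>

lemma convexity_growth:
  fixes f :: "real \<Rightarrow> real"
  assumes f: "\<And>t. (f has_real_derivative f' t) (at t)" and f': "\<And>t. (f' has_real_derivative f'' t) (at t)"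
    and f0: "f 0 > 0" "f' 0 = 0" and s: "s > 0"
    and le: "\<And>t. (f' t)\<^sup>2 \<le> f t * (f'' t - 2 * s\<^sup>2 * f 0)" and pos: "\<And>t. f'' t \<ge> 0"
    and t: "t \<ge> 0"
  shows "f t \<ge> f 0 / 4 * exp (2 * s * t)"
proof -
  have f'_nonneg: "f' r \<ge> 0" if "r \<ge> 0" for r
    using DERIV_nonneg_imp_nondecreasing[OF that, of f'] f' pos f0 by metis
  have f_ge: "f r \<ge> f 0" if "r \<ge> 0" for r
    using DERIV_nonneg_imp_nondecreasing[OF that, of f] f f'_nonneg by metis
  have f_pos: "f r > 0" if "r \<ge> 0" for r using f_ge[OF that] f0 by linarith
  \<comment> \<open>For the model this is the constant \<open>s\<^sup>2\<close>, as tanh^2 and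
    1/cosh^2 add up to 1. Its derivative is the defect in \<open>le\<close>, multiplied by
    \<open>f'\<close> and divided by twice the cube of \<open>f\<close>.\<close>
  define g where "g r = (f' r)\<^sup>2 / (4 * (f r)\<^sup>2) + s\<^sup>2 * f 0 / f r" for r
  have g_ge: "g r \<ge> s\<^sup>2" if r: "r \<ge> 0" for r
  proof -
    have "g 0 \<le> g r"
    proof (rule DERIV_nonneg_imp_nondecreasing[OF r])
      fix x assume x: "0 \<le> x" "x \<le> r"
      have fx: "f x > 0" by (rule f_pos[OF x(1)])
      have "(g has_real_derivative f' x / (2 * (f x)^3) * (f x * (f'' x - 2 * s\<^sup>2 * f 0) - (f' x)\<^sup>2)) (at x)"
        unfolding g_def using fx
        by (auto intro!: derivative_eq_intros f f' simp: field_simps power2_eq_square power3_eq_cube)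
      moreover have "f' x / (2 * (f x)^3) * (f x * (f'' x - 2 * s\<^sup>2 * f 0) - (f' x)\<^sup>2) \<ge> 0"
        using le[of x] f'_nonneg[OF x(1)] fx by simp
      ultimately show "\<exists>y. (g has_real_derivative y) (at x) \<and> 0 \<le> y" by blast
    qed
    then show ?thesis using f0 by (simp add: g_def)
  qed
  have f''_ge: "f'' r \<ge> 4 * s\<^sup>2 * f r - 2 * s\<^sup>2 * f 0" if r: "r \<ge> 0" for r
  proof -
    have fr: "f r > 0" by (rule f_pos[OF r])
    have "s\<^sup>2 * (4 * (f r)\<^sup>2) \<le> g r * (4 * (f r)\<^sup>2)" using g_ge[OF r] by (intro mult_right_mono) auto
    also have "\<dots> = (f' r)\<^sup>2 + 4 * s\<^sup>2 * f 0 * f r"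
      using fr by (simp add: g_def field_simps power2_eq_square)
    finally have "s\<^sup>2 * (4 * (f r)\<^sup>2) - 4 * s\<^sup>2 * f 0 * f r \<le> f r * (f'' r - 2 * s\<^sup>2 * f 0)"
      using le[of r] by linarith
    then have "f r * (4 * s\<^sup>2 * f r - 4 * s\<^sup>2 * f 0) \<le> f r * (f'' r - 2 * s\<^sup>2 * f 0)"
      by (simp add: algebra_simps power2_eq_square)
    then have "4 * s\<^sup>2 * f r - 4 * s\<^sup>2 * f 0 \<le> f'' r - 2 * s\<^sup>2 * f 0" using fr by (simp only: mult_le_cancel_left_pos)
    then show ?thesis by linarith
  qed
  \<comment> \<open>Subtracting \<open>f 0 / 2\<close> removes the inhomogeneity and leaves that the
    second derivative of \<open>\<phi>\<close> is at least \<open>4 * s\<^sup>2 * \<phi>\<close>.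
    The operator factors into \<open>d/dt - 2 s\<close> and \<open>d/dt + 2 s\<close>;
    \<open>\<psi>\<close> is the value of the second factor on \<open>\<phi>\<close>, so two first
    order integrations suffice.\<close>
  define \<phi> where "\<phi> r = f r - f 0 / 2" for r
  define \<psi> where "\<psi> r = f' r + 2 * s * \<phi> r" for r
  have \<psi>_ge: "\<psi> r \<ge> s * f 0 * exp (2 * s * r)" if r: "r \<ge> 0" for r
  proof -
    have "exp (- 2 * s * 0) * \<psi> 0 \<le> exp (- 2 * s * r) * \<psi> r"
    proof (rule DERIV_nonneg_imp_nondecreasing[OF r])
      fix x assume x: "0 \<le> x" "x \<le> r"
      have "((\<lambda>r. exp (- 2 * s * r) * \<psi> r) has_real_derivative exp (- 2 * s * x) * (f'' x - 4 * s\<^sup>2 * \<phi> x)) (at x)"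
        unfolding \<psi>_def \<phi>_def
        by (auto intro!: derivative_eq_intros f f' simp: algebra_simps power2_eq_square)
      moreover have "exp (- 2 * s * x) * (f'' x - 4 * s\<^sup>2 * \<phi> x) \<ge> 0"
      proof (rule mult_nonneg_nonneg)
        show "0 \<le> f'' x - 4 * s\<^sup>2 * \<phi> x" using f''_ge[OF x(1)] by (simp add: \<phi>_def algebra_simps)
      qed simp
      ultimately show "\<exists>y. ((\<lambda>r. exp (- 2 * s * r) * \<psi> r) has_real_derivative y) (at x) \<and> 0 \<le> y" by blast
    qed
    then show ?thesis using f0 by (simp add: \<psi>_def \<phi>_def exp_minus field_simps)
  qed
  have "exp (2 * s * 0) * \<phi> 0 - f 0 / 4 * exp (4 * s * 0) \<le> exp (2 * s * t) * \<phi> t - f 0 / 4 * exp (4 * s * t)"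
  proof (rule DERIV_nonneg_imp_nondecreasing[OF t])
    fix x assume x: "0 \<le> x" "x \<le> t"
    have e: "exp (4 * s * x) = exp (2 * s * x) * exp (2 * s * x)" by (simp add: exp_add[symmetric])
    have "((\<lambda>r. exp (2 * s * r) * \<phi> r - f 0 / 4 * exp (4 * s * r)) has_real_derivative
        exp (2 * s * x) * \<psi> x - s * f 0 * exp (4 * s * x)) (at x)"
      unfolding \<psi>_def \<phi>_def
      by (auto intro!: derivative_eq_intros f f' simp: algebra_simps)
    moreover have "exp (2 * s * x) * \<psi> x - s * f 0 * exp (4 * s * x) \<ge> 0"
      using mult_left_mono[OF \<psi>_ge[OF x(1)], of "exp (2 * s * x)"] unfolding e by (simp add: algebra_simps)
    ultimately show "\<exists>y. ((\<lambda>r. exp (2 * s * r) * \<phi> r - f 0 / 4 * exp (4 * s * r)) has_real_derivative y) (at x) \<and> 0 \<le> y" by blast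
  qed
  then have "f 0 / 4 * exp (4 * s * t) \<le> exp (2 * s * t) * \<phi> t" using f0 by (simp add: \<phi>_def)
  moreover have "exp (4 * s * t) = exp (2 * s * t) * exp (2 * s * t)" by (simp add: exp_add[symmetric])
  ultimately have "exp (2 * s * t) * (f 0 / 4 * exp (2 * s * t)) \<le> exp (2 * s * t) * \<phi> t" by (simp add: mult.assoc mult.left_commute)
  then have "f 0 / 4 * exp (2 * s * t) \<le> \<phi> t" by simp
  then show ?thesis using f0 by (simp add: \<phi>_def)
qed

section \<open>The group of the first order system \<open>u' = v\<close>,
  \<open>v' = - L u\<close>\<close>

locale bounded_below_form = energy_form +
  fixes s :: real
  assumes s_pos: "s > 0" and lower: "\<And>p. p \<in> \<Gamma> \<Longrightarrow> - s\<^sup>2 * (norm (fst p))\<^sup>2 \<le> a p p"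
begin

definition E :: "(('a \<times> 'b) \<times> 'a) set" where "E = \<Gamma> \<times> Y"

text \<open>The bounded generator with values \<open>(F v, - L F u)\<close>: by \<open>b_R\<close>,
  \<open>M F u - (u - F u) / k\<close> is \<open>- L F u\<close>, written without \<open>L\<close>.
  The first entry is \<open>R k\<close> of \<open>v\<close>, so that its value lies in the
  graph.\<close>

definition yosida :: "real \<Rightarrow> ('a \<times> 'b) \<times> 'a \<Rightarrow> ('a \<times> 'b) \<times> 'a" where
  "yosida k x = (R k (snd x),
     M *\<^sub>R F k (fst (fst x)) - (1 / k) *\<^sub>R (fst (fst x) - F k (fst (fst x))))"

definition A :: "nat \<Rightarrow> (('a \<times> 'b) \<times> 'a) endo" where "A n = endo_of (yosida (\<kappa> n))"

text \<open>The resolvent at \<open>k = 1\<close> in both entries. It commutes with every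
  \<open>A n\<close>, maps \<open>E\<close> into the domain of the generator and is injective on
  \<open>E\<close>; it serves to identify the generator in
  \<open>derivative_imp_gen\<close>.\<close>

definition smoothing :: "(('a \<times> 'b) \<times> 'a) endo" where
  "smoothing = endo_of (\<lambda>x. (R 1 (fst (fst x)), F 1 (snd x)))"

definition total_energy :: "('a \<times> 'b) \<times> 'a \<Rightarrow> real" where
  "total_energy x = a (fst x) (fst x) + snd x \<bullet> snd x"

lemma subspace_E: "subspace E"
  unfolding E_def by (intro subspace_Times \<Gamma> Y)

lemma closed_E: "closed E"
  unfolding E_def by (intro closed_Times \<Gamma> Y)

lemma E_iff: "x \<in> E \<longleftrightarrow> fst x \<in> \<Gamma> \<and> snd x \<in> Y"
  by (cases x) (simp add: E_def)

lemma bounded_linear_yosida: "k > 0 \<Longrightarrow> bounded_linear (yosida k)"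
  unfolding yosida_def[abs_def]
  by (intro bounded_linear_Pair bounded_linear_sub bounded_linear_scaleR_right[THEN bounded_linear_compose]
      bounded_linear_compose[OF bounded_linear_R] bounded_linear_compose[OF bounded_linear_F]
      bounded_linear_compose[OF bounded_linear_fst] bounded_linear_fst bounded_linear_snd)

lemma A_apply: "A n \<cdot> x = yosida (\<kappa> n) x"
  by (simp add: A_def endo_of_apply bounded_linear_yosida \<kappa>_pos)

lemma smoothing_apply: "smoothing \<cdot> x = (R 1 (fst (fst x)), F 1 (snd x))"
  unfolding smoothing_def
  by (subst endo_of_apply) (auto intro!: bounded_linear_Pair
      bounded_linear_compose[OF bounded_linear_R] bounded_linear_compose[OF bounded_linear_F]
      bounded_linear_compose[OF bounded_linear_fst] bounded_linear_fst bounded_linear_snd)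

lemma A_E:
  assumes "x \<in> E" shows "A n \<cdot> x \<in> E"
proof -
  have "fst (fst x) \<in> Y" using assms fst_Y by (simp add: E_iff)
  then show ?thesis unfolding A_apply E_iff yosida_def
    by (auto intro!: subspace_diff subspace_scale Y R_\<Gamma> F_Y \<kappa>_pos)
qed

lemma F_resolvent:
  assumes "k > 0" "m > 0"
  shows "(1 / k) *\<^sub>R (F m u - F k (F m u)) = (1 / m) *\<^sub>R (F k u - F k (F m u))"
  using arg_cong[OF resolvent_identity[OF assms, of u], of fst]
  by (simp add: F_def[symmetric] F_scaleR[OF assms(1)] F_diff[OF assms(1)])

lemma yosida_commute:
  assumes k: "k > 0" and m: "m > 0" shows "yosida k (yosida m x) = yosida m (yosida k x)"
proof -
  obtain u f v where x: "x = ((u, f), v)" by (metis prod.collapse)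
  \<comment> \<open>Graph points agree as soon as their first components do, which reduces the
    identity to the commuting operators \<open>F\<close>.\<close>
  have "R k (M *\<^sub>R F m u - (1 / m) *\<^sub>R (u - F m u)) = R m (M *\<^sub>R F k u - (1 / k) *\<^sub>R (u - F k u))"
  proof (rule \<Gamma>_eqI[OF R_\<Gamma>[OF k] R_\<Gamma>[OF m]])
    show "fst (R k (M *\<^sub>R F m u - (1 / m) *\<^sub>R (u - F m u))) = fst (R m (M *\<^sub>R F k u - (1 / k) *\<^sub>R (u - F k u)))"
      using F_resolvent[OF k m, of u]
      by (simp add: F_def[symmetric] F_scaleR[OF k] F_diff[OF k] F_scaleR[OF m] F_diff[OF m] F_commute[OF m k])
  qed
  moreover have "M *\<^sub>R F k (F m v) - (1 / k) *\<^sub>R (F m v - F k (F m v)) = M *\<^sub>R F m (F k v) - (1 / m) *\<^sub>R (F k v - F m (F k v))"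
    using F_resolvent[OF k m, of v] by (simp add: F_commute[OF m k])
  ultimately show ?thesis by (simp add: x yosida_def F_def[symmetric])
qed

lemma A_commute: "A m * A n = A n * A m"
  by (rule endo_eqI) (simp add: mult_apply_endo A_apply yosida_commute \<kappa>_pos)

lemma smoothing_commute: "A n * smoothing = smoothing * A n"
proof (rule endo_eqI)
  fix x :: "('a \<times> 'b) \<times> 'a"
  have k: "\<kappa> n > 0" by (rule \<kappa>_pos)
  obtain u f v where x: "x = ((u, f), v)" by (metis prod.collapse)
  have "R (\<kappa> n) (F 1 v) = R 1 (F (\<kappa> n) v)"
    by (rule \<Gamma>_eqI[OF R_\<Gamma> R_\<Gamma>]) (simp_all add: k F_def[symmetric] F_commute[OF k])
  then show "(A n * smoothing) \<cdot> x = (smoothing * A n) \<cdot> x"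
    by (simp add: x mult_apply_endo A_apply smoothing_apply yosida_def F_def[symmetric] F_diff F_scaleR F_commute[OF k])
qed

lemma smoothing_E: "x \<in> E \<Longrightarrow> smoothing \<cdot> x \<in> E"
  by (simp add: E_iff smoothing_apply R_\<Gamma> F_Y)

text \<open>Differentiation gives \<open>2 a(u, F v)\<close> and \<open>- 2 (v, L F u)\<close>. The
  first is \<open>2 (L F v, u)\<close>, and symmetry of \<open>F\<close> makes the two cancel; this
  is the reason for the same \<open>F\<close> in both entries of \<open>yosida\<close>.\<close>

lemma energy_derivative:
  assumes x: "x \<in> E" shows "((\<lambda>t. total_energy (flow (A n) t x)) has_real_derivative 0) (at t)"
proof -
  define y where "y t = flow (A n) t x" for t
  have yE: "y t \<in> E" unfolding y_def by (rule flow_invariant[OF subspace_E closed_E A_E x])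
  have y: "(y has_vector_derivative yosida (\<kappa> n) (y t)) (at t)"
    using flow_has_vector_derivative[of "A n" x t UNIV] by (simp add: y_def[abs_def] A_apply)
  have k: "\<kappa> n > 0" by (rule \<kappa>_pos)
  obtain u f v where yt: "y t = ((u, f), v)" by (metis prod.collapse)
  have p: "(u, f) \<in> \<Gamma>" using yE by (simp add: yt E_iff)
  define w where "w = M *\<^sub>R F (\<kappa> n) u - (1 / \<kappa> n) *\<^sub>R (u - F (\<kappa> n) u)"
  have d: "yosida (\<kappa> n) (y t) = (R (\<kappa> n) v, w)" by (simp add: yosida_def yt w_def)
  have d1: "((\<lambda>t. fst (y t)) has_vector_derivative R (\<kappa> n) v) (at t)"
    using bounded_linear.has_vector_derivative[OF bounded_linear_fst y] by (simp add: d)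
  have d2: "((\<lambda>t. snd (y t)) has_vector_derivative w) (at t)"
    using bounded_linear.has_vector_derivative[OF bounded_linear_snd y] by (simp add: d)
  have "((\<lambda>t. total_energy (y t)) has_vector_derivative
      (a (u, f) (R (\<kappa> n) v) + a (R (\<kappa> n) v) (u, f)) + (v \<bullet> w + w \<bullet> v)) (at t)"
    using has_vector_derivative_add[OF a.has_vector_derivative[OF d1 d1]
        bounded_bilinear.has_vector_derivative[OF bounded_bilinear_inner d2 d2]]
    by (simp add: total_energy_def yt)
  moreover have "a (R (\<kappa> n) v) (u, f) = (1 / \<kappa> n) * ((v - F (\<kappa> n) v) \<bullet> u) - M * (F (\<kappa> n) v \<bullet> u)"
    using b_R[OF k p, of v] k by (simp add: b_def F_def[symmetric] field_simps)
  moreover have "v \<bullet> w = M * (F (\<kappa> n) v \<bullet> u) - (1 / \<kappa> n) * ((v - F (\<kappa> n) v) \<bullet> u)"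
    by (simp add: w_def inner_diff_right inner_diff_left F_sym[OF k, of v])
  ultimately show ?thesis
    by (simp add: y_def sym_a[of "(u, f)"] inner_commute[of w] has_real_derivative_iff_has_vector_derivative)
qed

lemma energy_flow:
  assumes x: "x \<in> E" shows "total_energy (flow (A n) t x) = total_energy x"
proof -
  have "(\<lambda>t. total_energy (flow (A n) t x)) t = (\<lambda>t. total_energy (flow (A n) t x)) 0"
    by (rule DERIV_isconst_all) (auto intro: energy_derivative[OF x])
  then show ?thesis by (simp add: flow_0)
qed

text \<open>Energy conservation and \<open>a \<ge> - s\<^sup>2\<close> give \<open>|d/dt P| \<le> 2 s P\<close> for \<open>P = s\<^sup>2 |u|\<^sup>2 + |energy|\<close>, whence
  the growth rate \<open>s\<close> without a polynomial factor.\<close>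

lemma flow_potential_le:
  assumes x: "x \<in> E"
  shows "s\<^sup>2 * (norm (fst (fst (flow (A n) t x))))\<^sup>2 + \<bar>total_energy x\<bar>
    \<le> exp (2 * s * \<bar>t\<bar>) * (s\<^sup>2 * (norm (fst (fst x)))\<^sup>2 + \<bar>total_energy x\<bar>)" (is ?thesis1)
    and snd_flow_le: "(norm (snd (flow (A n) t x)))\<^sup>2 \<le> s\<^sup>2 * (norm (fst (fst (flow (A n) t x))))\<^sup>2 + \<bar>total_energy x\<bar>"
proof -
  define y where "y t = flow (A n) t x" for t
  have yE: "y t \<in> E" for t unfolding y_def by (rule flow_invariant[OF subspace_E closed_E A_E x])
  have k: "\<kappa> n > 0" by (rule \<kappa>_pos)
  have H: "total_energy (y t) = total_energy x" for t by (simp add: y_def energy_flow[OF x])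
  define P where "P t = s\<^sup>2 * (norm (fst (fst (y t))))\<^sup>2 + \<bar>total_energy x\<bar>" for t
  \<comment> \<open>The square of \<open>|v|\<close> is the energy minus \<open>a(u,u)\<close>, and
    \<open>- a(u,u)\<close> is at most \<open>s\<^sup>2 |u|\<^sup>2\<close> by
    \<open>lower\<close>.\<close>
  have v_le: "(norm (snd (y t)))\<^sup>2 \<le> P t" for t
    using lower[of "fst (y t)"] yE[of t] H[of t] by (simp add: E_iff total_energy_def P_def power2_norm_eq_inner)
  then show "(norm (snd (flow (A n) t x)))\<^sup>2 \<le> s\<^sup>2 * (norm (fst (fst (flow (A n) t x))))\<^sup>2 + \<bar>total_energy x\<bar>"
    by (simp add: P_def y_def)
  have "P t \<le> exp ((2 * s) * \<bar>t\<bar>) * P 0"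
  proof (rule exp_growth_if_derivative_le)
    fix t
    let ?u = "fst (fst (y t))" and ?v = "snd (y t)"
    have "(y has_vector_derivative yosida (\<kappa> n) (y t)) (at t)"
      using flow_has_vector_derivative[of "A n" x t UNIV] by (simp add: y_def[abs_def] A_apply)
    from bounded_linear.has_vector_derivative[OF bounded_linear_fst
        bounded_linear.has_vector_derivative[OF bounded_linear_fst this]]
    have "((\<lambda>t. fst (fst (y t))) has_vector_derivative F (\<kappa> n) ?v) (at t)"
      by (simp add: yosida_def F_def)
    from bounded_bilinear.has_vector_derivative[OF bounded_bilinear_inner this this]
    have "((\<lambda>t. fst (fst (y t)) \<bullet> fst (fst (y t))) has_real_derivative 2 * (?u \<bullet> F (\<kappa> n) ?v)) (at t)"
      by (simp add: has_real_derivative_iff_has_vector_derivative inner_commute)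
    then show "(P has_real_derivative s\<^sup>2 * (2 * (?u \<bullet> F (\<kappa> n) ?v))) (at t)"
      unfolding P_def[abs_def] power2_norm_eq_inner by (auto intro!: derivative_eq_intros)
    have P0: "P t \<ge> 0" by (simp add: P_def)
    have "s * norm ?u \<le> sqrt (P t)" by (rule real_le_rsqrt) (simp add: P_def power_mult_distrib)
    moreover have "norm (F (\<kappa> n) ?v) \<le> sqrt (P t)"
      using norm_F_le[OF k, of ?v] real_le_rsqrt[OF v_le[of t]] by linarith
    ultimately have "(s * norm ?u) * norm (F (\<kappa> n) ?v) \<le> sqrt (P t) * sqrt (P t)"
      using s_pos P0 by (intro mult_mono) auto
    then have "s * (norm ?u * norm (F (\<kappa> n) ?v)) \<le> P t" using P0 by simp
    moreover have "\<bar>?u \<bullet> F (\<kappa> n) ?v\<bar> \<le> norm ?u * norm (F (\<kappa> n) ?v)" by (rule Cauchy_Schwarz_ineq2)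
    ultimately have "s * \<bar>?u \<bullet> F (\<kappa> n) ?v\<bar> \<le> P t"
      using s_pos by (meson less_imp_le mult_left_mono order_trans)
    then have "(2 * s) * (s * \<bar>?u \<bullet> F (\<kappa> n) ?v\<bar>) \<le> (2 * s) * P t" using s_pos by (intro mult_left_mono) auto
    then show "\<bar>s\<^sup>2 * (2 * (?u \<bullet> F (\<kappa> n) ?v))\<bar> \<le> (2 * s) * P t"
      by (simp add: abs_mult power2_eq_square mult.assoc mult.left_commute)
  qed
  then show ?thesis1 by (simp add: P_def y_def flow_0)
qed

text \<open>\<open>P\<close> controls \<open>v\<close>, and also \<open>u\<close> since
  \<open>s > 0\<close>. By energy conservation \<open>a(u,u)\<close> is at most \<open>P\<close>,
  and \<open>coercive\<close> then recovers the full graph norm. \<open>K1\<close> collects these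
  losses at time \<open>t\<close>, \<open>K2\<close> bounds the initial \<open>P\<close>; neither
  depends on \<open>n\<close>.\<close>

lemma flow_bound_ex:
  "\<exists>C>0. \<forall>n t. \<forall>x\<in>E. norm (flow (A n) t x) \<le> C * exp (s * \<bar>t\<bar>) * norm x"
proof -
  obtain K where K: "K > 0" "\<And>x y. norm (a x y) \<le> norm x * norm y * K" using a.pos_bounded by blast
  define K1 where "K1 = 1 + (1 + \<bar>M\<bar> / s\<^sup>2) / \<delta>"
  define K2 where "K2 = s\<^sup>2 + K + 1"
  have "(1 + \<bar>M\<bar> / s\<^sup>2) / \<delta> \<ge> 0" "s\<^sup>2 \<ge> 0" using \<delta> by simp_all
  then have K12: "K1 > 0" "K2 > 0" using K(1) unfolding K1_def K2_def by linarith+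
  have "norm (flow (A n) t x) \<le> sqrt (K1 * K2) * exp (s * \<bar>t\<bar>) * norm x" if x: "x \<in> E" for n t x
  proof (rule power2_le_imp_le)
    show "0 \<le> sqrt (K1 * K2) * exp (s * \<bar>t\<bar>) * norm x" using K12 by simp
    define y where "y = flow (A n) t x"
    have yE: "y \<in> E" unfolding y_def by (rule flow_invariant[OF subspace_E closed_E A_E x])
    define P where "P = s\<^sup>2 * (norm (fst (fst y)))\<^sup>2 + \<bar>total_energy x\<bar>"
    have P0: "P \<ge> 0" by (simp add: P_def)
    have v: "(norm (snd y))\<^sup>2 \<le> P" using snd_flow_le[OF x] by (simp add: y_def P_def)
    have H: "total_energy y = total_energy x" by (simp add: y_def energy_flow[OF x])
    have "s\<^sup>2 * (norm (fst (fst y)))\<^sup>2 \<le> P" by (simp add: P_def)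
    then have u: "(norm (fst (fst y)))\<^sup>2 \<le> P / s\<^sup>2" using s_pos by (simp add: field_simps)
    have "\<delta> * (norm (fst y))\<^sup>2 \<le> a (fst y) (fst y) + M * (norm (fst (fst y)))\<^sup>2"
      using yE coercive by (simp add: E_iff)
    also have "\<dots> \<le> P + \<bar>M\<bar> * (P / s\<^sup>2)"
    proof (rule add_mono)
      have "0 \<le> s\<^sup>2 * (norm (fst (fst y)))\<^sup>2" by simp
      then show "a (fst y) (fst y) \<le> P"
        using H inner_ge_zero[of "snd y"] unfolding total_energy_def P_def by linarith
      show "M * (norm (fst (fst y)))\<^sup>2 \<le> \<bar>M\<bar> * (P / s\<^sup>2)"
        using u by (intro mult_mono) auto
    qed
    finally have p: "(norm (fst y))\<^sup>2 \<le> ((1 + \<bar>M\<bar> / s\<^sup>2) / \<delta>) * P" using \<delta> by (simp add: field_simps)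
    have "(norm y)\<^sup>2 = (norm (fst y))\<^sup>2 + (norm (snd y))\<^sup>2" by (simp add: norm_prod_def)
    also have "\<dots> \<le> K1 * P" using p v by (simp add: K1_def distrib_right)
    also have "\<dots> \<le> K1 * (exp (2 * s * \<bar>t\<bar>) * (s\<^sup>2 * (norm (fst (fst x)))\<^sup>2 + \<bar>total_energy x\<bar>))"
      using K12 flow_potential_le[OF x] by (intro mult_left_mono) (auto simp: P_def y_def)
    also have "s\<^sup>2 * (norm (fst (fst x)))\<^sup>2 + \<bar>total_energy x\<bar> \<le> K2 * (norm x)\<^sup>2"
    proof -
      have n1: "norm (fst x) \<le> norm x" "norm (fst (fst x)) \<le> norm x" "norm (snd x) \<le> norm x"
        using norm_fst_le'[of x] norm_fst_le'[of "fst x"] norm_snd_le'[of x] by linarith+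
      have "\<bar>total_energy x\<bar> \<le> norm (a (fst x) (fst x)) + (norm (snd x))\<^sup>2"
        unfolding total_energy_def power2_norm_eq_inner using abs_triangle_ineq[of "a (fst x) (fst x)" "snd x \<bullet> snd x"] by simp
      also have "\<dots> \<le> norm x * norm x * K + (norm x)\<^sup>2"
        using n1 K(1) by (intro add_mono order_trans[OF K(2)] mult_right_mono mult_mono power_mono) auto
      finally have "\<bar>total_energy x\<bar> \<le> (K + 1) * (norm x)\<^sup>2" by (simp add: power2_eq_square algebra_simps)
      moreover have "s\<^sup>2 * (norm (fst (fst x)))\<^sup>2 \<le> s\<^sup>2 * (norm x)\<^sup>2"
        using n1 by (intro mult_left_mono power_mono) auto
      ultimately show ?thesis by (simp add: K2_def algebra_simps)
    qed
    then have "K1 * (exp (2 * s * \<bar>t\<bar>) * (s\<^sup>2 * (norm (fst (fst x)))\<^sup>2 + \<bar>total_energy x\<bar>))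
        \<le> K1 * (exp (2 * s * \<bar>t\<bar>) * (K2 * (norm x)\<^sup>2))"
      using K12 by (intro mult_left_mono) auto
    also have "\<dots> = (sqrt (K1 * K2) * exp (s * \<bar>t\<bar>) * norm x)\<^sup>2"
    proof -
      have "exp (2 * s * \<bar>t\<bar>) = (exp (s * \<bar>t\<bar>))\<^sup>2" by (simp add: exp_double[symmetric] mult.assoc)
      then show ?thesis using K12 by (simp add: power_mult_distrib)
    qed
    finally show "(norm (flow (A n) t x))\<^sup>2 \<le> (sqrt (K1 * K2) * exp (s * \<bar>t\<bar>) * norm x)\<^sup>2"
      by (simp add: y_def)
  qed
  moreover have "sqrt (K1 * K2) > 0" using K12 by simp
  ultimately show ?thesis by blast
qed

definition C :: real where
  "C = (SOME C. C > 0 \<and> (\<forall>n t. \<forall>x\<in>E. norm (flow (A n) t x) \<le> C * exp (s * \<bar>t\<bar>) * norm x))"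

lemma C_props: "C > 0 \<and> (\<forall>n t. \<forall>x\<in>E. norm (flow (A n) t x) \<le> C * exp (s * \<bar>t\<bar>) * norm x)"
  unfolding C_def by (rule someI_ex[OF flow_bound_ex])

definition D :: "(('a \<times> 'b) \<times> 'a) set" where
  "D = {p. \<exists>w. dom_op p w} \<times> fst ` \<Gamma>"

text \<open>For \<open>x = (u, v)\<close> this is \<open>y = (v, - L u)\<close>; the condition on
  \<open>fst y\<close> says that \<open>v\<close> belongs to the form domain and supplies its second
  graph component.\<close>

definition gen :: "('a \<times> 'b) \<times> 'a \<Rightarrow> ('a \<times> 'b) \<times> 'a \<Rightarrow> bool" where
  "gen x y \<longleftrightarrow> fst y \<in> \<Gamma> \<and> fst (fst y) = snd x \<and> dom_op (fst x) (- snd y)"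

definition G :: "('a \<times> 'b) \<times> 'a \<Rightarrow> ('a \<times> 'b) \<times> 'a" where "G x = (SOME y. gen x y)"

lemma gen_ex: "x \<in> D \<Longrightarrow> \<exists>y. gen x y"
proof -
  assume "x \<in> D"
  then obtain p w q where x: "x = (p, fst q)" "dom_op p w" "q \<in> \<Gamma>" by (auto simp: D_def)
  then have "gen x (q, - w)" by (simp add: gen_def)
  then show ?thesis by blast
qed

lemma gen_D: "gen x y \<Longrightarrow> x \<in> D"
  unfolding D_def gen_def by (cases x) (auto simp: image_iff)

text \<open>On the domain the resolvent commutes with \<open>L\<close>, so
  \<open>A n \<cdot> x\<close> is the resolvent applied to both entries of \<open>y\<close>, and the
  strong convergence of \<open>R\<close> and \<open>F\<close> applies.\<close>

lemma A_tendsto: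
  assumes "gen x y" shows "(\<lambda>n. A n \<cdot> x) \<longlonglongrightarrow> y"
proof -
  define p q w where "p = fst x" and "q = fst y" and "w = - snd y"
  have x: "x = (p, fst q)" and y: "y = (q, - w)" and q: "q \<in> \<Gamma>" and p: "dom_op p w"
    using assms by (auto simp: gen_def p_def q_def w_def prod_eq_iff)
  have wY: "w \<in> Y" using p by (simp add: dom_op_def)
  have "M *\<^sub>R F (\<kappa> n) (fst p) - (1 / \<kappa> n) *\<^sub>R (fst p - F (\<kappa> n) (fst p)) = - F (\<kappa> n) w" for n
  proof -
    have k: "\<kappa> n > 0" by (rule \<kappa>_pos)
    have "fst p = F (\<kappa> n) (fst p + \<kappa> n *\<^sub>R (w + M *\<^sub>R fst p))"
      using arg_cong[OF R_dom_op[OF k p], of fst] by (simp add: F_def)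
    then have "fst p - F (\<kappa> n) (fst p) = \<kappa> n *\<^sub>R (F (\<kappa> n) w + M *\<^sub>R F (\<kappa> n) (fst p))"
      by (simp add: F_add[OF k] F_scaleR[OF k] algebra_simps)
    then show ?thesis using k by simp
  qed
  then have "A n \<cdot> x = (R (\<kappa> n) (fst q), - F (\<kappa> n) w)" for n
    by (simp add: A_apply yosida_def x)
  then show ?thesis unfolding y by (simp add: tendsto_Pair tendsto_minus R_tendsto[OF q] F_tendsto[OF wY])
qed

lemma gen_unique: "gen x y \<Longrightarrow> gen x z \<Longrightarrow> y = z"
  using A_tendsto LIMSEQ_unique by blast

lemma G_eq: "gen x y \<Longrightarrow> G x = y"
  unfolding G_def by (rule some_equality) (auto intro: gen_unique)

lemma E_dense: "E \<subseteq> closure D"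
  unfolding E_def D_def closure_Times using dom_op_dense Y_dense by blast

lemma D_E: "D \<subseteq> E"
  using fst_Y by (auto simp: D_def E_def dom_op_def)

sublocale approx_group E A D G C s
proof
  show "subspace E" "closed E" by (rule subspace_E closed_E)+
  show "A n \<cdot> x \<in> E" if "x \<in> E" for n x by (rule A_E[OF that])
  show "A m * A n = A n * A m" for m n by (rule A_commute)
  show "norm (flow (A n) t x) \<le> C * exp (s * \<bar>t\<bar>) * norm x" if "x \<in> E" for n t x using C_props that by blast
  show "C > 0" using C_props by blast
  show "s \<ge> 0" using s_pos by simp
  show "D \<subseteq> E" "E \<subseteq> closure D" by (rule D_E E_dense)+
  show "(\<lambda>n. A n \<cdot> x) \<longlonglongrightarrow> G x" if "x \<in> D" for x
    using gen_ex[OF that] G_eq A_tendsto by metis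
qed

lemma energy_T:
  assumes x: "x \<in> E" shows "total_energy (T t x) = total_energy x"
proof -
  have "(\<lambda>n. total_energy (flow (A n) t x)) \<longlonglongrightarrow> total_energy (T t x)"
    unfolding total_energy_def by (intro tendsto_intros a.tendsto flow_tendsto_T[OF x])
  then show ?thesis by (simp add: energy_flow[OF x] LIMSEQ_const_iff)
qed

text \<open>The generator is no larger than \<open>gen\<close>. Applying \<open>smoothing\<close>
  turns the difference quotients at \<open>x\<close> into those at a point of \<open>D\<close>,
  whose limit \<open>z\<close> is explicit. Comparing \<open>z\<close> with
  \<open>smoothing \<cdot> y\<close> gives two equations; the first yields \<open>v = fst q\<close>
  by injectivity of the resolvent.\<close>

lemma derivative_imp_gen:
  assumes x: "x \<in> E" and y: "y \<in> E" and lim: "((\<lambda>t. (1 / t) *\<^sub>R (T t x - x)) \<longlongrightarrow> y) (at 0)"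
  shows "gen x y"
proof -
  let ?J = "\<lambda>x. smoothing \<cdot> x"
  obtain p v where x_eq: "x = (p, v)" by (cases x)
  obtain q w where y_eq: "y = (q, w)" by (cases y)
  have p: "p \<in> \<Gamma>" "v \<in> Y" "q \<in> \<Gamma>" "w \<in> Y" using x y by (auto simp: x_eq y_eq E_iff)
  have uY: "fst p \<in> Y" "fst q \<in> Y" using fst_Y p by auto
  define z where "z = (R 1 v, - ((fst p - F 1 (fst p)) - M *\<^sub>R F 1 (fst p)))"
  have gz: "gen (?J x) z"
    using dom_op_R[of 1 "fst p"] uY by (simp add: gen_def z_def x_eq smoothing_apply R_\<Gamma> F_def)
  have JD: "?J x \<in> D" by (rule gen_D[OF gz])
  have "((\<lambda>t. (1 / t) *\<^sub>R (T t (?J x) - ?J x)) \<longlongrightarrow> z) (at 0)"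
    using T_derivative_0[OF JD] by (simp add: G_eq[OF gz])
  moreover have "((\<lambda>t. ?J ((1 / t) *\<^sub>R (T t x - x))) \<longlongrightarrow> ?J y) (at 0)"
    by (intro apply_endo.tendsto tendsto_const lim)
  moreover have "?J ((1 / t) *\<^sub>R (T t x - x)) = (1 / t) *\<^sub>R (T t (?J x) - ?J x)" for t
    by (simp add: apply_endo.scaleR_right apply_endo.diff_right T_commute[OF smoothing_commute smoothing_E x])
  ultimately have zy: "z = ?J y" using LIM_unique by auto
  have "R 1 v = R 1 (fst q)" using zy by (simp add: z_def y_eq smoothing_apply)
  then have v: "v = fst q"
    using R_inj[of 1 "v - fst q"] p uY by (simp add: R_diff subspace_diff[OF Y(1)])
  have "- ((fst p - F 1 (fst p)) - M *\<^sub>R F 1 (fst p)) = F 1 w" using zy by (simp add: z_def y_eq smoothing_apply)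
  \<comment> \<open>The second equation exhibits \<open>fst p\<close> as a value of the resolvent,
    which puts it into the operator domain.\<close>
  then have "fst p = F 1 (fst p) + M *\<^sub>R F 1 (fst p) - F 1 w" by (simp add: algebra_simps)
  then have "fst p = fst (R 1 (fst p + M *\<^sub>R fst p - w))"
    by (simp add: F_def[symmetric] F_add F_diff F_scaleR)
  then have pR: "p = R 1 (fst p + M *\<^sub>R fst p - w)" by (intro \<Gamma>_eqI p R_\<Gamma>) simp_all
  have "a p r = - w \<bullet> fst r" if "r \<in> \<Gamma>" for r
    using b_R[of 1 r "fst p + M *\<^sub>R fst p - w"] that
    by (simp add: F_def pR[symmetric] b_def inner_diff_left inner_add_left)
  then show ?thesis using p subspace_neg[OF Y(1)] by (simp add: gen_def x_eq y_eq dom_op_def v)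
qed

lemma gen_imp_derivative:
  "gen x y \<Longrightarrow> ((\<lambda>t. (1 / t) *\<^sub>R (T t x - x)) \<longlongrightarrow> y) (at 0)"
  using T_derivative_0[OF gen_D] by (simp add: G_eq)

lemma gen_E: "gen x y \<Longrightarrow> x \<in> E \<and> y \<in> E"
  using gen_D D_E G_E G_eq by blast

lemma
  assumes g: "gen x y"
  shows T_has_vector_derivative: "((\<lambda>t. T t x) has_vector_derivative T t y) (at t)" and gen_T: "gen (T t x) (T t y)"
proof -
  have xE: "x \<in> E" and yE: "y \<in> E" using gen_E[OF g] by auto
  have "((\<lambda>h. T t ((1 / h) *\<^sub>R (T h x - x)) - T t y) \<longlongrightarrow> 0) (at 0)"
  proof (rule Lim_null_comparison)
    have E1: "(1 / h) *\<^sub>R (T h x - x) \<in> E" for h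
      by (intro subspace_scale subspace_diff subspace_E T_E xE)
    have "norm (T t ((1 / h) *\<^sub>R (T h x - x)) - T t y) \<le> C * exp (s * \<bar>t\<bar>) * norm ((1 / h) *\<^sub>R (T h x - x) - y)" for h
      using T_linear[OF E1[of h] yE, of t 1 "-1"] T_le[of "(1 / h) *\<^sub>R (T h x - x) - y" t] E1[of h] yE subspace_E
      by (simp add: subspace_diff)
    then show "\<forall>\<^sub>F h in at 0. norm (T t ((1 / h) *\<^sub>R (T h x - x)) - T t y) \<le> C * exp (s * \<bar>t\<bar>) * norm ((1 / h) *\<^sub>R (T h x - x) - y)"
      by (intro always_eventually) blast
    show "((\<lambda>h. C * exp (s * \<bar>t\<bar>) * norm ((1 / h) *\<^sub>R (T h x - x) - y)) \<longlongrightarrow> 0) (at 0)"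
      by (intro tendsto_mult_right_zero tendsto_norm_zero LIM_zero gen_imp_derivative[OF g])
  qed
  moreover have eq1: "T t ((1 / h) *\<^sub>R (T h x - x)) = (1 / h) *\<^sub>R (T (t + h) x - T t x)" for h
    using T_linear[OF T_E[OF xE, of h] xE, of t "1 / h" "- 1 / h"] by (simp add: T_add[OF xE] scaleR_diff_right)
  ultimately have lim: "((\<lambda>h. (1 / h) *\<^sub>R (T (t + h) x - T t x)) \<longlongrightarrow> T t y) (at 0)"
    by (simp add: LIM_zero_iff)
  then have "((\<lambda>h. (1 / h) *\<^sub>R (T h (T t x) - T t x)) \<longlongrightarrow> T t y) (at 0)"
    by (simp add: T_add[OF xE, symmetric] add.commute)
  then show "gen (T t x) (T t y)" by (rule derivative_imp_gen[OF T_E[OF xE] T_E[OF yE]])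
  have quot: "((\<lambda>h. norm ((1 / h) *\<^sub>R (T (t + h) x - T t x) - T t y)) \<longlongrightarrow> 0) (at 0)"
    using lim by (simp add: LIM_zero_iff tendsto_norm_zero_iff)
  have eq2: "norm ((1 / h) *\<^sub>R (T (t + h) x - T t x) - T t y) = norm (T (t + h) x - T t x - h *\<^sub>R T t y) / norm h"
    if "h \<noteq> 0" for h
  proof -
    have "(1 / h) *\<^sub>R (T (t + h) x - T t x) - T t y = (1 / h) *\<^sub>R (T (t + h) x - T t x - h *\<^sub>R T t y)"
      using that by (simp add: algebra_simps)
    then show ?thesis by simp
  qed
  have "((\<lambda>h. norm (T (t + h) x - T t x - h *\<^sub>R T t y) / norm h) \<longlongrightarrow> 0) (at 0)"
    by (rule Lim_transform_eventually[OF quot]) (simp add: eventually_at_filter eq2 del: norm_conv_dist)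
  then show "((\<lambda>t. T t x) has_vector_derivative T t y) (at t)"
    unfolding has_vector_derivative_def has_derivative_at by (simp add: bounded_linear_scaleR_left)
qed

text \<open>For \<open>f = |u|\<^sup>2\<close> the second derivative is
  \<open>4 |v|\<^sup>2 + 2 \<sigma>\<^sup>2 f(0)\<close>, since the conserved energy is
  \<open>- \<sigma>\<^sup>2 f(0)\<close>. Hypothesis \<open>le\<close> of
  \<open>convexity_growth\<close> is then exactly Cauchy-Schwarz for
  \<open>f' = 2 (u \<bullet> v)\<close>. Starting in the operator domain makes \<open>f\<close>
  twice differentiable.\<close>

lemma exponential_instability:
  assumes p: "dom_op p w" and \<sigma>: "\<sigma> > 0" and neg: "a p p = - \<sigma>\<^sup>2 * (norm (fst p))\<^sup>2" and u: "fst p \<noteq> 0"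
    and t: "t \<ge> 0"
  shows "norm (fst (fst (T t (p, 0)))) \<ge> norm (fst p) / 2 * exp (\<sigma> * t)"
proof -
  define x where "x = (p, 0 :: 'a)"
  define y where "y = (0 :: 'a \<times> 'b, - w)"
  have g: "gen x y" using p by (simp add: gen_def x_def y_def subspace_0[OF \<Gamma>(1)])
  have xE: "x \<in> E" using gen_E[OF g] by simp
  define u v z where "u t = fst (fst (T t x))" and "v t = snd (T t x)" and "z t = snd (T t y)" for t
  have gt: "gen (T t x) (T t y)" for t by (rule gen_T[OF g])
  have v: "fst (fst (T t y)) = v t" for t using gt[of t] by (simp add: gen_def v_def)
  have du: "(u has_vector_derivative v t) (at t)" for t
    using bounded_linear.has_vector_derivative[OF bounded_linear_fst
        bounded_linear.has_vector_derivative[OF bounded_linear_fst T_has_vector_derivative[OF g, of t]]]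
    by (simp add: v u_def[abs_def])
  have dv: "(v has_vector_derivative z t) (at t)" for t
    using bounded_linear.has_vector_derivative[OF bounded_linear_snd T_has_vector_derivative[OF g, of t]]
    by (simp add: v_def[abs_def] z_def)
  define f where "f t = u t \<bullet> u t" for t
  have T0: "T 0 x = x" by (rule T_0[OF xE])
  have en: "a (fst (T t x)) (fst (T t x)) + v t \<bullet> v t = - \<sigma>\<^sup>2 * f 0" for t
    using energy_T[OF xE, of t] neg
    by (simp add: total_energy_def v_def f_def u_def T0 power2_norm_eq_inner) (simp add: x_def)
  have az: "u t \<bullet> z t = - a (fst (T t x)) (fst (T t x))" for t
  proof -
    have "a (fst (T t x)) (fst (T t x)) = - z t \<bullet> u t"
      using gt[of t] unfolding gen_def dom_op_def z_def u_def by blast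
    then show ?thesis by (simp add: inner_commute)
  qed
  have "f t \<ge> f 0 / 4 * exp (2 * \<sigma> * t)"
  proof (rule convexity_growth[OF _ _ _ _ \<sigma> _ _ t])
    show "(f has_real_derivative 2 * (u t \<bullet> v t)) (at t)" for t
      using bounded_bilinear.has_vector_derivative[OF bounded_bilinear_inner du[of t] du[of t]]
      by (simp add: f_def[abs_def] has_real_derivative_iff_has_vector_derivative inner_commute)
    have "((\<lambda>t. u t \<bullet> v t) has_real_derivative (u t \<bullet> z t + v t \<bullet> v t)) (at t)" for t
      using bounded_bilinear.has_vector_derivative[OF bounded_bilinear_inner du[of t] dv[of t]]
      by (simp add: has_real_derivative_iff_has_vector_derivative)
    then have "((\<lambda>t. 2 * (u t \<bullet> v t)) has_real_derivative 2 * (u t \<bullet> z t + v t \<bullet> v t)) (at t)" for t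
      by (auto intro!: derivative_eq_intros)
    moreover have "2 * (u t \<bullet> z t + v t \<bullet> v t) = 4 * (v t \<bullet> v t) + 2 * \<sigma>\<^sup>2 * f 0" for t
      using en[of t] az[of t] by (simp add: algebra_simps)
    ultimately show "((\<lambda>t. 2 * (u t \<bullet> v t)) has_real_derivative 4 * (v t \<bullet> v t) + 2 * \<sigma>\<^sup>2 * f 0) (at t)" for t
      by metis
    show "f 0 > 0" using \<open>fst p \<noteq> 0\<close> by (simp add: f_def u_def T0) (simp add: x_def)
    show "2 * (u 0 \<bullet> v 0) = 0" by (simp add: v_def T0) (simp add: x_def)
    show "(2 * (u t \<bullet> v t))\<^sup>2 \<le> f t * (4 * (v t \<bullet> v t) + 2 * \<sigma>\<^sup>2 * f 0 - 2 * \<sigma>\<^sup>2 * f 0)" for t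
      using Cauchy_Schwarz_ineq[of "u t" "v t"] by (simp add: f_def power_mult_distrib)
    show "0 \<le> 4 * (v t \<bullet> v t) + 2 * \<sigma>\<^sup>2 * f 0" for t by (simp add: f_def)
  qed
  also have "f 0 / 4 * exp (2 * \<sigma> * t) = (norm (u 0) / 2 * exp (\<sigma> * t))\<^sup>2"
    by (simp add: f_def power_mult_distrib power_divide power2_norm_eq_inner exp_double[symmetric] mult.assoc)
  finally have "(norm (u 0) / 2 * exp (\<sigma> * t))\<^sup>2 \<le> (norm (u t))\<^sup>2" by (simp add: f_def power2_norm_eq_inner)
  then have "norm (u 0) / 2 * exp (\<sigma> * t) \<le> norm (u t)" by (rule power2_le_imp_le) simp
  then show ?thesis by (simp add: u_def T0) (simp add: x_def)
qed

end

text \<open>Along a failing sequence, normalised in the graph norm, the first components tend to 0.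
  The second components then tend weakly to 0, the terms with \<open>k\<close> and \<open>m\<close>
  vanish in the limit, and the form tends to 1 while staying at most 1/2.\<close>

lemma coercive_of_compact_perturbation:
  fixes \<Gamma> :: "('y::{real_inner,banach} \<times> 'x::{real_inner,banach}) set"
    and k :: "'x \<Rightarrow> 'x \<Rightarrow> real" and m :: "'y \<Rightarrow> 'y \<Rightarrow> real"
  assumes \<Gamma>: "subspace \<Gamma>" "closed \<Gamma>" and graph: "\<And>f. (0, f) \<in> \<Gamma> \<Longrightarrow> f = 0"
    and k: "bounded_bilinear k" and m: "bounded_bilinear m"
    and compact: "\<And>f :: nat \<Rightarrow> 'x. (\<And>g. (\<lambda>n. f n \<bullet> g) \<longlonglongrightarrow> 0) \<Longrightarrow> (\<And>n. norm (f n) \<le> 1) \<Longrightarrow>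
      (\<lambda>n. k (f n) (f n)) \<longlonglongrightarrow> 0"
  shows "\<exists>M. \<forall>p\<in>\<Gamma>. 1/2 * (norm p)\<^sup>2
    \<le> (snd p \<bullet> snd p - k (snd p) (snd p) + m (fst p) (fst p)) + M * (norm (fst p))\<^sup>2"
proof (rule ccontr)
  interpret k: bounded_bilinear k by (rule k)
  interpret m: bounded_bilinear m by (rule m)
  define Q where "Q p = snd p \<bullet> snd p - k (snd p) (snd p) + m (fst p) (fst p)" for p
  assume "\<not> ?thesis"
  then have "\<forall>n::nat. \<exists>p\<in>\<Gamma>. Q p + n * (norm (fst p))\<^sup>2 < 1/2 * (norm p)\<^sup>2"
    unfolding Q_def by (meson not_less)
  then obtain r where r: "\<And>n::nat. r n \<in> \<Gamma>" "\<And>n. Q (r n) + n * (norm (fst (r n)))\<^sup>2 < 1/2 * (norm (r n))\<^sup>2"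
    by metis
  have r0: "norm (r n) > 0" for n
    using r(2)[of n] by (cases "r n = 0") (auto simp: Q_def k.zero_left m.zero_left)
  define p where "p n = (1 / norm (r n)) *\<^sub>R r n" for n
  have p\<Gamma>: "p n \<in> \<Gamma>" for n unfolding p_def by (intro subspace_scale \<Gamma> r)
  have np: "norm (p n) = 1" for n using r0[of n] by (simp add: p_def)
  have ineq: "Q (p n) + n * (norm (fst (p n)))\<^sup>2 < 1/2" for n
  proof -
    have "Q (p n) + n * (norm (fst (p n)))\<^sup>2 = (1 / norm (r n))\<^sup>2 * (Q (r n) + n * (norm (fst (r n)))\<^sup>2)"
      by (simp add: p_def Q_def k.scaleR_left k.scaleR_right m.scaleR_left m.scaleR_right power_mult_distrib
          power2_eq_square algebra_simps)
    also have "\<dots> < (1 / norm (r n))\<^sup>2 * (1/2 * (norm (r n))\<^sup>2)"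
      using r(2)[of n] r0[of n] by (intro mult_strict_left_mono) auto
    also have "\<dots> = 1/2" using r0[of n] by (simp add: power_divide)
    finally show ?thesis .
  qed
  have nu: "norm (fst (p n)) \<le> 1" and nf: "norm (snd (p n)) \<le> 1" for n
    using norm_fst_le'[of "p n"] norm_snd_le'[of "p n"] np[of n] by auto
  obtain K where K: "K > 0" "\<And>x y. norm (k x y) \<le> norm x * norm y * K" using k.pos_bounded by blast
  obtain L where L: "L > 0" "\<And>x y. norm (m x y) \<le> norm x * norm y * L" using m.pos_bounded by blast
  have kK: "\<bar>k (snd (p n)) (snd (p n))\<bar> \<le> K" for n
  proof -
    have "norm (snd (p n)) * norm (snd (p n)) * K \<le> 1 * 1 * K" using nf[of n] K(1) by (intro mult_right_mono mult_mono) auto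
    then show ?thesis using K(2)[of "snd (p n)" "snd (p n)"] by simp
  qed
  have mL: "\<bar>m (fst (p n)) (fst (p n))\<bar> \<le> L" for n
  proof -
    have "norm (fst (p n)) * norm (fst (p n)) * L \<le> 1 * 1 * L" using nu[of n] L(1) by (intro mult_right_mono mult_mono) auto
    then show ?thesis using L(2)[of "fst (p n)" "fst (p n)"] by simp
  qed
  have u_le: "(norm (fst (p n)))\<^sup>2 \<le> (1 + K + L) * (1 / real n)" if "n > 0" for n
  proof -
    have "n * (norm (fst (p n)))\<^sup>2 \<le> 1 + K + L"
      using ineq[of n] kK[of n] mL[of n] inner_ge_zero[of "snd (p n)"] unfolding Q_def by linarith
    then show ?thesis using that by (simp add: field_simps)
  qed
  have u2: "(\<lambda>n. (norm (fst (p n)))\<^sup>2) \<longlonglongrightarrow> 0"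
  proof (rule Lim_null_comparison)
    show "\<forall>\<^sub>F n in sequentially. norm ((norm (fst (p n)))\<^sup>2) \<le> (1 + K + L) * (1 / real n)"
      using eventually_gt_at_top[of 0] by eventually_elim (use u_le in auto)
    show "(\<lambda>n. (1 + K + L) * (1 / real n)) \<longlonglongrightarrow> 0" by (intro tendsto_mult_right_zero lim_1_over_n)
  qed
  then have "(\<lambda>n. norm (fst (p n))) \<longlonglongrightarrow> 0"
    using tendsto_real_sqrt[OF u2] by simp
  then have u: "(\<lambda>n. fst (p n)) \<longlonglongrightarrow> 0" by (rule tendsto_norm_zero_cancel)
  \<comment> \<open>The inner product of a point of \<open>D\<close> with a graph point depends on
    the first component of the latter alone, so it tends to 0 along \<open>p n\<close>. Density of
    \<open>D\<close> and \<open>norm (p n) = 1\<close> extend this to all of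
    \<open>\<Gamma>\<close>.\<close>
  define D where "D = {q \<in> \<Gamma>. \<exists>w. \<forall>p\<in>\<Gamma>. q \<bullet> p = w \<bullet> fst p}"
  have coer: "1 * (norm x)\<^sup>2 \<le> x \<bullet> x" for x :: "'y \<times> 'x" by (simp add: power2_norm_eq_inner)
  have D_dense: "\<Gamma> \<subseteq> closure D"
  proof (rule subset_closure_if_orthogonal_zero[OF bounded_bilinear_inner inner_commute \<Gamma> zero_less_one coer])
    show "subspace D"
      unfolding subspace_def
    proof (intro conjI ballI allI)
      show "0 \<in> D" by (auto simp: D_def subspace_0[OF \<Gamma>(1)] intro: exI[of _ 0])
      show "x + y \<in> D" if xy: "x \<in> D" "y \<in> D" for x y
      proof -
        obtain w z where "\<forall>p\<in>\<Gamma>. x \<bullet> p = w \<bullet> fst p" "\<forall>p\<in>\<Gamma>. y \<bullet> p = z \<bullet> fst p"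
          using xy by (auto simp: D_def)
        then show ?thesis using xy
          by (auto simp: D_def inner_add_left intro!: subspace_add[OF \<Gamma>(1)] exI[of _ "w + z"])
      qed
      show "c *\<^sub>R x \<in> D" if x: "x \<in> D" for c x
      proof -
        obtain w where "\<forall>p\<in>\<Gamma>. x \<bullet> p = w \<bullet> fst p" using x by (auto simp: D_def)
        then show ?thesis using x
          by (auto simp: D_def intro!: subspace_scale[OF \<Gamma>(1)] exI[of _ "c *\<^sub>R w"])
      qed
    qed
    show "D \<subseteq> \<Gamma>" by (auto simp: D_def)
    fix x assume x: "x \<in> \<Gamma>" and orth: "\<And>d. d \<in> D \<Longrightarrow> x \<bullet> d = 0"
    obtain d where d: "d \<in> \<Gamma>" "\<And>y. y \<in> \<Gamma> \<Longrightarrow> d \<bullet> y = fst x \<bullet> fst y"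
      using lax_milgram_symmetric[OF bounded_bilinear_inner inner_commute \<Gamma> zero_less_one coer
        bounded_linear_compose[OF bounded_linear_inner_right bounded_linear_fst]] by blast
    then have "d \<in> D" by (auto simp: D_def)
    then have "fst x \<bullet> fst x = 0" using orth d(2)[OF x] by (simp add: inner_commute)
    then show "x = 0" using graph[of "snd x"] x by (metis inner_eq_zero_iff prod.collapse zero_prod_def)
  qed
  have weak: "(\<lambda>n. snd (p n) \<bullet> g) \<longlonglongrightarrow> 0" for g
  proof -
    \<comment> \<open>\<open>(0, g)\<close> need not be a graph point; \<open>q\<close> is its
      orthogonal projection to \<open>\<Gamma>\<close> and has the same inner products with all
      \<open>p n\<close>.\<close>
    obtain q where q: "q \<in> \<Gamma>" "\<And>y. y \<in> \<Gamma> \<Longrightarrow> q \<bullet> y = (0, g) \<bullet> y"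
      using lax_milgram_symmetric[OF bounded_bilinear_inner inner_commute \<Gamma> zero_less_one coer
        bounded_linear_inner_right] by blast
    have "(\<lambda>n. p n \<bullet> q) \<longlonglongrightarrow> 0"
    proof (rule LIMSEQ_I)
      fix e :: real assume e: "e > 0"
      have "q \<in> closure D" using q(1) D_dense by blast
      then obtain d where d: "d \<in> D" "dist d q < e / 2"
        using e unfolding closure_approachable by (metis half_gt_zero)
      then obtain w where w: "\<And>p. p \<in> \<Gamma> \<Longrightarrow> d \<bullet> p = w \<bullet> fst p" by (auto simp: D_def)
      have "(\<lambda>n. w \<bullet> fst (p n)) \<longlonglongrightarrow> w \<bullet> 0" by (intro tendsto_intros u)
      then obtain N where N: "\<And>n. n \<ge> N \<Longrightarrow> \<bar>w \<bullet> fst (p n)\<bar> < e / 2"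
        using e LIMSEQ_D[of "\<lambda>n. w \<bullet> fst (p n)" 0 "e / 2"] by auto
      have "norm (p n \<bullet> q - 0) < e" if n: "n \<ge> N" for n
      proof -
        have "p n \<bullet> q = d \<bullet> p n + p n \<bullet> (q - d)" by (simp add: inner_diff_right inner_commute)
        moreover have "\<bar>p n \<bullet> (q - d)\<bar> \<le> norm (p n) * norm (q - d)" by (rule Cauchy_Schwarz_ineq2)
        moreover have "norm (q - d) < e / 2" using d(2) by (simp add: dist_norm norm_minus_commute)
        ultimately show ?thesis using N[OF n] w[OF p\<Gamma>, of n] np[of n] by simp
      qed
      then show "\<exists>N. \<forall>n\<ge>N. norm (p n \<bullet> q - 0) < e" by blast
    qed
    moreover have "p n \<bullet> q = snd (p n) \<bullet> g" for n
      using q(2)[OF p\<Gamma>, of n] by (simp add: inner_commute[of q] inner_commute[of "(0, g)"] inner_Pair_0)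
    ultimately show ?thesis by simp
  qed
  have k0: "(\<lambda>n. k (snd (p n)) (snd (p n))) \<longlonglongrightarrow> 0" by (rule compact[OF weak nf])
  have "(\<lambda>n. (1 - (norm (fst (p n)))\<^sup>2) - k (snd (p n)) (snd (p n)) + m (fst (p n)) (fst (p n))) \<longlonglongrightarrow> (1 - 0) - 0 + m 0 0"
    by (intro tendsto_intros u2 k0 m.tendsto u)
  moreover have "(1 - (norm (fst (p n)))\<^sup>2) - k (snd (p n)) (snd (p n)) + m (fst (p n)) (fst (p n)) \<le> 1/2" for n
  proof -
    have "(norm (fst (p n)))\<^sup>2 + (norm (snd (p n)))\<^sup>2 = 1" using np[of n] by (simp add: norm_prod_def)
    then have "snd (p n) \<bullet> snd (p n) = 1 - (norm (fst (p n)))\<^sup>2" by (simp add: power2_norm_eq_inner)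
    moreover have "0 \<le> n * (norm (fst (p n)))\<^sup>2" by simp
    ultimately show ?thesis using ineq[of n] unfolding Q_def by linarith
  qed
  ultimately have "(1 - 0) - 0 + m 0 0 \<le> 1/2" by (intro LIMSEQ_le_const2) auto
  then show False by (simp add: m.zero_left)
qed

section \<open>The lower bound of the form and the resolvent set\<close>

context energy_form
begin

lemma fst_eq_0_iff: "p \<in> \<Gamma> \<Longrightarrow> fst p = 0 \<longleftrightarrow> p = 0"
  using \<Gamma>_eqI[of p 0] subspace_0[OF \<Gamma>(1)] by auto

lemma form_ge_if_resolvent:
  assumes res: "\<And>\<mu>. \<mu> < \<eta> \<Longrightarrow> \<exists>C. \<forall>w\<in>Y. \<exists>p. dom_op p (\<mu> *\<^sub>R fst p + w) \<and> norm (fst p) \<le> C * norm w"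
    and p: "p \<in> \<Gamma>"
  shows "a p p \<ge> \<eta> * (norm (fst p))\<^sup>2"
proof (rule ccontr)
  assume less: "\<not> ?thesis"
  define S where "S = (\<lambda>p. a p p / (norm (fst p))\<^sup>2) ` {p \<in> \<Gamma>. fst p \<noteq> 0}"
  have ne: "fst p \<noteq> 0" using less fst_eq_0_iff[OF p] by (auto simp: a.zero_left)
  have "- M \<le> a q q / (norm (fst q))\<^sup>2" if "q \<in> \<Gamma>" "fst q \<noteq> 0" for q
  proof -
    have "0 \<le> \<delta> * (norm q)\<^sup>2" using \<delta> by simp
    then show ?thesis using coercive[OF that(1)] that(2) by (simp add: field_simps)
  qed
  then have bdd: "bdd_below S" unfolding S_def by (intro bdd_belowI2[where m = "- M"]) auto
  define m where "m = Inf S"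
  have "m \<le> a p p / (norm (fst p))\<^sup>2" unfolding m_def using bdd p ne by (intro cInf_lower) (auto simp: S_def)
  also have "\<dots> < \<eta>" using less ne by (simp add: field_simps)
  finally obtain C where C: "\<forall>w\<in>Y. \<exists>p. dom_op p (m *\<^sub>R fst p + w) \<and> norm (fst p) \<le> C * norm w"
    using res by blast
  \<comment> \<open>\<open>C\<close> may fail to be positive, whereas \<open>1 / B\<close> is the
    step length of the trial vector \<open>z - (1 / B) *\<^sub>R q\<close>.\<close>
  define B where "B = \<bar>C\<bar> + 1"
  have B: "B > 0" by (simp add: B_def)
  define c where "c p q = a p q - m * (fst p \<bullet> fst q)" for p q
  have c_ge: "c q q \<ge> 0" if "q \<in> \<Gamma>" for q
  proof (cases "fst q = 0")
    case True then show ?thesis using that by (simp add: c_def fst_eq_0_iff a.zero_left)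
  next
    case False
    then have "m \<le> a q q / (norm (fst q))\<^sup>2"
      unfolding m_def using bdd that by (intro cInf_lower) (auto simp: S_def)
    then show ?thesis using False by (simp add: c_def field_simps power2_norm_eq_inner)
  qed
  have "m + 1 / B \<le> a z z / (norm (fst z))\<^sup>2" if z: "z \<in> \<Gamma>" "fst z \<noteq> 0" for z
  proof -
    obtain q where q: "dom_op q (m *\<^sub>R fst q + fst z)" "norm (fst q) \<le> C * norm (fst z)"
      using C fst_Y[OF z(1)] by blast
    have q\<Gamma>: "q \<in> \<Gamma>" using q(1) by (simp add: dom_op_def)
    have cq: "c q y = fst z \<bullet> fst y" if "y \<in> \<Gamma>" for y
      using q(1) that by (simp add: dom_op_def c_def inner_add_left)
    have "fst z \<bullet> fst q \<le> norm (fst z) * norm (fst q)" by (rule norm_cauchy_schwarz)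
    also have "norm (fst q) \<le> B * norm (fst z)"
      using q(2) by (rule order_trans) (simp add: B_def distrib_right add_increasing2 mult_right_mono)
    finally have cqq: "c q q \<le> B * (norm (fst z))\<^sup>2"
      using cq[OF q\<Gamma>] by (simp add: mult_left_mono power2_eq_square mult.left_commute)
    have "z - (1 / B) *\<^sub>R q \<in> \<Gamma>" by (intro subspace_diff subspace_scale \<Gamma> z q\<Gamma>)
    then have "0 \<le> c (z - (1 / B) *\<^sub>R q) (z - (1 / B) *\<^sub>R q)" by (rule c_ge)
    also have "\<dots> = c z z - 2 / B * c q z + (1 / B)\<^sup>2 * c q q"
      by (simp add: c_def a.diff_left a.diff_right a.scaleR_left a.scaleR_right inner_diff_left inner_diff_right
          sym_a[of z q] inner_commute[of "fst z" "fst q"] power2_eq_square algebra_simps)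
    also have "\<dots> \<le> c z z - 2 / B * (norm (fst z))\<^sup>2 + (1 / B)\<^sup>2 * (B * (norm (fst z))\<^sup>2)"
      using cq[OF z(1)] cqq by (simp add: power2_norm_eq_inner mult_left_mono)
    also have "\<dots> = c z z - (norm (fst z))\<^sup>2 / B" using B by (simp add: power2_eq_square field_simps)
    finally have "(norm (fst z))\<^sup>2 / B \<le> a z z - m * (norm (fst z))\<^sup>2" by (simp add: c_def power2_norm_eq_inner)
    then show ?thesis using z(2) by (simp add: field_simps)
  qed
  \<comment> \<open>The gap \<open>1 / B\<close> is common to all Rayleigh quotients, which
    contradicts that \<open>m\<close> is their infimum.\<close>
  then have "m + 1 / B \<le> y" if "y \<in> S" for y using that by (auto simp: S_def)
  moreover have "S \<noteq> {}" using p ne unfolding S_def by blast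
  ultimately have "m + 1 / B \<le> Inf S" by (intro cInf_greatest)
  then have "m + 1 / B \<le> m" by (simp add: m_def)
  then show False using B by simp
qed

text \<open>The gap \<open>\<epsilon>\<close> bounds the form of \<open>L - \<eta>\<close> from
  below in the norm of \<open>Y\<close> only. A convex combination with \<open>coercive\<close>
  bounds it in the graph norm, so that \<open>lax_milgram_symmetric\<close> applies.\<close>

lemma resolvent_if_form_ge:
  assumes \<epsilon>: "\<epsilon> > 0" and ge: "\<And>p. p \<in> \<Gamma> \<Longrightarrow> a p p \<ge> (\<eta> + \<epsilon>) * (norm (fst p))\<^sup>2"
  shows "\<exists>C. \<forall>w\<in>Y. \<exists>p. dom_op p (\<eta> *\<^sub>R fst p + w) \<and> norm (fst p) \<le> C * norm w \<and>
    (\<forall>p'. dom_op p' (\<eta> *\<^sub>R fst p' + w) \<longrightarrow> p' = p)"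
proof (rule exI[of _ "1 / \<epsilon>"], rule ballI)
  fix w assume w: "w \<in> Y"
  define c where "c p q = a p q + (- \<eta>) * (fst p \<bullet> fst q)" for p q
  have bil: "bounded_bilinear c"
    unfolding c_def[abs_def] by (intro bounded_bilinear_plus bounded_bilinear_cmult bilinear_a bilinear_fst)
  interpret c: bounded_bilinear c by (rule bil)
  have sym: "c p q = c q p" for p q by (simp add: c_def sym_a[of p q] inner_commute[of "fst p"])
  have c_ge: "c p p \<ge> \<epsilon> * (norm (fst p))\<^sup>2" if "p \<in> \<Gamma>" for p
    using ge[OF that] by (simp add: c_def power2_norm_eq_inner algebra_simps)
  define N where "N = \<epsilon> + \<bar>M + \<eta>\<bar> + 1"
  \<comment> \<open>Chosen so that the loss \<open>\<theta> * \<bar>M + \<eta>\<bar>\<close> is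
    covered by the share \<open>(1 - \<theta>) * \<epsilon>\<close> of the gap.\<close>
  define \<theta> where "\<theta> = \<epsilon> / N"
  have N: "N > 0" using \<epsilon> by (simp add: N_def)
  have \<theta>: "\<theta> > 0" "(1 - \<theta>) * \<epsilon> \<ge> \<theta> * \<bar>M + \<eta>\<bar>" "\<theta> \<le> 1"
    using \<epsilon> N by (simp_all add: \<theta>_def field_simps) (simp_all add: N_def algebra_simps)
  have coer: "\<theta> * \<delta> * (norm p)\<^sup>2 \<le> c p p" if p: "p \<in> \<Gamma>" for p
  proof -
    have "\<theta> * (\<delta> * (norm p)\<^sup>2) \<le> \<theta> * (a p p + M * (norm (fst p))\<^sup>2)"
      using coercive[OF p] \<theta> by (intro mult_left_mono) auto
    also have "\<dots> = \<theta> * c p p + \<theta> * (M + \<eta>) * (norm (fst p))\<^sup>2"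
      by (simp add: c_def power2_norm_eq_inner algebra_simps)
    also have "\<theta> * (M + \<eta>) * (norm (fst p))\<^sup>2 \<le> (1 - \<theta>) * \<epsilon> * (norm (fst p))\<^sup>2"
    proof (rule mult_right_mono)
      show "\<theta> * (M + \<eta>) \<le> (1 - \<theta>) * \<epsilon>"
        using \<theta> mult_left_mono[of "M + \<eta>" "\<bar>M + \<eta>\<bar>" \<theta>] by linarith
    qed simp
    also have "\<dots> \<le> (1 - \<theta>) * c p p"
      using mult_left_mono[OF c_ge[OF p], of "1 - \<theta>"] \<theta> by (simp add: mult.assoc)
    finally show ?thesis by (simp add: algebra_simps)
  qed
  have pos: "\<theta> * \<delta> > 0" using \<theta> \<delta> by simp
  obtain p where p: "p \<in> \<Gamma>" "\<And>q. q \<in> \<Gamma> \<Longrightarrow> c p q = w \<bullet> fst q"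
    using lax_milgram_symmetric[OF bil sym \<Gamma> pos coer
        bounded_linear_compose[OF bounded_linear_inner_right[of w] bounded_linear_fst]] by blast
  have dom_iff: "dom_op p' (\<eta> *\<^sub>R fst p' + w) \<longleftrightarrow> p' \<in> \<Gamma> \<and> (\<forall>q\<in>\<Gamma>. c p' q = w \<bullet> fst q)" for p'
  proof -
    have "\<eta> *\<^sub>R fst p' + w \<in> Y" if "p' \<in> \<Gamma>"
      by (intro subspace_add subspace_scale Y fst_Y that w)
    then show ?thesis by (auto simp: dom_op_def c_def inner_add_left)
  qed
  show "\<exists>p. dom_op p (\<eta> *\<^sub>R fst p + w) \<and> norm (fst p) \<le> (1 / \<epsilon>) * norm w \<and>
    (\<forall>p'. dom_op p' (\<eta> *\<^sub>R fst p' + w) \<longrightarrow> p' = p)"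
  proof (intro exI conjI allI impI)
    show "dom_op p (\<eta> *\<^sub>R fst p + w)" using p by (simp add: dom_iff)
    have "\<epsilon> * (norm (fst p))\<^sup>2 \<le> w \<bullet> fst p" using c_ge[OF p(1)] p by simp
    also have "\<dots> \<le> norm w * norm (fst p)" by (rule norm_cauchy_schwarz)
    finally have "(\<epsilon> * norm (fst p)) * norm (fst p) \<le> norm w * norm (fst p)"
      by (simp add: power2_eq_square mult.assoc)
    then have "\<epsilon> * norm (fst p) \<le> norm w"
      by (cases "norm (fst p) = 0") (auto simp: mult_le_cancel_right)
    then show "norm (fst p) \<le> (1 / \<epsilon>) * norm w" using \<epsilon> by (simp add: field_simps)
    fix p' assume "dom_op p' (\<eta> *\<^sub>R fst p' + w)"
    then have p': "p' \<in> \<Gamma>" "\<And>q. q \<in> \<Gamma> \<Longrightarrow> c p' q = w \<bullet> fst q" by (auto simp: dom_iff)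
    have d: "p' - p \<in> \<Gamma>" using p p' \<Gamma> by (simp add: subspace_diff)
    have "c (p' - p) (p' - p) = 0" using p(2)[OF d] p'(2)[OF d] by (simp add: c.diff_left)
    then have "\<theta> * \<delta> * (norm (p' - p))\<^sup>2 \<le> 0" using coer[OF d] by simp
    then show "p' = p" using \<theta>(1) \<delta> by (simp add: mult_le_0_iff)
  qed
qed

text \<open>The instability argument needs initial data in the operator domain. A strict inequality
  between continuous functions of the graph point persists at nearby points of the dense
  domain.\<close>

lemma dom_op_below:
  assumes p: "p \<in> \<Gamma>" and less: "a p p < \<eta> * (norm (fst p))\<^sup>2"
  obtains q w where "dom_op q w" "a q q < \<eta> * (norm (fst q))\<^sup>2"
proof -
  have "p \<in> closure {p. \<exists>w. dom_op p w}" using p dom_op_dense by blast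
  then obtain q where q: "\<And>n. q n \<in> {p. \<exists>w. dom_op p w}" "q \<longlonglongrightarrow> p"
    unfolding closure_sequential by blast
  have "(\<lambda>n. a (q n) (q n) - \<eta> * (norm (fst (q n)))\<^sup>2) \<longlonglongrightarrow> a p p - \<eta> * (norm (fst p))\<^sup>2"
    by (intro tendsto_intros a.tendsto q)
  then have "\<forall>\<^sub>F n in sequentially. a (q n) (q n) - \<eta> * (norm (fst (q n)))\<^sup>2 < 0"
    by (rule order_tendstoD) (use less in simp)
  then obtain n where "a (q n) (q n) - \<eta> * (norm (fst (q n)))\<^sup>2 < 0"
    using eventually_happens trivial_limit_sequentially by blast
  then have "a (q n) (q n) < \<eta> * (norm (fst (q n)))\<^sup>2" by simp
  then show ?thesis using q(1)[of n] that by blast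
qed

end

section \<open>The Hilbert space of square integrable functions\<close>

definition sqint :: "('a::euclidean_space \<Rightarrow> real) set" where
  "sqint = {f. f \<in> borel_measurable lebesgue \<and> integrable lebesgue (\<lambda>x. (f x)\<^sup>2)}"

lemma sqint_measurable [measurable_dest]: "f \<in> sqint \<Longrightarrow> f \<in> borel_measurable lebesgue"
  and sqint_integrable: "f \<in> sqint \<Longrightarrow> integrable lebesgue (\<lambda>x. (f x)\<^sup>2)"
  by (auto simp: sqint_def)

lemma sqint_mult_integrable:
  assumes f: "f \<in> sqint" and g: "g \<in> sqint" shows "integrable lebesgue (\<lambda>x. f x * g x)"
proof (rule Bochner_Integration.integrable_bound)
  show "integrable lebesgue (\<lambda>x. (f x)\<^sup>2 + (g x)\<^sup>2)"
    by (intro Bochner_Integration.integrable_add sqint_integrable f g)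
  show "(\<lambda>x. f x * g x) \<in> borel_measurable lebesgue" using f g by measurable
  show "AE x in lebesgue. norm (f x * g x) \<le> norm ((f x)\<^sup>2 + (g x)\<^sup>2)"
  proof (rule AE_I2)
    fix x
    have "0 \<le> (\<bar>f x\<bar> - \<bar>g x\<bar>)\<^sup>2" by simp
    then have "2 * (\<bar>f x\<bar> * \<bar>g x\<bar>) \<le> (f x)\<^sup>2 + (g x)\<^sup>2" by (simp add: power2_diff)
    moreover have "0 \<le> \<bar>f x\<bar> * \<bar>g x\<bar>" by simp
    ultimately show "norm (f x * g x) \<le> norm ((f x)\<^sup>2 + (g x)\<^sup>2)"
      unfolding real_norm_def abs_mult by linarith
  qed
qed

lemma sqint_add:
  assumes f: "f \<in> sqint" and g: "g \<in> sqint" shows "(\<lambda>x. f x + g x) \<in> sqint"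
proof -
  have "integrable lebesgue (\<lambda>x. (f x)\<^sup>2 + (g x)\<^sup>2 + 2 * (f x * g x))"
    by (intro Bochner_Integration.integrable_add integrable_mult_right sqint_integrable sqint_mult_integrable f g)
  moreover have "(\<lambda>x. f x + g x) \<in> borel_measurable lebesgue" using f g by measurable
  ultimately show ?thesis by (simp add: sqint_def power2_sum mult.assoc)
qed

lemma sqint_cmult: "f \<in> sqint \<Longrightarrow> (\<lambda>x. c * f x) \<in> sqint"
  by (auto simp: sqint_def power_mult_distrib)

lemma sqint_zero: "(\<lambda>x. 0) \<in> sqint"
  by (simp add: sqint_def)

lemma sqint_uminus: "f \<in> sqint \<Longrightarrow> (\<lambda>x. - f x) \<in> sqint"
  using sqint_cmult[of f "-1"] by simp

lemma sqint_diff: "f \<in> sqint \<Longrightarrow> g \<in> sqint \<Longrightarrow> (\<lambda>x. f x - g x) \<in> sqint"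
  using sqint_add[OF _ sqint_uminus, of f g] by simp

lemma sqint_bounded_mult:
  assumes f: "f \<in> sqint" and h: "h \<in> borel_measurable lebesgue" and le: "\<And>x. \<bar>h x\<bar> \<le> K"
  shows "(\<lambda>x. h x * f x) \<in> sqint"
proof -
  have m: "(\<lambda>x. h x * f x) \<in> borel_measurable lebesgue" using f h by measurable
  have "integrable lebesgue (\<lambda>x. (h x * f x)\<^sup>2)"
  proof (rule Bochner_Integration.integrable_bound)
    show "integrable lebesgue (\<lambda>x. K\<^sup>2 * (f x)\<^sup>2)" by (intro integrable_mult_right sqint_integrable f)
    show "(\<lambda>x. (h x * f x)\<^sup>2) \<in> borel_measurable lebesgue" using m by measurable
    have "(h x * f x)\<^sup>2 \<le> K\<^sup>2 * (f x)\<^sup>2" for x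
      using power_mono[OF le[of x], of 2] by (simp add: power_mult_distrib mult_right_mono)
    then show "AE x in lebesgue. norm ((h x * f x)\<^sup>2) \<le> norm (K\<^sup>2 * (f x)\<^sup>2)" by simp
  qed
  then show ?thesis using m by (simp add: sqint_def)
qed

lemma sqint_cong_AE:
  assumes "f \<in> sqint" "g \<in> borel_measurable lebesgue" "AE x in lebesgue. f x = g x"
  shows "g \<in> sqint"
proof -
  have "integrable lebesgue (\<lambda>x. (g x)\<^sup>2)"
    using assms sqint_integrable[OF assms(1)]
    by (subst integrable_cong_AE[of _ _ "\<lambda>x. (f x)\<^sup>2"]) (auto elim!: eventually_mono)
  then show ?thesis using assms by (simp add: sqint_def)
qed

text \<open>With the weight \<open>2 ^ n\<close> the integrals are still summable, like
  \<open>(1/2) ^ n\<close>, so the weighted sum of squares is finite almost everywhere; each single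
  term is below the sum, which gives the decay \<open>sqrt (1/2) ^ n\<close>.\<close>

lemma AE_geometric_bound:
  assumes g: "\<And>n. g n \<in> sqint" and le: "\<And>n. (LINT x|lebesgue. (g n x)\<^sup>2) \<le> (1/4) ^ n"
  shows "AE x in lebesgue. \<exists>C. \<forall>n. \<bar>g n x\<bar> \<le> C * (sqrt (1/2)) ^ n"
proof -
  have [measurable]: "g n \<in> borel_measurable lebesgue" for n using g by measurable
  have "(\<integral>\<^sup>+x. (\<Sum>n. ennreal (2 ^ n * (g n x)\<^sup>2)) \<partial>lebesgue) = (\<Sum>n. \<integral>\<^sup>+x. ennreal (2 ^ n * (g n x)\<^sup>2) \<partial>lebesgue)"
    by (rule nn_integral_suminf) measurable
  also have "\<dots> \<le> (\<Sum>n. ennreal ((1/2) ^ n))"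
  proof (rule suminf_le)
    fix n :: nat
    have "(\<integral>\<^sup>+x. ennreal (2 ^ n * (g n x)\<^sup>2) \<partial>lebesgue) = ennreal (LINT x|lebesgue. 2 ^ n * (g n x)\<^sup>2)"
      by (rule nn_integral_eq_integral) (auto intro: sqint_integrable g)
    also have "\<dots> \<le> ennreal (2 ^ n * (1/4) ^ n)" using le[of n] by (intro ennreal_leI) simp
    also have "(2 ^ n * (1/4) ^ n :: real) = (1/2) ^ n" by (simp add: power_mult_distrib[symmetric])
    finally show "(\<integral>\<^sup>+x. ennreal (2 ^ n * (g n x)\<^sup>2) \<partial>lebesgue) \<le> ennreal ((1/2) ^ n)" .
  qed auto
  also have "\<dots> < \<infinity>"
    by (subst suminf_ennreal2) (auto simp: summable_geometric)
  finally have "AE x in lebesgue. (\<Sum>n. ennreal (2 ^ n * (g n x)\<^sup>2)) \<noteq> \<infinity>"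
    by (intro nn_integral_PInf_AE) auto
  then show ?thesis
  proof eventually_elim
    fix x assume fin: "(\<Sum>n. ennreal (2 ^ n * (g n x)\<^sup>2)) \<noteq> \<infinity>"
    define S where "S = enn2real (\<Sum>n. ennreal (2 ^ n * (g n x)\<^sup>2))"
    have S: "(\<Sum>n. ennreal (2 ^ n * (g n x)\<^sup>2)) = ennreal S" using fin by (simp add: S_def less_top)
    have S0: "S \<ge> 0" by (simp add: S_def)
    have "\<bar>g n x\<bar> \<le> sqrt S * (sqrt (1/2)) ^ n" for n
    proof (rule power2_le_imp_le)
      have "(\<Sum>n\<in>{n}. ennreal (2 ^ n * (g n x)\<^sup>2)) \<le> (\<Sum>n. ennreal (2 ^ n * (g n x)\<^sup>2))"
        by (rule sum_le_suminf) auto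
      then have "ennreal (2 ^ n * (g n x)\<^sup>2) \<le> ennreal S"
        unfolding S by (simp only: sum.insert sum.empty finite.emptyI empty_iff not_False_eq_True add_0_right)
      then have "2 ^ n * (g n x)\<^sup>2 \<le> S" by (simp only: ennreal_le_iff[OF S0])
      then have "(g n x)\<^sup>2 \<le> S * (1/2) ^ n" by (simp add: field_simps power_one_over)
      also have "\<dots> = (sqrt S * (sqrt (1/2)) ^ n)\<^sup>2"
      proof -
        have "((sqrt (1/2)) ^ n)\<^sup>2 = ((sqrt (1/2))\<^sup>2) ^ n" by (simp only: power_mult[symmetric] mult.commute)
        then show ?thesis using S0 by (simp add: power_mult_distrib)
      qed
      finally show "\<bar>g n x\<bar>\<^sup>2 \<le> (sqrt S * (sqrt (1/2)) ^ n)\<^sup>2" by simp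
    qed (use S0 in simp)
    then show "\<exists>C. \<forall>n. \<bar>g n x\<bar> \<le> C * (sqrt (1/2)) ^ n" by blast
  qed
qed

lemma summable_sqrt_half: "summable (\<lambda>n. C * (sqrt (1/2)) ^ n)"
  by (intro summable_mult summable_geometric) simp

lemma geometric_bound_tendsto_0:
  assumes "\<And>n. \<bar>g n\<bar> \<le> C * (sqrt (1/2)) ^ n" shows "g \<longlonglongrightarrow> (0::real)"
  by (rule Lim_null_comparison[OF always_eventually summable_LIMSEQ_zero[OF summable_sqrt_half[of C]]])
    (use assms in simp)

lemma geometric_bound_convergent:
  fixes f :: "nat \<Rightarrow> real"
  assumes "\<And>n. \<bar>f (Suc n) - f n\<bar> \<le> C * (sqrt (1/2)) ^ n" shows "convergent f"
proof -
  have "summable (\<lambda>n. f (Suc n) - f n)"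
    by (rule summable_comparison_test'[OF summable_sqrt_half, of 0]) (use assms in simp)
  then have "convergent (\<lambda>n. \<Sum>k<n. f (Suc k) - f k)" by (simp add: summable_iff_convergent)
  then have "convergent (\<lambda>n. f n - f 0)" by (simp add: sum_lessThan_telescope)
  then have "convergent (\<lambda>n. (f n - f 0) + f 0)" by (intro convergent_add convergent_const)
  then show ?thesis by simp
qed

text \<open>Fatou's lemma transfers a mean square bound on the tail to the pointwise limit.\<close>

lemma sqint_limit:
  assumes f: "\<And>n. f n \<in> sqint" and lim: "AE x in lebesgue. (\<lambda>n. f n x) \<longlonglongrightarrow> h x"
    and h: "h \<in> borel_measurable lebesgue"
    and le: "\<And>n. n \<ge> m \<Longrightarrow> (LINT x|lebesgue. (f n x - f m x)\<^sup>2) \<le> e"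
  shows "(\<lambda>x. h x - f m x) \<in> sqint" and "(LINT x|lebesgue. (h x - f m x)\<^sup>2) \<le> e"
proof -
  have [measurable]: "f n \<in> borel_measurable lebesgue" for n using f by measurable
  note h[measurable]
  have e: "0 \<le> e" using le[of m] by simp
  have "(\<integral>\<^sup>+x. ennreal ((h x - f m x)\<^sup>2) \<partial>lebesgue) = (\<integral>\<^sup>+x. liminf (\<lambda>n. ennreal ((f n x - f m x)\<^sup>2)) \<partial>lebesgue)"
  proof (rule nn_integral_cong_AE)
    show "AE x in lebesgue. ennreal ((h x - f m x)\<^sup>2) = liminf (\<lambda>n. ennreal ((f n x - f m x)\<^sup>2))"
      using lim
    proof eventually_elim
      fix x assume x: "(\<lambda>n. f n x) \<longlonglongrightarrow> h x"
      have "(\<lambda>n. ennreal ((f n x - f m x)\<^sup>2)) \<longlonglongrightarrow> ennreal ((h x - f m x)\<^sup>2)"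
        by (intro tendsto_ennrealI tendsto_intros x)
      then show "ennreal ((h x - f m x)\<^sup>2) = liminf (\<lambda>n. ennreal ((f n x - f m x)\<^sup>2))"
        by (rule lim_imp_Liminf[OF trivial_limit_sequentially, symmetric])
    qed
  qed
  also have "\<dots> \<le> liminf (\<lambda>n. \<integral>\<^sup>+x. ennreal ((f n x - f m x)\<^sup>2) \<partial>lebesgue)"
    by (rule nn_integral_liminf) measurable
  also have "\<dots> \<le> ennreal e"
  proof (rule order_trans[OF Liminf_le_Limsup[OF trivial_limit_sequentially] Limsup_bounded],
      rule eventually_mono[OF eventually_ge_at_top[of m]])
    fix n assume "n \<ge> m"
    have "(\<integral>\<^sup>+x. ennreal ((f n x - f m x)\<^sup>2) \<partial>lebesgue) = ennreal (LINT x|lebesgue. (f n x - f m x)\<^sup>2)"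
      by (rule nn_integral_eq_integral[OF sqint_integrable[OF sqint_diff[OF f f]]]) simp
    then show "(\<integral>\<^sup>+x. ennreal ((f n x - f m x)\<^sup>2) \<partial>lebesgue) \<le> ennreal e"
      using le[OF \<open>n \<ge> m\<close>] by (simp add: ennreal_leI)
  qed
  finally have le': "(\<integral>\<^sup>+x. ennreal ((h x - f m x)\<^sup>2) \<partial>lebesgue) \<le> ennreal e" .
  then have int: "integrable lebesgue (\<lambda>x. (h x - f m x)\<^sup>2)"
    by (intro integrableI_nonneg) (auto intro: le_less_trans)
  then show "(\<lambda>x. h x - f m x) \<in> sqint" by (simp add: sqint_def)
  have "ennreal (LINT x|lebesgue. (h x - f m x)\<^sup>2) \<le> ennreal e"
    using le' nn_integral_eq_integral[OF int] by simp
  then show "(LINT x|lebesgue. (h x - f m x)\<^sup>2) \<le> e" using e by (simp add: ennreal_le_iff)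
qed

definition l2_rel :: "('a::euclidean_space \<Rightarrow> real) \<Rightarrow> ('a \<Rightarrow> real) \<Rightarrow> bool" where
  "l2_rel f g \<longleftrightarrow> f \<in> sqint \<and> g \<in> sqint \<and> (AE x in lebesgue. f x = g x)"

\<comment> \<open>Square integrability is built into the partial equivalence relation, so every
  representative lies in \<open>sqint\<close>.\<close>
quotient_type (overloaded) 'a l2 = "'a::euclidean_space \<Rightarrow> real" / partial: l2_rel
proof (rule part_equivpI)
  show "\<exists>f :: 'a \<Rightarrow> real. l2_rel f f" using sqint_zero by (auto simp: l2_rel_def)
  show "symp (l2_rel :: ('a \<Rightarrow> real) \<Rightarrow> _)" by (auto simp: symp_def l2_rel_def elim!: eventually_mono)
  show "transp (l2_rel :: ('a \<Rightarrow> real) \<Rightarrow> _)"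
  proof (rule transpI)
    fix f g h :: "'a \<Rightarrow> real" assume "l2_rel f g" "l2_rel g h"
    then show "l2_rel f h" unfolding l2_rel_def
      by (auto elim: eventually_elim2)
  qed
qed

instantiation l2 :: (euclidean_space) real_inner
begin

lift_definition zero_l2 :: "'a l2" is "\<lambda>x. 0" by (simp add: l2_rel_def sqint_zero)
lift_definition plus_l2 :: "'a l2 \<Rightarrow> 'a l2 \<Rightarrow> 'a l2" is "\<lambda>f g x. f x + g x"
  unfolding l2_rel_def by (auto intro: sqint_add elim: eventually_elim2)
lift_definition uminus_l2 :: "'a l2 \<Rightarrow> 'a l2" is "\<lambda>f x. - f x"
  unfolding l2_rel_def by (auto intro: sqint_uminus elim: eventually_mono)
lift_definition minus_l2 :: "'a l2 \<Rightarrow> 'a l2 \<Rightarrow> 'a l2" is "\<lambda>f g x. f x - g x"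
  unfolding l2_rel_def by (auto intro: sqint_diff elim: eventually_elim2)
lift_definition scaleR_l2 :: "real \<Rightarrow> 'a l2 \<Rightarrow> 'a l2" is "\<lambda>c f x. c * f x"
  unfolding l2_rel_def by (auto intro: sqint_cmult elim: eventually_mono)
lift_definition inner_l2 :: "'a l2 \<Rightarrow> 'a l2 \<Rightarrow> real" is "\<lambda>f g. LINT x|lebesgue. f x * g x"
proof -
  fix f f' g g' :: "'a \<Rightarrow> real" assume A: "l2_rel f f'" "l2_rel g g'"
  then have [measurable]: "f \<in> borel_measurable lebesgue" "f' \<in> borel_measurable lebesgue"
    "g \<in> borel_measurable lebesgue" "g' \<in> borel_measurable lebesgue"
    by (auto simp: l2_rel_def sqint_measurable)
  show "(LINT x|lebesgue. f x * g x) = (LINT x|lebesgue. f' x * g' x)"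
    using A by (intro integral_cong_AE) (auto simp: l2_rel_def elim: eventually_elim2)
qed

definition norm_l2 :: "'a l2 \<Rightarrow> real" where "norm_l2 X = sqrt (inner X X)"
definition dist_l2 :: "'a l2 \<Rightarrow> 'a l2 \<Rightarrow> real" where "dist_l2 X Y = norm (X - Y)"
definition sgn_l2 :: "'a l2 \<Rightarrow> 'a l2" where "sgn_l2 X = scaleR (inverse (norm X)) X"
definition uniformity_l2 :: "('a l2 \<times> 'a l2) filter" where
  "uniformity_l2 = (INF e\<in>{0<..}. principal {(x, y). dist x y < e})"
definition open_l2 :: "'a l2 set \<Rightarrow> bool" where
  "open_l2 U = (\<forall>x\<in>U. eventually (\<lambda>(x', y). x' = x \<longrightarrow> y \<in> U) uniformity)"

instance
proof
  fix X Y W :: "'a l2" and c d :: real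
  show "dist X Y = norm (X - Y)" by (rule dist_l2_def)
  show "sgn X = scaleR (inverse (norm X)) X" by (rule sgn_l2_def)
  show "norm X = sqrt (inner X X)" by (rule norm_l2_def)
  show "uniformity = (INF e\<in>{0<..}. principal {(x::'a l2, y). dist x y < e})" by (rule uniformity_l2_def)
  show "open U = (\<forall>x\<in>U. eventually (\<lambda>(x', y). x' = x \<longrightarrow> y \<in> U) uniformity)" for U :: "'a l2 set"
    by (rule open_l2_def)
  show "X + Y + W = X + (Y + W)"
    by transfer (auto simp: l2_rel_def add.assoc intro!: sqint_add)
  show "X + Y = Y + X" by transfer (auto simp: l2_rel_def add.commute intro!: sqint_add)
  show "0 + X = X" by transfer (auto simp: l2_rel_def)
  show "- X + X = 0" by transfer (auto simp: l2_rel_def sqint_zero)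
  show "X - Y = X + - Y" by transfer (auto simp: l2_rel_def intro: sqint_diff)
  show "scaleR c (X + Y) = scaleR c X + scaleR c Y"
    by transfer (auto simp: l2_rel_def distrib_left intro!: sqint_add sqint_cmult)
  show "scaleR (c + d) X = scaleR c X + scaleR d X"
    by transfer (auto simp: l2_rel_def distrib_right intro!: sqint_add sqint_cmult)
  show "scaleR c (scaleR d X) = scaleR (c * d) X"
    by transfer (auto simp: l2_rel_def mult.assoc intro!: sqint_cmult)
  show "scaleR 1 X = X" by transfer (auto simp: l2_rel_def)
  show "inner X Y = inner Y X" by transfer (simp add: mult.commute)
  show "inner (X + Y) W = inner X W + inner Y W"
    by transfer (simp add: l2_rel_def distrib_right sqint_mult_integrable)
  show "inner (scaleR c X) Y = c * inner X Y"
    by transfer (simp add: l2_rel_def mult.assoc)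
  show "0 \<le> inner X X" by transfer simp
  show "inner X X = 0 \<longleftrightarrow> X = 0"
  proof transfer
    fix f :: "'a \<Rightarrow> real" assume f: "l2_rel f f"
    then have "integrable lebesgue (\<lambda>x. f x * f x)" by (simp add: l2_rel_def sqint_mult_integrable)
    then have "(LINT x|lebesgue. f x * f x) = 0 \<longleftrightarrow> (AE x in lebesgue. f x * f x = 0)"
      by (intro integral_nonneg_eq_0_iff_AE) auto
    then show "((LINT x|lebesgue. f x * f x) = 0) = l2_rel f (\<lambda>x. 0)"
      using f by (simp add: l2_rel_def sqint_zero)
  qed
qed

end

definition l2_of :: "('a::euclidean_space \<Rightarrow> real) \<Rightarrow> 'a l2" where "l2_of = abs_l2"
definition fun_of :: "'a::euclidean_space l2 \<Rightarrow> 'a \<Rightarrow> real" where "fun_of = rep_l2"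

lemma l2_of_fun_of [simp]: "l2_of (fun_of X) = X"
  unfolding l2_of_def fun_of_def by (rule Quotient3_abs_rep[OF Quotient3_l2])

lemma fun_of_sqint: "fun_of X \<in> sqint"
proof -
  have "l2_rel (rep_l2 X) (rep_l2 X)" by (rule Quotient3_rep_reflp[OF Quotient3_l2])
  then show ?thesis by (simp add: l2_rel_def fun_of_def)
qed

lemma l2_of_eq_iff: "f \<in> sqint \<Longrightarrow> g \<in> sqint \<Longrightarrow> l2_of f = l2_of g \<longleftrightarrow> (AE x in lebesgue. f x = g x)"
  unfolding l2_of_def using Quotient3_rel[OF Quotient3_l2, of f g] by (simp add: l2_rel_def)

lemma fun_of_l2_of: "f \<in> sqint \<Longrightarrow> AE x in lebesgue. fun_of (l2_of f) x = f x"
  using l2_of_eq_iff[OF fun_of_sqint, of f "l2_of f"] by simp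

lemma l2_of_add: "f \<in> sqint \<Longrightarrow> g \<in> sqint \<Longrightarrow> l2_of (\<lambda>x. f x + g x) = l2_of f + l2_of g"
  and l2_of_diff: "f \<in> sqint \<Longrightarrow> g \<in> sqint \<Longrightarrow> l2_of (\<lambda>x. f x - g x) = l2_of f - l2_of g"
  and l2_of_cmult: "f \<in> sqint \<Longrightarrow> l2_of (\<lambda>x. c * f x) = c *\<^sub>R l2_of f"
  and inner_l2_of: "f \<in> sqint \<Longrightarrow> g \<in> sqint \<Longrightarrow> l2_of f \<bullet> l2_of g = (LINT x|lebesgue. f x * g x)"
  unfolding l2_of_def
  by (auto intro!: plus_l2.abs_eq[symmetric] minus_l2.abs_eq[symmetric] scaleR_l2.abs_eq[symmetric] inner_l2.abs_eq
      simp: l2_rel_def)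

lemma l2_of_zero: "l2_of (\<lambda>x. 0) = 0"
  by (simp add: l2_of_def zero_l2_def)

lemma norm_l2_of_sq: "f \<in> sqint \<Longrightarrow> (norm (l2_of f))\<^sup>2 = (LINT x|lebesgue. (f x)\<^sup>2)"
  by (simp only: power2_norm_eq_inner inner_l2_of) (simp add: power2_eq_square)

lemma norm_l2_sq_diff: "(norm (X - Y))\<^sup>2 = (LINT x|lebesgue. (fun_of X x - fun_of Y x)\<^sup>2)"
  using norm_l2_of_sq[OF sqint_diff[OF fun_of_sqint fun_of_sqint], of X Y]
  by (simp add: l2_of_diff[OF fun_of_sqint fun_of_sqint])

lemma power2_le_quarter_power: "0 \<le> x \<Longrightarrow> x \<le> (1/2) ^ n \<Longrightarrow> x\<^sup>2 \<le> (1/4) ^ n" for x :: real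
  using power_mono[of x "(1/2) ^ n" 2] by (simp add: power_mult[symmetric] mult.commute[of n]) (simp add: power_mult power_divide)

instance l2 :: (euclidean_space) banach
proof
  fix X :: "nat \<Rightarrow> 'a l2" assume X: "Cauchy X"
  have "\<exists>N. \<forall>i\<ge>N. \<forall>j\<ge>N. norm (X i - X j) < (1/2) ^ n" for n
    using CauchyD[OF X, of "(1/2) ^ n"] by simp
  then obtain N where N: "\<And>n i j. i \<ge> N n \<Longrightarrow> j \<ge> N n \<Longrightarrow> norm (X i - X j) < (1/2) ^ n" by metis
  \<comment> \<open>Partial sums make \<open>r\<close> monotone and at least \<open>N n\<close>, so
    successive chosen terms differ by less than \<open>(1/2) ^ n\<close>.\<close>
  define r where "r n = (\<Sum>k\<le>n. N k)" for n
  have r: "r n \<ge> N n" "r n \<le> r m" if "n \<le> m" for n m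
    using that by (auto simp: r_def intro: member_le_sum sum_mono2)
  define f where "f n = fun_of (X (r n))" for n
  have f: "f n \<in> sqint" for n by (simp add: f_def fun_of_sqint)
  then have [measurable]: "f n \<in> borel_measurable lebesgue" for n by measurable
  have fd: "(LINT x|lebesgue. (f n x - f m x)\<^sup>2) \<le> (1/4) ^ m" if "n \<ge> m" for n m
    unfolding f_def norm_l2_sq_diff[symmetric]
    by (intro power2_le_quarter_power less_imp_le N norm_ge_zero order_trans[OF r(1)[OF order_refl]] r(2) that order_refl)
  have "AE x in lebesgue. \<exists>C. \<forall>n. \<bar>f (Suc n) x - f n x\<bar> \<le> C * (sqrt (1/2)) ^ n"
    by (rule AE_geometric_bound) (auto intro: sqint_diff f fd)
  then have lim: "AE x in lebesgue. (\<lambda>n. f n x) \<longlonglongrightarrow> lim (\<lambda>n. f n x)"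
  proof eventually_elim
    fix x assume "\<exists>C. \<forall>n. \<bar>f (Suc n) x - f n x\<bar> \<le> C * (sqrt (1/2)) ^ n"
    then have "convergent (\<lambda>n. f n x)" using geometric_bound_convergent by metis
    then show "(\<lambda>n. f n x) \<longlonglongrightarrow> lim (\<lambda>n. f n x)" by (simp add: convergent_LIMSEQ_iff)
  qed
  define h where "h x = lim (\<lambda>n. f n x)" for x
  have h: "h \<in> borel_measurable lebesgue" unfolding h_def[abs_def] by (rule borel_measurable_lim_metric) measurable
  have dh: "(\<lambda>x. h x - f m x) \<in> sqint" "(LINT x|lebesgue. (h x - f m x)\<^sup>2) \<le> (1/4) ^ m" for m
    using sqint_limit[OF f lim[folded h_def] h fd] by auto
  have hs: "h \<in> sqint" using sqint_add[OF dh(1)[of 0] f[of 0]] by simp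
  have conv: "norm (X (r m) - l2_of h) \<le> (1/2) ^ m" for m
  proof (rule power2_le_imp_le)
    have "l2_of (\<lambda>x. h x - f m x) = l2_of h - X (r m)" using l2_of_diff[OF hs f, of m] by (simp add: f_def)
    then have "(norm (X (r m) - l2_of h))\<^sup>2 = (norm (l2_of (\<lambda>x. h x - f m x)))\<^sup>2"
      by (simp add: norm_minus_commute)
    also have "\<dots> \<le> (1/4) ^ m" using dh by (simp add: norm_l2_of_sq)
    also have "\<dots> = ((1/2) ^ m)\<^sup>2" by (simp add: power_mult[symmetric] mult.commute[of m]) (simp add: power_mult power_divide)
    finally show "(norm (X (r m) - l2_of h))\<^sup>2 \<le> ((1/2) ^ m)\<^sup>2" .
  qed simp
  have "X \<longlonglongrightarrow> l2_of h"
  proof (rule LIMSEQ_I)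
    fix e :: real assume e: "e > 0"
    obtain m where m: "(1/2) ^ m < e / 2" using real_arch_pow_inv[of "e / 2" "1/2"] e by auto
    have "norm (X i - l2_of h) < e" if i: "i \<ge> N m" for i
      using N[OF i r(1)[OF order_refl]] conv[of m] m norm_triangle_ineq[of "X i - X (r m)" "X (r m) - l2_of h"]
      by simp
    then show "\<exists>no. \<forall>n\<ge>no. norm (X n - l2_of h) < e" by blast
  qed
  then show "convergent X" by (rule convergentI)
qed

lemma l2_tendsto_imp_AE_subseq:
  assumes "X \<longlonglongrightarrow> (Z :: 'a::euclidean_space l2)"
  obtains r :: "nat \<Rightarrow> nat" where "AE x in lebesgue. (\<lambda>n. fun_of (X (r n)) x) \<longlonglongrightarrow> fun_of Z x"
proof -
  have "\<exists>i. norm (X i - Z) < (1/2) ^ n" for n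
    using LIMSEQ_D[OF assms, of "(1/2) ^ n"] by auto
  then obtain r where r: "\<And>n. norm (X (r n) - Z) < (1/2) ^ n" by metis
  have "(LINT x|lebesgue. (fun_of (X (r n)) x - fun_of Z x)\<^sup>2) \<le> (1/4) ^ n" for n
    unfolding norm_l2_sq_diff[symmetric] by (rule power2_le_quarter_power[OF norm_ge_zero less_imp_le[OF r]])
  then have "AE x in lebesgue. \<exists>C. \<forall>n. \<bar>fun_of (X (r n)) x - fun_of Z x\<bar> \<le> C * (sqrt (1/2)) ^ n"
    by (intro AE_geometric_bound sqint_diff fun_of_sqint)
  then have "AE x in lebesgue. (\<lambda>n. fun_of (X (r n)) x) \<longlonglongrightarrow> fun_of Z x"
  proof eventually_elim
    fix x assume "\<exists>C. \<forall>n. \<bar>fun_of (X (r n)) x - fun_of Z x\<bar> \<le> C * (sqrt (1/2)) ^ n"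
    then obtain C where "\<And>n. \<bar>fun_of (X (r n)) x - fun_of Z x\<bar> \<le> C * (sqrt (1/2)) ^ n" by blast
    then show "(\<lambda>n. fun_of (X (r n)) x) \<longlonglongrightarrow> fun_of Z x"
      by (rule LIM_zero_cancel[OF geometric_bound_tendsto_0[of _ C]])
  qed
  then show ?thesis by (rule that)
qed

text \<open>The indicator of the unit cube is a unit vector, and adding small multiples of it gives
  other points near any \<open>X\<close>.\<close>

instance l2 :: (euclidean_space) perfect_space
proof
  fix X :: "'a l2"
  define f :: "'a \<Rightarrow> real" where "f = indicator (cbox 0 One)"
  have ff: "(\<lambda>x. (f x)\<^sup>2) = f" by (auto simp: f_def indicator_def)
  have "integrable lebesgue f" unfolding f_def
    by (subst integrable_indicator_iff) (auto simp: emeasure_lborel_cbox_eq)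
  then have f: "f \<in> sqint" unfolding sqint_def by (simp add: ff) 
  have "(norm (l2_of f))\<^sup>2 = (LINT x|lebesgue. f x)" by (simp add: norm_l2_of_sq[OF f] ff)
  also have "\<dots> = 1" by (simp add: f_def content_cbox_if measure_completion)
  finally have v: "norm (l2_of f) = 1" by (simp add: power2_eq_1_iff) (metis norm_ge_zero not_one_le_zero neg_0_le_iff_le)
  show "\<not> open {X}"
  proof
    assume "open {X}"
    then obtain e where e: "e > 0" "\<And>Y. dist Y X < e \<Longrightarrow> Y \<in> {X}" unfolding open_dist by blast
    have "dist (X + (e / 2) *\<^sub>R l2_of f) X < e" using e v by (simp add: dist_norm)
    then have "(e / 2) *\<^sub>R l2_of f = 0" using e(2) by (metis add_cancel_right_right singletonD)
    then show False using e v by auto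
  qed
qed

section \<open>The Newtonian potential on square integrable functions\<close>

lemma sigma_finite_lebesgue: "sigma_finite_measure (lebesgue :: 'a::euclidean_space measure)"
proof
  obtain A :: "'a set set" where A: "countable A \<and> A \<subseteq> sets lborel \<and> \<Union>A = space lborel \<and>
      (\<forall>a\<in>A. emeasure lborel a \<noteq> \<infinity>)"
    using lborel.sigma_finite_countable[where 'a='a] by (rule exE)
  then show "\<exists>A. countable A \<and> A \<subseteq> sets (lebesgue :: 'a measure) \<and> \<Union>A = space lebesgue \<and> (\<forall>a\<in>A. emeasure lebesgue a \<noteq> \<infinity>)"
    by (intro exI[of _ A] conjI) (simp_all add: subset_eq)
qed

interpretation lebesgue: sigma_finite_measure "lebesgue :: 'a::euclidean_space measure"
  by (rule sigma_finite_lebesgue)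

interpretation lebesgue_pair: pair_sigma_finite "lebesgue :: 'a::euclidean_space measure" "lebesgue :: 'b::euclidean_space measure" ..

text \<open>If \<open>k\<close> is the dyadic scale of \<open>d\<close>, that is
  \<open>(1/2) ^ Suc k \<le> d\<close> and \<open>d < (1/2) ^ k\<close>, the single summand at
  \<open>k\<close> is already large enough.\<close>

lemma inverse_square_le_dyadic_sum:
  fixes d :: real
  assumes "0 < d" "d < 1"
  shows "ennreal (1 / d\<^sup>2) \<le> (\<Sum>k. ennreal (4 ^ Suc k) * indicator {..<(1/2) ^ k} d)"
proof -
  have ex: "\<exists>n. (1/2) ^ n \<le> d"
    using real_arch_pow_inv[of d "1/2"] assms by (auto intro: less_imp_le)
  define n where "n = (LEAST n. (1/2) ^ n \<le> d)"
  have n: "(1/2) ^ n \<le> d" unfolding n_def by (rule LeastI_ex[OF ex])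
  have "n \<noteq> 0" using n assms by (intro notI) simp
  then obtain k where k: "n = Suc k" by (cases n) auto
  have dk: "d < (1/2) ^ k" using not_less_Least[of k "\<lambda>n. (1/2) ^ n \<le> d"] by (simp add: n_def[symmetric] k)
  have "1 / d\<^sup>2 \<le> 1 / ((1/2) ^ Suc k)\<^sup>2" using n assms unfolding k by (intro divide_left_mono power_mono) auto
  also have "\<dots> = 4 ^ Suc k"
  proof -
    have "((1/2) ^ Suc k)\<^sup>2 = (((1/2)::real)\<^sup>2) ^ Suc k" by (simp only: power_mult[symmetric] mult.commute)
    then show ?thesis by (simp add: power_divide)
  qed
  finally have "ennreal (1 / d\<^sup>2) \<le> ennreal (4 ^ Suc k)" by (rule ennreal_leI)
  also have "\<dots> = (\<Sum>k\<in>{k}. ennreal (4 ^ Suc k) * indicator {..<(1/2) ^ k} d)" using dk by simp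
  also have "\<dots> \<le> (\<Sum>k. ennreal (4 ^ Suc k) * indicator {..<(1/2) ^ k} d)" by (rule sum_le_suminf) auto
  finally show ?thesis .
qed

text \<open>Dyadic balls in place of polar coordinates: \<open>4 ^ Suc k\<close> meets a volume
  proportional to \<open>(1/8) ^ k\<close>, which leaves \<open>4 * (1/2) ^ k\<close>, and these add
  up to 8.\<close>

lemma nn_integral_inverse_square_ball:
  fixes x :: "real ^ 3"
  shows "(\<integral>\<^sup>+y. ennreal (1 / (norm (x - y))\<^sup>2) * indicator (ball x 1) y \<partial>lebesgue) \<le> ennreal (8 * unit_ball_vol 3)"
proof -
  have "(\<integral>\<^sup>+y. ennreal (1 / (norm (x - y))\<^sup>2) * indicator (ball x 1) y \<partial>lebesgue)
      \<le> (\<integral>\<^sup>+y. (\<Sum>k. ennreal (4 ^ Suc k) * indicator (ball x ((1/2) ^ k)) y) \<partial>lebesgue)"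
  proof (rule nn_integral_mono)
    fix y :: "real ^ 3"
    have ind: "(indicator {..<(1/2) ^ k} (norm (x - y)) :: ennreal) = indicator (ball x ((1/2) ^ k)) y" for k :: nat
      by (simp add: indicator_def dist_norm)
    show "ennreal (1 / (norm (x - y))\<^sup>2) * indicator (ball x 1) y
        \<le> (\<Sum>k. ennreal (4 ^ Suc k) * indicator (ball x ((1/2) ^ k)) y)"
    proof (cases "x \<noteq> y \<and> norm (x - y) < 1")
      case True
      then show ?thesis
        using inverse_square_le_dyadic_sum[of "norm (x - y)"] unfolding ind by (simp add: dist_norm)
    qed (auto simp: dist_norm)
  qed
  also have "\<dots> = (\<Sum>k. \<integral>\<^sup>+y. ennreal (4 ^ Suc k) * indicator (ball x ((1/2) ^ k)) y \<partial>lebesgue)"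
    by (rule nn_integral_suminf) (auto intro!: borel_measurable_times_ennreal borel_measurable_indicator)
  also have "\<dots> \<le> (\<Sum>k. ennreal (4 * unit_ball_vol 3 * (1/2) ^ k))"
  proof (rule suminf_le)
    fix k :: nat
    have "(\<integral>\<^sup>+y. ennreal (4 ^ Suc k) * indicator (ball x ((1/2) ^ k)) y \<partial>lebesgue) = ennreal (4 ^ Suc k) * emeasure lebesgue (ball x ((1/2) ^ k))"
      by (simp add: nn_integral_cmult_indicator)
    also have "emeasure lebesgue (ball x ((1/2) ^ k)) = ennreal (unit_ball_vol 3 * ((1/2) ^ k) ^ 3)"
      by (simp add: emeasure_ball)
    also have "ennreal (4 ^ Suc k) * \<dots> = ennreal (4 ^ Suc k * (unit_ball_vol 3 * ((1/2) ^ k) ^ 3))"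
      by (rule ennreal_mult'[symmetric]) simp
    also have "4 ^ Suc k * (unit_ball_vol 3 * ((1/2) ^ k) ^ 3) = 4 * unit_ball_vol 3 * (1/2) ^ k"
    proof -
      have "((1/2 :: real) ^ k) ^ 3 = ((1/2) ^ 3) ^ k" by (simp only: power_mult[symmetric] mult.commute)
      then have "4 ^ k * ((1/2 :: real) ^ k) ^ 3 = (1/2) ^ k"
        by (simp only: power_mult_distrib[symmetric]) (simp add: power3_eq_cube)
      then show ?thesis by simp
    qed
    finally show "(\<integral>\<^sup>+y. ennreal (4 ^ Suc k) * indicator (ball x ((1/2) ^ k)) y \<partial>lebesgue) \<le> ennreal (4 * unit_ball_vol 3 * (1/2) ^ k)"
      by simp
  qed auto
  also have "\<dots> = ennreal (\<Sum>k. 4 * unit_ball_vol 3 * (1/2) ^ k)"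
    by (rule suminf_ennreal2) (auto intro!: summable_mult summable_geometric)
  also have "(\<Sum>k. 4 * unit_ball_vol 3 * (1/2 :: real) ^ k) = 8 * unit_ball_vol 3"
    by (subst suminf_mult) (auto simp: suminf_geometric summable_geometric)
  finally show ?thesis .
qed

text \<open>\<open>\<theta>\<close> will be the reciprocal square root of
  \<open>\<Phi>''(\<rho>\<^sub>0)\<close>, extended by zero: conjugation with it turns the Newtonian
  form on the weighted space into one with kernel \<open>ker\<close> on \<open>l2\<close>.\<close>

locale weighted_newton =
  fixes \<Omega> :: "(real ^ 3) set" and \<theta> :: "real ^ 3 \<Rightarrow> real" and B :: real
  assumes \<Omega>_meas: "\<Omega> \<in> sets lebesgue" and \<Omega>_bounded: "bounded \<Omega>"
    and \<theta>_meas [measurable]: "\<theta> \<in> borel_measurable lebesgue" and \<theta>_le: "\<And>x. \<bar>\<theta> x\<bar> \<le> B * indicator \<Omega> x"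
begin

definition ker :: "real ^ 3 \<Rightarrow> real ^ 3 \<Rightarrow> real" where "ker x y = \<theta> x * \<theta> y / norm (x - y)"

lemma ker_sym: "ker x y = ker y x"
  by (simp add: ker_def norm_minus_commute mult.commute)

lemma \<theta>_outside: "x \<notin> \<Omega> \<Longrightarrow> \<theta> x = 0"
  using \<theta>_le[of x] by simp

lemma ker_measurable [measurable]: "(\<lambda>(x, y). ker x y) \<in> borel_measurable (lebesgue \<Otimes>\<^sub>M lebesgue)"
proof -
  have [measurable]: "(\<lambda>x. x) \<in> measurable lebesgue (borel :: (real ^ 3) measure)"
    by (rule measurable_completion) simp
  show ?thesis unfolding ker_def by measurable
qed

text \<open>Bound for the \<open>l2\<close> norm of every kernel section. The unit ball around
  \<open>x\<close> contributes \<open>8 * unit_ball_vol 3\<close>; outside it the distance is at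
  least 1, and the contribution is at most the measure of \<open>\<Omega>\<close>.\<close>

definition Cker :: real where "Cker = B\<^sup>2 * sqrt (8 * unit_ball_vol 3 + measure lebesgue \<Omega>)"

lemma Cker_nonneg: "Cker \<ge> 0" by (simp add: Cker_def)

lemma emeasure_\<Omega>: "emeasure lebesgue \<Omega> = ennreal (measure lebesgue \<Omega>)"
  using bounded_set_imp_lmeasurable[OF \<Omega>_bounded \<Omega>_meas] by (simp add: emeasure_eq_measure2)

lemma nn_integral_ker_sq: "(\<integral>\<^sup>+y. ennreal ((ker x y)\<^sup>2) \<partial>lebesgue) \<le> ennreal (Cker\<^sup>2)"
proof -
  have [measurable]: "(\<lambda>x. x) \<in> measurable lebesgue (borel :: (real ^ 3) measure)"
    by (rule measurable_completion) simp
  note \<Omega>_meas [measurable]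
  have "(\<integral>\<^sup>+y. ennreal ((ker x y)\<^sup>2) \<partial>lebesgue)
      \<le> (\<integral>\<^sup>+y. ennreal (B^4) * (ennreal (1 / (norm (x - y))\<^sup>2) * indicator (ball x 1) y + indicator \<Omega> y) \<partial>lebesgue)"
  proof (rule nn_integral_mono)
    fix y
    show "ennreal ((ker x y)\<^sup>2) \<le> ennreal (B^4) * (ennreal (1 / (norm (x - y))\<^sup>2) * indicator (ball x 1) y + indicator \<Omega> y)"
    proof (cases "x \<in> \<Omega> \<and> y \<in> \<Omega>")
      case True
      have B: "\<bar>\<theta> x\<bar> \<le> B" "\<bar>\<theta> y\<bar> \<le> B" using \<theta>_le[of x] \<theta>_le[of y] True by auto
      then have "(\<theta> x)\<^sup>2 \<le> B\<^sup>2" "(\<theta> y)\<^sup>2 \<le> B\<^sup>2" using power_mono[of "\<bar>\<theta> x\<bar>" B 2] power_mono[of "\<bar>\<theta> y\<bar>" B 2] by auto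
      then have "(\<theta> x)\<^sup>2 * (\<theta> y)\<^sup>2 \<le> B\<^sup>2 * B\<^sup>2" by (intro mult_mono) auto
      then have "(\<theta> x)\<^sup>2 * (\<theta> y)\<^sup>2 \<le> B^4" by (simp add: power_add[symmetric])
      then have "(ker x y)\<^sup>2 \<le> B^4 * (1 / (norm (x - y))\<^sup>2)"
        by (simp add: ker_def power_divide power_mult_distrib divide_right_mono)
      also have "\<dots> \<le> B^4 * (1 / (norm (x - y))\<^sup>2 * indicator (ball x 1) y + 1)"
      proof (rule mult_left_mono)
        show "1 / (norm (x - y))\<^sup>2 \<le> 1 / (norm (x - y))\<^sup>2 * indicator (ball x 1) y + 1"
        proof (cases "norm (x - y) < 1")
          case False
          then have "1 \<le> (norm (x - y))\<^sup>2" by simp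
          then have "1 / (norm (x - y))\<^sup>2 \<le> 1 / 1" by (intro divide_left_mono) auto
          then show ?thesis using False by (simp add: dist_norm)
        qed (simp add: dist_norm)
      qed simp
      finally have "ennreal ((ker x y)\<^sup>2) \<le> ennreal (B^4 * (1 / (norm (x - y))\<^sup>2 * indicator (ball x 1) y + 1))"
        by (rule ennreal_leI)
      also have "\<dots> = ennreal (B^4) * (ennreal (1 / (norm (x - y))\<^sup>2) * indicator (ball x 1) y + indicator \<Omega> y)"
        using True by (cases "y \<in> ball x 1") (simp_all add: ennreal_mult)
      finally show ?thesis .
    qed (auto simp: ker_def \<theta>_outside)
  qed
  also have "\<dots> = ennreal (B^4) * ((\<integral>\<^sup>+y. ennreal (1 / (norm (x - y))\<^sup>2) * indicator (ball x 1) y \<partial>lebesgue) + emeasure lebesgue \<Omega>)"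
  proof -
    have m: "(\<lambda>y. ennreal (1 / (norm (x - y))\<^sup>2) * indicator (ball x 1) y) \<in> borel_measurable lebesgue"
      by (intro borel_measurable_times_ennreal borel_measurable_indicator) (measurable, auto)
    have m2: "(\<lambda>y. indicator \<Omega> y :: ennreal) \<in> borel_measurable lebesgue" by measurable
    show ?thesis
      using nn_integral_cmult[OF borel_measurable_add[OF m m2]] nn_integral_add[OF m m2] \<Omega>_meas
      by simp
  qed
  also have "\<dots> \<le> ennreal (B^4) * (ennreal (8 * unit_ball_vol 3) + ennreal (measure lebesgue \<Omega>))"
    unfolding emeasure_\<Omega> by (intro mult_left_mono add_right_mono nn_integral_inverse_square_ball) auto
  also have "\<dots> = ennreal (B^4 * (8 * unit_ball_vol 3 + measure lebesgue \<Omega>))"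
    by (simp add: ennreal_mult ennreal_plus)
  also have "B^4 * (8 * unit_ball_vol 3 + measure lebesgue \<Omega>) = Cker\<^sup>2"
    by (simp add: Cker_def power_mult_distrib power_mult[symmetric])
  finally show ?thesis .
qed

lemma ker_sqint: "ker x \<in> sqint"
proof -
  have "integrable lebesgue (\<lambda>y. (ker x y)\<^sup>2)"
    by (rule integrableI_nonneg) (auto intro: le_less_trans[OF nn_integral_ker_sq])
  then show ?thesis by (simp add: sqint_def)
qed

lemma norm_ker_le: "norm (l2_of (ker x)) \<le> Cker"
proof (rule power2_le_imp_le[OF _ Cker_nonneg])
  have "ennreal (LINT y|lebesgue. (ker x y)\<^sup>2) \<le> ennreal (Cker\<^sup>2)"
    using nn_integral_ker_sq[of x] nn_integral_eq_integral[OF sqint_integrable[OF ker_sqint]] by simp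
  then show "(norm (l2_of (ker x)))\<^sup>2 \<le> Cker\<^sup>2" by (simp add: norm_l2_of_sq[OF ker_sqint])
qed

text \<open>As an inner product with a kernel section, the value of the potential at each point is
  weakly continuous in \<open>X\<close>.\<close>

definition pot :: "(real ^ 3) l2 \<Rightarrow> real ^ 3 \<Rightarrow> real" where "pot X x = l2_of (ker x) \<bullet> X"

lemma pot_eq: "f \<in> sqint \<Longrightarrow> pot (l2_of f) x = (LINT y|lebesgue. ker x y * f y)"
  by (simp add: pot_def inner_l2_of ker_sqint)

lemma pot_le: "\<bar>pot X x\<bar> \<le> Cker * norm X * indicator \<Omega> x"
proof (cases "x \<in> \<Omega>")
  case True
  have "\<bar>pot X x\<bar> \<le> norm (l2_of (ker x)) * norm X" unfolding pot_def by (rule Cauchy_Schwarz_ineq2)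
  also have "\<dots> \<le> Cker * norm X" by (intro mult_right_mono norm_ker_le) auto
  finally show ?thesis using True by simp
next
  case False
  then have "ker x = (\<lambda>y. 0)" by (auto simp: ker_def \<theta>_outside)
  then show ?thesis using False by (simp add: pot_def l2_of_zero)
qed

lemma pot_measurable [measurable]: "pot X \<in> borel_measurable lebesgue"
proof -
  have [measurable]: "fun_of X \<in> borel_measurable lebesgue" by (rule sqint_measurable[OF fun_of_sqint])
  have "(\<lambda>x. LINT y|lebesgue. ker x y * fun_of X y) \<in> borel_measurable lebesgue"
    by measurable
  moreover have "pot X = (\<lambda>x. LINT y|lebesgue. ker x y * fun_of X y)"
    using pot_eq[OF fun_of_sqint, of X] by auto
  ultimately show ?thesis by simp
qed

lemma indicator_\<Omega>_integrable: "integrable lebesgue (\<lambda>x. c * indicator \<Omega> x :: real)"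
  using \<Omega>_meas emeasure_\<Omega> by (intro integrable_mult_right) (auto simp: integrable_indicator_iff)

lemma indicator_\<Omega>_sqint: "(\<lambda>x. c * indicator \<Omega> x) \<in> sqint"
proof -
  have "(\<lambda>x. (c * indicator \<Omega> x)\<^sup>2) = (\<lambda>x. c\<^sup>2 * indicator \<Omega> x :: real)"
    by (auto simp: indicator_def)
  then show ?thesis using indicator_\<Omega>_integrable[of "c\<^sup>2"] \<Omega>_meas by (simp add: sqint_def)
qed

lemma pot_sqint: "pot X \<in> sqint"
  and norm_pot_le: "norm (l2_of (pot X)) \<le> Cker * sqrt (measure lebesgue \<Omega>) * norm X"
proof -
  have le: "(pot X x)\<^sup>2 \<le> (Cker * norm X)\<^sup>2 * indicator \<Omega> x" for x
    using power_mono[OF pot_le[of X x], of 2] by (cases "x \<in> \<Omega>") auto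
  have "integrable lebesgue (\<lambda>x. (pot X x)\<^sup>2)"
    by (rule Bochner_Integration.integrable_bound[OF indicator_\<Omega>_integrable[of "(Cker * norm X)\<^sup>2"]]) (use le in auto)
  then show s: "pot X \<in> sqint" by (simp add: sqint_def)
  show "norm (l2_of (pot X)) \<le> Cker * sqrt (measure lebesgue \<Omega>) * norm X"
  proof (rule power2_le_imp_le)
    have "(norm (l2_of (pot X)))\<^sup>2 = (LINT x|lebesgue. (pot X x)\<^sup>2)" by (rule norm_l2_of_sq[OF s])
    also have "\<dots> \<le> (LINT x|lebesgue. (Cker * norm X)\<^sup>2 * indicator \<Omega> x)"
      by (intro integral_mono sqint_integrable s indicator_\<Omega>_integrable le)
    also have "\<dots> = (Cker * sqrt (measure lebesgue \<Omega>) * norm X)\<^sup>2"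
      using \<Omega>_meas by (simp add: power_mult_distrib)
    finally show "(norm (l2_of (pot X)))\<^sup>2 \<le> (Cker * sqrt (measure lebesgue \<Omega>) * norm X)\<^sup>2" .
  qed (simp add: Cker_nonneg)
qed

definition newton_form :: "(real ^ 3) l2 \<Rightarrow> (real ^ 3) l2 \<Rightarrow> real" where
  "newton_form X W = l2_of (pot X) \<bullet> W"

lemma newton_form_eq:
  "f \<in> sqint \<Longrightarrow> g \<in> sqint \<Longrightarrow> newton_form (l2_of f) (l2_of g) = (LINT x|lebesgue. (LINT y|lebesgue. ker x y * f y) * g x)"
  by (simp add: newton_form_def inner_l2_of pot_sqint pot_eq)

lemma bilinear_newton_form: "bounded_bilinear newton_form"
proof
  have add: "l2_of (pot (X + X')) = l2_of (pot X) + l2_of (pot X')" for X X'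
  proof -
    have "pot (X + X') = (\<lambda>x. pot X x + pot X' x)" by (rule ext) (simp add: pot_def inner_add_right)
    then show ?thesis by (simp add: l2_of_add pot_sqint)
  qed
  have cmult: "l2_of (pot (c *\<^sub>R X)) = c *\<^sub>R l2_of (pot X)" for c X
  proof -
    have "pot (c *\<^sub>R X) = (\<lambda>x. c * pot X x)" by (rule ext) (simp add: pot_def)
    then show ?thesis by (simp add: l2_of_cmult pot_sqint)
  qed
  show "newton_form (X + X') W = newton_form X W + newton_form X' W" for X X' W
    by (simp add: newton_form_def add inner_add_left)
  show "newton_form X (W + W') = newton_form X W + newton_form X W'" for X W W'
    by (simp add: newton_form_def inner_add_right)
  show "newton_form (c *\<^sub>R X) W = c *\<^sub>R newton_form X W" "newton_form X (c *\<^sub>R W) = c *\<^sub>R newton_form X W" for c X W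
    by (simp_all add: newton_form_def cmult)
  show "\<exists>K. \<forall>X W. norm (newton_form X W) \<le> norm X * norm W * K"
  proof (intro exI allI)
    fix X W
    have "norm (newton_form X W) \<le> norm (l2_of (pot X)) * norm W"
      unfolding newton_form_def real_norm_def by (rule Cauchy_Schwarz_ineq2)
    also have "\<dots> \<le> (Cker * sqrt (measure lebesgue \<Omega>) * norm X) * norm W"
      by (intro mult_right_mono norm_pot_le) auto
    finally show "norm (newton_form X W) \<le> norm X * norm W * (Cker * sqrt (measure lebesgue \<Omega>))"
      by (simp add: mult.assoc mult.commute mult.left_commute)
  qed
qed

text \<open>Symmetry of the kernel and Fubini. The inner integrals of absolute values are at most
  \<open>Cker * norm X\<close> on \<open>\<Omega>\<close> and vanish outside; with \<open>g\<close>
  square integrable this gives integrability on the product.\<close>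

lemma newton_form_sym: "newton_form X W = newton_form W X"
proof -
  define f g where "f = fun_of X" and "g = fun_of W"
  have f: "f \<in> sqint" and g: "g \<in> sqint" by (auto simp: f_def g_def fun_of_sqint)
  have [measurable]: "f \<in> borel_measurable lebesgue" "g \<in> borel_measurable lebesgue"
    using f g by (auto intro: sqint_measurable)
  have abs_f: "(\<lambda>x. \<bar>f x\<bar>) \<in> sqint" and abs_g: "(\<lambda>x. \<bar>g x\<bar>) \<in> sqint"
    using f g by (auto simp: sqint_def)
  have abs_ker: "(\<lambda>y. \<bar>ker x y\<bar>) \<in> sqint" for x using ker_sqint[of x] by (auto simp: sqint_def)
  have "integrable (lebesgue \<Otimes>\<^sub>M lebesgue) (\<lambda>(x, y). ker x y * f y * g x)"
  proof (rule lebesgue_pair.Fubini_integrable)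
    show "(\<lambda>(x, y). ker x y * f y * g x) \<in> borel_measurable (lebesgue \<Otimes>\<^sub>M lebesgue)" by measurable
    have int: "integrable lebesgue (\<lambda>y. ker x y * f y * g x)" for x
      by (intro integrable_mult_left sqint_mult_integrable ker_sqint f)
    then show "AE x in lebesgue. integrable lebesgue (\<lambda>y. case (x, y) of (x, y) \<Rightarrow> ker x y * f y * g x)" by simp
    have le: "\<bar>LINT y|lebesgue. \<bar>ker x y\<bar> * \<bar>f y\<bar>\<bar> \<le> Cker * norm X * indicator \<Omega> x" for x
    proof (cases "x \<in> \<Omega>")
      case True
      have "\<bar>LINT y|lebesgue. \<bar>ker x y\<bar> * \<bar>f y\<bar>\<bar> = \<bar>l2_of (\<lambda>y. \<bar>ker x y\<bar>) \<bullet> l2_of (\<lambda>x. \<bar>f x\<bar>)\<bar>"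
        by (simp add: inner_l2_of abs_ker abs_f)
      also have "\<dots> \<le> norm (l2_of (\<lambda>y. \<bar>ker x y\<bar>)) * norm (l2_of (\<lambda>x. \<bar>f x\<bar>))" by (rule Cauchy_Schwarz_ineq2)
      also have "norm (l2_of (\<lambda>y. \<bar>ker x y\<bar>)) = norm (l2_of (ker x))"
        by (rule power2_eq_imp_eq) (simp_all add: norm_l2_of_sq abs_ker ker_sqint)
      also have "norm (l2_of (\<lambda>x. \<bar>f x\<bar>)) = norm X"
        by (rule power2_eq_imp_eq) (use norm_l2_of_sq[OF abs_f] norm_l2_of_sq[OF f] in \<open>simp_all add: f_def\<close>)
      finally show ?thesis using True mult_right_mono[OF norm_ker_le[of x] norm_ge_zero[of X]] by simp
    next
      case False
      then have "ker x = (\<lambda>y. 0)" by (auto simp: ker_def \<theta>_outside)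
      then show ?thesis by (simp add: False)
    qed
    have "integrable lebesgue (\<lambda>x. (Cker * norm X * indicator \<Omega> x) * \<bar>g x\<bar>)"
      by (rule sqint_mult_integrable[OF indicator_\<Omega>_sqint abs_g])
    then show "integrable lebesgue (\<lambda>x. LINT y|lebesgue. norm (case (x, y) of (x, y) \<Rightarrow> ker x y * f y * g x))"
    proof (rule Bochner_Integration.integrable_bound)
      show "(\<lambda>x. LINT y|lebesgue. norm (case (x, y) of (x, y) \<Rightarrow> ker x y * f y * g x)) \<in> borel_measurable lebesgue"
        by measurable
      have "norm (LINT y|lebesgue. norm (ker x y * f y * g x)) \<le> norm ((Cker * norm X * indicator \<Omega> x) * \<bar>g x\<bar>)" for x
      proof -
        have "(LINT y|lebesgue. norm (ker x y * f y * g x)) = (LINT y|lebesgue. \<bar>ker x y\<bar> * \<bar>f y\<bar>) * \<bar>g x\<bar>"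
          by (simp add: abs_mult)
        then show ?thesis using mult_right_mono[OF le[of x], of "\<bar>g x\<bar>"] Cker_nonneg by (simp add: abs_mult)
      qed
      then show "AE x in lebesgue. norm (LINT y|lebesgue. norm (case (x, y) of (x, y) \<Rightarrow> ker x y * f y * g x))
        \<le> norm ((Cker * norm X * indicator \<Omega> x) * \<bar>g x\<bar>)" by simp
    qed
  qed
  then have "(LINT y|lebesgue. (LINT x|lebesgue. ker x y * f y * g x)) = (LINT x|lebesgue. (LINT y|lebesgue. ker x y * f y * g x))"
    by (rule lebesgue_pair.Fubini_integral)
  moreover have "newton_form X W = (LINT x|lebesgue. (LINT y|lebesgue. ker x y * f y * g x))"
    using newton_form_eq[OF f g] by (simp add: f_def g_def)
  moreover have "newton_form W X = (LINT y|lebesgue. (LINT x|lebesgue. ker x y * f y * g x))"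
  proof -
    have "(LINT x|lebesgue. ker x y * f y * g x) = (LINT x|lebesgue. (ker y x * g x) * f y)" for y
      by (intro Bochner_Integration.integral_cong refl) (simp add: ker_sym[of y])
    then show ?thesis using newton_form_eq[OF g f] by (simp add: f_def g_def)
  qed
  ultimately show ?thesis by simp
qed

text \<open>The kernel is Hilbert--Schmidt: weak convergence gives pointwise convergence of the potentials,
  which are uniformly bounded and supported in the bounded set \<open>\<Omega>\<close>.\<close>

lemma newton_form_compact:
  assumes weak: "\<And>g. (\<lambda>n. X n \<bullet> g) \<longlonglongrightarrow> 0" and le: "\<And>n. norm (X n) \<le> 1"
  shows "(\<lambda>n. newton_form (X n) (X n)) \<longlonglongrightarrow> 0"
proof -
  have pt: "(\<lambda>n. pot (X n) x) \<longlonglongrightarrow> 0" for x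
    using weak[of "l2_of (ker x)"] by (simp add: pot_def inner_commute)
  have "(\<lambda>n. LINT x|lebesgue. (pot (X n) x)\<^sup>2) \<longlonglongrightarrow> (LINT x|(lebesgue :: (real ^ 3) measure). 0)"
  proof (rule integral_dominated_convergence)
    show "integrable lebesgue (\<lambda>x. Cker\<^sup>2 * indicator \<Omega> x :: real)" by (rule indicator_\<Omega>_integrable)
    show "AE x in lebesgue. (\<lambda>n. (pot (X n) x)\<^sup>2) \<longlonglongrightarrow> 0"
      by (simp add: pt)
    fix n
    have "(pot (X n) x)\<^sup>2 \<le> Cker\<^sup>2 * indicator \<Omega> x" for x
    proof -
      have "\<bar>pot (X n) x\<bar> \<le> Cker * 1 * indicator \<Omega> x"
        by (rule order_trans[OF pot_le]) (intro mult_right_mono mult_left_mono le Cker_nonneg, simp)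
      from power_mono[OF this, of 2] show ?thesis by (cases "x \<in> \<Omega>") auto
    qed
    then show "AE x in lebesgue. norm ((pot (X n) x)\<^sup>2) \<le> Cker\<^sup>2 * indicator \<Omega> x" by simp
  qed auto
  then have "(\<lambda>n. (norm (l2_of (pot (X n))))\<^sup>2) \<longlonglongrightarrow> 0" by (simp add: norm_l2_of_sq[OF pot_sqint])
  from tendsto_real_sqrt[OF this] have n0: "(\<lambda>n. norm (l2_of (pot (X n)))) \<longlonglongrightarrow> 0" by simp
  have "norm (newton_form (X n) (X n)) \<le> norm (l2_of (pot (X n)))" for n
  proof -
    have "norm (newton_form (X n) (X n)) \<le> norm (l2_of (pot (X n))) * norm (X n)"
      unfolding newton_form_def real_norm_def by (rule Cauchy_Schwarz_ineq2)
    also have "\<dots> \<le> norm (l2_of (pot (X n))) * 1" by (intro mult_left_mono le) auto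
    finally show ?thesis by simp
  qed
  then show ?thesis by (intro Lim_null_comparison[OF always_eventually n0]) blast
qed

end

section \<open>Integration by parts and axi-symmetric test functions\<close>

lemma integral_lebesgue_translation:
  fixes f :: "'a::euclidean_space \<Rightarrow> real"
  assumes [measurable]: "f \<in> borel_measurable borel"
  shows "(LINT x|lebesgue. f (x + c)) = (LINT x|lebesgue. f x)"
proof -
  have "(LINT x|lebesgue. f (x + c)) = (LINT x|lborel. f (c + x))"
    by (subst integral_completion) (auto simp: add.commute)
  also have "\<dots> = (LINT x|distr lborel borel ((+) c). f x)" by (subst integral_distr) auto
  also have "\<dots> = (LINT x|lebesgue. f x)" by (subst integral_completion) (auto simp: lborel_distr_plus)
  finally show ?thesis .
qed

lemma integrable_continuous_bounded_support:
  fixes f :: "'a::euclidean_space \<Rightarrow> real"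
  assumes f: "continuous_on UNIV f" and supp: "\<And>x. norm x > \<rho> \<Longrightarrow> f x = 0"
  shows "integrable lebesgue f"
proof -
  have "integrable lborel (\<lambda>x. indicator (cball 0 \<rho>) x *\<^sub>R f x)"
    by (rule borel_integrable_compact) (auto intro: continuous_on_subset[OF f])
  moreover have "(\<lambda>x. indicator (cball 0 \<rho>) x *\<^sub>R f x) = f"
  proof (rule ext)
    show "indicator (cball 0 \<rho>) x *\<^sub>R f x = f x" for x using supp[of x] by (cases "\<rho> < norm x") auto
  qed
  ultimately have "integrable lborel f" by simp
  moreover have "f \<in> borel_measurable lborel" using borel_measurable_continuous_onI[OF f] by simp
  ultimately show ?thesis by (simp add: integrable_completion)
qed

text \<open>The integral of a difference quotient of \<open>\<phi>\<close> in direction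
  \<open>e\<close> vanishes by translation invariance. The quotients converge to
  \<open>g x \<bullet> e\<close> and are dominated, because \<open>\<phi>\<close> is Lipschitz with
  bounded support.\<close>

lemma integral_gradient_zero:
  fixes \<phi> :: "'a::euclidean_space \<Rightarrow> real"
  assumes g: "\<And>x. GDERIV \<phi> x :> g x" and cont: "continuous_on UNIV g"
    and supp: "\<And>x. norm x > \<rho> \<Longrightarrow> \<phi> x = 0"
  shows "(LINT x|lebesgue. g x \<bullet> e) = 0"
proof -
  have der: "(\<phi> has_derivative (\<lambda>h. h \<bullet> g x)) (at x)" for x using g[of x] by (simp add: gderiv_def)
  have cont_\<phi>: "continuous_on UNIV \<phi>"
    by (intro continuous_at_imp_continuous_on ballI has_derivative_continuous[OF der])
  have meas: "\<phi> \<in> borel_measurable borel" by (rule borel_measurable_continuous_onI[OF cont_\<phi>])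
  have int: "integrable lebesgue \<phi>" by (rule integrable_continuous_bounded_support[OF cont_\<phi> supp])
  have g0: "g x = 0" if "norm x > \<rho>" for x
  proof -
    have "open {x. \<rho> < norm x}" by (intro open_Collect_less continuous_intros)
    then have "(\<phi> has_derivative (\<lambda>h. 0)) (at x)"
      by (rule has_derivative_transform_within_open[OF has_derivative_const[of "0::real"]])
        (use that supp in auto)
    then have "(\<lambda>h. h \<bullet> g x) = (\<lambda>h. 0)" by (rule has_derivative_unique[OF der])
    from fun_cong[OF this, of "g x"] show ?thesis by simp
  qed
  have "bounded (g ` cball 0 \<rho>)"
    by (intro compact_imp_bounded compact_continuous_image continuous_on_subset[OF cont]) auto
  then obtain K where K: "\<forall>y\<in>g ` cball 0 \<rho>. norm y \<le> K" unfolding bounded_iff by blast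
  have gK: "norm (g x) \<le> \<bar>K\<bar>" for x
  proof (cases "norm x > \<rho>")
    case False
    then have "norm (g x) \<le> K" using K by simp
    then show ?thesis by simp
  qed (simp add: g0)
  have lip: "\<bar>\<phi> y - \<phi> x\<bar> \<le> \<bar>K\<bar> * norm (y - x)" for x y
  proof -
    have "norm (\<phi> y - \<phi> x) \<le> \<bar>K\<bar> * norm (y - x)"
    proof (rule differentiable_bound[of UNIV \<phi> "\<lambda>x h. h \<bullet> g x"])
      show "(\<phi> has_derivative (\<lambda>h. h \<bullet> g x)) (at x within UNIV)" for x using der by simp
      show "onorm (\<lambda>h. h \<bullet> g x) \<le> \<bar>K\<bar>" for x
      proof (rule onorm_le)
        fix h
        have "norm (h \<bullet> g x) \<le> norm h * norm (g x)" unfolding real_norm_def by (rule Cauchy_Schwarz_ineq2)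
        also have "\<dots> \<le> norm h * \<bar>K\<bar>" by (intro mult_left_mono gK) auto
        finally show "norm (h \<bullet> g x) \<le> \<bar>K\<bar> * norm h" by (simp add: mult.commute)
      qed
    qed auto
    then show ?thesis by simp
  qed
  define h where "h n = 1 / real (Suc n)" for n
  have h: "h n > 0" "h n \<le> 1" for n by (auto simp: h_def)
  have h_lim: "h \<longlonglongrightarrow> 0" unfolding h_def[abs_def] by (rule LIMSEQ_Suc[OF lim_1_over_n])
  define q where "q n x = (\<phi> (x + h n *\<^sub>R e) - \<phi> x) / h n" for n x
  have "(\<lambda>n. LINT x|lebesgue. q n x) \<longlonglongrightarrow> (LINT x|lebesgue. g x \<bullet> e)"
  proof (rule integral_dominated_convergence)
    have "(\<lambda>x. g x \<bullet> e) \<in> borel_measurable borel"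
      by (intro borel_measurable_continuous_onI continuous_intros cont)
    then show "(\<lambda>x. g x \<bullet> e) \<in> borel_measurable lebesgue" by (intro measurable_completion) simp
    have "q n \<in> borel_measurable borel" for n unfolding q_def[abs_def] using meas by measurable
    then show "q n \<in> borel_measurable lebesgue" for n by (intro measurable_completion) simp
    \<comment> \<open>Since \<open>h n \<le> 1\<close>, all quotients are supported in the ball
      enlarged by \<open>norm e\<close>.\<close>
    show "integrable lebesgue (\<lambda>x. (\<bar>K\<bar> * norm e) * indicator (cball 0 (\<rho> + norm e)) x)"
      by (intro integrable_mult_right) (auto simp: integrable_indicator_iff intro!: emeasure_bounded_finite[unfolded infinity_ennreal_def])
    show "AE x in lebesgue. (\<lambda>n. q n x) \<longlonglongrightarrow> g x \<bullet> e"
    proof (rule AE_I2)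
      fix x
      have "((\<lambda>t. \<phi> (x + t *\<^sub>R e)) has_derivative (\<lambda>t. (t *\<^sub>R e) \<bullet> g x)) (at 0)"
      proof (rule has_derivative_compose[of "\<lambda>t. x + t *\<^sub>R e" "\<lambda>t. t *\<^sub>R e"])
        show "((\<lambda>t. x + t *\<^sub>R e) has_derivative (\<lambda>t. t *\<^sub>R e)) (at 0)" by (auto intro!: derivative_eq_intros)
        show "(\<phi> has_derivative (\<lambda>h. h \<bullet> g x)) (at (x + 0 *\<^sub>R e))" using der[of x] by simp
      qed
      then have "((\<lambda>t. \<phi> (x + t *\<^sub>R e)) has_field_derivative (e \<bullet> g x)) (at 0)"
        by (simp add: has_field_derivative_def mult_commute_abs)
      then have "((\<lambda>t. (\<phi> (x + t *\<^sub>R e) - \<phi> x) / t) \<longlongrightarrow> e \<bullet> g x) (at 0)" by (simp add: DERIV_def)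
      moreover have "filterlim h (at 0) sequentially"
        unfolding filterlim_at using h_lim h(1) by (auto intro!: always_eventually simp: less_imp_neq[symmetric])
      ultimately show "(\<lambda>n. q n x) \<longlonglongrightarrow> g x \<bullet> e"
        unfolding q_def inner_commute[of "g x"] by (rule filterlim_compose)
    qed
    fix n
    have "norm (q n x) \<le> (\<bar>K\<bar> * norm e) * indicator (cball 0 (\<rho> + norm e)) x" for x
    proof (cases "norm x \<le> \<rho> + norm e")
      case True
      have "\<bar>\<phi> (x + h n *\<^sub>R e) - \<phi> x\<bar> \<le> \<bar>K\<bar> * (h n * norm e)" using lip[of "x + h n *\<^sub>R e" x] h[of n] by simp
      then show ?thesis using True h[of n] by (simp add: q_def abs_div field_simps)
    next
      case False
      have "h n * norm e \<le> norm e" using h[of n] by (simp add: mult_left_le_one_le)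
      moreover have nx: "norm x > \<rho>" using False norm_ge_zero[of e] by linarith
      ultimately have "norm (x + h n *\<^sub>R e) > \<rho>"
        using False norm_triangle_ineq4[of "x + h n *\<^sub>R e" "h n *\<^sub>R e"] h[of n] by auto
      then show ?thesis using nx supp by (simp add: q_def False)
    qed
    then show "AE x in lebesgue. norm (q n x) \<le> (\<bar>K\<bar> * norm e) * indicator (cball 0 (\<rho> + norm e)) x" by simp
  qed
  moreover have "(LINT x|lebesgue. q n x) = 0" for n
  proof -
    have int2: "integrable lebesgue (\<lambda>x. \<phi> (x + h n *\<^sub>R e))"
    proof (rule integrable_continuous_bounded_support[where \<rho> = "\<rho> + norm (h n *\<^sub>R e)"])
      show "continuous_on UNIV (\<lambda>x. \<phi> (x + h n *\<^sub>R e))"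
        by (intro continuous_on_compose2[OF cont_\<phi>] continuous_intros) auto
      fix x :: 'a assume "\<rho> + norm (h n *\<^sub>R e) < norm x"
      then have "norm (x + h n *\<^sub>R e) > \<rho>" using norm_triangle_ineq4[of "x + h n *\<^sub>R e" "h n *\<^sub>R e"] by simp
      then show "\<phi> (x + h n *\<^sub>R e) = 0" by (rule supp)
    qed
    then show ?thesis unfolding q_def using int integral_lebesgue_translation[OF meas, of "h n *\<^sub>R e"] by simp
  qed
  ultimately show ?thesis by (simp add: LIMSEQ_const_iff)
qed

section \<open>Axi-symmetric cut-off functions and the vanishing lemma\<close>

definition possq :: "real \<Rightarrow> real" where "possq t = (max 0 t)\<^sup>2"

lemma possq_derivative: "(possq has_real_derivative 2 * max 0 t) (at t)"
proof -
  consider "t > 0" | "t < 0" | "t = 0" by linarith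
  then show ?thesis
  proof cases
    case 1
    have "((\<lambda>t. t\<^sup>2) has_real_derivative 2 * max 0 t) (at t)" using 1 by (auto intro!: derivative_eq_intros)
    then show ?thesis
      by (rule has_field_derivative_transform_within_open[of _ _ _ "{0<..}"]) (use 1 in \<open>auto simp: possq_def\<close>)
  next
    case 2
    have "((\<lambda>t. 0) has_real_derivative 2 * max 0 t) (at t)" using 2 by auto
    then show ?thesis
      by (rule has_field_derivative_transform_within_open[of _ _ _ "{..<0}"]) (use 2 in \<open>auto simp: possq_def\<close>)
  next
    case 3
    have "((\<lambda>h. (possq (0 + h) - possq 0) / h) \<longlongrightarrow> 0) (at 0)"
    proof (rule Lim_null_comparison)
      show "\<forall>\<^sub>F h in at 0. norm ((possq (0 + h) - possq 0) / h) \<le> \<bar>h\<bar>"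
        by (intro always_eventually allI) (auto simp: possq_def max_def power2_eq_square)
      show "((\<lambda>h. \<bar>h\<bar>) \<longlongrightarrow> (0::real)) (at 0)" by (rule tendsto_rabs_zero) simp
    qed
    then show ?thesis by (simp add: 3 DERIV_def)
  qed
qed

definition radsq :: "real ^ 3 \<Rightarrow> real" where "radsq x = (x $ 1)\<^sup>2 + (x $ 2)\<^sup>2"

lemma cyl_eq: "cyl x = (sqrt (radsq x), x $ 3)"
  by (simp add: cyl_def radsq_def)

lemma cyl_eq_iff: "cyl x = cyl y \<longleftrightarrow> radsq x = radsq y \<and> x $ 3 = y $ 3"
  by (simp add: cyl_eq)

lemma GDERIV_component: "GDERIV (\<lambda>x :: real ^ 'n. x $ i) x :> axis i 1"
  using bounded_linear_imp_has_derivative[OF bounded_linear_vec_nth[of i]]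
  unfolding gderiv_def by (simp add: inner_axis)

lemma GDERIV_radsq: "GDERIV radsq x :> (2 * x $ 1) *\<^sub>R axis 1 1 + (2 * x $ 2) *\<^sub>R axis 2 1"
  unfolding radsq_def[abs_def] power2_eq_square
  by (rule GDERIV_subst[OF GDERIV_add[OF GDERIV_mult[OF GDERIV_component GDERIV_component]
          GDERIV_mult[OF GDERIV_component GDERIV_component]]])
    (simp add: scaleR_left_distrib[symmetric])

lemma continuous_radsq: "continuous_on S radsq"
  unfolding radsq_def[abs_def] by (intro continuous_intros)

text \<open>A \<open>C\<^sup>1\<close> function of \<open>(r\<^sup>2, z)\<close> that increases to the indicator function of \<open>(a,b) \<times> (c,d)\<close> as \<open>n \<rightarrow> \<infinity>\<close>.\<close>

definition bump :: "real \<Rightarrow> real \<Rightarrow> real \<Rightarrow> real \<Rightarrow> real \<Rightarrow> real \<Rightarrow> real \<Rightarrow> real" where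
  "bump a b c d n s z = 1 - exp (- n * (possq ((s - a) * (b - s)) * possq ((z - c) * (d - z))))"

text \<open>\<open>bump_s\<close> and \<open>bump_z\<close> are the partial derivatives of
  \<open>bump\<close> in \<open>s\<close> and in \<open>z\<close>.\<close>

definition bump_s :: "real \<Rightarrow> real \<Rightarrow> real \<Rightarrow> real \<Rightarrow> real \<Rightarrow> real \<Rightarrow> real \<Rightarrow> real" where
  "bump_s a b c d n s z = exp (- n * (possq ((s - a) * (b - s)) * possq ((z - c) * (d - z))))
     * (n * (2 * max 0 ((s - a) * (b - s)) * ((b - s) - (s - a)) * possq ((z - c) * (d - z))))"

definition bump_z :: "real \<Rightarrow> real \<Rightarrow> real \<Rightarrow> real \<Rightarrow> real \<Rightarrow> real \<Rightarrow> real \<Rightarrow> real" where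
  "bump_z a b c d n s z = exp (- n * (possq ((s - a) * (b - s)) * possq ((z - c) * (d - z))))
     * (n * (possq ((s - a) * (b - s)) * (2 * max 0 ((z - c) * (d - z)) * ((d - z) - (z - c)))))"

definition bump_grad :: "real \<Rightarrow> real \<Rightarrow> real \<Rightarrow> real \<Rightarrow> real \<Rightarrow> real ^ 3 \<Rightarrow> real ^ 3" where
  "bump_grad a b c d n x = (2 * x $ 1 * bump_s a b c d n (radsq x) (x $ 3)) *\<^sub>R axis 1 1
     + (2 * x $ 2 * bump_s a b c d n (radsq x) (x $ 3)) *\<^sub>R axis 2 1
     + bump_z a b c d n (radsq x) (x $ 3) *\<^sub>R axis 3 1"

lemma possq_quadratic_derivative:
  "((\<lambda>s. possq ((s - a) * (b - s))) has_real_derivative 2 * max 0 ((s - a) * (b - s)) * ((b - s) - (s - a))) (at s)"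
  by (rule DERIV_cong[OF DERIV_chain2[OF possq_derivative]]) (auto intro!: derivative_eq_intros)

lemma bump_GDERIV: "GDERIV (\<lambda>x. bump a b c d n (radsq x) (x $ 3)) x :> bump_grad a b c d n x"
proof -
  let ?P = "\<lambda>x :: real ^ 3. possq ((radsq x - a) * (b - radsq x)) * possq ((x $ 3 - c) * (d - x $ 3))"
  have P: "GDERIV ?P x :> possq ((radsq x - a) * (b - radsq x)) *\<^sub>R
      (2 * max 0 ((x $ 3 - c) * (d - x $ 3)) * ((d - x $ 3) - (x $ 3 - c))) *\<^sub>R axis 3 1 +
      possq ((x $ 3 - c) * (d - x $ 3)) *\<^sub>R
      (2 * max 0 ((radsq x - a) * (b - radsq x)) * ((b - radsq x) - (radsq x - a))) *\<^sub>R
        ((2 * x $ 1) *\<^sub>R axis 1 1 + (2 * x $ 2) *\<^sub>R axis 2 1)"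
    by (rule GDERIV_mult[OF GDERIV_DERIV_compose[OF GDERIV_radsq possq_quadratic_derivative]
          GDERIV_DERIV_compose[OF GDERIV_component possq_quadratic_derivative]])
  have "((\<lambda>t. 1 - exp (- n * t)) has_real_derivative n * exp (- n * ?P x)) (at (?P x))"
    by (auto intro!: derivative_eq_intros)
  from GDERIV_DERIV_compose[OF P this] show ?thesis
    unfolding bump_def
    by (rule GDERIV_subst) (simp add: bump_grad_def bump_s_def bump_z_def scaleR_add_right algebra_simps)
qed

lemma continuous_possq: "continuous_on S possq"
  by (intro continuous_at_imp_continuous_on ballI DERIV_isCont[OF possq_derivative])

lemma continuous_bump:
  assumes "continuous_on S f" "continuous_on S g"
  shows "continuous_on S (\<lambda>x. bump a b c d n (f x) (g x))"
    "continuous_on S (\<lambda>x. bump_s a b c d n (f x) (g x))"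
    "continuous_on S (\<lambda>x. bump_z a b c d n (f x) (g x))"
  unfolding bump_def bump_s_def bump_z_def
  by (intro continuous_intros continuous_on_max continuous_on_compose2[OF continuous_possq[of UNIV]] assms subset_UNIV)+

lemma continuous_bump_grad: "continuous_on S (bump_grad a b c d n)"
  unfolding bump_grad_def[abs_def]
  by (intro continuous_intros continuous_bump continuous_radsq)

definition tube :: "real \<Rightarrow> real \<Rightarrow> real \<Rightarrow> real \<Rightarrow> (real ^ 3) set" where
  "tube a b c d = {x. a \<le> radsq x \<and> radsq x \<le> b \<and> c \<le> x $ 3 \<and> x $ 3 \<le> d}"

lemma bump_outside:
  assumes "a < b" "c < d" "x \<notin> tube a b c d"
  shows "bump a b c d n (radsq x) (x $ 3) = 0" "bump_s a b c d n (radsq x) (x $ 3) = 0"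
    "bump_z a b c d n (radsq x) (x $ 3) = 0" "bump_grad a b c d n x = 0"
proof -
  have neg: "(t - u) * (v - t) \<le> 0" if "u < v" "t < u \<or> v < t" for t u v :: real
    using that by (auto intro: mult_nonpos_nonneg mult_nonneg_nonpos)
  have "(radsq x - a) * (b - radsq x) \<le> 0 \<or> (x $ 3 - c) * (d - x $ 3) \<le> 0"
    using assms neg[of a b "radsq x"] neg[of c d "x $ 3"] unfolding tube_def by auto
  then show "bump a b c d n (radsq x) (x $ 3) = 0"
    and 1: "bump_s a b c d n (radsq x) (x $ 3) = 0" and 2: "bump_z a b c d n (radsq x) (x $ 3) = 0"
    by (auto simp: bump_def bump_s_def bump_z_def possq_def max_def)
  show "bump_grad a b c d n x = 0" by (simp add: bump_grad_def 1 2)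
qed

lemma compact_tube: "compact (tube a b c d)"
proof -
  have "closed (tube a b c d)"
    unfolding tube_def by (intro closed_Collect_conj closed_Collect_le continuous_intros continuous_radsq)
  moreover have "bounded (tube a b c d)"
    unfolding bounded_iff
  proof (intro exI ballI)
    fix x assume x: "x \<in> tube a b c d"
    have "(norm x)\<^sup>2 = radsq x + (x $ 3)\<^sup>2"
      by (simp add: norm_vec_def L2_set_def sum_3 radsq_def)
    also have "\<dots> \<le> \<bar>b\<bar> + (\<bar>c\<bar> + \<bar>d\<bar>)\<^sup>2"
    proof (rule add_mono)
      show "radsq x \<le> \<bar>b\<bar>" using x by (auto simp: tube_def)
      have "\<bar>x $ 3\<bar> \<le> \<bar>c\<bar> + \<bar>d\<bar>" using x by (auto simp: tube_def)
      from power_mono[OF this, of 2] show "(x $ 3)\<^sup>2 \<le> (\<bar>c\<bar> + \<bar>d\<bar>)\<^sup>2" by simp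
    qed
    finally show "norm x \<le> sqrt (\<bar>b\<bar> + (\<bar>c\<bar> + \<bar>d\<bar>)\<^sup>2)" by (rule real_le_rsqrt)
  qed
  ultimately show ?thesis by (simp add: compact_eq_bounded_closed)
qed

lemma bump_tendsto:
  assumes "a < b" "c < d"
  shows "(\<lambda>n. bump a b c d (real n) (radsq x) (x $ 3))
    \<longlonglongrightarrow> indicator {x. a < radsq x \<and> radsq x < b \<and> c < x $ 3 \<and> x $ 3 < d} x"
proof (cases "a < radsq x \<and> radsq x < b \<and> c < x $ 3 \<and> x $ 3 < d")
  case True
  define p where "p = possq ((radsq x - a) * (b - radsq x)) * possq ((x $ 3 - c) * (d - x $ 3))"
  have p: "p > 0" using True unfolding p_def possq_def by (intro mult_pos_pos) (auto simp: max_def)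
  have "(\<lambda>n. exp (- p) ^ n) \<longlonglongrightarrow> 0" by (rule LIMSEQ_power_zero) (use p in simp)
  then have "(\<lambda>n. 1 - exp (- p) ^ n) \<longlonglongrightarrow> 1 - 0" by (rule tendsto_diff[OF tendsto_const])
  then show ?thesis using True by (simp add: bump_def p_def[symmetric] exp_of_nat_mult[symmetric])
next
  case False
  have neg: "(t - u) * (v - t) \<le> 0" if "u < v" "t \<le> u \<or> v \<le> t" for t u v :: real
    using that by (auto intro: mult_nonpos_nonneg mult_nonneg_nonpos)
  have "(radsq x - a) * (b - radsq x) \<le> 0 \<or> (x $ 3 - c) * (d - x $ 3) \<le> 0"
    using assms False neg[of a b "radsq x"] neg[of c d "x $ 3"] by (auto simp: not_less)
  then have "bump a b c d (real n) (radsq x) (x $ 3) = 0" for n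
    by (auto simp: bump_def possq_def max_def)
  then show ?thesis using False by simp
qed

lemma bump_bounds: "n \<ge> 0 \<Longrightarrow> 0 \<le> bump a b c d n s z \<and> bump a b c d n s z \<le> 1"
  by (simp add: bump_def possq_def)

definition otube :: "real \<Rightarrow> real \<Rightarrow> real \<Rightarrow> real \<Rightarrow> (real ^ 3) set" where
  "otube a b c d = {x. a < radsq x \<and> radsq x < b \<and> c < x $ 3 \<and> x $ 3 < d}"

lemma otube_tube: "otube a b c d \<subseteq> tube a b c d"
  by (auto simp: otube_def tube_def)

lemma open_otube: "open (otube a b c d)"
  unfolding otube_def by (intro open_Collect_conj open_Collect_less continuous_intros continuous_radsq)

text \<open>This map separates the circles around the axis just as \<open>cyl\<close> does, but it
  is polynomial and hence smooth across the axis.\<close>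

definition radz :: "real ^ 3 \<Rightarrow> real \<times> real" where "radz x = (radsq x, x $ 3)"

lemma continuous_radz: "continuous_on S radz"
  unfolding radz_def[abs_def] by (intro continuous_intros continuous_radsq)

lemma sets_lebesgue_radz_vimage: "A \<in> sets borel \<Longrightarrow> radz -` A \<in> sets lebesgue"
  using measurable_sets[OF borel_measurable_continuous_onI[OF continuous_radz], of A] by simp

lemma radz_box_otube:
  "otube a b c d \<inter> radz -` box p p' = otube (max a (fst p)) (min b (fst p')) (max c (snd p)) (min d (snd p'))"
  by (cases p; cases p') (auto simp: otube_def radz_def box_def Basis_prod_def)

text \<open>The integral over \<open>radz -` A\<close> vanishes for boxes \<open>A\<close>, hence for all Borel sets; since a closed subset
  of the set \<open>{F > 0}\<close> has a Borel saturation inside \<open>{F > 0}\<close>, the latter is a null set.\<close>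

lemma tube_positive_part_null:
  fixes F :: "real ^ 3 \<Rightarrow> real"
  assumes F: "integrable lebesgue F"
    and sat: "\<And>x y. x \<in> otube a b c d \<Longrightarrow> y \<in> otube a b c d \<Longrightarrow> radz x = radz y \<Longrightarrow> F x = F y"
    and zero: "\<And>a' b' c' d'. otube a' b' c' d' \<subseteq> otube a b c d \<Longrightarrow> (LINT x:otube a' b' c' d'|lebesgue. F x) = 0"
  shows "{x \<in> otube a b c d. F x > 0} \<in> null_sets lebesgue"
proof -
  let ?O = "otube a b c d"
  have O: "?O \<in> sets lebesgue" using open_otube by simp
  have meas [measurable]: "F \<in> borel_measurable lebesgue" using F by auto
  have setint: "set_integrable lebesgue S F" if "S \<in> sets lebesgue" for S
    unfolding set_integrable_def by (rule integrable_mult_indicator[OF that F])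
  have borel_zero: "(LINT x:?O \<inter> radz -` A|lebesgue. F x) = 0" if A: "A \<in> sets borel" for A
  proof -
    have A': "A \<in> sigma_sets UNIV (range (\<lambda>(a, b). box a b :: (real \<times> real) set))"
      using A unfolding borel_eq_box by simp
    have sb: "S \<in> sets borel" if "S \<in> sigma_sets UNIV (range (\<lambda>(a, b). box a b :: (real \<times> real) set))" for S
      using that unfolding borel_eq_box by simp
    have G: "Int_stable (range (\<lambda>(a, b). box a b :: (real \<times> real) set))"
      "range (\<lambda>(a, b). box a b :: (real \<times> real) set) \<subseteq> Pow UNIV"
      by (auto simp: Int_stable_def box_Int_box)
    show ?thesis
      using G A'
    \<comment> \<open>Dynkin's argument: boxes are stable under intersection and generate the Borel
      sets, and the sets with zero integral are closed under complements and disjoint countable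
      unions.\<close>
    proof (induction A rule: sigma_sets_induct_disjoint)
      case (basic A)
      then obtain p p' where "A = box p p'" by auto
      then have eq: "?O \<inter> radz -` A = otube (max a (fst p)) (min b (fst p')) (max c (snd p)) (min d (snd p'))"
        by (simp only: radz_box_otube)
      show ?case unfolding eq by (rule zero) (auto simp: otube_def)
    next
      case empty
      show ?case by (simp add: set_lebesgue_integral_def)
    next
      case (compl A)
      have A: "radz -` A \<in> sets lebesgue" by (rule sets_lebesgue_radz_vimage[OF sb[OF compl(1)]])
      have "(LINT x:(?O \<inter> radz -` A) \<union> (?O \<inter> radz -` (UNIV - A))|lebesgue. F x)
        = (LINT x:?O \<inter> radz -` A|lebesgue. F x) + (LINT x:?O \<inter> radz -` (UNIV - A)|lebesgue. F x)"
        by (rule set_integral_Un) (use O A in \<open>auto intro!: setint simp: vimage_Diff\<close>)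
      moreover have "(?O \<inter> radz -` A) \<union> (?O \<inter> radz -` (UNIV - A)) = ?O" by auto
      ultimately show ?case using zero[of a b c d] compl by simp
    next
      case (union A)
      have "(LINT x:(\<Union>i. ?O \<inter> radz -` A i)|lebesgue. F x) = (\<Sum>i. (LINT x:?O \<inter> radz -` A i|lebesgue. F x))"
      proof (rule lebesgue_integral_countable_add)
        have m: "?O \<inter> radz -` A i \<in> sets lebesgue" for i
          using union(2) by (intro sets.Int O sets_lebesgue_radz_vimage sb) auto
        then show "?O \<inter> radz -` A i \<in> sets lebesgue" for i .
        show "(?O \<inter> radz -` A i) \<inter> (?O \<inter> radz -` A j) = {}" if "i \<noteq> j" for i j
        proof -
          have "A i \<inter> A j = {}" using union(1) that unfolding disjoint_family_on_def by blast
          then show ?thesis by blast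
        qed
        show "set_integrable lebesgue (\<Union>i. ?O \<inter> radz -` A i) F" by (intro setint sets.countable_UN) (use m in blast)
      qed
      also have "\<dots> = 0" by (simp only: union(3) suminf_zero)
      also have "(\<Union>i. ?O \<inter> radz -` A i) = ?O \<inter> radz -` (\<Union>i. A i)" by (simp only: vimage_UN Int_UN_distrib)
      finally show ?case .
    qed
  qed
  define S where "S = {x \<in> ?O. F x > 0}"
  have S: "S \<in> sets lebesgue"
  proof -
    have "{x \<in> space lebesgue. F x > 0} \<in> sets lebesgue" by measurable
    then have "?O \<inter> {x. F x > 0} \<in> sets lebesgue" using O by auto
    moreover have "?O \<inter> {x. F x > 0} = S" by (auto simp: S_def)
    ultimately show ?thesis by simp
  qed
  have "emeasure lebesgue S \<le> ennreal e" if e: "e > 0" for e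
  proof -
    \<comment> \<open>Inner regularity supplies a compact \<open>T\<close>. \<open>S\<close> itself
      need not be the preimage of a Borel set under \<open>radz\<close>, as \<open>F\<close> is
      merely Lebesgue measurable.\<close>
    obtain T where T: "closed T" "T \<subseteq> S" "S - T \<in> lmeasurable" "emeasure lebesgue (S - T) < ennreal e"
      using sets_lebesgue_inner_closed[OF S e] by metis
    have "T \<subseteq> tube a b c d" using T(2) otube_tube[of a b c d] by (auto simp: S_def)
    then have "compact T" using T(1) compact_tube[of a b c d]
      by (meson bounded_subset compact_eq_bounded_closed)
    then have "closed (radz ` T)" by (intro compact_imp_closed compact_continuous_image continuous_radz)
    then have A: "radz ` T \<in> sets borel" by simp
    define W where "W = ?O \<inter> radz -` (radz ` T)"
    have W: "W \<in> sets lebesgue" unfolding W_def by (intro sets.Int O sets_lebesgue_radz_vimage A)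
    have WS: "F x > 0" if "x \<in> W" for x
    proof -
      have "radz x \<in> radz ` T" using that by (simp add: W_def)
      then obtain t where t: "radz x = radz t" "t \<in> T" by (rule imageE)
      then have "t \<in> ?O" "F t > 0" using T(2) unfolding S_def by blast+
      moreover have "x \<in> ?O" using that by (simp add: W_def)
      ultimately show ?thesis using sat[of x t] t(1) by simp
    qed
    have TW: "T \<subseteq> W" using T(2) unfolding W_def S_def by blast
    have "(LINT x|lebesgue. indicator W x *\<^sub>R F x) = 0"
      using borel_zero[OF A] by (simp add: W_def set_lebesgue_integral_def)
    moreover have "integrable lebesgue (\<lambda>x. indicator W x *\<^sub>R F x)" using setint[OF W] by (simp add: set_integrable_def)
    moreover have "AE x in lebesgue. 0 \<le> indicator W x *\<^sub>R F x"
      by (rule AE_I2) (use WS in \<open>auto simp: indicator_def less_imp_le\<close>)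
    ultimately have "AE x in lebesgue. indicator W x *\<^sub>R F x = 0"
      by (simp only: integral_nonneg_eq_0_iff_AE)
    then have "AE x in lebesgue. x \<notin> W"
    proof eventually_elim
      fix x assume "indicator W x *\<^sub>R F x = 0"
      then show "x \<notin> W" using WS[of x] by (cases "x \<in> W") auto
    qed
    then have "W \<in> null_sets lebesgue" using W by (simp add: AE_iff_null_sets)
    moreover have Tm: "T \<in> sets lebesgue" using T(1) by simp
    ultimately have "T \<in> null_sets lebesgue" using null_sets_subset[OF _ _ TW] by blast
    then have "emeasure lebesgue T = 0" by (rule null_setsD1)
    moreover have "emeasure lebesgue S \<le> emeasure lebesgue (S - T) + emeasure lebesgue T"
    proof -
      have "emeasure lebesgue ((S - T) \<union> T) \<le> emeasure lebesgue (S - T) + emeasure lebesgue T"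
        by (rule emeasure_subadditive) (use S Tm in auto)
      moreover have "(S - T) \<union> T = S" using T(2) by auto
      ultimately show ?thesis by simp
    qed
    ultimately show ?thesis using T(4) by simp
  qed
  then have le: "emeasure lebesgue S \<le> 0 + ennreal e" if "e > 0" for e using that by simp
  have "emeasure lebesgue S \<le> 0" by (rule ennreal_le_epsilon) (rule le)
  then have "emeasure lebesgue S = 0" by simp
  then have "S \<in> null_sets lebesgue" by (rule null_setsI[OF _ S])
  then show ?thesis by (simp only: S_def)
qed

text \<open>Otherwise points outside \<open>\<Omega>\<close> approach \<open>x\<close> in
  \<open>r\<^sup>2\<close> and \<open>z\<close>. Their limit point lies on the circle through
  \<open>x\<close>, hence in \<open>\<Omega>\<close> by axial symmetry, and outside
  \<open>\<Omega>\<close> by openness. Rational parameters make the resulting cover of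
  \<open>\<Omega>\<close> countable.\<close>

lemma otube_neighbourhood:
  assumes \<Omega>: "open \<Omega>" "axisymmetric_set \<Omega>" and x: "x \<in> \<Omega>"
  obtains a b c d where "a \<in> \<rat>" "b \<in> \<rat>" "c \<in> \<rat>" "d \<in> \<rat>" "x \<in> otube a b c d" "tube a b c d \<subseteq> \<Omega>"
proof (rule ccontr)
  assume no: "\<not> thesis"
  have "\<exists>y. y \<notin> \<Omega> \<and> \<bar>radsq y - radsq x\<bar> \<le> 1 / Suc n \<and> \<bar>y $ 3 - x $ 3\<bar> \<le> 1 / Suc n" for n
  proof -
    let ?e = "1 / real (Suc n)"
    obtain a where a: "a \<in> \<rat>" "radsq x - ?e < a" "a < radsq x" using Rats_dense_in_real[of "radsq x - ?e" "radsq x"] by auto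
    obtain b where b: "b \<in> \<rat>" "radsq x < b" "b < radsq x + ?e" using Rats_dense_in_real[of "radsq x" "radsq x + ?e"] by auto
    obtain c where c: "c \<in> \<rat>" "x $ 3 - ?e < c" "c < x $ 3" using Rats_dense_in_real[of "x $ 3 - ?e" "x $ 3"] by auto
    obtain d where d: "d \<in> \<rat>" "x $ 3 < d" "d < x $ 3 + ?e" using Rats_dense_in_real[of "x $ 3" "x $ 3 + ?e"] by auto
    have "x \<in> otube a b c d" using a b c d by (simp add: otube_def)
    then have "\<not> tube a b c d \<subseteq> \<Omega>" using no that[OF a(1) b(1) c(1) d(1)] by blast
    then obtain y where "y \<in> tube a b c d" "y \<notin> \<Omega>" by blast
    then show ?thesis using a b c d by (intro exI[of _ y]) (auto simp: tube_def)
  qed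
  then obtain y where y: "\<And>n. y n \<notin> \<Omega>" "\<And>n. \<bar>radsq (y n) - radsq x\<bar> \<le> 1 / Suc n" "\<And>n. \<bar>y n $ 3 - x $ 3\<bar> \<le> 1 / Suc n"
    by metis
  have "y n \<in> tube (radsq x - 1) (radsq x + 1) (x $ 3 - 1) (x $ 3 + 1)" for n
  proof -
    have "1 / real (Suc n) \<le> 1" by simp
    then show ?thesis using y(2)[of n] y(3)[of n] unfolding tube_def mem_Collect_eq by linarith
  qed
  then obtain l r where l: "strict_mono r" "(y \<circ> r) \<longlonglongrightarrow> l"
    using compact_tube unfolding compact_def by metis
  have null: "(\<lambda>n. 1 / real (Suc (r n))) \<longlonglongrightarrow> 0"
    using LIMSEQ_subseq_LIMSEQ[OF LIMSEQ_Suc[OF lim_1_over_n] l(1)] by (simp add: o_def)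
  have "isCont radsq l" using continuous_radsq[of UNIV] by (simp add: continuous_on_eq_continuous_at)
  from isCont_tendsto_compose[OF this l(2)] have l1: "(\<lambda>n. radsq (y (r n))) \<longlonglongrightarrow> radsq l" by (simp add: o_def)
  have l2: "(\<lambda>n. radsq (y (r n)) - radsq x) \<longlonglongrightarrow> 0"
    by (rule Lim_null_comparison[OF always_eventually null]) (use y(2) in simp)
  have 1: "radsq l = radsq x" by (rule LIMSEQ_unique[OF l1 LIM_zero_cancel[OF l2]])
  have l3: "(\<lambda>n. y (r n) $ 3) \<longlonglongrightarrow> l $ 3" using tendsto_vec_nth[OF l(2)] by (simp add: o_def)
  have l4: "(\<lambda>n. y (r n) $ 3 - x $ 3) \<longlonglongrightarrow> 0"
    by (rule Lim_null_comparison[OF always_eventually null]) (use y(3) in simp)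
  have 2: "l $ 3 = x $ 3" by (rule LIMSEQ_unique[OF l3 LIM_zero_cancel[OF l4]])
  have "l \<in> - \<Omega>"
    by (rule closed_sequentially[OF _ _ l(2)]) (use \<Omega>(1) y(1) in auto)
  moreover have "cyl x = cyl l" using 1 2 by (simp add: cyl_eq_iff)
  ultimately show False using \<Omega>(2) x unfolding axisymmetric_set_def by blast
qed

text \<open>The fundamental lemma of the calculus of variations for functions of
  \<open>cyl x\<close>, tested with cut-offs of \<open>(r\<^sup>2, z)\<close> only. As
  \<open>n\<close> grows, \<open>bump\<close> gives zero integrals over small tubes; this settles
  the positive parts of \<open>f\<close> and of \<open>- f\<close>, and a countable cover
  finishes.\<close>

lemma axisymmetric_zero_AE:
  assumes \<Omega>: "open \<Omega>" "axisymmetric_set \<Omega>"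
    and int: "\<And>a b c d. tube a b c d \<subseteq> \<Omega> \<Longrightarrow> integrable lebesgue (\<lambda>x. indicator (tube a b c d) x * f (cyl x) :: real)"
    and orth: "\<And>a b c d n. a < b \<Longrightarrow> c < d \<Longrightarrow> tube a b c d \<subseteq> \<Omega> \<Longrightarrow> n \<ge> 0 \<Longrightarrow>
      (LINT x|lebesgue_on \<Omega>. f (cyl x) * bump a b c d n (radsq x) (x $ 3)) = 0"
  shows "AE x in lebesgue_on \<Omega>. f (cyl x) = 0"
proof -
  have \<Omega>m: "\<Omega> \<inter> space lebesgue \<in> sets lebesgue" using \<Omega>(1) by simp
  have null: "{x \<in> otube a b c d. f (cyl x) \<noteq> 0} \<in> null_sets lebesgue" if sub: "tube a b c d \<subseteq> \<Omega>" for a b c d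
  proof -
    define F where "F x = indicator (tube a b c d) x * f (cyl x)" for x
    have F: "integrable lebesgue F" using int[OF sub] by (simp add: F_def[abs_def])
    then have [measurable]: "F \<in> borel_measurable lebesgue" by auto
    have F_eq: "F x = f (cyl x)" if "x \<in> otube a b c d" for x
      using that otube_tube[of a b c d] unfolding F_def by (metis indicator_simps(1) mult_1 subsetD)
    have sat: "F x = F y" if "x \<in> otube a b c d" "y \<in> otube a b c d" "radz x = radz y" for x y
      using that F_eq cyl_eq_iff[of x y] by (simp add: radz_def)
    have otube_zero: "(LINT x:otube a' b' c' d'|lebesgue. F x) = 0" if sub': "tube a' b' c' d' \<subseteq> tube a b c d" for a' b' c' d'
    proof (cases "a' < b' \<and> c' < d'")
      case True
      have z: "(LINT x|lebesgue. F x * bump a' b' c' d' n (radsq x) (x $ 3)) = 0" if "n \<ge> 0" for n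
      proof -
        have "F x * bump a' b' c' d' n (radsq x) (x $ 3)
          = indicator \<Omega> x *\<^sub>R (f (cyl x) * bump a' b' c' d' n (radsq x) (x $ 3))" for x
        proof (cases "x \<in> tube a' b' c' d'")
          case True
          then have "x \<in> tube a b c d" "x \<in> \<Omega>" using sub sub' by blast+
          then show ?thesis by (simp add: F_def)
        qed (use True in \<open>simp add: bump_outside\<close>)
        then have "(LINT x|lebesgue. F x * bump a' b' c' d' n (radsq x) (x $ 3))
          = (LINT x|lebesgue_on \<Omega>. f (cyl x) * bump a' b' c' d' n (radsq x) (x $ 3))"
          by (simp only: integral_restrict_space[OF \<Omega>m])
        also have "\<dots> = 0" using True sub sub' that by (intro orth) auto
        finally show ?thesis .
      qed
      have "(\<lambda>n. LINT x|lebesgue. F x * bump a' b' c' d' (real n) (radsq x) (x $ 3))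
        \<longlonglongrightarrow> (LINT x|lebesgue. F x * indicator (otube a' b' c' d') x)"
      proof (rule integral_dominated_convergence[where w = "\<lambda>x. norm (F x)"])
        show "(\<lambda>x. F x * indicator (otube a' b' c' d') x) \<in> borel_measurable lebesgue"
          using open_otube by (intro borel_measurable_times borel_measurable_indicator) auto
        show "(\<lambda>x. F x * bump a' b' c' d' (real n) (radsq x) (x $ 3)) \<in> borel_measurable lebesgue" for n
        proof (intro borel_measurable_times)
          have "(\<lambda>x. bump a' b' c' d' (real n) (radsq x) (x $ 3)) \<in> borel_measurable borel"
            by (intro borel_measurable_continuous_onI continuous_bump continuous_radsq continuous_intros)
          then show "(\<lambda>x. bump a' b' c' d' (real n) (radsq x) (x $ 3)) \<in> borel_measurable lebesgue"
            by (intro measurable_completion) simp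
        qed simp
        show "integrable lebesgue (\<lambda>x. norm (F x))" using F by (rule integrable_norm)
        show "AE x in lebesgue. (\<lambda>n. F x * bump a' b' c' d' (real n) (radsq x) (x $ 3)) \<longlonglongrightarrow> F x * indicator (otube a' b' c' d') x"
          by (intro AE_I2 tendsto_mult tendsto_const) (use bump_tendsto True in \<open>auto simp: otube_def\<close>)
        show "AE x in lebesgue. norm (F x * bump a' b' c' d' (real n) (radsq x) (x $ 3)) \<le> norm (F x)" for n
          by (rule AE_I2) (simp add: abs_mult mult_left_le bump_bounds)
      qed
      then have "(LINT x|lebesgue. F x * indicator (otube a' b' c' d') x) = 0"
        by (simp add: z LIMSEQ_const_iff)
      then show ?thesis by (simp add: set_lebesgue_integral_def mult.commute)
    next
      case False
      then have "otube a' b' c' d' = {}" by (auto simp: otube_def)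
      then show ?thesis by (simp add: set_lebesgue_integral_def)
    qed
    have zero: "(LINT x:otube a' b' c' d'|lebesgue. F x) = 0" if s: "otube a' b' c' d' \<subseteq> otube a b c d" for a' b' c' d'
    proof -
      \<comment> \<open>The parameters of the smaller open tube may leave the given ranges, for
        instance when it is empty. Cutting them off does not change the set and keeps the closed
        tube inside.\<close>
      have eq: "otube a' b' c' d' = otube (max a' a) (min b' b) (max c' c) (min d' d)"
        using s by (auto simp: otube_def)
      have "tube (max a' a) (min b' b) (max c' c) (min d' d) \<subseteq> tube a b c d" by (auto simp: tube_def)
      then show ?thesis unfolding eq by (rule otube_zero)
    qed
    have "{x \<in> otube a b c d. F x > 0} \<in> null_sets lebesgue"
      by (rule tube_positive_part_null[OF F sat zero])
    moreover have "{x \<in> otube a b c d. - F x > 0} \<in> null_sets lebesgue"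
    proof (rule tube_positive_part_null)
      show "integrable lebesgue (\<lambda>x. - F x)" using F by simp
      show "- F x = - F y" if "x \<in> otube a b c d" "y \<in> otube a b c d" "radz x = radz y" for x y
        using sat[OF that] by simp
      show "(LINT x:otube a' b' c' d'|lebesgue. - F x) = 0" if "otube a' b' c' d' \<subseteq> otube a b c d" for a' b' c' d'
        using zero[OF that] by (simp add: set_lebesgue_integral_def)
    qed
    ultimately have "{x \<in> otube a b c d. F x > 0} \<union> {x \<in> otube a b c d. - F x > 0} \<in> null_sets lebesgue" by (rule null_sets.Un)
    moreover have "{x \<in> otube a b c d. F x > 0} \<union> {x \<in> otube a b c d. - F x > 0} = {x \<in> otube a b c d. f (cyl x) \<noteq> 0}"
      using F_eq by force
    ultimately show ?thesis by simp
  qed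
  define I where "I = {(a, b, c, d). a \<in> \<rat> \<and> b \<in> \<rat> \<and> c \<in> \<rat> \<and> d \<in> \<rat> \<and> tube a b c d \<subseteq> \<Omega>}"
  have "I \<subseteq> \<rat> \<times> \<rat> \<times> \<rat> \<times> \<rat>" by (auto simp: I_def)
  then have "countable I" by (rule countable_subset) (intro countable_SIGMA countable_rat)
  then have N: "(\<Union>(a, b, c, d)\<in>I. {x \<in> otube a b c d. f (cyl x) \<noteq> 0}) \<in> null_sets lebesgue"
    by (rule null_sets_UN') (auto simp: I_def intro: null)
  have "{x \<in> space lebesgue. \<not> (x \<in> \<Omega> \<longrightarrow> f (cyl x) = 0)} \<subseteq> (\<Union>(a, b, c, d)\<in>I. {x \<in> otube a b c d. f (cyl x) \<noteq> 0})"
  proof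
    fix x assume x: "x \<in> {x \<in> space lebesgue. \<not> (x \<in> \<Omega> \<longrightarrow> f (cyl x) = 0)}"
    then have "x \<in> \<Omega>" by simp
    then obtain a b c d where "a \<in> \<rat>" "b \<in> \<rat>" "c \<in> \<rat>" "d \<in> \<rat>" "x \<in> otube a b c d" "tube a b c d \<subseteq> \<Omega>"
      by (rule otube_neighbourhood[OF \<Omega>])
    then have "(a, b, c, d) \<in> I" "x \<in> {x \<in> otube a b c d. f (cyl x) \<noteq> 0}" using x by (simp_all add: I_def)
    then show "x \<in> (\<Union>(a, b, c, d)\<in>I. {x \<in> otube a b c d. f (cyl x) \<noteq> 0})"
      by (intro UN_I[of "(a, b, c, d)"]) simp_all
  qed
  then have "AE x in lebesgue. x \<in> \<Omega> \<longrightarrow> f (cyl x) = 0" by (intro AE_I'[OF N])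
  then show ?thesis using \<Omega>m by (simp add: AE_restrict_space_iff)
qed

section \<open>The coefficients\<close>

text \<open>Near 0 the integrand is of order \<open>t powr (\<gamma> - 2)\<close>, integrable
  because \<open>\<gamma> > 1\<close>. Without this, \<open>integral\<close> in
  \<open>enthalpy1\<close> would return its default 0.\<close>

lemma enthalpy_integrand_integrable:
  assumes P: "pressure_law P \<gamma> K" and s: "s > 0"
  shows "(\<lambda>t. deriv P t / t) integrable_on {0..s}"
proof -
  have cont: "continuous_on {0<..} (deriv P)" and pos: "\<And>t. t > 0 \<Longrightarrow> deriv P t > 0" and \<gamma>: "6/5 < \<gamma>" "\<gamma> < 2"
    and lim: "((\<lambda>t. t powr (1 - \<gamma>) * deriv P t) \<longlongrightarrow> K) (at_right 0)"
    using P by (auto simp: pressure_law_def)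
  have "\<forall>\<^sub>F t in at_right 0. t powr (1 - \<gamma>) * deriv P t < K + 1"
    using order_tendstoD(2)[OF lim, of "K + 1"] by simp
  then obtain d where d: "d > 0" "\<And>t. 0 < t \<Longrightarrow> t < d \<Longrightarrow> t powr (1 - \<gamma>) * deriv P t < K + 1"
    unfolding eventually_at_right_field by blast
  define e where "e = min (d / 2) s"
  have e: "0 < e" "e \<le> s" "e < d" using d s by (auto simp: e_def)
  have contk: "continuous_on {0<..} (\<lambda>t. deriv P t / t)" by (intro continuous_intros cont) auto
  have bound: "norm (deriv P t / t) \<le> (K + 1) * t powr (\<gamma> - 2)" if t: "t \<in> {0<..e}" for t
  proof -
    have t0: "t > 0" "t < d" using t e by auto
    have le: "t powr (\<gamma> - 2) * (t powr (1 - \<gamma>) * deriv P t) \<le> t powr (\<gamma> - 2) * (K + 1)"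
      using d(2)[OF t0] by (intro mult_left_mono) auto
    have eq: "t powr (\<gamma> - 2) * (t powr (1 - \<gamma>) * deriv P t) = deriv P t / t"
      using t0 by (simp add: mult.assoc[symmetric] powr_add[symmetric] powr_minus_divide)
    have n: "norm (deriv P t / t) = deriv P t / t" using pos[OF t0(1)] t0 by simp
    show ?thesis using le unfolding n eq by (simp only: mult.commute[of "K + 1"])
  qed
  have "(\<lambda>t. deriv P t / t) integrable_on {0<..e}"
  proof (rule measurable_bounded_by_integrable_imp_integrable[OF _ _ bound])
    show "(\<lambda>t. deriv P t / t) \<in> borel_measurable (lebesgue_on {0<..e})"
      by (rule continuous_imp_measurable_on_sets_lebesgue[OF continuous_on_subset[OF contk]]) auto
    have "(\<lambda>t. t powr (\<gamma> - 2)) integrable_on {0<..e}" using \<gamma> e by (intro integrable_on_powr_from_0') auto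
    from integrable_cmul[OF this, of "K + 1"]
    show "(\<lambda>t. (K + 1) * t powr (\<gamma> - 2)) integrable_on {0<..e}" by simp
  qed auto
  then have 1: "(\<lambda>t. deriv P t / t) integrable_on {0..e}"
    by (rule integrable_spike_set) (auto intro: negligible_subset[of "{0}"])
  have 2: "(\<lambda>t. deriv P t / t) integrable_on {e..s}"
    using e by (intro integrable_continuous_real continuous_on_subset[OF contk]) auto
  show ?thesis
    by (rule Henstock_Kurzweil_Integration.integrable_combine[OF less_imp_le[OF e(1)] e(2) 1 2])
qed

text \<open>The base point \<open>s / 2\<close> keeps the fundamental theorem of calculus away from
  the singular end 0; the rest of the integral is a constant.\<close>

lemma enthalpy2_eq:
  assumes P: "pressure_law P \<gamma> K" and s: "s > 0"
  shows "enthalpy2 P s = deriv P s / s"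
proof -
  let ?k = "\<lambda>t. deriv P t / t"
  have cont: "continuous_on {0<..} (deriv P)" using P by (simp add: pressure_law_def)
  have contk: "continuous_on {0<..} ?k" by (intro continuous_intros cont) auto
  have "((\<lambda>x. integral {s / 2 .. x} ?k) has_real_derivative ?k s) (at s within {s / 2 .. 2 * s})"
    using s by (intro integral_has_real_derivative continuous_on_subset[OF contk]) auto
  moreover have "at s within {s / 2 .. 2 * s} = at s" using s by (intro at_within_interior) auto
  ultimately have "((\<lambda>x. integral {s / 2 .. x} ?k) has_real_derivative ?k s) (at s)" by simp
  then have "((\<lambda>x. integral {0 .. s / 2} ?k + integral {s / 2 .. x} ?k) has_real_derivative 0 + ?k s) (at s)"
    by (intro DERIV_add DERIV_const)
  then have "(enthalpy1 P has_real_derivative 0 + ?k s) (at s)"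
  proof (rule has_field_derivative_transform_within_open[of _ _ _ "{s / 2 <..}"])
    show "integral {0 .. s / 2} ?k + integral {s / 2 .. x} ?k = enthalpy1 P x" if "x \<in> {s / 2 <..}" for x
      unfolding enthalpy1_def using that s
      by (intro Henstock_Kurzweil_Integration.integral_combine enthalpy_integrand_integrable[OF P]) auto
  qed (use s in auto)
  then show ?thesis unfolding enthalpy2_def by (simp add: DERIV_imp_deriv)
qed

lemma enthalpy2_continuous:
  assumes P: "pressure_law P \<gamma> K" shows "continuous_on {0<..} (enthalpy2 P)"
proof -
  have "continuous_on {0<..} (\<lambda>t. deriv P t / t)"
    using P by (intro continuous_intros) (auto simp: pressure_law_def)
  then show ?thesis by (rule continuous_on_eq) (simp add: enthalpy2_eq[OF P])
qed

text \<open>As \<open>\<gamma> < 2\<close>, the quotient \<open>P'(t) / t\<close> behaves like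
  \<open>t powr (\<gamma> - 2)\<close> and does not degenerate at vacuum; away from 0 it is
  continuous and positive on a compact interval. This is what bounds the weight
  \<open>\<theta>\<close> of the Newtonian kernel.\<close>

lemma enthalpy2_lower_bound:
  assumes P: "pressure_law P \<gamma> K"
  shows "\<exists>h>0. \<forall>s. 0 < s \<and> s \<le> m \<longrightarrow> h \<le> enthalpy2 P s"
proof -
  have pos: "\<And>t. t > 0 \<Longrightarrow> deriv P t > 0" and \<gamma>: "\<gamma> < 2" and K: "K > 0"
    and lim: "((\<lambda>t. t powr (1 - \<gamma>) * deriv P t) \<longlongrightarrow> K) (at_right 0)"
    using P by (auto simp: pressure_law_def)
  have "\<forall>\<^sub>F t in at_right 0. K / 2 < t powr (1 - \<gamma>) * deriv P t"
    using order_tendstoD(1)[OF lim, of "K / 2"] K by simp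
  then obtain d where d: "d > 0" "\<And>t. 0 < t \<Longrightarrow> t < d \<Longrightarrow> K / 2 < t powr (1 - \<gamma>) * deriv P t"
    unfolding eventually_at_right_field by blast
  define e where "e = min (d / 2) 1"
  have e: "0 < e" "e < d" "e \<le> 1" using d by (auto simp: e_def)
  have near: "K / 2 \<le> enthalpy2 P t" if t: "0 < t" "t \<le> e" for t
  proof -
    have "1 = 1 powr (\<gamma> - 2)" by simp
    also have "\<dots> \<le> t powr (\<gamma> - 2)" using t e \<gamma> by (intro powr_mono2') auto
    finally have "1 * (K / 2) \<le> t powr (\<gamma> - 2) * (t powr (1 - \<gamma>) * deriv P t)"
      using d(2)[of t] t e K by (intro mult_mono) auto
    also have "\<dots> = deriv P t / t"
      using t by (simp add: mult.assoc[symmetric] powr_add[symmetric] powr_minus_divide)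
    finally show ?thesis using enthalpy2_eq[OF P t(1)] by simp
  qed
  show ?thesis
  proof (cases "e \<le> m")
    case True
    have "continuous_on {e..m} (enthalpy2 P)" using e by (intro continuous_on_subset[OF enthalpy2_continuous[OF P]]) auto
    then obtain y where y: "y \<in> {e..m}" "\<And>t. t \<in> {e..m} \<Longrightarrow> enthalpy2 P y \<le> enthalpy2 P t"
      using continuous_attains_inf[of "{e..m}" "enthalpy2 P"] True by auto
    have "enthalpy2 P y > 0" using y(1) e pos[of y] by (simp add: enthalpy2_eq[OF P])
    moreover have "min (K / 2) (enthalpy2 P y) \<le> enthalpy2 P t" if t: "0 < t" "t \<le> m" for t
      using near[of t] y(2)[of t] t by (cases "t \<le> e") auto
    ultimately show ?thesis using K
      by (intro exI[of _ "min (K / 2) (enthalpy2 P y)"]) simp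
  next
    case False
    then show ?thesis using K near by (intro exI[of _ "K / 2"]) auto
  qed
qed

text \<open>The product rule gives \<open>2 r \<omega> \<omega>' + 4 \<omega>\<^sup>2\<close> for
  \<open>r > 0\<close>, whose value at 0 is the one fixed in \<open>Upsilon\<close>.\<close>

lemma Upsilon_continuous:
  assumes \<omega>: "C1_on_interval \<omega> 0 R" and R: "R > 0"
  shows "continuous_on {0..R} (Upsilon \<omega> R)"
proof -
  obtain \<omega>' where \<omega>': "continuous_on {0..R} \<omega>'"
    and d: "\<And>r. r \<in> {0..R} \<Longrightarrow> (\<omega> has_real_derivative \<omega>' r) (at r within {0..R})"
    using \<omega> by (auto simp: C1_on_interval_def)
  have cont: "continuous_on {0..R} \<omega>"
    using d by (intro DERIV_continuous_on) auto
  have "continuous_on {0..R} (\<lambda>r. 2 * \<omega> r * \<omega>' r * r + 4 * (\<omega> r)\<^sup>2)"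
    by (intro continuous_intros cont \<omega>')
  then show ?thesis
  proof (rule continuous_on_eq)
    fix r assume r: "r \<in> {0..R}"
    show "2 * \<omega> r * \<omega>' r * r + 4 * (\<omega> r)\<^sup>2 = Upsilon \<omega> R r"
    proof (cases "r = 0")
      case False
      have "((\<lambda>s. (\<omega> s)\<^sup>2 * s ^ 4) has_real_derivative (2 * \<omega> r * \<omega>' r * r + 4 * (\<omega> r)\<^sup>2) * r ^ 3) (at r within {0..R})"
        by (auto intro!: derivative_eq_intros d[OF r] simp: power2_eq_square power3_eq_cube power4_eq_xxxx algebra_simps)
      then have "vector_derivative (\<lambda>s. (\<omega> s)\<^sup>2 * s ^ 4) (at r within {0..R}) = (2 * \<omega> r * \<omega>' r * r + 4 * (\<omega> r)\<^sup>2) * r ^ 3"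
        using R r by (intro vector_derivative_within_closed_interval)
          (auto simp: has_real_derivative_iff_has_vector_derivative)
      then show ?thesis using False by (simp add: Upsilon_def)
    qed (simp add: Upsilon_def)
  qed
qed

section \<open>Weighted spaces as subspaces of \<open>L\<^sup>2\<close>\<close>

lemma sqint_bounded_on:
  fixes k :: "'a::euclidean_space \<Rightarrow> real"
  assumes S: "S \<in> sets lebesgue" "bounded S" and k: "k \<in> borel_measurable (lebesgue_on S)"
    and le: "\<And>x. x \<in> S \<Longrightarrow> \<bar>k x\<bar> \<le> B"
  shows "(\<lambda>x. indicator S x * k x) \<in> sqint"
proof -
  have m: "(\<lambda>x. indicator S x * k x) \<in> borel_measurable lebesgue"
    using k S(1) by (simp add: borel_measurable_restrict_space_iff)
  have "integrable lebesgue (\<lambda>x. (indicator S x * k x)\<^sup>2)"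
  proof (rule Bochner_Integration.integrable_bound)
    show "integrable lebesgue (\<lambda>x. B\<^sup>2 * indicator S x :: real)"
      using bounded_set_imp_lmeasurable[OF S(2,1)]
      by (intro integrable_mult_right) (auto simp: integrable_indicator_iff fmeasurable_def)
    show "(\<lambda>x. (indicator S x * k x)\<^sup>2) \<in> borel_measurable lebesgue" using m by measurable
    have "(indicator S x * k x)\<^sup>2 \<le> B\<^sup>2 * indicator S x" for x
      using power_mono[OF le[of x], of 2] by (cases "x \<in> S") auto
    then show "AE x in lebesgue. norm ((indicator S x * k x)\<^sup>2) \<le> norm (B\<^sup>2 * indicator S x)" by simp
  qed
  then show ?thesis using m by (simp add: sqint_def)
qed

lemma sqint_continuous_compact:
  fixes k :: "'a::euclidean_space \<Rightarrow> real"
  assumes S: "compact S" and k: "continuous_on S k"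
  shows "(\<lambda>x. indicator S x * k x) \<in> sqint"
proof -
  have "bounded (k ` S)" by (intro compact_imp_bounded compact_continuous_image k S)
  then obtain B where "\<forall>y\<in>k ` S. norm y \<le> B" unfolding bounded_iff by blast
  then have B: "\<bar>k x\<bar> \<le> B" if "x \<in> S" for x using that by simp
  have Sm: "S \<in> sets lebesgue" using S by (simp add: compact_imp_closed)
  show ?thesis
    by (rule sqint_bounded_on[OF Sm compact_imp_bounded[OF S] continuous_imp_measurable_on_sets_lebesgue[OF k Sm] B])
qed

locale weight =
  fixes \<Omega> :: "(real ^ 3) set" and w :: "rz \<Rightarrow> real"
  assumes open_\<Omega>: "open \<Omega>" and w_cont: "continuous_on \<Omega> (\<lambda>x. w (cyl x))"
    and w_pos: "\<And>x. x \<in> \<Omega> \<Longrightarrow> w (cyl x) > 0"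
begin

text \<open>The isometry of the weighted space into square integrable functions on R^3;
  \<open>V\<close> is the same map into \<open>l2\<close> classes.\<close>

definition emb :: "(rz \<Rightarrow> real) \<Rightarrow> real ^ 3 \<Rightarrow> real" where
  "emb f x = indicator \<Omega> x * (sqrt (w (cyl x)) * f (cyl x))"

definition V :: "(rz \<Rightarrow> real) \<Rightarrow> (real ^ 3) l2" where "V f = l2_of (emb f)"

lemma \<Omega>_sets: "\<Omega> \<in> sets lebesgue" "\<Omega> \<inter> space lebesgue \<in> sets lebesgue"
  using open_\<Omega> by auto

lemma sqrt_w_measurable: "(\<lambda>x. sqrt (w (cyl x))) \<in> borel_measurable (lebesgue_on \<Omega>)"
  by (intro continuous_imp_measurable_on_sets_lebesgue continuous_intros w_cont \<Omega>_sets)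

lemma emb_measurable_iff:
  "emb f \<in> borel_measurable lebesgue \<longleftrightarrow> (\<lambda>x. f (cyl x)) \<in> borel_measurable (lebesgue_on \<Omega>)"
proof -
  have "emb f \<in> borel_measurable lebesgue \<longleftrightarrow> (\<lambda>x. sqrt (w (cyl x)) * f (cyl x)) \<in> borel_measurable (lebesgue_on \<Omega>)"
    by (simp add: borel_measurable_restrict_space_iff[OF \<Omega>_sets(2)] emb_def[abs_def])
  also have "\<dots> \<longleftrightarrow> (\<lambda>x. f (cyl x)) \<in> borel_measurable (lebesgue_on \<Omega>)"
  proof
    assume "(\<lambda>x. sqrt (w (cyl x)) * f (cyl x)) \<in> borel_measurable (lebesgue_on \<Omega>)"
    then have "(\<lambda>x. (sqrt (w (cyl x)) * f (cyl x)) / sqrt (w (cyl x))) \<in> borel_measurable (lebesgue_on \<Omega>)"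
      using sqrt_w_measurable by (intro borel_measurable_divide)
    then show "(\<lambda>x. f (cyl x)) \<in> borel_measurable (lebesgue_on \<Omega>)"
    proof (rule measurable_cong[THEN iffD1, rotated])
      fix x assume "x \<in> space (lebesgue_on \<Omega>)"
      then show "(sqrt (w (cyl x)) * f (cyl x)) / sqrt (w (cyl x)) = f (cyl x)"
        using w_pos[of x] by (simp add: space_restrict_space)
    qed
  qed (intro borel_measurable_times sqrt_w_measurable)
  finally show ?thesis .
qed

lemma emb_mult: "emb f x * emb g x = indicator \<Omega> x *\<^sub>R (w (cyl x) * (f (cyl x) * g (cyl x)))"
proof (cases "x \<in> \<Omega>")
  case True
  then have "sqrt (w (cyl x)) * sqrt (w (cyl x)) = w (cyl x)" using w_pos[OF True] by simp
  then show ?thesis using True by (simp add: emb_def algebra_simps)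
qed (simp add: emb_def)

lemma L2w_iff: "f \<in> L2w \<Omega> w \<longleftrightarrow> emb f \<in> sqint"
proof -
  have "(\<lambda>x. (emb f x)\<^sup>2) = (\<lambda>x. indicator \<Omega> x *\<^sub>R (w (cyl x) * (f (cyl x))\<^sup>2))"
    by (rule ext) (simp only: power2_eq_square emb_mult)
  then show ?thesis
    by (simp only: L2w_def sqint_def mem_Collect_eq emb_measurable_iff integrable_restrict_space[OF \<Omega>_sets(2)])
qed

lemma V_inner:
  assumes "f \<in> L2w \<Omega> w" "g \<in> L2w \<Omega> w"
  shows "V f \<bullet> V g = (LINT x|lebesgue_on \<Omega>. w (cyl x) * (f (cyl x) * g (cyl x)))"
    and "integrable (lebesgue_on \<Omega>) (\<lambda>x. w (cyl x) * (f (cyl x) * g (cyl x)))"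
  using assms sqint_mult_integrable[of "emb f" "emb g"]
  by (simp_all only: V_def L2w_iff inner_l2_of emb_mult integral_restrict_space[OF \<Omega>_sets(2)] integrable_restrict_space[OF \<Omega>_sets(2)])

lemma norm_V: "f \<in> L2w \<Omega> w \<Longrightarrow> norm (V f) = norm_L2w \<Omega> w f"
  using V_inner(1)[of f f] by (simp add: norm_eq_sqrt_inner norm_L2w_def power2_eq_square)

lemma emb_add: "emb (\<lambda>p. f p + g p) = (\<lambda>x. emb f x + emb g x)"
  and emb_cmult: "emb (\<lambda>p. c * f p) = (\<lambda>x. c * emb f x)"
  by (auto simp: emb_def algebra_simps)

lemma L2w_add: "f \<in> L2w \<Omega> w \<Longrightarrow> g \<in> L2w \<Omega> w \<Longrightarrow> (\<lambda>p. f p + g p) \<in> L2w \<Omega> w"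
  and V_add: "f \<in> L2w \<Omega> w \<Longrightarrow> g \<in> L2w \<Omega> w \<Longrightarrow> V (\<lambda>p. f p + g p) = V f + V g"
  and L2w_cmult: "f \<in> L2w \<Omega> w \<Longrightarrow> (\<lambda>p. c * f p) \<in> L2w \<Omega> w"
  and V_cmult: "f \<in> L2w \<Omega> w \<Longrightarrow> V (\<lambda>p. c * f p) = c *\<^sub>R V f"
  by (simp_all add: L2w_iff V_def emb_add emb_cmult sqint_add sqint_cmult l2_of_add l2_of_cmult)

lemma L2w_zero: "(\<lambda>p. 0) \<in> L2w \<Omega> w" and V_zero: "V (\<lambda>p. 0) = 0"
  using sqint_zero by (simp_all add: L2w_iff V_def emb_def[abs_def] l2_of_zero)

lemma subspace_V: "subspace (V ` L2w \<Omega> w)"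
  unfolding subspace_def
proof (intro conjI ballI allI)
  show "0 \<in> V ` L2w \<Omega> w" using V_zero L2w_zero by (metis image_eqI)
  show "x + y \<in> V ` L2w \<Omega> w" if xy: "x \<in> V ` L2w \<Omega> w" "y \<in> V ` L2w \<Omega> w" for x y
  proof -
    obtain f g where fg: "f \<in> L2w \<Omega> w" "x = V f" "g \<in> L2w \<Omega> w" "y = V g" using xy by blast
    show ?thesis unfolding fg(2,4) V_add[OF fg(1,3), symmetric] by (rule imageI[OF L2w_add[OF fg(1,3)]])
  qed
  show "c *\<^sub>R x \<in> V ` L2w \<Omega> w" if x: "x \<in> V ` L2w \<Omega> w" for c x
  proof -
    obtain f where f: "f \<in> L2w \<Omega> w" "x = V f" using x by blast
    show ?thesis unfolding f(2) V_cmult[OF f(1), symmetric] by (rule imageI[OF L2w_cmult[OF f(1)]])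
  qed
qed

lemma V_eq_0_iff: "f \<in> L2w \<Omega> w \<Longrightarrow> V f = 0 \<longleftrightarrow> (AE x in lebesgue_on \<Omega>. f (cyl x) = 0)"
proof -
  assume f: "f \<in> L2w \<Omega> w"
  have "V f = 0 \<longleftrightarrow> (AE x in lebesgue. emb f x = 0)"
    using l2_of_eq_iff[of "emb f" "\<lambda>x. 0"] f sqint_zero by (simp add: V_def l2_of_zero L2w_iff)
  also have "\<dots> \<longleftrightarrow> (AE x in lebesgue. x \<in> \<Omega> \<longrightarrow> f (cyl x) = 0)"
  proof -
    have "emb f x = 0 \<longleftrightarrow> (x \<in> \<Omega> \<longrightarrow> f (cyl x) = 0)" for x
      using w_pos[of x] by (cases "x \<in> \<Omega>") (auto simp: emb_def)
    then show ?thesis by simp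
  qed
  also have "\<dots> \<longleftrightarrow> (AE x in lebesgue_on \<Omega>. f (cyl x) = 0)"
    by (simp add: AE_restrict_space_iff \<Omega>_sets)
  finally show ?thesis .
qed

lemma closed_V: "closed (V ` L2w \<Omega> w)"
  unfolding closed_sequential_limits
proof (intro allI impI, elim conjE)
  fix X Z assume X: "\<forall>n. X n \<in> V ` L2w \<Omega> w" and XZ: "X \<longlonglongrightarrow> Z"
  have "\<forall>n. \<exists>g. g \<in> L2w \<Omega> w \<and> X n = V g" using X by auto
  then obtain f where f: "\<And>n. f n \<in> L2w \<Omega> w" "\<And>n. X n = V (f n)" by metis
  obtain r :: "nat \<Rightarrow> nat" where r: "AE x in lebesgue. (\<lambda>n. fun_of (X (r n)) x) \<longlonglongrightarrow> fun_of Z x"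
    using l2_tendsto_imp_AE_subseq[OF XZ] .
  have "AE x in lebesgue. fun_of (X (r n)) x = emb (f (r n)) x" for n
    using fun_of_l2_of[of "emb (f (r n))"] f(1)[of "r n"] by (simp add: f(2) V_def L2w_iff)
  then have "AE x in lebesgue. \<forall>n. fun_of (X (r n)) x = emb (f (r n)) x" by (simp add: AE_all_countable)
  with r have lim: "AE x in lebesgue. (\<lambda>n. emb (f (r n)) x) \<longlonglongrightarrow> fun_of Z x"
    by eventually_elim simp
  \<comment> \<open>The limit is taken at points \<open>p\<close> of the meridian plane and not at
    \<open>x\<close>, so that the result is again a function of \<open>cyl x\<close>; this is what
    makes the image closed.\<close>
  define g where "g p = lim (\<lambda>n. f (r n) p)" for p
  have eq: "AE x in lebesgue. fun_of Z x = emb g x" using lim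
  proof eventually_elim
    fix x assume x: "(\<lambda>n. emb (f (r n)) x) \<longlonglongrightarrow> fun_of Z x"
    show "fun_of Z x = emb g x"
    proof (cases "x \<in> \<Omega>")
      case True
      then have s: "sqrt (w (cyl x)) > 0" using w_pos by simp
      have "(\<lambda>n. emb (f (r n)) x / sqrt (w (cyl x))) \<longlonglongrightarrow> fun_of Z x / sqrt (w (cyl x))"
        using s by (intro tendsto_divide x tendsto_const) auto
      moreover have "emb (f (r n)) x / sqrt (w (cyl x)) = f (r n) (cyl x)" for n using True s by (simp add: emb_def)
      ultimately have "(\<lambda>n. f (r n) (cyl x)) \<longlonglongrightarrow> fun_of Z x / sqrt (w (cyl x))" by simp
      then have "g (cyl x) = fun_of Z x / sqrt (w (cyl x))" unfolding g_def by (rule limI)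
      then show ?thesis using True s by (simp add: emb_def)
    next
      case False
      then have "(\<lambda>n. 0) \<longlonglongrightarrow> fun_of Z x" using x by (simp add: emb_def)
      then show ?thesis using False by (simp add: emb_def LIMSEQ_const_iff)
    qed
  qed
  have "(\<lambda>x. f n (cyl x)) \<in> borel_measurable (lebesgue_on \<Omega>)" for n using f(1)[of n] by (simp add: L2w_def)
  then have "(\<lambda>x. g (cyl x)) \<in> borel_measurable (lebesgue_on \<Omega>)"
    unfolding g_def by (intro borel_measurable_lim_metric)
  then have "emb g \<in> borel_measurable lebesgue" by (simp add: emb_measurable_iff)
  then have gs: "emb g \<in> sqint" by (rule sqint_cong_AE[OF fun_of_sqint _ eq])
  then have "Z = V g" using l2_of_eq_iff[OF fun_of_sqint gs, of Z] eq by (simp add: V_def)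
  then show "Z \<in> V ` L2w \<Omega> w" using gs by (simp add: L2w_iff)
qed

lemma L2w_continuous_support:
  assumes S: "compact S" "S \<subseteq> \<Omega>" and f: "continuous_on \<Omega> (\<lambda>x. f (cyl x))"
    and zero: "\<And>x. x \<in> \<Omega> \<Longrightarrow> x \<notin> S \<Longrightarrow> f (cyl x) = 0"
  shows "f \<in> L2w \<Omega> w"
proof -
  have "(\<lambda>x. indicator S x * (sqrt (w (cyl x)) * f (cyl x))) \<in> sqint"
    using S by (intro sqint_continuous_compact continuous_on_subset[OF _ S(2)] continuous_intros w_cont f)
  moreover have "(\<lambda>x. indicator S x * (sqrt (w (cyl x)) * f (cyl x))) = emb f"
  proof (rule ext)
    fix x show "indicator S x * (sqrt (w (cyl x)) * f (cyl x)) = emb f x"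
      using S(2) zero[of x] by (cases "x \<in> S"; cases "x \<in> \<Omega>") (auto simp: emb_def)
  qed
  ultimately show ?thesis by (simp add: L2w_iff)
qed

text \<open>Cauchy-Schwarz with \<open>k / sqrt w\<close>, which is bounded on \<open>S\<close>
  because \<open>w\<close> is continuous and positive there.\<close>

lemma L2w_locally_integrable:
  assumes f: "f \<in> L2w \<Omega> w" and S: "compact S" "S \<subseteq> \<Omega>" and k: "continuous_on \<Omega> k"
  shows "integrable lebesgue (\<lambda>x. indicator S x * (k x * f (cyl x)))"
proof -
  have "(\<lambda>x. indicator S x * (k x / sqrt (w (cyl x)))) \<in> sqint"
  proof (intro sqint_continuous_compact S continuous_on_subset[OF _ S(2)] continuous_intros w_cont k ballI)
    fix x assume "x \<in> \<Omega>"
    then show "sqrt (w (cyl x)) \<noteq> 0" using w_pos[of x] by simp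
  qed
  then have "integrable lebesgue (\<lambda>x. (indicator S x * (k x / sqrt (w (cyl x)))) * emb f x)"
    using f by (intro sqint_mult_integrable) (simp_all add: L2w_iff)
  moreover have "(indicator S x * (k x / sqrt (w (cyl x)))) * emb f x = indicator S x * (k x * f (cyl x))" for x
    using w_pos[of x] S(2) by (cases "x \<in> S") (auto simp: emb_def)
  ultimately show ?thesis by simp
qed

end

section \<open>The linearized operator of a rotating star\<close>

definition test_fun :: "(real ^ 3) set \<Rightarrow> (real ^ 3 \<Rightarrow> real) \<Rightarrow> (real ^ 3 \<Rightarrow> real ^ 3) \<Rightarrow> bool" where
  "test_fun \<Omega> \<phi> g \<longleftrightarrow> (\<forall>x. GDERIV \<phi> x :> g x) \<and> continuous_on UNIV g \<and>
     (\<exists>S. compact S \<and> S \<subseteq> \<Omega> \<and> (\<forall>x. x \<notin> S \<longrightarrow> \<phi> x = 0))"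

lemma is_div_test_fun:
  "is_div \<Omega> \<rho>\<^sub>0 u f \<longleftrightarrow> (\<forall>\<phi> g. test_fun \<Omega> \<phi> g \<longrightarrow>
     (LINT x|lebesgue_on \<Omega>. f (cyl x) * \<phi> x) = - (LINT x|lebesgue_on \<Omega>. \<rho>\<^sub>0 (cyl x) * (field3 u x \<bullet> g x)))"
  by (simp add: is_div_def test_fun_def)

lemma test_fun_continuous: "test_fun \<Omega> \<phi> g \<Longrightarrow> continuous_on S \<phi>"
  unfolding test_fun_def gderiv_def
  by (intro continuous_at_imp_continuous_on ballI) (auto intro: has_derivative_continuous)

lemma bump_test_fun:
  assumes "a < b" "c < d" "tube a b c d \<subseteq> \<Omega>"
  shows "test_fun \<Omega> (\<lambda>x. bump a b c d n (radsq x) (x $ 3)) (bump_grad a b c d n)"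
  unfolding test_fun_def
proof (intro conjI allI)
  show "\<exists>S. compact S \<and> S \<subseteq> \<Omega> \<and> (\<forall>x. x \<notin> S \<longrightarrow> bump a b c d n (radsq x) (x $ 3) = 0)"
    by (rule exI[of _ "tube a b c d"]) (simp add: compact_tube assms bump_outside)
qed (rule bump_GDERIV continuous_bump_grad)+

lemma inner_field3:
  "field3 u x \<bullet> y = fst (u (cyl x)) * (x $ 1 / fst (cyl x) * y $ 1 + x $ 2 / fst (cyl x) * y $ 2) + snd (u (cyl x)) * y $ 3"
  by (simp add: field3_def inner_vec_def sum_3 algebra_simps)

lemma continuous_cyl: "continuous_on S cyl"
  unfolding cyl_eq[abs_def] by (intro continuous_intros continuous_radsq)

lemma fst_cyl: "fst (cyl x) = sqrt (radsq x)" and snd_cyl: "snd (cyl x) = x $ 3"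
  and fst_cyl_sq: "(fst (cyl x))\<^sup>2 = radsq x"
  by (simp_all add: cyl_eq radsq_def)

lemma component_le_radius: "\<bar>x $ 1\<bar> \<le> fst (cyl x)" "\<bar>x $ 2\<bar> \<le> fst (cyl x)"
  by (auto simp: fst_cyl radsq_def intro!: real_le_rsqrt)

text \<open>The star enters the analysis through its coefficients: a positive continuous density,
  \<open>\<Phi>''(\<rho>\<^sub>0)\<close> continuous and at least \<open>h\<^sub>0 > 0\<close>, and
  \<open>Upsilon\<close> continuous and bounded by \<open>U\<close>. At the boundary the density may
  tend to 0 and \<open>\<Phi>''(\<rho>\<^sub>0)\<close> to infinity.\<close>

locale star =
  fixes P :: "real \<Rightarrow> real" and \<rho>\<^sub>0 :: "rz \<Rightarrow> real" and \<Omega> :: "(real ^ 3) set" and \<omega>\<^sub>0 :: "real \<Rightarrow> real"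
    and R\<^sub>0 h\<^sub>0 \<mu>\<^sub>0 U :: real
  assumes open_\<Omega>: "open \<Omega>" and bounded_\<Omega>: "bounded \<Omega>" and axisym: "axisymmetric_set \<Omega>"
    and \<rho>_cont: "continuous_on \<Omega> (\<lambda>x. \<rho>\<^sub>0 (cyl x))" and \<rho>_pos: "\<And>x. x \<in> \<Omega> \<Longrightarrow> \<rho>\<^sub>0 (cyl x) > 0"
    and \<rho>_le: "\<And>x. x \<in> \<Omega> \<Longrightarrow> \<rho>\<^sub>0 (cyl x) \<le> \<mu>\<^sub>0"
    and h_cont: "continuous_on \<Omega> (\<lambda>x. enthalpy2 P (\<rho>\<^sub>0 (cyl x)))"
    and h_ge: "\<And>x. x \<in> \<Omega> \<Longrightarrow> h\<^sub>0 \<le> enthalpy2 P (\<rho>\<^sub>0 (cyl x))" and h\<^sub>0: "h\<^sub>0 > 0"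
    and U_cont: "continuous_on \<Omega> (\<lambda>x. Upsilon \<omega>\<^sub>0 R\<^sub>0 (fst (cyl x)))"
    and U_le: "\<And>x. x \<in> \<Omega> \<Longrightarrow> \<bar>Upsilon \<omega>\<^sub>0 R\<^sub>0 (fst (cyl x))\<bar> \<le> U"
begin

lemma h_pos: "x \<in> \<Omega> \<Longrightarrow> enthalpy2 P (\<rho>\<^sub>0 (cyl x)) > 0"
  using h_ge h\<^sub>0 by (meson less_le_trans)

sublocale r: weight \<Omega> \<rho>\<^sub>0
  by standard (fact open_\<Omega> \<rho>_cont \<rho>_pos)+

sublocale h: weight \<Omega> "\<lambda>p. enthalpy2 P (\<rho>\<^sub>0 p)"
  by standard (fact open_\<Omega> h_cont h_pos)+

abbreviation X where "X \<equiv> L2w \<Omega> (\<lambda>p. enthalpy2 P (\<rho>\<^sub>0 p))"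

definition \<theta> :: "real ^ 3 \<Rightarrow> real" where "\<theta> x = indicator \<Omega> x * (1 / sqrt (enthalpy2 P (\<rho>\<^sub>0 (cyl x))))"

sublocale newton: weighted_newton \<Omega> \<theta> "1 / sqrt h\<^sub>0"
proof
  show "\<Omega> \<in> sets lebesgue" "bounded \<Omega>" by (fact r.\<Omega>_sets bounded_\<Omega>)+
  have "continuous_on \<Omega> (\<lambda>x. 1 / sqrt (enthalpy2 P (\<rho>\<^sub>0 (cyl x))))"
  proof (intro continuous_intros h_cont ballI)
    fix x assume "x \<in> \<Omega>" then show "sqrt (enthalpy2 P (\<rho>\<^sub>0 (cyl x))) \<noteq> 0" using h_pos[of x] by simp
  qed
  then have "(\<lambda>x. 1 / sqrt (enthalpy2 P (\<rho>\<^sub>0 (cyl x)))) \<in> borel_measurable (lebesgue_on \<Omega>)"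
    by (rule continuous_imp_measurable_on_sets_lebesgue[OF _ r.\<Omega>_sets(1)])
  then show "\<theta> \<in> borel_measurable lebesgue"
    by (simp add: borel_measurable_restrict_space_iff[OF r.\<Omega>_sets(2)] \<theta>_def[abs_def])
  fix x show "\<bar>\<theta> x\<bar> \<le> 1 / sqrt h\<^sub>0 * indicator \<Omega> x"
  proof (cases "x \<in> \<Omega>")
    case True
    have "1 / sqrt (enthalpy2 P (\<rho>\<^sub>0 (cyl x))) \<le> 1 / sqrt h\<^sub>0"
      using h_ge[OF True] h_pos[OF True] h\<^sub>0 by (intro divide_left_mono) auto
    then show ?thesis using True h_pos[OF True] by (simp add: \<theta>_def)
  qed (simp add: \<theta>_def)
qed

definition T1 :: "(real ^ 3 \<Rightarrow> real) \<Rightarrow> real ^ 3 \<Rightarrow> real" where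
  "T1 \<phi> x = indicator \<Omega> x * (\<phi> x / sqrt (enthalpy2 P (\<rho>\<^sub>0 (cyl x))))"

definition T2 :: "(real ^ 3 \<Rightarrow> real ^ 3) \<Rightarrow> real ^ 3 \<Rightarrow> real" where
  "T2 g x = indicator \<Omega> x * (sqrt (\<rho>\<^sub>0 (cyl x)) * (x $ 1 / fst (cyl x) * g x $ 1 + x $ 2 / fst (cyl x) * g x $ 2))"

definition T3 :: "(real ^ 3 \<Rightarrow> real ^ 3) \<Rightarrow> real ^ 3 \<Rightarrow> real" where
  "T3 g x = indicator \<Omega> x * (sqrt (\<rho>\<^sub>0 (cyl x)) * g x $ 3)"

text \<open>Representer of a test pair: the distributional identity between \<open>u\<close> and its
  divergence becomes orthogonality to \<open>tst \<phi> g\<close>, so the graph is cut out of a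
  closed set by closed hyperplanes.\<close>

definition tst :: "(real ^ 3 \<Rightarrow> real) \<Rightarrow> (real ^ 3 \<Rightarrow> real ^ 3) \<Rightarrow> ((real ^ 3) l2 \<times> (real ^ 3) l2) \<times> (real ^ 3) l2" where
  "tst \<phi> g = ((l2_of (T2 g), l2_of (T3 g)), l2_of (T1 \<phi>))"

lemma T1_sqint:
  assumes t: "test_fun \<Omega> \<phi> g" shows "T1 \<phi> \<in> sqint"
proof -
  obtain S where S: "compact S" "S \<subseteq> \<Omega>" "\<And>x. x \<notin> S \<Longrightarrow> \<phi> x = 0" using t unfolding test_fun_def by blast
  have "(\<lambda>x. indicator S x * (\<phi> x / sqrt (enthalpy2 P (\<rho>\<^sub>0 (cyl x))))) \<in> sqint"
  proof (intro sqint_continuous_compact S continuous_on_divide test_fun_continuous[OF t] continuous_on_real_sqrt ballI)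
    show "continuous_on S (\<lambda>x. enthalpy2 P (\<rho>\<^sub>0 (cyl x)))" by (rule continuous_on_subset[OF h_cont S(2)])
    fix x assume "x \<in> S" then show "sqrt (enthalpy2 P (\<rho>\<^sub>0 (cyl x))) \<noteq> 0" using h_pos[of x] S(2) by auto
  qed
  moreover have "(\<lambda>x. indicator S x * (\<phi> x / sqrt (enthalpy2 P (\<rho>\<^sub>0 (cyl x))))) = T1 \<phi>"
  proof (rule ext)
    fix x show "indicator S x * (\<phi> x / sqrt (enthalpy2 P (\<rho>\<^sub>0 (cyl x)))) = T1 \<phi> x"
      using S(2) S(3)[of x] by (cases "x \<in> S") (auto simp: T1_def)
  qed
  ultimately show ?thesis by simp
qed

lemma T23_sqint:
  assumes g: "continuous_on UNIV g" shows "T2 g \<in> sqint" "T3 g \<in> sqint"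
proof -
  have "bounded (g ` closure \<Omega>)"
    using bounded_\<Omega> by (intro compact_imp_bounded compact_continuous_image continuous_on_subset[OF g]) (auto simp: compact_closure)
  then obtain B where "\<forall>y\<in>g ` closure \<Omega>. norm y \<le> B" unfolding bounded_iff by blast
  then have B: "norm (g x) \<le> B" if "x \<in> \<Omega>" for x using that closure_subset by blast
  have gc: "\<bar>g x $ i\<bar> \<le> B" if "x \<in> \<Omega>" for x i
    using component_le_norm_cart[of "g x" i] B[OF that] by linarith
  have sq: "sqrt (\<rho>\<^sub>0 (cyl x)) \<le> sqrt \<mu>\<^sub>0" "0 \<le> sqrt (\<rho>\<^sub>0 (cyl x))" "0 \<le> sqrt \<mu>\<^sub>0" if "x \<in> \<Omega>" for x
    using \<rho>_le[OF that] \<rho>_pos[OF that] by auto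
  have m: "(\<lambda>x. x $ i / fst (cyl x)) \<in> borel_measurable (lebesgue_on \<Omega>)" for i
    by (intro borel_measurable_divide continuous_imp_measurable_on_sets_lebesgue r.\<Omega>_sets continuous_intros continuous_on_fst[OF continuous_cyl])
  have mg: "(\<lambda>x. g x $ i) \<in> borel_measurable (lebesgue_on \<Omega>)" for i
    by (intro continuous_imp_measurable_on_sets_lebesgue r.\<Omega>_sets continuous_intros continuous_on_subset[OF g]) auto
  \<comment> \<open>These quotients have no limit on the axis and are 0 there by the convention for
    division by zero, so only boundedness and measurability can be used.\<close>
  have frac: "\<bar>x $ 1 / fst (cyl x)\<bar> \<le> 1" "\<bar>x $ 2 / fst (cyl x)\<bar> \<le> 1" for x
    using component_le_radius[of x] by (auto simp: abs_div divide_le_eq_1)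
  show "T2 g \<in> sqint"
    unfolding T2_def[abs_def]
  proof (rule sqint_bounded_on[OF r.\<Omega>_sets(1) bounded_\<Omega>])
    show "(\<lambda>x. sqrt (\<rho>\<^sub>0 (cyl x)) * (x $ 1 / fst (cyl x) * g x $ 1 + x $ 2 / fst (cyl x) * g x $ 2)) \<in> borel_measurable (lebesgue_on \<Omega>)"
      by (intro borel_measurable_times borel_measurable_add r.sqrt_w_measurable m mg)
    fix x assume x: "x \<in> \<Omega>"
    have "\<bar>x $ 1 / fst (cyl x) * g x $ 1\<bar> \<le> 1 * B" "\<bar>x $ 2 / fst (cyl x) * g x $ 2\<bar> \<le> 1 * B"
      unfolding abs_mult using frac[of x] gc[OF x] by (intro mult_mono; simp)+
    then have "\<bar>x $ 1 / fst (cyl x) * g x $ 1 + x $ 2 / fst (cyl x) * g x $ 2\<bar> \<le> 2 * B" by linarith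
    then show "\<bar>sqrt (\<rho>\<^sub>0 (cyl x)) * (x $ 1 / fst (cyl x) * g x $ 1 + x $ 2 / fst (cyl x) * g x $ 2)\<bar> \<le> sqrt \<mu>\<^sub>0 * (2 * B)"
      unfolding abs_mult[of "sqrt (\<rho>\<^sub>0 (cyl x))"] using sq[OF x] by (intro mult_mono) auto
  qed
  show "T3 g \<in> sqint"
    unfolding T3_def[abs_def]
  proof (rule sqint_bounded_on[OF r.\<Omega>_sets(1) bounded_\<Omega>])
    show "(\<lambda>x. sqrt (\<rho>\<^sub>0 (cyl x)) * g x $ 3) \<in> borel_measurable (lebesgue_on \<Omega>)"
      by (intro borel_measurable_times r.sqrt_w_measurable mg)
    fix x assume x: "x \<in> \<Omega>"
    show "\<bar>sqrt (\<rho>\<^sub>0 (cyl x)) * g x $ 3\<bar> \<le> sqrt \<mu>\<^sub>0 * B"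
      unfolding abs_mult using sq[OF x] gc[OF x] by (intro mult_mono) auto
  qed
qed

definition J :: "(rz \<Rightarrow> rz) \<Rightarrow> (real ^ 3) l2 \<times> (real ^ 3) l2" where
  "J u = (r.V (\<lambda>p. fst (u p)), r.V (\<lambda>p. snd (u p)))"

definition YY :: "((real ^ 3) l2 \<times> (real ^ 3) l2) set" where
  "YY = r.V ` L2w \<Omega> \<rho>\<^sub>0 \<times> r.V ` L2w \<Omega> \<rho>\<^sub>0"

definition \<Gamma> :: "(((real ^ 3) l2 \<times> (real ^ 3) l2) \<times> (real ^ 3) l2) set" where
  "\<Gamma> = {p \<in> YY \<times> h.V ` X. \<forall>\<phi> g. test_fun \<Omega> \<phi> g \<longrightarrow> p \<bullet> tst \<phi> g = 0}"

lemma Ysp_iff: "u \<in> Ysp \<Omega> \<rho>\<^sub>0 \<longleftrightarrow> (\<lambda>p. fst (u p)) \<in> L2w \<Omega> \<rho>\<^sub>0 \<and> (\<lambda>p. snd (u p)) \<in> L2w \<Omega> \<rho>\<^sub>0"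
  by (simp add: Ysp_def)

lemma J_YY: "u \<in> Ysp \<Omega> \<rho>\<^sub>0 \<Longrightarrow> J u \<in> YY"
  by (simp add: Ysp_iff J_def YY_def)

lemma YY_J: assumes "y \<in> YY" obtains u where "u \<in> Ysp \<Omega> \<rho>\<^sub>0" "y = J u"
proof -
  obtain f g where "f \<in> L2w \<Omega> \<rho>\<^sub>0" "g \<in> L2w \<Omega> \<rho>\<^sub>0" "y = (r.V f, r.V g)" using assms by (auto simp: YY_def)
  then show ?thesis using that[of "\<lambda>p. (f p, g p)"] by (simp add: Ysp_iff J_def)
qed

lemma subspace_YY: "subspace YY" and closed_YY: "closed YY"
  unfolding YY_def by (intro subspace_Times closed_Times r.subspace_V r.closed_V)+

lemma subspace_\<Gamma>: "subspace \<Gamma>"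
proof -
  have s: "subspace (YY \<times> h.V ` X)" by (intro subspace_Times subspace_YY h.subspace_V)
  show ?thesis
    unfolding subspace_def
  proof (intro conjI ballI allI)
    show "0 \<in> \<Gamma>" using subspace_0[OF s] by (simp add: \<Gamma>_def del: mem_Times_iff)
    show "x + y \<in> \<Gamma>" if "x \<in> \<Gamma>" "y \<in> \<Gamma>" for x y
      using that subspace_add[OF s, of x y] by (simp add: \<Gamma>_def inner_add_left del: mem_Times_iff)
    show "c *\<^sub>R x \<in> \<Gamma>" if "x \<in> \<Gamma>" for c x
      using that subspace_scale[OF s, of x c] by (simp add: \<Gamma>_def del: mem_Times_iff)
  qed
qed

lemma closed_\<Gamma>: "closed \<Gamma>"
proof -
  have "\<Gamma> = (YY \<times> h.V ` X) \<inter> (\<Inter>(\<phi>, g)\<in>{(\<phi>, g). test_fun \<Omega> \<phi> g}. {p. p \<bullet> tst \<phi> g = 0})"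
    by (auto simp: \<Gamma>_def)
  moreover have "closed {p. p \<bullet> tst \<phi> g = 0}" for \<phi> g by (intro closed_Collect_eq continuous_intros)
  ultimately show ?thesis
    by (auto intro!: closed_Int closed_Times closed_YY h.closed_V closed_INT)
qed

lemma inner_tst:
  assumes u: "u \<in> Ysp \<Omega> \<rho>\<^sub>0" and f: "f \<in> X" and t: "test_fun \<Omega> \<phi> g"
  shows "h.V f \<bullet> l2_of (T1 \<phi>) = (LINT x|lebesgue_on \<Omega>. f (cyl x) * \<phi> x)"
    and "(J u, h.V f) \<bullet> tst \<phi> g
      = (LINT x|lebesgue_on \<Omega>. f (cyl x) * \<phi> x) + (LINT x|lebesgue_on \<Omega>. \<rho>\<^sub>0 (cyl x) * (field3 u x \<bullet> g x))"
proof -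
  let ?u1 = "\<lambda>p. fst (u p)" and ?u2 = "\<lambda>p. snd (u p)"
  have g: "continuous_on UNIV g" using t by (simp add: test_fun_def)
  have s: "r.emb ?u1 \<in> sqint" "r.emb ?u2 \<in> sqint" "h.emb f \<in> sqint"
    using u f by (auto simp: Ysp_iff r.L2w_iff h.L2w_iff)
  have p1: "h.emb f x * T1 \<phi> x = indicator \<Omega> x *\<^sub>R (f (cyl x) * \<phi> x)" for x
    using h_pos[of x] by (cases "x \<in> \<Omega>") (simp_all add: h.emb_def T1_def)
  show 1: "h.V f \<bullet> l2_of (T1 \<phi>) = (LINT x|lebesgue_on \<Omega>. f (cyl x) * \<phi> x)"
    by (simp only: h.V_def inner_l2_of[OF s(3) T1_sqint[OF t]] p1 integral_restrict_space[OF r.\<Omega>_sets(2)])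
  have p2: "r.emb ?u1 x * T2 g x + r.emb ?u2 x * T3 g x = indicator \<Omega> x *\<^sub>R (\<rho>\<^sub>0 (cyl x) * (field3 u x \<bullet> g x))" for x
  proof (cases "x \<in> \<Omega>")
    case True
    have sq: "sqrt (\<rho>\<^sub>0 (cyl x)) * sqrt (\<rho>\<^sub>0 (cyl x)) = \<rho>\<^sub>0 (cyl x)" using \<rho>_pos[OF True] by simp
    have "r.emb ?u1 x * T2 g x + r.emb ?u2 x * T3 g x
      = (sqrt (\<rho>\<^sub>0 (cyl x)) * sqrt (\<rho>\<^sub>0 (cyl x))) * (field3 u x \<bullet> g x)"
      using True unfolding inner_field3 r.emb_def T2_def T3_def by (simp add: algebra_simps del: real_sqrt_mult_self)
    then show ?thesis using True by (simp only: sq indicator_simps scaleR_one)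
  qed (simp add: r.emb_def)
  have "r.V ?u1 \<bullet> l2_of (T2 g) + r.V ?u2 \<bullet> l2_of (T3 g) = (LINT x|lebesgue. r.emb ?u1 x * T2 g x + r.emb ?u2 x * T3 g x)"
    unfolding r.V_def inner_l2_of[OF s(1) T23_sqint(1)[OF g]] inner_l2_of[OF s(2) T23_sqint(2)[OF g]]
    by (intro Bochner_Integration.integral_add[symmetric] sqint_mult_integrable s T23_sqint g)
  also have "\<dots> = (LINT x|lebesgue_on \<Omega>. \<rho>\<^sub>0 (cyl x) * (field3 u x \<bullet> g x))"
    by (simp only: p2 integral_restrict_space[OF r.\<Omega>_sets(2)])
  finally show "(J u, h.V f) \<bullet> tst \<phi> g
      = (LINT x|lebesgue_on \<Omega>. f (cyl x) * \<phi> x) + (LINT x|lebesgue_on \<Omega>. \<rho>\<^sub>0 (cyl x) * (field3 u x \<bullet> g x))"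
    by (simp add: J_def tst_def 1)
qed

lemma mem_\<Gamma>_iff:
  assumes u: "u \<in> Ysp \<Omega> \<rho>\<^sub>0" and f: "f \<in> X"
  shows "(J u, h.V f) \<in> \<Gamma> \<longleftrightarrow> is_div \<Omega> \<rho>\<^sub>0 u f"
  using J_YY[OF u] f inner_tst(2)[OF u f] unfolding \<Gamma>_def is_div_test_fun
  by (auto simp: eq_neg_iff_add_eq_0 simp del: inner_Pair)

text \<open>A divergence of the zero field annihilates every test function, in particular the
  axi-symmetric bumps.\<close>

lemma graph_\<Gamma>:
  assumes "(0, F) \<in> \<Gamma>" shows "F = 0"
proof -
  obtain f where f: "f \<in> X" "F = h.V f" using assms by (auto simp: \<Gamma>_def)
  have "AE x in lebesgue_on \<Omega>. f (cyl x) = 0"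
  proof (rule axisymmetric_zero_AE[OF open_\<Omega> axisym])
    show "integrable lebesgue (\<lambda>x. indicator (tube a b c d) x * f (cyl x))" if "tube a b c d \<subseteq> \<Omega>" for a b c d
      using h.L2w_locally_integrable[OF f(1) compact_tube that, of "\<lambda>x. 1"] by simp
    fix a b c d n :: real
    assume "a < b" "c < d" "tube a b c d \<subseteq> \<Omega>" "n \<ge> 0"
    then have t: "test_fun \<Omega> (\<lambda>x. bump a b c d n (radsq x) (x $ 3)) (bump_grad a b c d n)" by (intro bump_test_fun)
    have u0: "(\<lambda>p. 0) \<in> Ysp \<Omega> \<rho>\<^sub>0" by (simp add: Ysp_iff r.L2w_zero)
    have "(0, F) \<bullet> tst (\<lambda>x. bump a b c d n (radsq x) (x $ 3)) (bump_grad a b c d n) = 0"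
      using assms t unfolding \<Gamma>_def by blast
    then show "(LINT x|lebesgue_on \<Omega>. f (cyl x) * bump a b c d n (radsq x) (x $ 3)) = 0"
      using inner_tst(1)[OF u0 f(1) t] by (simp add: tst_def f(2))
  qed
  then show ?thesis using h.V_eq_0_iff[OF f(1)] f(2) by simp
qed

lemma innerY_J:
  assumes "u \<in> Ysp \<Omega> \<rho>\<^sub>0" "v \<in> Ysp \<Omega> \<rho>\<^sub>0" shows "innerY \<Omega> \<rho>\<^sub>0 u v = J u \<bullet> J v"
proof -
  have "(LINT x|lebesgue_on \<Omega>. \<rho>\<^sub>0 (cyl x) * (u (cyl x) \<bullet> v (cyl x)))
    = (LINT x|lebesgue_on \<Omega>. \<rho>\<^sub>0 (cyl x) * (fst (u (cyl x)) * fst (v (cyl x))) + \<rho>\<^sub>0 (cyl x) * (snd (u (cyl x)) * snd (v (cyl x))))"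
    by (simp add: inner_prod_def distrib_left)
  also have "\<dots> = J u \<bullet> J v"
    using assms r.V_inner(2)[of "\<lambda>p. fst (u p)" "\<lambda>p. fst (v p)"] r.V_inner(2)[of "\<lambda>p. snd (u p)" "\<lambda>p. snd (v p)"]
    by (subst Bochner_Integration.integral_add) (simp_all add: J_def Ysp_iff r.V_inner(1))
  finally show ?thesis by (simp add: innerY_def)
qed

lemma normY_J: "u \<in> Ysp \<Omega> \<rho>\<^sub>0 \<Longrightarrow> normY \<Omega> \<rho>\<^sub>0 u = norm (J u)"
  by (simp add: normY_def innerY_J norm_eq_sqrt_inner)

lemma Ysp_lin: "u \<in> Ysp \<Omega> \<rho>\<^sub>0 \<Longrightarrow> v \<in> Ysp \<Omega> \<rho>\<^sub>0 \<Longrightarrow> (\<lambda>p. s *\<^sub>R u p + t *\<^sub>R v p) \<in> Ysp \<Omega> \<rho>\<^sub>0"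
  and J_lin: "u \<in> Ysp \<Omega> \<rho>\<^sub>0 \<Longrightarrow> v \<in> Ysp \<Omega> \<rho>\<^sub>0 \<Longrightarrow> J (\<lambda>p. s *\<^sub>R u p + t *\<^sub>R v p) = s *\<^sub>R J u + t *\<^sub>R J v"
  by (simp_all add: Ysp_iff J_def r.L2w_add r.L2w_cmult r.V_add r.V_cmult)

lemma J_cong_AE:
  assumes u: "u \<in> Ysp \<Omega> \<rho>\<^sub>0" and v: "v \<in> Ysp \<Omega> \<rho>\<^sub>0"
  shows "J u = J v \<longleftrightarrow> (AE x in lebesgue_on \<Omega>. u (cyl x) = v (cyl x))"
proof -
  have d: "(\<lambda>p. 1 *\<^sub>R u p + (-1) *\<^sub>R v p) \<in> Ysp \<Omega> \<rho>\<^sub>0" by (rule Ysp_lin[OF u v])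
  have "J u = J v \<longleftrightarrow> J (\<lambda>p. 1 *\<^sub>R u p + (-1) *\<^sub>R v p) = 0" unfolding J_lin[OF u v] by simp
  also have "\<dots> \<longleftrightarrow> (AE x in lebesgue_on \<Omega>. fst (1 *\<^sub>R u (cyl x) + (-1) *\<^sub>R v (cyl x)) = 0) \<and>
      (AE x in lebesgue_on \<Omega>. snd (1 *\<^sub>R u (cyl x) + (-1) *\<^sub>R v (cyl x)) = 0)"
    using d unfolding Ysp_iff by (simp only: J_def zero_prod_def prod.inject r.V_eq_0_iff)
  also have "\<dots> \<longleftrightarrow> (AE x in lebesgue_on \<Omega>. u (cyl x) = v (cyl x))"
    unfolding AE_conj_iff[symmetric] by (intro AE_cong) (auto simp: prod_eq_iff)
  finally show ?thesis .
qed

text \<open>The test fields \<open>(r b / \<rho>\<^sub>0, 0)\<close> and \<open>(0, b / \<rho>\<^sub>0)\<close> for bump functions \<open>b\<close> of \<open>(r\<^sup>2, z)\<close> belong to \<open>Z\<close>;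
  the factor \<open>r\<close> makes \<open>\<rho>\<^sub>0 u\<close> a \<open>C\<^sup>1\<close> field across the axis.\<close>

lemma bump_fields:
  fixes a b c d n :: real
  assumes ab: "a < b" "c < d" and sub: "tube a b c d \<subseteq> \<Omega>"
  defines "u1 \<equiv> \<lambda>p. (fst p * bump a b c d n ((fst p)\<^sup>2) (snd p) / \<rho>\<^sub>0 p, 0 :: real)"
    and "u2 \<equiv> \<lambda>p. (0 :: real, bump a b c d n ((fst p)\<^sup>2) (snd p) / \<rho>\<^sub>0 p)"
    and "f1 \<equiv> \<lambda>p. 2 * bump a b c d n ((fst p)\<^sup>2) (snd p) + 2 * (fst p)\<^sup>2 * bump_s a b c d n ((fst p)\<^sup>2) (snd p)"
    and "f2 \<equiv> \<lambda>p. bump_z a b c d n ((fst p)\<^sup>2) (snd p)"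
  shows "u1 \<in> Ysp \<Omega> \<rho>\<^sub>0" "u2 \<in> Ysp \<Omega> \<rho>\<^sub>0" "f1 \<in> X" "f2 \<in> X" "is_div \<Omega> \<rho>\<^sub>0 u1 f1" "is_div \<Omega> \<rho>\<^sub>0 u2 f2"
proof -
  let ?b = "\<lambda>x :: real ^ 3. bump a b c d n (radsq x) (x $ 3)"
  let ?bs = "\<lambda>x :: real ^ 3. bump_s a b c d n (radsq x) (x $ 3)"
  let ?bz = "\<lambda>x :: real ^ 3. bump_z a b c d n (radsq x) (x $ 3)"
  note S = compact_tube[of a b c d] sub
  have cb: "continuous_on A ?b" "continuous_on A ?bs" "continuous_on A ?bz" for A
    by (intro continuous_bump continuous_radsq continuous_intros)+
  note out = bump_outside[OF ab]
  have \<rho>0: "\<rho>\<^sub>0 (cyl x) \<noteq> 0" if "x \<in> \<Omega>" for x using \<rho>_pos[OF that] by simp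
  have "(\<lambda>p. fst p * bump a b c d n ((fst p)\<^sup>2) (snd p) / \<rho>\<^sub>0 p) \<in> L2w \<Omega> \<rho>\<^sub>0"
    by (rule r.L2w_continuous_support[OF S])
      (auto simp: fst_cyl_sq snd_cyl out \<rho>0 intro!: continuous_intros continuous_on_fst[OF continuous_cyl] cb \<rho>_cont)
  then show u1: "u1 \<in> Ysp \<Omega> \<rho>\<^sub>0" by (simp add: Ysp_iff u1_def r.L2w_zero)
  have "(\<lambda>p. bump a b c d n ((fst p)\<^sup>2) (snd p) / \<rho>\<^sub>0 p) \<in> L2w \<Omega> \<rho>\<^sub>0"
    by (rule r.L2w_continuous_support[OF S])
      (auto simp: fst_cyl_sq snd_cyl out \<rho>0 intro!: continuous_intros cb \<rho>_cont)
  then show u2: "u2 \<in> Ysp \<Omega> \<rho>\<^sub>0" by (simp add: Ysp_iff u2_def r.L2w_zero)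
  show f1: "f1 \<in> X" unfolding f1_def
    by (rule h.L2w_continuous_support[OF S])
      (auto simp: fst_cyl_sq snd_cyl out intro!: continuous_intros cb continuous_radsq)
  show f2: "f2 \<in> X" unfolding f2_def
    by (rule h.L2w_continuous_support[OF S])
      (auto simp: fst_cyl_sq snd_cyl out intro!: cb)
  have "bounded (tube a b c d)" using S(1) by (rule compact_imp_bounded)
  then obtain K where K: "\<forall>x\<in>tube a b c d. norm x \<le> K" unfolding bounded_iff by blast
  have supp: "x \<notin> tube a b c d" if "norm x > K" for x using K that by force
  have int_restrict: "(LINT x|lebesgue_on \<Omega>. k x) = (LINT x|lebesgue. k x)" if "\<And>x. x \<notin> \<Omega> \<Longrightarrow> k x = 0" for k :: "real ^ 3 \<Rightarrow> real"
  proof -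
    have "indicator \<Omega> x *\<^sub>R k x = k x" for x using that[of x] by (cases "x \<in> \<Omega>") auto
    then show ?thesis by (simp only: integral_restrict_space[OF r.\<Omega>_sets(2)])
  qed
  have out\<Omega>: "?b x = 0" "?bs x = 0" "?bz x = 0" if "x \<notin> \<Omega>" for x using out[of x] that sub by blast+
  have grad_b: "bump_grad a b c d n x \<bullet> axis 1 1 = 2 * x $ 1 * ?bs x"
    "bump_grad a b c d n x \<bullet> axis 2 1 = 2 * x $ 2 * ?bs x"
    "bump_grad a b c d n x \<bullet> axis 3 1 = ?bz x" for x
    by (simp_all add: bump_grad_def inner_add_left inner_axis_axis)
  show "is_div \<Omega> \<rho>\<^sub>0 u1 f1"
    unfolding is_div_test_fun
  proof (intro allI impI)
    fix \<phi> g assume t: "test_fun \<Omega> \<phi> g"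
    have g: "\<And>x. GDERIV \<phi> x :> g x" "continuous_on UNIV g" using t by (auto simp: test_fun_def)
    have c\<phi>: "continuous_on A \<phi>" for A by (rule test_fun_continuous[OF t])
    let ?A = "\<lambda>x. (2 * ?b x + 2 * radsq x * ?bs x) * \<phi> x"
    let ?B = "\<lambda>x. ?b x * (x $ 1 * g x $ 1 + x $ 2 * g x $ 2)"
    have A: "(LINT x|lebesgue_on \<Omega>. f1 (cyl x) * \<phi> x) = (LINT x|lebesgue. ?A x)"
      by (subst int_restrict) (auto simp: f1_def fst_cyl_sq snd_cyl out\<Omega>)
    have "(LINT x|lebesgue_on \<Omega>. \<rho>\<^sub>0 (cyl x) * (field3 u1 x \<bullet> g x)) = (LINT x|lebesgue_on \<Omega>. ?B x)"
    proof (rule Bochner_Integration.integral_cong[OF refl])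
      fix x assume "x \<in> space (lebesgue_on \<Omega>)"
      then have "\<rho>\<^sub>0 (cyl x) \<noteq> 0" using \<rho>0 by (simp add: space_restrict_space)
      \<comment> \<open>On the axis \<open>field3\<close> divides by zero; there
        \<open>x $ 1\<close> and \<open>x $ 2\<close> vanish and both sides are 0.\<close>
      moreover have "fst (cyl x) = 0 \<Longrightarrow> x $ 1 = 0 \<and> x $ 2 = 0" using component_le_radius[of x] by simp
      ultimately show "\<rho>\<^sub>0 (cyl x) * (field3 u1 x \<bullet> g x) = ?B x"
        unfolding inner_field3 u1_def
        by (cases "fst (cyl x) = 0") (simp_all add: fst_cyl_sq snd_cyl field_simps)
    qed
    also have "\<dots> = (LINT x|lebesgue. ?B x)" by (rule int_restrict) (simp add: out\<Omega>)
    finally have B: "(LINT x|lebesgue_on \<Omega>. \<rho>\<^sub>0 (cyl x) * (field3 u1 x \<bullet> g x)) = (LINT x|lebesgue. ?B x)" .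
    have intA: "integrable lebesgue ?A"
      by (rule integrable_continuous_bounded_support[where \<rho> = K])
        (auto simp: out supp intro!: continuous_intros cb continuous_radsq c\<phi>)
    have intB: "integrable lebesgue ?B"
      by (rule integrable_continuous_bounded_support[where \<rho> = K])
        (auto simp: out supp intro!: continuous_intros cb g(2))
    \<comment> \<open>The gradient of \<open>\<phi>\<close> times the bump times
      \<open>x $ i\<close>. Its components in direction \<open>i\<close>, for
      \<open>i = 1, 2\<close>, add up to \<open>?A + ?B\<close> and integrate to 0: this is the
      integration by parts.\<close>
    let ?G = "\<lambda>i x. (\<phi> x * ?b x) *\<^sub>R axis i 1 + x $ i *\<^sub>R (\<phi> x *\<^sub>R bump_grad a b c d n x + ?b x *\<^sub>R g x)"
    have G: "GDERIV (\<lambda>x. (\<phi> x * ?b x) * x $ i) x :> ?G i x" for i x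
      by (intro GDERIV_mult g(1) bump_GDERIV GDERIV_component)
    have Gc: "continuous_on UNIV (?G i)" for i
      by (intro continuous_intros cb c\<phi> g(2) continuous_bump_grad)
    have z: "(LINT x|lebesgue. ?G i x \<bullet> axis i 1) = 0" for i
      by (rule integral_gradient_zero[OF G Gc, where \<rho> = K]) (simp add: out supp)
    have intG: "integrable lebesgue (\<lambda>x. ?G i x \<bullet> axis i 1)" for i
      by (rule integrable_continuous_bounded_support[where \<rho> = K])
        (auto simp: out supp intro!: continuous_intros cb c\<phi> g(2) continuous_bump_grad)
    have "?A x + ?B x = ?G 1 x \<bullet> axis 1 1 + ?G 2 x \<bullet> axis 2 1" for x
      by (simp add: inner_add_left grad_b inner_axis[of "g x"] inner_axis_axis radsq_def power2_eq_square algebra_simps)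
    then have "(LINT x|lebesgue. ?A x + ?B x) = (LINT x|lebesgue. ?G 1 x \<bullet> axis 1 1 + ?G 2 x \<bullet> axis 2 1)"
      by (simp only:)
    then have "(LINT x|lebesgue. ?A x) + (LINT x|lebesgue. ?B x) = 0"
      unfolding Bochner_Integration.integral_add[OF intA intB] Bochner_Integration.integral_add[OF intG intG] z by simp
    then show "(LINT x|lebesgue_on \<Omega>. f1 (cyl x) * \<phi> x) = - (LINT x|lebesgue_on \<Omega>. \<rho>\<^sub>0 (cyl x) * (field3 u1 x \<bullet> g x))"
      unfolding A B by simp
  qed
  show "is_div \<Omega> \<rho>\<^sub>0 u2 f2"
    unfolding is_div_test_fun
  proof (intro allI impI)
    fix \<phi> g assume t: "test_fun \<Omega> \<phi> g"
    have g: "\<And>x. GDERIV \<phi> x :> g x" "continuous_on UNIV g" using t by (auto simp: test_fun_def)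
    have c\<phi>: "continuous_on A \<phi>" for A by (rule test_fun_continuous[OF t])
    let ?A = "\<lambda>x. ?bz x * \<phi> x"
    let ?B = "\<lambda>x. ?b x * g x $ 3"
    have A: "(LINT x|lebesgue_on \<Omega>. f2 (cyl x) * \<phi> x) = (LINT x|lebesgue. ?A x)"
      by (subst int_restrict) (auto simp: f2_def fst_cyl_sq snd_cyl out\<Omega>)
    have "(LINT x|lebesgue_on \<Omega>. \<rho>\<^sub>0 (cyl x) * (field3 u2 x \<bullet> g x)) = (LINT x|lebesgue_on \<Omega>. ?B x)"
    proof (rule Bochner_Integration.integral_cong[OF refl])
      fix x assume "x \<in> space (lebesgue_on \<Omega>)"
      then have "\<rho>\<^sub>0 (cyl x) \<noteq> 0" using \<rho>0 by (simp add: space_restrict_space)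
      then show "\<rho>\<^sub>0 (cyl x) * (field3 u2 x \<bullet> g x) = ?B x"
        unfolding inner_field3 u2_def by (simp add: fst_cyl_sq snd_cyl)
    qed
    also have "\<dots> = (LINT x|lebesgue. ?B x)" by (rule int_restrict) (simp add: out\<Omega>)
    finally have B: "(LINT x|lebesgue_on \<Omega>. \<rho>\<^sub>0 (cyl x) * (field3 u2 x \<bullet> g x)) = (LINT x|lebesgue. ?B x)" .
    have intA: "integrable lebesgue ?A"
      by (rule integrable_continuous_bounded_support[where \<rho> = K])
        (auto simp: out supp intro!: continuous_intros cb c\<phi>)
    have intB: "integrable lebesgue ?B"
      by (rule integrable_continuous_bounded_support[where \<rho> = K])
        (auto simp: out supp intro!: continuous_intros cb g(2))
    let ?G = "\<lambda>x. \<phi> x *\<^sub>R bump_grad a b c d n x + ?b x *\<^sub>R g x"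
    have z: "(LINT x|lebesgue. ?G x \<bullet> axis 3 1) = 0"
    proof (rule integral_gradient_zero[where \<rho> = K])
      show "GDERIV (\<lambda>x. \<phi> x * ?b x) x :> ?G x" for x by (intro GDERIV_mult g(1) bump_GDERIV)
      show "continuous_on UNIV ?G" by (intro continuous_intros cb c\<phi> g(2) continuous_bump_grad)
    qed (simp add: out supp)
    have "?A x + ?B x = ?G x \<bullet> axis 3 1" for x
      by (simp add: inner_add_left grad_b inner_axis[of "g x"] mult.commute)
    then have "(LINT x|lebesgue. ?A x + ?B x) = 0" using z by (simp only:)
    then have "(LINT x|lebesgue. ?A x) + (LINT x|lebesgue. ?B x) = 0"
      unfolding Bochner_Integration.integral_add[OF intA intB] .
    then show "(LINT x|lebesgue_on \<Omega>. f2 (cyl x) * \<phi> x) = - (LINT x|lebesgue_on \<Omega>. \<rho>\<^sub>0 (cyl x) * (field3 u2 x \<bullet> g x))"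
      unfolding A B by simp
  qed
qed

text \<open>Orthogonality to the two kinds of bump fields yields \<open>r v\<^sub>r = 0\<close> and
  \<open>v\<^sub>z = 0\<close> almost everywhere; the factor \<open>r\<close> of the radial field
  costs only the axis, a null set.\<close>

lemma dense_\<Gamma>:
  assumes y: "y \<in> YY" and orth: "\<And>p. p \<in> \<Gamma> \<Longrightarrow> y \<bullet> fst p = 0"
  shows "y = 0"
proof -
  obtain v where v: "v \<in> Ysp \<Omega> \<rho>\<^sub>0" "y = J v" using YY_J[OF y] .
  have v12: "(\<lambda>p. fst (v p)) \<in> L2w \<Omega> \<rho>\<^sub>0" "(\<lambda>p. snd (v p)) \<in> L2w \<Omega> \<rho>\<^sub>0" using v(1) by (auto simp: Ysp_iff)
  have orth': "(LINT x|lebesgue_on \<Omega>. \<rho>\<^sub>0 (cyl x) * (v (cyl x) \<bullet> u (cyl x))) = 0"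
    if "u \<in> Ysp \<Omega> \<rho>\<^sub>0" "f \<in> X" "is_div \<Omega> \<rho>\<^sub>0 u f" for u f
    using orth[of "(J u, h.V f)"] that innerY_J[OF v(1) that(1)] by (simp add: mem_\<Gamma>_iff v(2) innerY_def)
  have "AE x in lebesgue_on \<Omega>. (\<lambda>p. fst p * fst (v p)) (cyl x) = 0"
  proof (rule axisymmetric_zero_AE[OF open_\<Omega> axisym])
    show "integrable lebesgue (\<lambda>x. indicator (tube a b c d) x * (fst (cyl x) * fst (v (cyl x))))" if "tube a b c d \<subseteq> \<Omega>" for a b c d
      by (rule r.L2w_locally_integrable[OF v12(1) compact_tube that continuous_on_fst[OF continuous_cyl]])
    fix a b c d n :: real
    assume A: "a < b" "c < d" "tube a b c d \<subseteq> \<Omega>" "n \<ge> 0"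
    note F = bump_fields[OF A(1-3), of n]
    have "(LINT x|lebesgue_on \<Omega>. (fst (cyl x) * fst (v (cyl x))) * bump a b c d n (radsq x) (x $ 3))
      = (LINT x|lebesgue_on \<Omega>. \<rho>\<^sub>0 (cyl x) * (v (cyl x) \<bullet> (fst (cyl x) * bump a b c d n ((fst (cyl x))\<^sup>2) (snd (cyl x)) / \<rho>\<^sub>0 (cyl x), 0)))"
    proof (rule Bochner_Integration.integral_cong[OF refl])
      fix x assume "x \<in> space (lebesgue_on \<Omega>)"
      then have "\<rho>\<^sub>0 (cyl x) \<noteq> 0" using \<rho>_pos[of x] by (simp add: space_restrict_space)
      then show "(fst (cyl x) * fst (v (cyl x))) * bump a b c d n (radsq x) (x $ 3)
        = \<rho>\<^sub>0 (cyl x) * (v (cyl x) \<bullet> (fst (cyl x) * bump a b c d n ((fst (cyl x))\<^sup>2) (snd (cyl x)) / \<rho>\<^sub>0 (cyl x), 0))"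
        by (simp add: inner_prod_def fst_cyl_sq snd_cyl)
    qed
    also have "\<dots> = 0" using orth'[OF F(1,3,5)] by simp
    finally show "(LINT x|lebesgue_on \<Omega>. (fst (cyl x) * fst (v (cyl x))) * bump a b c d n (radsq x) (x $ 3)) = 0" .
  qed
  moreover have "AE x in lebesgue_on \<Omega>. fst (cyl x) \<noteq> 0"
  proof -
    have "negligible {x :: real ^ 3. x $ 1 = 0}"
      using negligible_standard_hyperplane_cart[of 1] by simp
    then have "AE x in lebesgue. \<not> (x :: real ^ 3) \<in> {x. x $ 1 = 0}"
      unfolding negligible_iff_null_sets by (rule AE_not_in)
    then have "AE x in lebesgue. (x :: real ^ 3) \<in> \<Omega> \<longrightarrow> fst (cyl x) \<noteq> 0"
    proof eventually_elim
      fix x :: "real ^ 3" assume "\<not> x \<in> {x. x $ 1 = 0}"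
      then show "x \<in> \<Omega> \<longrightarrow> fst (cyl x) \<noteq> 0" using component_le_radius(1)[of x] by auto
    qed
    then show ?thesis by (simp add: AE_restrict_space_iff r.\<Omega>_sets)
  qed
  ultimately have z1: "AE x in lebesgue_on \<Omega>. fst (v (cyl x)) = 0" by eventually_elim simp
  have z2: "AE x in lebesgue_on \<Omega>. (\<lambda>p. snd (v p)) (cyl x) = 0"
  proof (rule axisymmetric_zero_AE[OF open_\<Omega> axisym])
    show "integrable lebesgue (\<lambda>x. indicator (tube a b c d) x * snd (v (cyl x)))" if "tube a b c d \<subseteq> \<Omega>" for a b c d
      using r.L2w_locally_integrable[OF v12(2) compact_tube that, of "\<lambda>x. 1"] by simp
    fix a b c d n :: real
    assume A: "a < b" "c < d" "tube a b c d \<subseteq> \<Omega>" "n \<ge> 0"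
    note F = bump_fields[OF A(1-3), of n]
    have "(LINT x|lebesgue_on \<Omega>. snd (v (cyl x)) * bump a b c d n (radsq x) (x $ 3))
      = (LINT x|lebesgue_on \<Omega>. \<rho>\<^sub>0 (cyl x) * (v (cyl x) \<bullet> (0, bump a b c d n ((fst (cyl x))\<^sup>2) (snd (cyl x)) / \<rho>\<^sub>0 (cyl x))))"
    proof (rule Bochner_Integration.integral_cong[OF refl])
      fix x assume "x \<in> space (lebesgue_on \<Omega>)"
      then have "\<rho>\<^sub>0 (cyl x) \<noteq> 0" using \<rho>_pos[of x] by (simp add: space_restrict_space)
      then show "snd (v (cyl x)) * bump a b c d n (radsq x) (x $ 3)
        = \<rho>\<^sub>0 (cyl x) * (v (cyl x) \<bullet> (0, bump a b c d n ((fst (cyl x))\<^sup>2) (snd (cyl x)) / \<rho>\<^sub>0 (cyl x)))"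
        by (simp add: inner_prod_def fst_cyl_sq snd_cyl)
    qed
    also have "\<dots> = 0" using orth'[OF F(2,4,6)] by simp
    finally show "(LINT x|lebesgue_on \<Omega>. snd (v (cyl x)) * bump a b c d n (radsq x) (x $ 3)) = 0" .
  qed
  show ?thesis using z1 z2 v12 by (simp add: v(2) J_def zero_prod_def r.V_eq_0_iff)
qed

end

section \<open>The quadratic form of the star and the operator it defines\<close>

context star
begin

definition \<upsilon> :: "real ^ 3 \<Rightarrow> real" where "\<upsilon> x = indicator \<Omega> x * Upsilon \<omega>\<^sub>0 R\<^sub>0 (fst (cyl x))"

lemma \<upsilon>_measurable: "\<upsilon> \<in> borel_measurable lebesgue" and \<upsilon>_le: "\<bar>\<upsilon> x\<bar> \<le> \<bar>U\<bar>"
proof -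
  have "(\<lambda>x. Upsilon \<omega>\<^sub>0 R\<^sub>0 (fst (cyl x))) \<in> borel_measurable (lebesgue_on \<Omega>)"
    by (rule continuous_imp_measurable_on_sets_lebesgue[OF U_cont r.\<Omega>_sets(1)])
  then show "\<upsilon> \<in> borel_measurable lebesgue"
    by (simp add: borel_measurable_restrict_space_iff[OF r.\<Omega>_sets(2)] \<upsilon>_def[abs_def])
  show "\<bar>\<upsilon> x\<bar> \<le> \<bar>U\<bar>" using U_le[of x] by (cases "x \<in> \<Omega>") (auto simp: \<upsilon>_def)
qed

lemma \<upsilon>_mult_sqint: "f \<in> sqint \<Longrightarrow> (\<lambda>x. \<upsilon> x * f x) \<in> sqint"
  by (rule sqint_bounded_mult[OF _ \<upsilon>_measurable \<upsilon>_le])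

text \<open>Multiplication by \<open>Upsilon\<close> inside \<open>\<Omega>\<close>. The coefficient
  is bounded, so this part of the form is continuous in the norm of \<open>Y\<close> and can be
  absorbed in the constant of the Garding inequality.\<close>

definition mulop :: "(real ^ 3) l2 \<Rightarrow> (real ^ 3) l2" where "mulop Z = l2_of (\<lambda>x. \<upsilon> x * fun_of Z x)"

lemma mulop_l2_of: "f \<in> sqint \<Longrightarrow> mulop (l2_of f) = l2_of (\<lambda>x. \<upsilon> x * f x)"
  unfolding mulop_def
  by (subst l2_of_eq_iff) (auto intro: \<upsilon>_mult_sqint fun_of_sqint elim!: eventually_mono[OF fun_of_l2_of])

lemma bounded_linear_mulop: "bounded_linear mulop"
proof (rule bounded_linear_intro)
  fix Z W :: "(real ^ 3) l2" and c :: real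
  have "mulop (Z + W) = mulop (l2_of (\<lambda>x. fun_of Z x + fun_of W x))"
    by (simp add: l2_of_add fun_of_sqint)
  also have "\<dots> = l2_of (\<lambda>x. \<upsilon> x * fun_of Z x + \<upsilon> x * fun_of W x)"
    by (simp add: mulop_l2_of sqint_add fun_of_sqint distrib_left)
  finally show "mulop (Z + W) = mulop Z + mulop W"
    by (simp add: mulop_def l2_of_add \<upsilon>_mult_sqint fun_of_sqint)
  have "mulop (c *\<^sub>R Z) = mulop (l2_of (\<lambda>x. c * fun_of Z x))"
    by (simp add: l2_of_cmult fun_of_sqint)
  also have "\<dots> = l2_of (\<lambda>x. c * (\<upsilon> x * fun_of Z x))"
    by (simp add: mulop_l2_of sqint_cmult fun_of_sqint mult.left_commute)
  finally show "mulop (c *\<^sub>R Z) = c *\<^sub>R mulop Z"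
    by (simp add: mulop_def l2_of_cmult \<upsilon>_mult_sqint fun_of_sqint)
  show "norm (mulop Z) \<le> norm Z * \<bar>U\<bar>"
  proof (rule power2_le_imp_le)
    have "(norm (mulop Z))\<^sup>2 = (LINT x|lebesgue. (\<upsilon> x * fun_of Z x)\<^sup>2)"
      by (simp add: mulop_def norm_l2_of_sq \<upsilon>_mult_sqint fun_of_sqint)
    also have "\<dots> \<le> (LINT x|lebesgue. \<bar>U\<bar>\<^sup>2 * (fun_of Z x)\<^sup>2)"
    proof (intro integral_mono sqint_integrable \<upsilon>_mult_sqint fun_of_sqint integrable_mult_right)
      fix x show "(\<upsilon> x * fun_of Z x)\<^sup>2 \<le> \<bar>U\<bar>\<^sup>2 * (fun_of Z x)\<^sup>2"
        using power_mono[OF \<upsilon>_le[of x], of 2] by (simp add: power_mult_distrib mult_right_mono)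
    qed
    also have "\<dots> = (norm Z * \<bar>U\<bar>)\<^sup>2"
      using norm_l2_of_sq[OF fun_of_sqint, of Z] by (simp add: power_mult_distrib mult.commute)
    finally show "(norm (mulop Z))\<^sup>2 \<le> (norm Z * \<bar>U\<bar>)\<^sup>2" .
  qed simp
qed

definition mform :: "(real ^ 3) l2 \<times> (real ^ 3) l2 \<Rightarrow> (real ^ 3) l2 \<times> (real ^ 3) l2 \<Rightarrow> real" where
  "mform u v = mulop (fst u) \<bullet> fst v"

lemma bilinear_mform: "bounded_bilinear mform"
  unfolding mform_def[abs_def]
  by (rule bounded_bilinear.comp[OF bounded_bilinear_inner
        bounded_linear_compose[OF bounded_linear_mulop bounded_linear_fst] bounded_linear_fst])

lemma mform_sym: "mform u v = mform v u"
proof -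
  have "mulop Z \<bullet> W = (LINT x|lebesgue. \<upsilon> x * (fun_of Z x * fun_of W x))" for Z W
    using inner_l2_of[OF \<upsilon>_mult_sqint[OF fun_of_sqint] fun_of_sqint, of Z W]
    by (simp add: mulop_def mult.assoc)
  then show ?thesis by (simp add: mform_def mult.commute)
qed

type_synonym graph = "((real ^ 3) l2 \<times> (real ^ 3) l2) \<times> (real ^ 3) l2"

text \<open>In \<open>l2\<close> coordinates the enthalpy term is the plain inner product of the
  second components, since the weight is absorbed by the embedding.\<close>

definition form :: "graph \<Rightarrow> graph \<Rightarrow> real" where
  "form p q = snd p \<bullet> snd q - newton.newton_form (snd p) (snd q) + mform (fst p) (fst q)"

definition M\<^sub>0 :: real where
  "M\<^sub>0 = (SOME M. \<forall>p\<in>\<Gamma>. 1/2 * (norm p)\<^sup>2 \<le> form p p + M * (norm (fst p))\<^sup>2)"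

lemma M\<^sub>0: "p \<in> \<Gamma> \<Longrightarrow> 1/2 * (norm p)\<^sup>2 \<le> form p p + M\<^sub>0 * (norm (fst p))\<^sup>2"
proof -
  have "\<exists>M. \<forall>p\<in>\<Gamma>. 1/2 * (norm p)\<^sup>2
      \<le> (snd p \<bullet> snd p - newton.newton_form (snd p) (snd p) + mform (fst p) (fst p)) + M * (norm (fst p))\<^sup>2"
    by (rule coercive_of_compact_perturbation[OF subspace_\<Gamma> closed_\<Gamma> graph_\<Gamma>
          newton.bilinear_newton_form bilinear_mform newton.newton_form_compact])
  then have "\<exists>M. \<forall>p\<in>\<Gamma>. 1/2 * (norm p)\<^sup>2 \<le> form p p + M * (norm (fst p))\<^sup>2" by (simp only: form_def)
  from someI_ex[OF this] show "p \<in> \<Gamma> \<Longrightarrow> 1/2 * (norm p)\<^sup>2 \<le> form p p + M\<^sub>0 * (norm (fst p))\<^sup>2"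
    unfolding M\<^sub>0_def by blast
qed

lemma \<Gamma>_sub: "p \<in> \<Gamma> \<Longrightarrow> fst p \<in> YY \<and> snd p \<in> h.V ` X"
  unfolding \<Gamma>_def by auto

sublocale form: energy_form \<Gamma> YY form M\<^sub>0 "1/2"
proof (rule energy_form.intro)
  have snd2: "bounded_bilinear (\<lambda>(p :: graph) (q :: graph). snd p \<bullet> snd q)"
    by (rule bounded_bilinear.comp[OF bounded_bilinear_inner bounded_linear_snd bounded_linear_snd])
  have n2: "bounded_bilinear (\<lambda>(p :: graph) (q :: graph). newton.newton_form (snd p) (snd q))"
    by (rule bounded_bilinear.comp[OF newton.bilinear_newton_form bounded_linear_snd bounded_linear_snd])
  have m2: "bounded_bilinear (\<lambda>(p :: graph) (q :: graph). mform (fst p) (fst q))"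
    by (rule bounded_bilinear.comp[OF bilinear_mform bounded_linear_fst bounded_linear_fst])
  have "bounded_bilinear (\<lambda>(p :: graph) (q :: graph). (snd p \<bullet> snd q + (- 1) * newton.newton_form (snd p) (snd q)) + mform (fst p) (fst q))"
    by (intro bounded_bilinear_plus bounded_bilinear_cmult snd2 n2 m2)
  moreover have "(\<lambda>p q. (snd p \<bullet> snd q + (- 1) * newton.newton_form (snd p) (snd q)) + mform (fst p) (fst q)) = form"
    by (intro ext) (simp add: form_def)
  ultimately show "bounded_bilinear form" by simp
  show "form p q = form q p" for p q
    by (simp add: form_def newton.newton_form_sym[of "snd p"] mform_sym[of "fst p"] inner_commute[of "snd p"])
  show "subspace \<Gamma>" "closed \<Gamma>" "subspace YY" "closed YY"
    by (fact subspace_\<Gamma> closed_\<Gamma> subspace_YY closed_YY)+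
  show "f = 0" if "(0, f) \<in> \<Gamma>" for f by (rule graph_\<Gamma>[OF that])
  show "fst p \<in> YY" if "p \<in> \<Gamma>" for p using \<Gamma>_sub[OF that] by simp
  show "w = 0" if "w \<in> YY" "\<And>p. p \<in> \<Gamma> \<Longrightarrow> w \<bullet> fst p = 0" for w by (rule dense_\<Gamma>[OF that])
  show "(1/2 :: real) > 0" by simp
  show "1/2 * (norm p)\<^sup>2 \<le> form p p + M\<^sub>0 * (norm (fst p))\<^sup>2" if "p \<in> \<Gamma>" for p by (rule M\<^sub>0[OF that])
qed

abbreviation Z where "Z \<equiv> Zsp P \<Omega> \<rho>\<^sub>0"
abbreviation dv where "dv \<equiv> wdiv P \<Omega> \<rho>\<^sub>0"

text \<open>The graph point of \<open>u\<close>. \<open>wdiv\<close> picks some divergence, but by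
  \<open>graph_\<Gamma>\<close> its class is unique, so \<open>q\<close> respects linear
  combinations.\<close>

definition q :: "(rz \<Rightarrow> rz) \<Rightarrow> graph" where "q u = (J u, h.V (dv u))"

lemma Z_iff: "u \<in> Z \<longleftrightarrow> u \<in> Ysp \<Omega> \<rho>\<^sub>0 \<and> (\<exists>f\<in>X. is_div \<Omega> \<rho>\<^sub>0 u f)"
  by (simp add: Zsp_def Xsp_def)

lemma Z_Y: "u \<in> Z \<Longrightarrow> u \<in> Ysp \<Omega> \<rho>\<^sub>0"
  by (simp add: Z_iff)

lemma dv_props: assumes "u \<in> Z" shows "dv u \<in> X" "is_div \<Omega> \<rho>\<^sub>0 u (dv u)"
proof -
  have "\<exists>f. f \<in> Xsp P \<Omega> \<rho>\<^sub>0 \<and> is_div \<Omega> \<rho>\<^sub>0 u f" using assms by (auto simp: Zsp_def)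
  from someI_ex[OF this] show "dv u \<in> X" "is_div \<Omega> \<rho>\<^sub>0 u (dv u)" by (simp_all add: wdiv_def Xsp_def)
qed

lemma fst_q [simp]: "fst (q u) = J u"
  by (simp add: q_def)

lemma q_\<Gamma>: "u \<in> Z \<Longrightarrow> q u \<in> \<Gamma>"
  using mem_\<Gamma>_iff[OF Z_Y dv_props(1)] dv_props(2) by (simp add: q_def)

text \<open>Both \<open>Z\<close> and \<open>q\<close> depend only on the class of \<open>u\<close>
  in \<open>Y\<close>, because a graph point is determined by its first component.\<close>

lemma q_eqI:
  assumes u: "u \<in> Ysp \<Omega> \<rho>\<^sub>0" and p: "p \<in> \<Gamma>" "fst p = J u"
  shows "u \<in> Z" and "q u = p"
proof -
  obtain f where f: "f \<in> X" "snd p = h.V f" using \<Gamma>_sub[OF p(1)] by auto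
  then have "p = (J u, h.V f)" using p(2) by (simp add: prod_eq_iff)
  then have "is_div \<Omega> \<rho>\<^sub>0 u f" using p(1) mem_\<Gamma>_iff[OF u f(1)] by simp
  then show uZ: "u \<in> Z" using u f(1) by (auto simp: Z_iff)
  show "q u = p" by (rule form.\<Gamma>_eqI[OF q_\<Gamma>[OF uZ] p(1)]) (simp add: p(2))
qed

lemma \<Gamma>_q: assumes "p \<in> \<Gamma>" obtains u where "u \<in> Z" "p = q u"
proof -
  obtain u where "u \<in> Ysp \<Omega> \<rho>\<^sub>0" "fst p = J u" using YY_J \<Gamma>_sub[OF assms] by blast
  then show ?thesis using q_eqI[OF _ assms] that by metis
qed

lemma Z_lin: "u \<in> Z \<Longrightarrow> v \<in> Z \<Longrightarrow> (\<lambda>p. s *\<^sub>R u p + t *\<^sub>R v p) \<in> Z"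
  and q_lin: "u \<in> Z \<Longrightarrow> v \<in> Z \<Longrightarrow> q (\<lambda>p. s *\<^sub>R u p + t *\<^sub>R v p) = s *\<^sub>R q u + t *\<^sub>R q v"
proof -
  assume u: "u \<in> Z" and v: "v \<in> Z"
  have *: "(\<lambda>p. s *\<^sub>R u p + t *\<^sub>R v p) \<in> Ysp \<Omega> \<rho>\<^sub>0" "s *\<^sub>R q u + t *\<^sub>R q v \<in> \<Gamma>"
    "fst (s *\<^sub>R q u + t *\<^sub>R q v) = J (\<lambda>p. s *\<^sub>R u p + t *\<^sub>R v p)"
    using Ysp_lin[OF Z_Y[OF u] Z_Y[OF v]] J_lin[OF Z_Y[OF u] Z_Y[OF v]]
      subspace_add[OF subspace_\<Gamma>] subspace_scale[OF subspace_\<Gamma>] q_\<Gamma>[OF u] q_\<Gamma>[OF v] by simp_all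
  show "(\<lambda>p. s *\<^sub>R u p + t *\<^sub>R v p) \<in> Z" "q (\<lambda>p. s *\<^sub>R u p + t *\<^sub>R v p) = s *\<^sub>R q u + t *\<^sub>R q v"
    by (rule q_eqI[OF *])+
qed

lemma normZ_q: "u \<in> Z \<Longrightarrow> normZ P \<Omega> \<rho>\<^sub>0 u = norm (fst (q u)) + norm (snd (q u))"
  by (simp add: normZ_def normY_J Z_Y q_def h.norm_V dv_props)

text \<open>The factors \<open>\<theta>\<close> of the kernel cancel the square roots of
  \<open>\<Phi>''(\<rho>\<^sub>0)\<close> in the embedded functions, which leaves the unweighted
  Newtonian potential.\<close>

lemma newton_form_V:
  assumes f: "f \<in> X" and g: "g \<in> X"
  shows "newton.newton_form (h.V f) (h.V g) = (LINT x|lebesgue_on \<Omega>. newton \<Omega> f x * g (cyl x))"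
    and "integrable (lebesgue_on \<Omega>) (\<lambda>x. newton \<Omega> f x * g (cyl x))"
proof -
  have s: "h.emb f \<in> sqint" "h.emb g \<in> sqint" using f g by (simp_all add: h.L2w_iff)
  have ker: "newton.ker x y * h.emb f y = \<theta> x * (indicator \<Omega> y *\<^sub>R (f (cyl y) / norm (x - y)))" for x y
    using h_pos[of y] by (cases "y \<in> \<Omega>") (simp_all add: newton.ker_def h.emb_def \<theta>_def)
  have pot: "newton.pot (h.V f) x = \<theta> x * newton \<Omega> f x" for x
    unfolding h.V_def newton.pot_eq[OF s(1)] newton_def integral_restrict_space[OF r.\<Omega>_sets(2)] ker
    by (rule integral_mult_right_zero)
  have pt: "newton.pot (h.V f) x * h.emb g x = indicator \<Omega> x *\<^sub>R (newton \<Omega> f x * g (cyl x))" for x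
    using h_pos[of x] by (cases "x \<in> \<Omega>") (simp_all add: pot h.emb_def \<theta>_def)
  show "newton.newton_form (h.V f) (h.V g) = (LINT x|lebesgue_on \<Omega>. newton \<Omega> f x * g (cyl x))"
    unfolding newton.newton_form_def h.V_def[of g] inner_l2_of[OF newton.pot_sqint s(2)] pt
      integral_restrict_space[OF r.\<Omega>_sets(2)] ..
  show "integrable (lebesgue_on \<Omega>) (\<lambda>x. newton \<Omega> f x * g (cyl x))"
    unfolding integrable_restrict_space[OF r.\<Omega>_sets(2)] pt[symmetric]
    by (rule sqint_mult_integrable[OF newton.pot_sqint s(2)])
qed

definition Yfield :: "(rz \<Rightarrow> rz) \<Rightarrow> rz \<Rightarrow> rz" where
  "Yfield u p = (Upsilon \<omega>\<^sub>0 R\<^sub>0 (fst p) * fst (u p), 0)"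

lemma Yfield:
  assumes u: "u \<in> Ysp \<Omega> \<rho>\<^sub>0"
  shows Yfield_Y: "Yfield u \<in> Ysp \<Omega> \<rho>\<^sub>0" and J_Yfield: "J (Yfield u) = (mulop (fst (J u)), 0)"
proof -
  let ?u = "\<lambda>p. fst (u p)"
  have s: "r.emb ?u \<in> sqint" using u by (simp add: Ysp_iff r.L2w_iff)
  have e: "r.emb (\<lambda>p. fst (Yfield u p)) = (\<lambda>x. \<upsilon> x * r.emb ?u x)"
  proof (rule ext)
    show "r.emb (\<lambda>p. fst (Yfield u p)) x = \<upsilon> x * r.emb ?u x" for x
      by (cases "x \<in> \<Omega>") (simp_all add: r.emb_def \<upsilon>_def Yfield_def)
  qed
  have "(\<lambda>p. fst (Yfield u p)) \<in> L2w \<Omega> \<rho>\<^sub>0" unfolding r.L2w_iff e by (rule \<upsilon>_mult_sqint[OF s])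
  moreover have sn: "(\<lambda>p. snd (Yfield u p)) = (\<lambda>p. 0)" by (simp add: Yfield_def)
  ultimately show "Yfield u \<in> Ysp \<Omega> \<rho>\<^sub>0" by (simp add: Ysp_iff r.L2w_zero)
  show "J (Yfield u) = (mulop (fst (J u)), 0)"
    by (simp add: J_def sn r.V_zero) (simp add: r.V_def e mulop_l2_of[OF s])
qed

lemma mform_J:
  assumes u: "u \<in> Ysp \<Omega> \<rho>\<^sub>0" and v: "v \<in> Ysp \<Omega> \<rho>\<^sub>0"
  shows "mform (J u) (J v) = J (Yfield u) \<bullet> J v"
    and "mform (J u) (J v) = (LINT x|lebesgue_on \<Omega>. \<rho>\<^sub>0 (cyl x) * Upsilon \<omega>\<^sub>0 R\<^sub>0 (fst (cyl x)) * (fst (u (cyl x)) * fst (v (cyl x))))"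
proof -
  show 1: "mform (J u) (J v) = J (Yfield u) \<bullet> J v"
    by (simp add: mform_def J_Yfield[OF u] inner_prod_def)
  have "\<dots> = (LINT x|lebesgue_on \<Omega>. \<rho>\<^sub>0 (cyl x) * (Yfield u (cyl x) \<bullet> v (cyl x)))"
    using innerY_J[OF Yfield_Y[OF u] v] by (simp add: innerY_def)
  then show "mform (J u) (J v) = (LINT x|lebesgue_on \<Omega>. \<rho>\<^sub>0 (cyl x) * Upsilon \<omega>\<^sub>0 R\<^sub>0 (fst (cyl x)) * (fst (u (cyl x)) * fst (v (cyl x))))"
    unfolding 1 by (simp add: Yfield_def inner_prod_def mult.assoc)
qed

lemma Lform_q: "u \<in> Z \<Longrightarrow> Lform P \<Omega> \<rho>\<^sub>0 \<omega>\<^sub>0 R\<^sub>0 u = form (q u) (q u)"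
  unfolding Lform_def form_def fst_q mform_J(2)[OF Z_Y Z_Y]
  by (simp add: q_def h.V_inner(1)[OF dv_props(1) dv_props(1)] newton_form_V(1)[OF dv_props(1) dv_props(1)] power2_eq_square)

text \<open>The bridge from the differential operator to the form. \<open>is_grad\<close> tests with
  all of \<open>Z\<close>, whose graph points exhaust \<open>\<Gamma>\<close> by
  \<open>\<Gamma>_q\<close>; so the gradient equation together with the multiplication term is the
  weak equation \<open>form.dom_op\<close>.\<close>

lemma Lop_iff:
  "Lop P \<Omega> \<rho>\<^sub>0 \<omega>\<^sub>0 R\<^sub>0 u w \<longleftrightarrow> u \<in> Z \<and> w \<in> Ysp \<Omega> \<rho>\<^sub>0 \<and> form.dom_op (q u) (J w)"
proof (cases "u \<in> Z \<and> w \<in> Ysp \<Omega> \<rho>\<^sub>0")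
  case True
  then have u: "u \<in> Z" and w: "w \<in> Ysp \<Omega> \<rho>\<^sub>0" and uY: "u \<in> Ysp \<Omega> \<rho>\<^sub>0" using Z_Y by auto
  let ?k = "\<lambda>x. enthalpy2 P (\<rho>\<^sub>0 (cyl x)) * dv u (cyl x) - newton \<Omega> (dv u) x"
  have k: "(LINT x|lebesgue_on \<Omega>. ?k x * dv v (cyl x)) = form (q u) (q v) - mform (J u) (J v)" if v: "v \<in> Z" for v
  proof -
    have "(LINT x|lebesgue_on \<Omega>. ?k x * dv v (cyl x))
      = (LINT x|lebesgue_on \<Omega>. enthalpy2 P (\<rho>\<^sub>0 (cyl x)) * (dv u (cyl x) * dv v (cyl x)) - newton \<Omega> (dv u) x * dv v (cyl x))"
      by (simp add: algebra_simps)
    also have "\<dots> = h.V (dv u) \<bullet> h.V (dv v) - newton.newton_form (h.V (dv u)) (h.V (dv v))"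
      unfolding h.V_inner(1)[OF dv_props(1)[OF u] dv_props(1)[OF v]] newton_form_V(1)[OF dv_props(1)[OF u] dv_props(1)[OF v]]
      by (rule Bochner_Integration.integral_diff[OF h.V_inner(2)[OF dv_props(1)[OF u] dv_props(1)[OF v]]
            newton_form_V(2)[OF dv_props(1)[OF u] dv_props(1)[OF v]]])
    finally show ?thesis by (simp add: form_def q_def)
  qed
  have grad: "is_grad P \<Omega> \<rho>\<^sub>0 ?k g \<longleftrightarrow> g \<in> Ysp \<Omega> \<rho>\<^sub>0 \<and> (\<forall>v\<in>Z. J g \<bullet> J v = - (form (q u) (q v) - mform (J u) (J v)))" for g
    unfolding is_grad_def using k innerY_J Z_Y by auto
  have dom: "form.dom_op (q u) (J w) \<longleftrightarrow> (\<forall>v\<in>Z. form (q u) (q v) = J w \<bullet> J v)"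
    unfolding form.dom_op_def
  proof (intro iffI conjI ballI)
    show "form (q u) (q v) = J w \<bullet> J v"
      if "q u \<in> \<Gamma> \<and> J w \<in> YY \<and> (\<forall>qa\<in>\<Gamma>. form (q u) qa = J w \<bullet> fst qa)" "v \<in> Z" for v
      using that q_\<Gamma>[OF that(2)] by simp
    show "q u \<in> \<Gamma>" "J w \<in> YY" by (fact q_\<Gamma>[OF u] J_YY[OF w])+
    fix p assume A: "\<forall>v\<in>Z. form (q u) (q v) = J w \<bullet> J v" and "p \<in> \<Gamma>"
    then obtain v where "v \<in> Z" "p = q v" using \<Gamma>_q by blast
    then show "form (q u) p = J w \<bullet> fst p" using A by simp
  qed
  have "Lop P \<Omega> \<rho>\<^sub>0 \<omega>\<^sub>0 R\<^sub>0 u w \<longleftrightarrow> (\<exists>g. is_grad P \<Omega> \<rho>\<^sub>0 ?k g \<and>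
      (AE x in lebesgue_on \<Omega>. w (cyl x) = - g (cyl x) + (Upsilon \<omega>\<^sub>0 R\<^sub>0 (fst (cyl x)) * fst (u (cyl x)), 0)))"
    using u w by (simp add: Lop_def)
  also have "\<dots> \<longleftrightarrow> form.dom_op (q u) (J w)"
    unfolding dom
  proof (intro iffI ballI)
    fix v assume v: "v \<in> Z" and "\<exists>g. is_grad P \<Omega> \<rho>\<^sub>0 ?k g \<and>
      (AE x in lebesgue_on \<Omega>. w (cyl x) = - g (cyl x) + (Upsilon \<omega>\<^sub>0 R\<^sub>0 (fst (cyl x)) * fst (u (cyl x)), 0))"
    then obtain g where g: "is_grad P \<Omega> \<rho>\<^sub>0 ?k g"
      and ae: "AE x in lebesgue_on \<Omega>. w (cyl x) = - g (cyl x) + (Upsilon \<omega>\<^sub>0 R\<^sub>0 (fst (cyl x)) * fst (u (cyl x)), 0)" by blast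
    have gY: "g \<in> Ysp \<Omega> \<rho>\<^sub>0" and gv: "J g \<bullet> J v = - (form (q u) (q v) - mform (J u) (J v))"
      using g v unfolding grad by auto
    have "J w = J (\<lambda>p. (-1) *\<^sub>R g p + 1 *\<^sub>R Yfield u p)"
      unfolding J_cong_AE[OF w Ysp_lin[OF gY Yfield_Y[OF uY]]] using ae by (simp add: Yfield_def)
    also have "\<dots> = - J g + J (Yfield u)"
      using J_lin[OF gY Yfield_Y[OF uY], of "-1" 1] by (simp only: scaleR_one scaleR_minus1_left)
    finally show "form (q u) (q v) = J w \<bullet> J v"
      using gv mform_J(1)[OF uY Z_Y[OF v]] by (simp add: inner_diff_left inner_add_left)
  next
    assume A: "\<forall>v\<in>Z. form (q u) (q v) = J w \<bullet> J v"
    \<comment> \<open>The equation for \<open>w\<close> leaves no other choice for the gradient, up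
      to a null set.\<close>
    define g where "g p = 1 *\<^sub>R Yfield u p + (-1) *\<^sub>R w p" for p
    have gY: "g \<in> Ysp \<Omega> \<rho>\<^sub>0" unfolding g_def[abs_def] by (rule Ysp_lin[OF Yfield_Y[OF uY] w])
    have Jg: "J g = J (Yfield u) - J w" 
      using J_lin[OF Yfield_Y[OF uY] w, of 1 "-1"] unfolding g_def[abs_def]
      by (simp only: scaleR_one scaleR_minus1_left diff_conv_add_uminus)
    have "J g \<bullet> J v = - (form (q u) (q v) - mform (J u) (J v))" if "v \<in> Z" for v
      using A that mform_J(1)[OF uY Z_Y[OF that]] by (simp add: Jg inner_diff_left)
    then have "is_grad P \<Omega> \<rho>\<^sub>0 ?k g" unfolding grad using gY by blast
    moreover have "AE x in lebesgue_on \<Omega>. w (cyl x) = - g (cyl x) + (Upsilon \<omega>\<^sub>0 R\<^sub>0 (fst (cyl x)) * fst (u (cyl x)), 0)"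
      by (rule AE_I2) (simp add: g_def Yfield_def)
    ultimately show "\<exists>g. is_grad P \<Omega> \<rho>\<^sub>0 ?k g \<and>
      (AE x in lebesgue_on \<Omega>. w (cyl x) = - g (cyl x) + (Upsilon \<omega>\<^sub>0 R\<^sub>0 (fst (cyl x)) * fst (u (cyl x)), 0))" by blast
  qed
  finally show ?thesis using u w by simp
qed (auto simp: Lop_def)

abbreviation specL where
  "specL \<equiv> spectrum (Ysp \<Omega> \<rho>\<^sub>0) (normY \<Omega> \<rho>\<^sub>0) (Lop P \<Omega> \<rho>\<^sub>0 \<omega>\<^sub>0 R\<^sub>0)"

lemma resolvent_form:
  assumes "\<mu> \<notin> specL"
  shows "\<exists>C. \<forall>w\<in>YY. \<exists>p. form.dom_op p (\<mu> *\<^sub>R fst p + w) \<and> norm (fst p) \<le> C * norm w"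
proof -
  obtain C where C: "\<forall>w\<in>Ysp \<Omega> \<rho>\<^sub>0. \<exists>u\<in>Ysp \<Omega> \<rho>\<^sub>0. Lop P \<Omega> \<rho>\<^sub>0 \<omega>\<^sub>0 R\<^sub>0 u (\<lambda>p. \<mu> *\<^sub>R u p + w p) \<and>
      normY \<Omega> \<rho>\<^sub>0 u \<le> C * normY \<Omega> \<rho>\<^sub>0 w"
  proof -
    have "\<mu> \<in> resolvent_set (Ysp \<Omega> \<rho>\<^sub>0) (normY \<Omega> \<rho>\<^sub>0) (Lop P \<Omega> \<rho>\<^sub>0 \<omega>\<^sub>0 R\<^sub>0)"
      using assms by (simp add: spectrum_def)
    then show ?thesis using that unfolding resolvent_set_def mem_Collect_eq by blast
  qed
  show ?thesis
  proof (intro exI[of _ C] ballI)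
    fix w assume "w \<in> YY"
    then obtain w' where w': "w' \<in> Ysp \<Omega> \<rho>\<^sub>0" "w = J w'" using YY_J by blast
    then obtain u where u: "u \<in> Ysp \<Omega> \<rho>\<^sub>0" "Lop P \<Omega> \<rho>\<^sub>0 \<omega>\<^sub>0 R\<^sub>0 u (\<lambda>p. \<mu> *\<^sub>R u p + w' p)"
      "normY \<Omega> \<rho>\<^sub>0 u \<le> C * normY \<Omega> \<rho>\<^sub>0 w'" using C by blast
    have "J (\<lambda>p. \<mu> *\<^sub>R u p + w' p) = \<mu> *\<^sub>R J u + J w'" using J_lin[OF u(1) w'(1), of \<mu> 1] by simp
    then show "\<exists>p. form.dom_op p (\<mu> *\<^sub>R fst p + w) \<and> norm (fst p) \<le> C * norm w"
      using u w' by (intro exI[of _ "q u"]) (simp add: Lop_iff normY_J)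
  qed
qed

text \<open>Otherwise \<open>resolvent_if_form_ge\<close> would solve the equation at
  \<open>\<eta>\<close> with a bounded inverse, and \<open>\<eta>\<close> would be in the resolvent
  set.\<close>

lemma spectrum_form:
  assumes "\<eta> \<in> specL" "\<epsilon> > 0"
  obtains p where "p \<in> \<Gamma>" "form p p < (\<eta> + \<epsilon>) * (norm (fst p))\<^sup>2"
proof (rule ccontr)
  assume "\<not> thesis"
  then have "form p p \<ge> (\<eta> + \<epsilon>) * (norm (fst p))\<^sup>2" if "p \<in> \<Gamma>" for p using that \<open>\<And>p. p \<in> \<Gamma> \<Longrightarrow> form p p < (\<eta> + \<epsilon>) * (norm (fst p))\<^sup>2 \<Longrightarrow> thesis\<close> not_less by blast
  from form.resolvent_if_form_ge[OF assms(2) this]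
  obtain C where C: "\<forall>w\<in>YY. \<exists>p. form.dom_op p (\<eta> *\<^sub>R fst p + w) \<and> norm (fst p) \<le> C * norm w \<and>
    (\<forall>p'. form.dom_op p' (\<eta> *\<^sub>R fst p' + w) \<longrightarrow> p' = p)" by blast
  have "\<eta> \<in> resolvent_set (Ysp \<Omega> \<rho>\<^sub>0) (normY \<Omega> \<rho>\<^sub>0) (Lop P \<Omega> \<rho>\<^sub>0 \<omega>\<^sub>0 R\<^sub>0)"
    unfolding resolvent_set_def mem_Collect_eq
  proof (intro exI[of _ C] ballI)
    fix w assume w: "w \<in> Ysp \<Omega> \<rho>\<^sub>0"
    have Jl: "J (\<lambda>p. \<eta> *\<^sub>R u p + w p) = \<eta> *\<^sub>R J u + J w" "(\<lambda>p. \<eta> *\<^sub>R u p + w p) \<in> Ysp \<Omega> \<rho>\<^sub>0" if "u \<in> Ysp \<Omega> \<rho>\<^sub>0" for u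
      using J_lin[OF that w, of \<eta> 1] Ysp_lin[OF that w, of \<eta> 1] by simp_all
    obtain p where p: "form.dom_op p (\<eta> *\<^sub>R fst p + J w)" "norm (fst p) \<le> C * norm (J w)"
      "\<forall>p'. form.dom_op p' (\<eta> *\<^sub>R fst p' + J w) \<longrightarrow> p' = p" using C J_YY[OF w] by blast
    have "p \<in> \<Gamma>" using p(1) by (simp add: form.dom_op_def)
    then obtain u where u: "u \<in> Z" "p = q u" using \<Gamma>_q by blast
    note uY = Z_Y[OF u(1)]
    show "\<exists>u\<in>Ysp \<Omega> \<rho>\<^sub>0. Lop P \<Omega> \<rho>\<^sub>0 \<omega>\<^sub>0 R\<^sub>0 u (\<lambda>p. \<eta> *\<^sub>R u p + w p) \<and> normY \<Omega> \<rho>\<^sub>0 u \<le> C * normY \<Omega> \<rho>\<^sub>0 w \<and>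
      (\<forall>u'\<in>Ysp \<Omega> \<rho>\<^sub>0. Lop P \<Omega> \<rho>\<^sub>0 \<omega>\<^sub>0 R\<^sub>0 u' (\<lambda>p. \<eta> *\<^sub>R u' p + w p) \<longrightarrow> normY \<Omega> \<rho>\<^sub>0 (\<lambda>p. u' p - u p) = 0)"
    proof (intro bexI[OF _ uY] conjI ballI impI)
      show "Lop P \<Omega> \<rho>\<^sub>0 \<omega>\<^sub>0 R\<^sub>0 u (\<lambda>p. \<eta> *\<^sub>R u p + w p)" using p(1) u uY by (simp add: Lop_iff Jl)
      show "normY \<Omega> \<rho>\<^sub>0 u \<le> C * normY \<Omega> \<rho>\<^sub>0 w" using p(2) u uY w by (simp add: normY_J)
      fix u' assume u': "u' \<in> Ysp \<Omega> \<rho>\<^sub>0" "Lop P \<Omega> \<rho>\<^sub>0 \<omega>\<^sub>0 R\<^sub>0 u' (\<lambda>p. \<eta> *\<^sub>R u' p + w p)"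
      then have "form.dom_op (q u') (\<eta> *\<^sub>R fst (q u') + J w)" by (simp add: Lop_iff Jl)
      then have "q u' = p" by (rule p(3)[rule_format])
      then have "J u' = J u" using u(2) by (metis fst_q)
      then show "normY \<Omega> \<rho>\<^sub>0 (\<lambda>p. u' p - u p) = 0"
        using J_lin[OF u'(1) uY, of 1 "-1"] Ysp_lin[OF u'(1) uY, of 1 "-1"] by (simp add: normY_J)
    qed
  qed
  then show False using assms(1) by (simp add: spectrum_def)
qed

end

section \<open>Transfer of the abstract group to \<open>Z \<times> Y\<close>, and the growth
  bounds\<close>

context star
begin

lemma form_ge:
  assumes "\<forall>\<mu>\<in>specL. \<eta> \<le> \<mu>" "p \<in> \<Gamma>"
  shows "form p p \<ge> \<eta> * (norm (fst p))\<^sup>2"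
proof (rule form.form_ge_if_resolvent[OF _ assms(2)])
  fix \<mu> assume "\<mu> < \<eta>"
  then have "\<mu> \<notin> specL" using assms(1) by force
  then show "\<exists>C. \<forall>w\<in>YY. \<exists>p. form.dom_op p (\<mu> *\<^sub>R fst p + w) \<and> norm (fst p) \<le> C * norm w"
    by (rule resolvent_form)
qed

abbreviation H where "H \<equiv> ZYsp P \<Omega> \<rho>\<^sub>0"

definition \<iota> :: "(rz \<Rightarrow> rz \<times> rz) \<Rightarrow> graph \<times> ((real ^ 3) l2 \<times> (real ^ 3) l2)" where
  "\<iota> W = (q (\<lambda>p. fst (W p)), J (\<lambda>p. snd (W p)))"

text \<open>The counterpart of \<open>normZY\<close> in \<open>l2\<close> coordinates: a sum of
  norms, equivalent but not equal to the Hilbert norm of the product.\<close>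

definition nrm :: "graph \<times> ((real ^ 3) l2 \<times> (real ^ 3) l2) \<Rightarrow> real" where
  "nrm x = norm (fst (fst x)) + norm (snd (fst x)) + norm (snd x)"

lemma H_iff: "W \<in> H \<longleftrightarrow> (\<lambda>p. fst (W p)) \<in> Z \<and> (\<lambda>p. snd (W p)) \<in> Ysp \<Omega> \<rho>\<^sub>0"
  by (simp add: ZYsp_def o_def)

lemma \<iota>_in: "W \<in> H \<Longrightarrow> \<iota> W \<in> \<Gamma> \<times> YY"
  by (simp add: H_iff \<iota>_def q_\<Gamma> J_YY)

lemma \<iota>_surj: assumes "x \<in> \<Gamma> \<times> YY" obtains W where "W \<in> H" "\<iota> W = x"
proof -
  obtain u where u: "u \<in> Z" "fst x = q u" using \<Gamma>_q[of "fst x"] assms by (metis mem_Times_iff)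
  obtain v where v: "v \<in> Ysp \<Omega> \<rho>\<^sub>0" "snd x = J v" using YY_J[of "snd x"] assms by (metis mem_Times_iff)
  show ?thesis by (rule that[of "\<lambda>p. (u p, v p)"]) (use u v in \<open>simp_all add: H_iff \<iota>_def prod_eq_iff\<close>)
qed

lemma normZY_\<iota>: "W \<in> H \<Longrightarrow> normZY P \<Omega> \<rho>\<^sub>0 W = nrm (\<iota> W)"
  by (simp add: normZY_def o_def H_iff nrm_def \<iota>_def normZ_q normY_J)

lemma H_lin: "W \<in> H \<Longrightarrow> W' \<in> H \<Longrightarrow> (\<lambda>p. s *\<^sub>R W p + t *\<^sub>R W' p) \<in> H"
  and \<iota>_lin: "W \<in> H \<Longrightarrow> W' \<in> H \<Longrightarrow> \<iota> (\<lambda>p. s *\<^sub>R W p + t *\<^sub>R W' p) = s *\<^sub>R \<iota> W + t *\<^sub>R \<iota> W'"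
  by (simp_all add: H_iff \<iota>_def Z_lin Ysp_lin q_lin J_lin)

lemma H_diff: "W \<in> H \<Longrightarrow> W' \<in> H \<Longrightarrow> (\<lambda>p. W p - W' p) \<in> H"
  and \<iota>_diff: "W \<in> H \<Longrightarrow> W' \<in> H \<Longrightarrow> \<iota> (\<lambda>p. W p - W' p) = \<iota> W - \<iota> W'"
  using H_lin[of W W' 1 "-1"] \<iota>_lin[of W W' 1 "-1"] by simp_all

lemma norm_le_nrm: "norm x \<le> nrm x"
proof -
  have "norm x \<le> norm (fst x) + norm (snd x)" using norm_Pair_le[of "fst x" "snd x"] by simp
  moreover have "norm (fst x) \<le> norm (fst (fst x)) + norm (snd (fst x))"
    using norm_Pair_le[of "fst (fst x)" "snd (fst x)"] by simp
  ultimately show ?thesis by (simp add: nrm_def)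
qed

lemma nrm_le_norm: "nrm x \<le> 3 * norm x"
  using norm_fst_le'[of x] norm_snd_le'[of x] norm_fst_le'[of "fst x"] norm_snd_le'[of "fst x"]
  unfolding nrm_def by linarith

lemma nrm_0: "nrm 0 = 0"
  by (simp add: nrm_def)

lemma nrm_tendsto_0_iff: "((\<lambda>t. nrm (f t)) \<longlongrightarrow> 0) F \<longleftrightarrow> (f \<longlongrightarrow> 0) F"
proof
  assume "((\<lambda>t. nrm (f t)) \<longlongrightarrow> 0) F"
  then show "(f \<longlongrightarrow> 0) F"
    by (rule Lim_null_comparison[rotated]) (intro always_eventually allI norm_le_nrm)
next
  assume f: "(f \<longlongrightarrow> 0) F"
  show "((\<lambda>t. nrm (f t)) \<longlongrightarrow> 0) F"
  proof (rule Lim_null_comparison)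
    show "\<forall>\<^sub>F t in F. norm (nrm (f t)) \<le> 3 * norm (f t)"
      using nrm_le_norm order_trans[OF norm_ge_zero norm_le_nrm] by (intro always_eventually allI) simp
    show "((\<lambda>t. 3 * norm (f t)) \<longlongrightarrow> 0) F" by (intro tendsto_mult_right_zero tendsto_norm_zero f)
  qed
qed

theorem linear_stability:
  assumes spec: "\<eta> \<in> specL" "\<forall>\<mu>\<in>specL. \<eta> \<le> \<mu>" and neg: "\<eta> < 0"
  shows "\<exists>T :: real \<Rightarrow> (rz \<Rightarrow> rz \<times> rz) \<Rightarrow> (rz \<Rightarrow> rz \<times> rz).
      C0_group H (normZY P \<Omega> \<rho>\<^sub>0) T
    \<and> (\<forall>U W. generator H (normZY P \<Omega> \<rho>\<^sub>0) T U W \<longleftrightarrow> second_order_op P \<Omega> \<rho>\<^sub>0 \<omega>\<^sub>0 R\<^sub>0 U W)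
    \<and> (\<exists>C>0. \<forall>U\<in>H. \<forall>t>0. normZ P \<Omega> \<rho>\<^sub>0 (fst \<circ> T t U) + normY \<Omega> \<rho>\<^sub>0 (snd \<circ> T t U)
          \<le> C * exp (sqrt (- \<eta>) * t) * (normZ P \<Omega> \<rho>\<^sub>0 (fst \<circ> U) + normY \<Omega> \<rho>\<^sub>0 (snd \<circ> U)))
    \<and> (\<forall>U\<in>H. \<forall>t. energy P \<Omega> \<rho>\<^sub>0 \<omega>\<^sub>0 R\<^sub>0 (fst \<circ> T t U) (snd \<circ> T t U)
          = energy P \<Omega> \<rho>\<^sub>0 \<omega>\<^sub>0 R\<^sub>0 (fst \<circ> U) (snd \<circ> U))
    \<and> (\<forall>\<epsilon>. 0 < \<epsilon> \<and> \<epsilon> < - \<eta> \<longrightarrow>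
          (\<exists>u\<in>Z. normZ P \<Omega> \<rho>\<^sub>0 u \<noteq> 0 \<and>
            (\<exists>c>0. \<forall>t>0. normY \<Omega> \<rho>\<^sub>0 (fst \<circ> T t (\<lambda>p. (u p, 0)))
               \<ge> c * exp (sqrt (- \<eta> - \<epsilon>) * t) * normZ P \<Omega> \<rho>\<^sub>0 u)))"
proof -
  define s where "s = sqrt (- \<eta>)"
  have s: "s > 0" "s\<^sup>2 = - \<eta>" using neg by (auto simp: s_def)
  have "bounded_below_form_axioms \<Gamma> form s"
  proof
    show "s > 0" by (rule s)
    show "- s\<^sup>2 * (norm (fst p))\<^sup>2 \<le> form p p" if "p \<in> \<Gamma>" for p
      using form_ge[OF spec(2) that] by (simp add: s(2))
  qed
  then interpret G: bounded_below_form \<Gamma> YY form M\<^sub>0 "1/2" s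
    by (rule bounded_below_form.intro[OF form.energy_form_axioms])
  have E: "G.E = \<Gamma> \<times> YY" by (rule G.E_def)
  have \<iota>E: "\<iota> W \<in> G.E" if "W \<in> H" for W using \<iota>_in[OF that] by (simp only: E)
  \<comment> \<open>A fixed representative for every class. The flow on classes thereby becomes a
    map on functions, and the group laws hold up to functions of norm zero.\<close>
  define \<kappa> where "\<kappa> x = (SOME W. W \<in> H \<and> \<iota> W = x)" for x
  have \<kappa>: "\<kappa> x \<in> H" "\<iota> (\<kappa> x) = x" if x: "x \<in> G.E" for x
  proof -
    have "\<exists>W. W \<in> H \<and> \<iota> W = x" using \<iota>_surj[of x] x unfolding E by metis
    from someI_ex[OF this] show "\<kappa> x \<in> H" "\<iota> (\<kappa> x) = x" unfolding \<kappa>_def by auto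
  qed
  define S where "S t W = \<kappa> (G.T t (\<iota> W))" for t W
  have S: "S t W \<in> H" "\<iota> (S t W) = G.T t (\<iota> W)" if "W \<in> H" for t W
    unfolding S_def by (rule \<kappa>[OF G.T_E[OF \<iota>E[OF that]]])+
  have N_diff: "normZY P \<Omega> \<rho>\<^sub>0 (\<lambda>p. W p - W' p) = nrm (\<iota> W - \<iota> W')" if "W \<in> H" "W' \<in> H" for W W'
    using that by (simp only: normZY_\<iota>[OF H_diff] \<iota>_diff)
  have T_nrm: "nrm (G.T t x) \<le> 3 * G.C * exp (s * \<bar>t\<bar>) * nrm x" if x: "x \<in> G.E" for t x
  proof -
    have "nrm (G.T t x) \<le> 3 * norm (G.T t x)" by (rule nrm_le_norm)
    also have "\<dots> \<le> 3 * (G.C * exp (s * \<bar>t\<bar>) * norm x)" using G.T_le[OF x] by simp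
    also have "\<dots> \<le> 3 * (G.C * exp (s * \<bar>t\<bar>) * nrm x)"
      using G.C_pos norm_le_nrm by (intro mult_left_mono) auto
    finally show ?thesis by (simp add: mult.assoc)
  qed
  have group: "C0_group H (normZY P \<Omega> \<rho>\<^sub>0) S"
    unfolding C0_group_def
  proof (intro conjI allI ballI)
    show "S t W \<in> H" if "W \<in> H" for t W by (rule S(1)[OF that])
    show "normZY P \<Omega> \<rho>\<^sub>0 (\<lambda>p. S t (\<lambda>q. a *\<^sub>R W q + b *\<^sub>R W' q) p - (a *\<^sub>R S t W p + b *\<^sub>R S t W' p)) = 0"
      if W: "W \<in> H" "W' \<in> H" for t W W' a b
    proof -
      have "\<iota> (S t (\<lambda>q. a *\<^sub>R W q + b *\<^sub>R W' q)) = \<iota> (\<lambda>p. a *\<^sub>R S t W p + b *\<^sub>R S t W' p)"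
        by (simp only: S(2)[OF H_lin[OF W]] \<iota>_lin[OF W] \<iota>_lin[OF S(1)[OF W(1)] S(1)[OF W(2)]] S(2)[OF W(1)] S(2)[OF W(2)]
            G.T_linear[OF \<iota>E[OF W(1)] \<iota>E[OF W(2)]])
      then show ?thesis
        by (simp only: N_diff[OF S(1)[OF H_lin[OF W]] H_lin[OF S(1)[OF W(1)] S(1)[OF W(2)]]] diff_self nrm_0)
    qed
    show "\<exists>C. \<forall>W\<in>H. normZY P \<Omega> \<rho>\<^sub>0 (S t W) \<le> C * normZY P \<Omega> \<rho>\<^sub>0 W" for t
      using T_nrm[OF \<iota>E] S by (intro exI[of _ "3 * G.C * exp (s * \<bar>t\<bar>)"] ballI) (simp add: normZY_\<iota>)
    show "normZY P \<Omega> \<rho>\<^sub>0 (\<lambda>p. S 0 W p - W p) = 0" if W: "W \<in> H" for W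
      by (simp only: N_diff[OF S(1)[OF W] W] S(2)[OF W] G.T_0[OF \<iota>E[OF W]] diff_self nrm_0)
    show "normZY P \<Omega> \<rho>\<^sub>0 (\<lambda>p. S (r + t) W p - S r (S t W) p) = 0" if W: "W \<in> H" for r t W
      by (simp only: N_diff[OF S(1)[OF W] S(1)[OF S(1)[OF W]]] S(2)[OF W] S(2)[OF S(1)[OF W]]
          G.T_add[OF \<iota>E[OF W]] diff_self nrm_0)
    show "((\<lambda>t. normZY P \<Omega> \<rho>\<^sub>0 (\<lambda>p. S t W p - W p)) \<longlongrightarrow> 0) (at 0)" if W: "W \<in> H" for W
      unfolding N_diff[OF S(1)[OF W] W] S(2)[OF W] nrm_tendsto_0_iff
      by (rule LIM_zero[OF G.T_continuous_0[OF \<iota>E[OF W]]])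
  qed
  \<comment> \<open>The first components need only agree in \<open>Y\<close>: by
    \<open>q_eqI\<close> this already puts \<open>v\<close> into \<open>Z\<close> and makes the
    \<open>Z\<close> norm of the difference vanish.\<close>
  have op: "second_order_op P \<Omega> \<rho>\<^sub>0 \<omega>\<^sub>0 R\<^sub>0 U W \<longleftrightarrow> U \<in> H \<and> W \<in> H \<and> G.gen (\<iota> U) (\<iota> W)" for U W
  proof
    assume A: "second_order_op P \<Omega> \<rho>\<^sub>0 \<omega>\<^sub>0 R\<^sub>0 U W"
    define u v w z where "u = (\<lambda>p. fst (U p))" and "v = (\<lambda>p. snd (U p))" and "w = (\<lambda>p. fst (W p))" and "z = (\<lambda>p. snd (W p))"
    have W: "W \<in> H" and vZ: "v \<in> Z" and n: "normZ P \<Omega> \<rho>\<^sub>0 (\<lambda>p. w p - v p) = 0"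
      and L: "Lop P \<Omega> \<rho>\<^sub>0 \<omega>\<^sub>0 R\<^sub>0 u (\<lambda>p. - z p)"
      using A by (simp_all add: second_order_op_def o_def u_def v_def w_def z_def)
    have wZ: "w \<in> Z" and zY: "z \<in> Ysp \<Omega> \<rho>\<^sub>0" using W by (simp_all add: H_iff w_def z_def)
    have uZ: "u \<in> Z" and dom: "form.dom_op (q u) (J (\<lambda>p. - z p))" using L by (simp_all add: Lop_iff)
    have "J (\<lambda>p. - z p) = - J z" using J_lin[OF zY zY, of "-1" 0] by simp
    moreover have "J w = J v"
    proof -
      have "q (\<lambda>p. w p - v p) = q w - q v" and wvZ: "(\<lambda>p. w p - v p) \<in> Z"
        using q_lin[OF wZ vZ, of 1 "-1"] Z_lin[OF wZ vZ, of 1 "-1"] by simp_all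
      then have "norm (J w - J v) \<le> normZ P \<Omega> \<rho>\<^sub>0 (\<lambda>p. w p - v p)" by (simp add: normZ_q[OF wvZ])
      then show ?thesis using n by simp
    qed
    ultimately have "G.gen (\<iota> U) (\<iota> W)"
      using dom q_\<Gamma>[OF wZ] by (simp add: G.gen_def \<iota>_def u_def v_def w_def z_def)
    then show "U \<in> H \<and> W \<in> H \<and> G.gen (\<iota> U) (\<iota> W)"
      using W uZ Z_Y[OF vZ] by (simp add: H_iff u_def v_def)
  next
    assume A: "U \<in> H \<and> W \<in> H \<and> G.gen (\<iota> U) (\<iota> W)"
    define u v w z where "u = (\<lambda>p. fst (U p))" and "v = (\<lambda>p. snd (U p))" and "w = (\<lambda>p. fst (W p))" and "z = (\<lambda>p. snd (W p))"
    have uZ: "u \<in> Z" and vY: "v \<in> Ysp \<Omega> \<rho>\<^sub>0" and wZ: "w \<in> Z" and zY: "z \<in> Ysp \<Omega> \<rho>\<^sub>0"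
      using A by (simp_all add: H_iff u_def v_def w_def z_def)
    have g: "J w = J v" "form.dom_op (q u) (- J z)"
      using A by (simp_all add: G.gen_def \<iota>_def u_def v_def w_def z_def)
    have vZ: "v \<in> Z" and qv: "q v = q w" using q_eqI[OF vY q_\<Gamma>[OF wZ]] g(1) by simp_all
    have "q (\<lambda>p. w p - v p) = q w - q v" and wvZ: "(\<lambda>p. w p - v p) \<in> Z"
      using q_lin[OF wZ vZ, of 1 "-1"] Z_lin[OF wZ vZ, of 1 "-1"] by simp_all
    then have "normZ P \<Omega> \<rho>\<^sub>0 (\<lambda>p. w p - v p) = 0" by (simp add: normZ_q[OF wvZ] qv g(1))
    moreover have "J (\<lambda>p. - z p) = - J z" "(\<lambda>p. - z p) \<in> Ysp \<Omega> \<rho>\<^sub>0"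
      using J_lin[OF zY zY, of "-1" 0] Ysp_lin[OF zY zY, of "-1" 0] by simp_all
    ultimately show "second_order_op P \<Omega> \<rho>\<^sub>0 \<omega>\<^sub>0 R\<^sub>0 U W"
      using A vZ uZ g(2) by (simp add: second_order_op_def o_def Lop_iff u_def v_def w_def z_def)
  qed
  have gen: "generator H (normZY P \<Omega> \<rho>\<^sub>0) S U W \<longleftrightarrow> second_order_op P \<Omega> \<rho>\<^sub>0 \<omega>\<^sub>0 R\<^sub>0 U W" for U W
  proof (cases "U \<in> H \<and> W \<in> H")
    case True
    then have U: "U \<in> H" and W: "W \<in> H" by auto
    have quot: "(\<lambda>p. (1 / t) *\<^sub>R (S t U p - U p)) \<in> H"
      "\<iota> (\<lambda>p. (1 / t) *\<^sub>R (S t U p - U p)) = (1 / t) *\<^sub>R (G.T t (\<iota> U) - \<iota> U)" for t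
      using H_lin[OF H_diff[OF S(1)[OF U] U] U, of "1 / t" t 0] \<iota>_lin[OF H_diff[OF S(1)[OF U] U] U, of "1 / t" t 0]
        \<iota>_diff[OF S(1)[OF U] U, of t] S(2)[OF U, of t] by simp_all
    have "generator H (normZY P \<Omega> \<rho>\<^sub>0) S U W \<longleftrightarrow>
        ((\<lambda>t. nrm ((1 / t) *\<^sub>R (G.T t (\<iota> U) - \<iota> U) - \<iota> W)) \<longlongrightarrow> 0) (at 0)"
      using U W by (simp only: generator_def N_diff[OF quot(1) W] quot(2) simp_thms)
    also have "\<dots> \<longleftrightarrow> ((\<lambda>t. (1 / t) *\<^sub>R (G.T t (\<iota> U) - \<iota> U)) \<longlongrightarrow> \<iota> W) (at 0)"
      unfolding nrm_tendsto_0_iff by (rule LIM_zero_iff)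
    also have "\<dots> \<longleftrightarrow> G.gen (\<iota> U) (\<iota> W)"
      using G.derivative_imp_gen[OF \<iota>E[OF U] \<iota>E[OF W]] G.gen_imp_derivative by (intro iffI)
    finally show ?thesis using U W by (simp only: op simp_thms)
  qed (auto simp: generator_def op)
  have growth: "normZ P \<Omega> \<rho>\<^sub>0 (fst \<circ> S t U) + normY \<Omega> \<rho>\<^sub>0 (snd \<circ> S t U)
      \<le> 3 * G.C * exp (sqrt (- \<eta>) * t) * (normZ P \<Omega> \<rho>\<^sub>0 (fst \<circ> U) + normY \<Omega> \<rho>\<^sub>0 (snd \<circ> U))"
    if U: "U \<in> H" and t: "t > 0" for U t
    unfolding normZY_def[symmetric] normZY_\<iota>[OF S(1)[OF U]] normZY_\<iota>[OF U] S(2)[OF U]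
    using T_nrm[OF \<iota>E[OF U], of t] t by (simp add: s_def)
  have en: "energy P \<Omega> \<rho>\<^sub>0 \<omega>\<^sub>0 R\<^sub>0 (fst \<circ> W) (snd \<circ> W) = G.total_energy (\<iota> W)" if "W \<in> H" for W
    using that by (simp add: energy_def H_iff o_def G.total_energy_def \<iota>_def normY_J Lform_q power2_norm_eq_inner)
  have unstable: "\<exists>u\<in>Z. normZ P \<Omega> \<rho>\<^sub>0 u \<noteq> 0 \<and> (\<exists>c>0. \<forall>t>0. normY \<Omega> \<rho>\<^sub>0 (fst \<circ> S t (\<lambda>p. (u p, 0)))
               \<ge> c * exp (sqrt (- \<eta> - \<epsilon>) * t) * normZ P \<Omega> \<rho>\<^sub>0 u)" if \<epsilon>: "0 < \<epsilon>" "\<epsilon> < - \<eta>" for \<epsilon>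
  proof -
    obtain p\<^sub>0 where "p\<^sub>0 \<in> \<Gamma>" "form p\<^sub>0 p\<^sub>0 < (\<eta> + \<epsilon>) * (norm (fst p\<^sub>0))\<^sup>2" by (rule spectrum_form[OF spec(1) \<epsilon>(1)])
    then obtain p w where p: "form.dom_op p w" "form p p < (\<eta> + \<epsilon>) * (norm (fst p))\<^sup>2" by (rule form.dom_op_below)
    have p\<Gamma>: "p \<in> \<Gamma>" using p(1) by (simp add: form.dom_op_def)
    have ne: "fst p \<noteq> 0"
    proof
      assume "fst p = 0"
      then have "p = 0" using form.fst_eq_0_iff[OF p\<Gamma>] by simp
      then show False using p(2) by (simp add: form.a.zero_left)
    qed
    obtain u where u: "u \<in> Z" "p = q u" using \<Gamma>_q[OF p\<Gamma>] .
    \<comment> \<open>\<open>- \<sigma>\<^sup>2\<close> is the Rayleigh quotient of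
      \<open>p\<close>. It lies below \<open>\<eta> + \<epsilon>\<close>, so \<open>\<sigma>\<close>
      is at least the required rate.\<close>
    define \<sigma> where "\<sigma> = sqrt (- form p p / (norm (fst p))\<^sup>2)"
    have gt: "- \<eta> - \<epsilon> < - form p p / (norm (fst p))\<^sup>2" using p(2) ne by (simp add: field_simps)
    then have \<sigma>: "\<sigma> > 0" "\<sigma>\<^sup>2 = - form p p / (norm (fst p))\<^sup>2" "sqrt (- \<eta> - \<epsilon>) \<le> \<sigma>"
      using \<epsilon> unfolding \<sigma>_def by auto
    have form_p: "form p p = - \<sigma>\<^sup>2 * (norm (fst p))\<^sup>2" using ne by (simp add: \<sigma>(2))
    let ?U = "\<lambda>p. (u p, 0 :: rz)"
    have 0: "(\<lambda>p. 0 :: rz) \<in> Ysp \<Omega> \<rho>\<^sub>0" "J (\<lambda>p. 0) = 0"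
      by (simp_all add: Ysp_iff r.L2w_zero J_def r.V_zero zero_prod_def)
    have U: "?U \<in> H" "\<iota> ?U = (p, 0)" using u 0 by (simp_all add: H_iff \<iota>_def)
    have "norm (J u) > 0" using ne u by simp
    then have nZ: "normZ P \<Omega> \<rho>\<^sub>0 u > 0" by (simp add: normZ_q[OF u(1)] add_pos_nonneg)
    \<comment> \<open>The lower bound is proportional to the \<open>Y\<close> norm of the data, the
      claim to the \<open>Z\<close> norm; \<open>c\<close> is half the ratio of the two and may
      depend on the data.\<close>
    define c where "c = norm (fst p) / (2 * normZ P \<Omega> \<rho>\<^sub>0 u)"
    have "c > 0" using ne nZ by (simp add: c_def)
    moreover have "c * exp (sqrt (- \<eta> - \<epsilon>) * t) * normZ P \<Omega> \<rho>\<^sub>0 u \<le> normY \<Omega> \<rho>\<^sub>0 (fst \<circ> S t ?U)" if t: "t > 0" for t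
    proof -
      have "c * exp (sqrt (- \<eta> - \<epsilon>) * t) * normZ P \<Omega> \<rho>\<^sub>0 u = norm (fst p) / 2 * exp (sqrt (- \<eta> - \<epsilon>) * t)"
        using nZ by (simp add: c_def)
      also have "\<dots> \<le> norm (fst p) / 2 * exp (\<sigma> * t)"
        using \<sigma>(3) t by (intro mult_left_mono) auto
      also have "\<dots> \<le> norm (fst (fst (G.T t (p, 0))))"
        using G.exponential_instability[OF p(1) \<sigma>(1) form_p ne, of t] t by simp
      also have "\<dots> = norm (fst (fst (\<iota> (S t ?U))))" by (simp only: S(2)[OF U(1)] U(2))
      also have "\<dots> = normY \<Omega> \<rho>\<^sub>0 (fst \<circ> S t ?U)"
        using S(1)[OF U(1), of t] by (simp add: \<iota>_def H_iff o_def normY_J Z_Y)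
      finally show ?thesis .
    qed
    ultimately show ?thesis using u(1) nZ by (intro bexI[of _ u] conjI exI[of _ c]) auto
  qed
  have "3 * G.C > 0" using G.C_pos by simp
  then have growth': "\<exists>C>0. \<forall>U\<in>H. \<forall>t>0. normZ P \<Omega> \<rho>\<^sub>0 (fst \<circ> S t U) + normY \<Omega> \<rho>\<^sub>0 (snd \<circ> S t U)
          \<le> C * exp (sqrt (- \<eta>) * t) * (normZ P \<Omega> \<rho>\<^sub>0 (fst \<circ> U) + normY \<Omega> \<rho>\<^sub>0 (snd \<circ> U))"
    using growth by blast
  have energy': "\<forall>U\<in>H. \<forall>t. energy P \<Omega> \<rho>\<^sub>0 \<omega>\<^sub>0 R\<^sub>0 (fst \<circ> S t U) (snd \<circ> S t U)
          = energy P \<Omega> \<rho>\<^sub>0 \<omega>\<^sub>0 R\<^sub>0 (fst \<circ> U) (snd \<circ> U)"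
    by (intro ballI allI) (simp only: en[OF S(1)] en S(2) G.energy_T[OF \<iota>E])
  show ?thesis
    by (rule exI[of _ S], intro conjI group growth' energy' allI impI) (use gen unstable in blast)+
qed

end

text \<open>A nonempty open set does not fit into the plane \<open>x $ 1 = 0\<close>. Positivity
  makes \<open>{0..R\<^sub>0}\<close> nondegenerate, as the one-sided derivative in
  \<open>Upsilon\<close> requires.\<close>

lemma rotating_star_radius_pos:
  assumes "open \<Omega>" "\<Omega> \<noteq> {}" "\<forall>x\<in>closure \<Omega>. fst (cyl x) \<le> R\<^sub>0"
  shows "R\<^sub>0 > 0"
proof -
  have "\<not> negligible \<Omega>" using assms(1,2) by (simp add: open_not_negligible)
  then have "\<not> \<Omega> \<subseteq> {x :: real ^ 3. x $ 1 = 0}"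
    using negligible_standard_hyperplane_cart[of 1] negligible_subset by blast
  then obtain x where x: "x \<in> \<Omega>" "x $ 1 \<noteq> 0" by blast
  then have "0 < fst (cyl x)" using component_le_radius(1)[of x] by linarith
  then show ?thesis using assms(3) x(1) closure_subset by force
qed

theorem theorem1p2:
  fixes P :: "real \<Rightarrow> real" and \<gamma>\<^sub>0 K :: real
    and \<rho>\<^sub>0 :: "real \<times> real \<Rightarrow> real" and \<Omega> :: "(real ^ 3) set"
    and \<omega>\<^sub>0 :: "real \<Rightarrow> real" and R\<^sub>0 a b \<eta>\<^sub>0 :: real
  assumes "pressure_law P \<gamma>\<^sub>0 K"
    and "rotating_star P \<rho>\<^sub>0 \<Omega> \<omega>\<^sub>0 R\<^sub>0"
    and "C2_pos_curvature_near \<Omega> (R\<^sub>0, 0)"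
    and "C1_on_interval \<omega>\<^sub>0 0 R\<^sub>0"
    and "comparable_to_dist_power \<Omega> \<rho>\<^sub>0 (1 / (\<gamma>\<^sub>0 - 1))"
    and "(INF r\<in>{0..R\<^sub>0}. Upsilon \<omega>\<^sub>0 R\<^sub>0 r) < 0"
    and "Upsilon \<omega>\<^sub>0 R\<^sub>0 ` {0..R\<^sub>0} = {- a..b}" and "a > 0" and "b \<ge> 0"
    and "\<eta>\<^sub>0 \<in> spectrum (Ysp \<Omega> \<rho>\<^sub>0) (normY \<Omega> \<rho>\<^sub>0) (Lop P \<Omega> \<rho>\<^sub>0 \<omega>\<^sub>0 R\<^sub>0)"
    and "\<forall>\<mu>\<in>spectrum (Ysp \<Omega> \<rho>\<^sub>0) (normY \<Omega> \<rho>\<^sub>0) (Lop P \<Omega> \<rho>\<^sub>0 \<omega>\<^sub>0 R\<^sub>0). \<eta>\<^sub>0 \<le> \<mu>"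
    and "\<eta>\<^sub>0 \<le> - a"
  shows "\<exists>T :: real \<Rightarrow> (real \<times> real \<Rightarrow> (real \<times> real) \<times> (real \<times> real)) \<Rightarrow>
                        (real \<times> real \<Rightarrow> (real \<times> real) \<times> (real \<times> real)).
      C0_group (ZYsp P \<Omega> \<rho>\<^sub>0) (normZY P \<Omega> \<rho>\<^sub>0) T
    \<and> (\<forall>U W. generator (ZYsp P \<Omega> \<rho>\<^sub>0) (normZY P \<Omega> \<rho>\<^sub>0) T U W
              \<longleftrightarrow> second_order_op P \<Omega> \<rho>\<^sub>0 \<omega>\<^sub>0 R\<^sub>0 U W)
    \<and> (\<exists>C>0. \<forall>U\<in>ZYsp P \<Omega> \<rho>\<^sub>0. \<forall>t>0.
          normZ P \<Omega> \<rho>\<^sub>0 (fst \<circ> T t U) + normY \<Omega> \<rho>\<^sub>0 (snd \<circ> T t U)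
          \<le> C * exp (sqrt (- \<eta>\<^sub>0) * t)
              * (normZ P \<Omega> \<rho>\<^sub>0 (fst \<circ> U) + normY \<Omega> \<rho>\<^sub>0 (snd \<circ> U)))
    \<and> (\<forall>U\<in>ZYsp P \<Omega> \<rho>\<^sub>0. \<forall>t.
          energy P \<Omega> \<rho>\<^sub>0 \<omega>\<^sub>0 R\<^sub>0 (fst \<circ> T t U) (snd \<circ> T t U)
          = energy P \<Omega> \<rho>\<^sub>0 \<omega>\<^sub>0 R\<^sub>0 (fst \<circ> U) (snd \<circ> U))
    \<and> (\<forall>\<epsilon>. 0 < \<epsilon> \<and> \<epsilon> < - \<eta>\<^sub>0 \<longrightarrow>
          (\<exists>u\<in>Zsp P \<Omega> \<rho>\<^sub>0. normZ P \<Omega> \<rho>\<^sub>0 u \<noteq> 0 \<and>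
            (\<exists>c>0. \<forall>t>0.
               normY \<Omega> \<rho>\<^sub>0 (fst \<circ> T t (\<lambda>p. (u p, 0)))
               \<ge> c * exp (sqrt (- \<eta>\<^sub>0 - \<epsilon>) * t) * normZ P \<Omega> \<rho>\<^sub>0 u)))"
proof -
  note P = assms(1)
  have \<Omega>: "open \<Omega>" "bounded \<Omega>" "\<Omega> \<noteq> {}" "axisymmetric_set \<Omega>"
    and \<rho>: "continuous_on UNIV (\<lambda>x. \<rho>\<^sub>0 (cyl x))" "\<And>x. x \<in> \<Omega> \<Longrightarrow> \<rho>\<^sub>0 (cyl x) > 0"
    and R: "\<forall>x\<in>closure \<Omega>. fst (cyl x) \<le> R\<^sub>0"
    using assms(2) by (simp_all add: rotating_star_def)
  have R_pos: "R\<^sub>0 > 0" by (rule rotating_star_radius_pos[OF \<Omega>(1,3) R])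
  have "bounded ((\<lambda>x. \<rho>\<^sub>0 (cyl x)) ` closure \<Omega>)"
    using \<Omega>(2) by (intro compact_imp_bounded compact_continuous_image continuous_on_subset[OF \<rho>(1)]) (auto simp: compact_closure)
  then obtain m where "\<forall>y\<in>(\<lambda>x. \<rho>\<^sub>0 (cyl x)) ` closure \<Omega>. norm y \<le> m" unfolding bounded_iff by blast
  then have \<rho>_le: "\<rho>\<^sub>0 (cyl x) \<le> m" if "x \<in> \<Omega>" for x using that closure_subset[of \<Omega>] by fastforce
  obtain h where h: "h > 0" "\<And>t. 0 < t \<and> t \<le> m \<Longrightarrow> h \<le> enthalpy2 P t"
    using enthalpy2_lower_bound[OF P, of m] by blast
  have rad: "fst (cyl x) \<in> {0..R\<^sub>0}" if "x \<in> \<Omega>" for x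
    using R that closure_subset[of \<Omega>] by (auto simp: fst_cyl radsq_def)
  \<comment> \<open>\<open>m\<close> bounds the density on the compact closure of
    \<open>\<Omega>\<close>, \<open>h\<close> bounds \<open>enthalpy2 P\<close> from below for
    densities up to \<open>m\<close>, and \<open>max a b\<close> comes from the range of
    \<open>Upsilon\<close>.\<close>
  interpret star P \<rho>\<^sub>0 \<Omega> \<omega>\<^sub>0 R\<^sub>0 h m "max a b"
  proof
    show "continuous_on \<Omega> (\<lambda>x. \<rho>\<^sub>0 (cyl x))" by (rule continuous_on_subset[OF \<rho>(1)]) simp
    then show "continuous_on \<Omega> (\<lambda>x. enthalpy2 P (\<rho>\<^sub>0 (cyl x)))"
      by (rule continuous_on_compose2[OF enthalpy2_continuous[OF P]]) (use \<rho>(2) in auto)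
    show "continuous_on \<Omega> (\<lambda>x. Upsilon \<omega>\<^sub>0 R\<^sub>0 (fst (cyl x)))"
      by (rule continuous_on_compose2[OF Upsilon_continuous[OF assms(4) R_pos] continuous_on_fst[OF continuous_cyl]])
        (use rad in blast)
    show "\<bar>Upsilon \<omega>\<^sub>0 R\<^sub>0 (fst (cyl x))\<bar> \<le> max a b" if "x \<in> \<Omega>" for x
    proof -
      have "Upsilon \<omega>\<^sub>0 R\<^sub>0 (fst (cyl x)) \<in> {- a..b}" using rad[OF that] assms(7) by blast
      then show ?thesis by auto
    qed
    show "h \<le> enthalpy2 P (\<rho>\<^sub>0 (cyl x))" if "x \<in> \<Omega>" for x using h(2) \<rho>(2)[OF that] \<rho>_le[OF that] by simp
  qed (fact \<Omega> \<rho>(2) \<rho>_le h(1))+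
  show ?thesis
    by (rule linear_stability[OF assms(10,11)]) (use assms(8,12) in linarith)
qed

end
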